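(* Let $k$ be a positive integer and let $h(z)=\sum_{n\ge 1}a(n)q^n$, $q=e^{2\pi i z}$, be a normalized Hecke eigen cusp form of weight $k$ for the full modular group $SL_2(\mathbb{Z})$. Put $\lambda(n)=a(n)/n^{(k-1)/2}$ and set $\delta_2=2/11$, $\delta_3=1/9$, $\delta_4=2/27$. Then for each $j\in\{2,3,4\}$ the sequence $\{\lambda(n^j)\}_{n\ge 1}$ changes sign infinitely often. Moreover, for every sufficiently small $\epsilon>0$, the number of sign changes of $\{\lambda(n^j)\}$ with $n$ in the interval $(x,2x]$ is $\gg x^{\delta_j-2\epsilon}$ for all sufficiently large $x$.
   Context: A "sign change" of a real sequence means a pair of indices in the given range at which the sequence takes values of opposite (strict) sign. The implied constant in $\gg$ may depend on $h$, $j$ and $\epsilon$. *)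

theory Defs
  imports "HOL-Complex_Analysis.Complex_Analysis"
begin

definition upper_half_plane :: "complex set" where
  "upper_half_plane = {z. Im z > 0}"

definition modular_transform_invariant :: "nat \<Rightarrow> (complex \<Rightarrow> complex) \<Rightarrow> bool" where
  "modular_transform_invariant k h \<longleftrightarrow>
     (\<forall>a b c d :: int. a * d - b * c = 1 \<longrightarrow>
        (\<forall>z \<in> upper_half_plane.
           h ((of_int a * z + of_int b) / (of_int c * z + of_int d))
             = (of_int c * z + of_int d) ^ k * h z))"

definition cusp_q_expansion :: "(complex \<Rightarrow> complex) \<Rightarrow> (nat \<Rightarrow> complex) \<Rightarrow> bool" where
  "cusp_q_expansion h a \<longleftrightarrow> a 0 = 0 \<and>
     (\<forall>z \<in> upper_half_plane. (\<lambda>n. a n * exp (2 * of_real pi * \<i> * of_nat n * z)) sums h z)"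

definition cusp_form :: "nat \<Rightarrow> (complex \<Rightarrow> complex) \<Rightarrow> bool" where
  "cusp_form k h \<longleftrightarrow> h holomorphic_on upper_half_plane \<and> modular_transform_invariant k h
     \<and> (\<exists>a. cusp_q_expansion h a)"

definition hecke_op :: "nat \<Rightarrow> nat \<Rightarrow> (complex \<Rightarrow> complex) \<Rightarrow> complex \<Rightarrow> complex" where
  "hecke_op k n h z = of_nat n ^ (k - 1) *
     (\<Sum>d\<in>{d. d dvd n}. \<Sum>b<d. h ((of_nat (n div d) * z + of_nat b) / of_nat d) / of_nat d ^ k)"

definition hecke_eigenform :: "nat \<Rightarrow> (complex \<Rightarrow> complex) \<Rightarrow> bool" where
  "hecke_eigenform k h \<longleftrightarrow>
     (\<forall>n \<ge> 1. \<exists>c. \<forall>z \<in> upper_half_plane. hecke_op k n h z = c * h z)"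

text \<open>Normalized coefficients lambda(n) = a(n)/n^((k-1)/2) (real for Hecke eigenforms;
  we take the real part).\<close>
definition normalized_coeff :: "nat \<Rightarrow> (nat \<Rightarrow> complex) \<Rightarrow> nat \<Rightarrow> real" where
  "normalized_coeff k a n = Re (a n) / real n powr ((real k - 1) / 2)"

definition sign_changes :: "(nat \<Rightarrow> real) \<Rightarrow> nat set \<Rightarrow> nat" where
  "sign_changes f S = Sup {m. \<exists>g :: nat \<Rightarrow> nat. strict_mono_on {..m} g \<and> (\<forall>i\<le>m. g i \<in> S)
      \<and> (\<forall>i<m. f (g i) * f (g (Suc i)) < 0)}"

definition delta_exp :: "nat \<Rightarrow> real" where
  "delta_exp j = (if j = 2 then 2/11 else if j = 3 then 1/9 else if j = 4 then 2/27 else 0)"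

end

theory Submission
  imports Defs "HOL-Number_Theory.Number_Theory"
begin

text \<open>The argument is elementary and shows that both signs occur in every interval
  \<open>(y, y + C y^(3/4)]\<close>, hence \<open>x^(1/4)\<close> sign changes in \<open>(x, 2x]\<close>; each \<open>delta_j\<close> is below \<open>1/4\<close>.

  Nonvanishing: the periods of the Eichler integrals of \<open>h\<close> against integral binary forms span a
  nonzero finitely generated group on which \<open>a(p)\<close> acts through the Hecke correspondence. For
  \<open>l = 2, 3\<close> the filtration of this group modulo \<open>l\<close> by powers of Dickson's invariant
  \<open>X^l Y - X Y^l\<close> shows that \<open>a(p) - 2\<close> is nilpotent modulo \<open>l\<close> whenever \<open>p\<close> is congruent to 1
  modulo \<open>l\<close>, so that \<open>a(p^m)\<close> is congruent to \<open>m + 1\<close> and does not vanish unless \<open>l\<close> divides \<open>m + 1\<close>.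
  Hence \<open>a(n^j)\<close> is nonzero if all prime factors of \<open>n\<close> are 1 modulo 3; values of \<open>u^2 + u + 1\<close> with
  \<open>u\<close> not 1 modulo 3 are such \<open>n\<close>. Two of any three of them have coefficients of equal sign, which
  gives positive values \<open>a(n^j)\<close> in short intervals.

  Negative values: if \<open>a(p)^2 \<ge> 4 p^(k-1)\<close> for all \<open>p\<close> congruent to 1 modulo 3, the Euler product of
  \<open>sum lambda(n)^2 n^(-s)\<close> would exceed the bound \<open>O(1/(s-1))\<close> that follows from the boundedness of
  \<open>|h(z)| y^(k/2)\<close>. For a prime violating this inequality, \<open>e \<mapsto> a(p^(j e))\<close> satisfies a linear recurrence
  that forces a negative value, and multiplying \<open>n\<close> by \<open>p^e\<close> turns positive coefficients into negative ones.\<close>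

subsection \<open>Power series on circles\<close>

text \<open>The eigenvalues are given only as complex numbers, so a congruence for
  \<open>a(p)\<close> has to be read off from its action on the period group; the multipliers of
  that group stand in for a ring of integers. Two moduli occur because the exponent is
  \<open>m = j e\<close>: \<open>m + 1\<close> is odd for \<open>j = 2, 4\<close> and prime to 3 for
  \<open>j = 3\<close>. An odd prime that is 1 modulo 3 is 1 modulo both. The group is nonzero
  because otherwise the \<open>(k-1)\<close>-fold integral of \<open>h\<close> would be modular of
  weight \<open>2 - k\<close>. Comparing signs uses multiplicativity of \<open>Re (a n)\<close>, so
  the coefficients have to be real. This comes from self-adjointness of the Hecke operators for the
  Petersson product, integrated over a Siegel set with weights in place of a fundamental domain. The
  exponent 3/4 arises since a product of two values of \<open>u^2 + u + 1\<close> with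
  \<open>u\<close> near \<open>y^(1/4)\<close> changes by the order of \<open>y^(3/4)\<close> when
  \<open>u\<close> moves by a bounded amount. The auxiliary prime exceeds 13 because of the constant
  terms 1, 7, 13 of the three quadratic values that are compared.\<close>

lemma sum_root_of_unity_power:
  fixes n :: int
  assumes "d > 0"
  shows "(\<Sum>b<d. cis (2 * pi * real_of_int n * real b / real d)) = (if int d dvd n then of_nat d else 0)"
proof -
  define w where "w = cis (2 * pi * real_of_int n / real d)"
  have pw: "cis (2 * pi * real_of_int n * real b / real d) = w ^ b" for b
    unfolding w_def Complex.DeMoivre by (rule arg_cong[where f = cis]) (simp add: field_simps)
  have "w ^ d = cis (2 * pi * real_of_int n)"
    using assms by (simp add: w_def Complex.DeMoivre field_simps)
  also have "\<dots> = 1" using cis_multiple_2pi[of "real_of_int n"] by simp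
  finally have wd: "w ^ d = 1" .
  show ?thesis
  proof (cases "int d dvd n")
    case True
    then obtain m where "n = int d * m" by blast
    hence "w = cis (2 * pi * real_of_int m)" using assms by (simp add: w_def field_simps)
    also have "\<dots> = 1" using cis_multiple_2pi[of "real_of_int m"] by simp
    finally have "w = 1" .
    thus ?thesis using True by (simp add: pw)
  next
    case False
    have "w \<noteq> 1"
    proof
      assume "w = 1"
      hence "cos (2 * pi * real_of_int n / real d) = 1" by (simp add: w_def complex_eq_iff)
      then obtain m :: int where "2 * pi * real_of_int n / real d = of_int m * 2 * pi"
        by (auto simp: cos_one_2pi_int)
      hence "real_of_int n = of_int m * real d" using assms by (simp add: field_simps)
      hence "n = m * int d" by (metis of_int_eq_iff of_int_mult of_int_of_nat_eq)
      thus False using False by simp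
    qed
    hence "(\<Sum>b<d. w ^ b) = 0" using wd sum_gp_strict[of w d] by simp
    thus ?thesis using False by (simp add: pw)
  qed
qed

text \<open>Orthogonality of the characters \<open>?e\<close> modulo \<open>M\<close> removes the
  off-diagonal terms. Sampling at \<open>M\<close> points plays the part of the circle
  integral.\<close>

lemma parseval_polynomial:
  fixes c :: "nat \<Rightarrow> complex"
  assumes "M > 0"
  shows "(\<Sum>j<M. (norm (\<Sum>n<M. c n * cis (2 * pi * real n * real j / real M)))\<^sup>2)
       = real M * (\<Sum>n<M. (norm (c n))\<^sup>2)"
proof -
  let ?e = "\<lambda>n j. cis (2 * pi * real n * real j / real M)"
  have e: "?e n j * cnj (?e m j) = cis (2 * pi * real_of_int (int n - int m) * real j / real M)" for n m j
    by (simp add: cis_cnj cis_mult diff_divide_distrib algebra_simps)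
  have "complex_of_real (\<Sum>j<M. (norm (\<Sum>n<M. c n * ?e n j))\<^sup>2)
     = (\<Sum>j<M. (\<Sum>n<M. c n * ?e n j) * (\<Sum>m<M. cnj (c m * ?e m j)))"
    unfolding of_real_sum by (intro sum.cong refl) (simp only: complex_norm_square cnj_sum)
  also have "\<dots> = (\<Sum>j<M. \<Sum>n<M. \<Sum>m<M. c n * cnj (c m) * (?e n j * cnj (?e m j)))"
    by (simp add: sum_product mult_ac)
  also have "\<dots> = (\<Sum>n<M. \<Sum>m<M. c n * cnj (c m) * (\<Sum>j<M. ?e n j * cnj (?e m j)))"
    by (subst sum.swap, rule sum.cong[OF refl], subst sum.swap) (simp add: sum_distrib_left)
  also have "\<dots> = (\<Sum>n<M. \<Sum>m<M. c n * cnj (c m) * (if n = m then of_nat M else 0))"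
  proof (intro sum.cong refl)
    fix n m assume "n \<in> {..<M}" "m \<in> {..<M}"
    hence "int M dvd int n - int m \<longleftrightarrow> n = m"
      using zdvd_imp_le[of "int M" "int n - int m"] zdvd_imp_le[of "int M" "int m - int n"]
      by (cases n m rule: linorder_cases) (auto simp: dvd_diff_commute)
    thus "c n * cnj (c m) * (\<Sum>j<M. ?e n j * cnj (?e m j)) = c n * cnj (c m) * (if n = m then of_nat M else 0)"
      using sum_root_of_unity_power[OF assms, of "int n - int m"] by (simp only: e)
  qed
  also have "\<dots> = (\<Sum>n<M. c n * cnj (c n) * of_nat M)"
    by (intro sum.cong refl) (simp add: if_distrib cong: if_cong)
  also have "\<dots> = complex_of_real (real M * (\<Sum>n<M. (norm (c n))\<^sup>2))"
    unfolding of_real_mult of_real_sum of_real_of_nat_eq sum_distrib_left complex_norm_square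
    by (simp only: mult.commute)
  finally show ?thesis by (simp only: of_real_eq_iff)
qed

text \<open>Truncating at \<open>M\<close> terms costs at most the tail \<open>\<epsilon> M\<close>
  uniformly on the circle, the truncation obeys discrete Parseval at the \<open>M\<close>-th roots
  of unity, and \<open>M\<close> tends to infinity. Bessel's inequality thus follows from finite
  sums.\<close>

lemma bessel_power_series:
  fixes c :: "nat \<Rightarrow> complex"
  assumes sm: "summable (\<lambda>n. norm (c n))"
    and bd: "\<And>\<theta>. norm (\<Sum>n. c n * cis (real n * \<theta>)) \<le> C"
  shows "(\<Sum>n<N. (norm (c n))\<^sup>2) \<le> C\<^sup>2"
proof -
  define \<epsilon> where "\<epsilon> M = (\<Sum>n. norm (c (n + M)))" for M
  have "\<epsilon> \<longlonglongrightarrow> 0" using suminf_exist_split2[OF sm] unfolding \<epsilon>_def .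
  hence lim: "(\<lambda>M. (C + \<epsilon> M)\<^sup>2) \<longlonglongrightarrow> (C + 0)\<^sup>2" by (intro tendsto_intros)
  have "\<forall>\<^sub>F M in sequentially. (\<Sum>n<N. (norm (c n))\<^sup>2) \<le> (C + \<epsilon> M)\<^sup>2"
    using eventually_ge_at_top[of "Suc N"]
  proof eventually_elim
    case (elim M)
    have part: "norm (\<Sum>n<M. c n * cis (real n * \<theta>)) \<le> C + \<epsilon> M" for \<theta>
    proof -
      have s1: "summable (\<lambda>n. c n * cis (real n * \<theta>))"
        by (rule summable_norm_cancel) (use sm in \<open>simp add: norm_mult\<close>)
      have s2: "summable (\<lambda>n. norm (c (n + M) * cis (real (n + M) * \<theta>)))"
        using summable_ignore_initial_segment[OF sm, of M] by (simp add: norm_mult)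
      have "(\<Sum>n. c n * cis (real n * \<theta>)) = (\<Sum>n. c (n + M) * cis (real (n + M) * \<theta>)) + (\<Sum>n<M. c n * cis (real n * \<theta>))"
        by (rule suminf_split_initial_segment[OF s1])
      moreover have "norm (\<Sum>n. c (n + M) * cis (real (n + M) * \<theta>)) \<le> \<epsilon> M"
        using summable_norm[OF s2] by (simp add: \<epsilon>_def norm_mult)
      ultimately show ?thesis using bd[of \<theta>]
        by (smt (verit, best) add_diff_cancel_left' norm_triangle_ineq4)
    qed
    have "real M * (\<Sum>n<M. (norm (c n))\<^sup>2) = (\<Sum>j<M. (norm (\<Sum>n<M. c n * cis (real n * (2 * pi * real j / real M))))\<^sup>2)"
      using parseval_polynomial[of M c] elim by (simp add: mult_ac)
    also have "\<dots> \<le> (\<Sum>j<M. (C + \<epsilon> M)\<^sup>2)"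
      by (intro sum_mono power_mono part) auto
    finally have "(\<Sum>n<M. (norm (c n))\<^sup>2) \<le> (C + \<epsilon> M)\<^sup>2"
      using elim by simp
    moreover have "(\<Sum>n<N. (norm (c n))\<^sup>2) \<le> (\<Sum>n<M. (norm (c n))\<^sup>2)"
      using elim by (intro sum_mono2) auto
    ultimately show ?case by linarith
  qed
  from tendsto_lowerbound[OF lim this] show ?thesis by simp
qed

section \<open>Fourier expansions on the upper half plane\<close>

definition qexp :: "complex \<Rightarrow> complex" where
  "qexp z = exp (2 * of_real pi * \<i> * z)"

lemma norm_qexp: "norm (qexp z) = exp (- 2 * pi * Im z)"
  by (simp add: qexp_def)

lemma norm_qexp_less_1: "Im z > 0 \<Longrightarrow> norm (qexp z) < 1"
  by (simp add: norm_qexp)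

lemma qexp_nonzero [simp]: "qexp z \<noteq> 0"
  by (simp add: qexp_def)

lemma qexp_add: "qexp (z + w) = qexp z * qexp w"
  by (simp add: qexp_def exp_add ring_distribs)

lemma qexp_mult_of_nat: "qexp (of_nat n * z) = qexp z ^ n"
  unfolding qexp_def exp_of_nat_mult[symmetric] by (simp add: mult_ac)

lemma qexp_of_real: "qexp (of_real x) = cis (2 * pi * x)"
  by (simp add: qexp_def cis_conv_exp mult_ac)

lemma has_field_derivative_qexp [derivative_intros]:
  assumes "(f has_field_derivative f') (at z within A)"
  shows "((\<lambda>z. qexp (f z)) has_field_derivative (2 * of_real pi * \<i> * qexp (f z) * f')) (at z within A)"
  unfolding qexp_def by (auto intro!: derivative_eq_intros assms)

lemma qexp_surj:
  assumes "x \<noteq> 0" "norm x < 1"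
  obtains z where "Im z > 0" "qexp z = x"
proof
  define z where "z = Ln x / (2 * of_real pi * \<i>)"
  show "qexp z = x" using assms by (simp add: z_def qexp_def)
  hence "exp (- 2 * pi * Im z) < 1" using assms norm_qexp[of z] by simp
  thus "Im z > 0" by (simp add: zero_less_mult_iff)
qed

lemma qexpansion_bessel:
  fixes c :: "nat \<Rightarrow> complex"
  assumes sm: "summable (\<lambda>n. norm (c n) * exp (- 2 * pi * y) ^ n)"
    and bd: "\<And>x. norm (\<Sum>n. c n * qexp (Complex x y) ^ n) \<le> C"
  shows "(\<Sum>n<N. (norm (c n))\<^sup>2 * exp (- 4 * pi * y * real n)) \<le> C\<^sup>2"
proof -
  have 1: "(norm (c n * of_real (exp (- 2 * pi * y) ^ n)))\<^sup>2 = (norm (c n))\<^sup>2 * exp (- 4 * pi * y * real n)" for n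
    by (simp add: norm_mult power_mult_distrib norm_power mult_ac flip: exp_of_nat_mult exp_double)
  have "(\<Sum>n<N. (norm (c n * of_real (exp (- 2 * pi * y) ^ n)))\<^sup>2) \<le> C\<^sup>2"
  proof (rule bessel_power_series)
    show "summable (\<lambda>n. norm (c n * of_real (exp (- 2 * pi * y) ^ n)))"
      using sm by (simp add: norm_mult norm_power)
    fix \<theta> :: real
    have "qexp (Complex (\<theta> / (2 * pi)) y) = of_real (exp (- 2 * pi * y)) * cis \<theta>"
      by (simp add: qexp_def exp_eq_polar)
    hence "qexp (Complex (\<theta> / (2 * pi)) y) ^ n = of_real (exp (- 2 * pi * y) ^ n) * cis (real n * \<theta>)" for n
      by (simp add: power_mult_distrib Complex.DeMoivre)
    thus "norm (\<Sum>n. c n * of_real (exp (- 2 * pi * y) ^ n) * cis (real n * \<theta>)) \<le> C"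
      using bd[of "\<theta> / (2 * pi)"] by (simp add: mult.assoc)
  qed
  thus ?thesis by (simp only: 1)
qed

text \<open>Bessel's inequality with the bound \<open>C = 0\<close> on a single horizontal
  line.\<close>

lemma qexpansion_eq_0:
  fixes c :: "nat \<Rightarrow> complex"
  assumes sm: "summable (\<lambda>n. norm (c n) * exp (- 2 * pi * y) ^ n)"
    and z: "\<And>x. (\<Sum>n. c n * qexp (Complex x y) ^ n) = 0"
  shows "c n = 0"
proof -
  have "(\<Sum>m<Suc n. (norm (c m))\<^sup>2 * exp (- 4 * pi * y * real m)) \<le> 0\<^sup>2"
    by (rule qexpansion_bessel[OF sm]) (simp add: z)
  hence "(\<Sum>m<Suc n. (norm (c m))\<^sup>2 * exp (- 4 * pi * y * real m)) = 0"
    by (intro antisym sum_nonneg) (simp_all only: zero_power2, simp)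
  hence "(norm (c n))\<^sup>2 * exp (- 4 * pi * y * real n) = 0"
    by (subst (asm) sum_nonneg_eq_0_iff) auto
  thus ?thesis by simp
qed

subsection \<open>Integral matrices and the Hecke relations\<close>

type_synonym mat2 = "int \<times> int \<times> int \<times> int"

fun mdet :: "mat2 \<Rightarrow> int" where "mdet (a, b, c, d) = a * d - b * c"
fun mmul :: "mat2 \<Rightarrow> mat2 \<Rightarrow> mat2" where
  "mmul (a, b, c, d) (a', b', c', d') = (a * a' + b * c', a * b' + b * d', c * a' + d * c', c * b' + d * d')"
fun madj :: "mat2 \<Rightarrow> mat2" where "madj (a, b, c, d) = (d, - b, - c, a)"
fun mob :: "mat2 \<Rightarrow> complex \<Rightarrow> complex" where
  "mob (a, b, c, d) z = (of_int a * z + of_int b) / (of_int c * z + of_int d)"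
fun aut :: "mat2 \<Rightarrow> complex \<Rightarrow> complex" where
  "aut (a, b, c, d) z = of_int c * z + of_int d"

lemma mdet_mmul [simp]: "mdet (mmul M N) = mdet M * mdet N"
  by (cases M; cases N) (simp add: algebra_simps)

lemma mdet_madj [simp]: "mdet (madj M) = mdet M"
  by (cases M) (simp add: algebra_simps)

lemma madj_madj [simp]: "madj (madj M) = M"
  by (cases M) simp

lemma mmul_assoc: "mmul (mmul L M) N = mmul L (mmul M N)"
  by (cases L; cases M; cases N) (simp add: algebra_simps)

lemma madj_mmul: "mdet M = 1 \<Longrightarrow> mmul (madj M) (mmul M N) = N"
proof (cases M; cases N)
  fix a b c d a' b' c' d' assume *: "M = (a, b, c, d)" "N = (a', b', c', d')" "mdet M = 1"
  hence 1: "a * d - b * c = 1" by simp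
  have "d * (a * a' + b * c') - b * (c * a' + d * c') = a'" "d * (a * b' + b * d') - b * (c * b' + d * d') = b'"
    "a * (c * a' + d * c') - c * (a * a' + b * c') = c'" "a * (c * b' + d * d') - c * (a * b' + b * d') = d'"
    using arg_cong[OF 1, of "\<lambda>x. x * a'"] arg_cong[OF 1, of "\<lambda>x. x * b'"]
      arg_cong[OF 1, of "\<lambda>x. x * c'"] arg_cong[OF 1, of "\<lambda>x. x * d'"]
    by (simp_all add: algebra_simps)
  thus ?thesis using * by simp
qed

lemma aut_nonzero:
  assumes "mdet M > 0" "Im z > 0"
  shows "aut M z \<noteq> 0"
proof (cases M)
  case (fields a b c d)
  show ?thesis
  proof
    assume 0: "aut M z = 0"
    hence "Im (of_int c * z + of_int d) = 0" by (simp add: fields)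
    hence "c = 0" using assms by simp
    moreover from this 0 have "d = 0" by (simp add: fields)
    ultimately show False using assms fields by simp
  qed
qed

lemma Im_mob:
  assumes "mdet M > 0" "Im z > 0"
  shows "Im (mob M z) = mdet M * Im z / (norm (aut M z))\<^sup>2"
proof (cases M)
  case (fields a b c d)
  have nz: "of_int c * z + of_int d \<noteq> 0" using aut_nonzero[OF assms] by (simp add: fields)
  have "Im (mob M z) = Im ((of_int a * z + of_int b) * cnj (of_int c * z + of_int d) / of_real ((norm (of_int c * z + of_int d))\<^sup>2))"
    by (simp add: fields complex_div_cnj[of _ "of_int c * z + of_int d"])
  also have "\<dots> = Im ((of_int a * z + of_int b) * cnj (of_int c * z + of_int d)) / (norm (of_int c * z + of_int d))\<^sup>2"
    by (rule Im_divide_of_real)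
  also have "Im ((of_int a * z + of_int b) * cnj (of_int c * z + of_int d)) = mdet M * Im z"
    by (simp add: fields algebra_simps)
  finally show ?thesis by (simp add: fields)
qed

lemma Im_mob_pos: "mdet M > 0 \<Longrightarrow> Im z > 0 \<Longrightarrow> Im (mob M z) > 0"
  using Im_mob[of M z] aut_nonzero[of M z] by simp

lemma mob_mmul:
  assumes "mdet N > 0" "Im z > 0"
  shows "mob (mmul M N) z = mob M (mob N z)"
proof (cases M; cases N)
  fix a b c d a' b' c' d' assume *: "M = (a, b, c, d)" "N = (a', b', c', d')"
  have "of_int c' * z + of_int d' \<noteq> 0" using aut_nonzero[OF assms] by (simp add: *)
  thus ?thesis by (simp add: * divide_simps) (simp add: algebra_simps)
qed

lemma aut_mmul:
  assumes "mdet N > 0" "Im z > 0"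
  shows "aut (mmul M N) z = aut M (mob N z) * aut N z"
proof (cases M; cases N)
  fix a b c d a' b' c' d' assume *: "M = (a, b, c, d)" "N = (a', b', c', d')"
  have "of_int c' * z + of_int d' \<noteq> 0" using aut_nonzero[OF assms] by (simp add: *)
  thus ?thesis by (simp add: * divide_simps) (simp add: algebra_simps)
qed

lemma mmul_madj_self: "mmul (madj M) M = (mdet M, 0, 0, mdet M)"
  by (cases M) (simp add: algebra_simps)

lemma mob_madj_mob:
  assumes "mdet M > 0" "Im z > 0"
  shows "mob (madj M) (mob M z) = z"
  using assms mob_mmul[OF assms, of "madj M"] by (simp add: mmul_madj_self)

lemma aut_madj_mob:
  assumes "mdet M > 0" "Im z > 0"
  shows "aut (madj M) (mob M z) * aut M z = of_int (mdet M)"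
  using assms aut_mmul[OF assms, of "madj M"] by (simp add: mmul_madj_self)

lemma has_field_derivative_mob:
  assumes "mdet M > 0" "Im z > 0"
  shows "(mob M has_field_derivative of_int (mdet M) / (aut M z)\<^sup>2) (at z)"
proof (cases M)
  case (fields a b c d)
  have nz: "of_int c * z + of_int d \<noteq> 0" using aut_nonzero[OF assms] by (simp add: fields)
  have "((\<lambda>z. (of_int a * z + of_int b) / (of_int c * z + of_int d)) has_field_derivative
     of_int (mdet M) / (aut M z)\<^sup>2) (at z)"
    using nz by (auto intro!: derivative_eq_intros simp: fields power2_eq_square divide_simps) (simp add: algebra_simps)
  moreover have "mob M = (\<lambda>z. (of_int a * z + of_int b) / (of_int c * z + of_int d))"
    by (auto simp: fields)
  ultimately show ?thesis by simp
qed

text \<open>\<open>qexp\<close> maps the half plane onto the punctured unit disc, so the series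
  converges at a real radius \<open>r\<close> strictly between \<open>norm x\<close> and 1; this
  dominates the series of norms at \<open>x\<close>.\<close>

lemma qexpansion_abs_summable:
  fixes c :: "nat \<Rightarrow> complex" and x :: complex
  assumes "\<And>z. Im z > 0 \<Longrightarrow> summable (\<lambda>n. c n * qexp z ^ n)" and "norm x < 1"
  shows "summable (\<lambda>n. norm (c n) * norm x ^ n)"
proof -
  define r where "r = (norm x + 1) / 2"
  have r: "norm x < r" "0 < r" "r < 1" using assms(2) by (auto simp: r_def add_nonneg_pos)
  have "complex_of_real r \<noteq> 0" "norm (complex_of_real r) < 1" using r by auto
  then obtain z where z: "Im z > 0" "qexp z = complex_of_real r" by (rule qexp_surj)
  have "summable (\<lambda>n. norm (c n * x ^ n))"
    by (rule powser_insidea[of _ "qexp z"]) (use assms(1)[OF z(1)] z(2) r in auto)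
  thus ?thesis by (simp add: norm_mult norm_power)
qed

lemma qexpansion_unique:
  fixes b c :: "nat \<Rightarrow> complex"
  assumes b: "\<And>z. Im z > 0 \<Longrightarrow> (\<lambda>n. b n * qexp z ^ n) sums f z"
    and c: "\<And>z. Im z > 0 \<Longrightarrow> (\<lambda>n. c n * qexp z ^ n) sums f z"
  shows "b n = c n"
proof -
  have d: "(\<lambda>n. (b n - c n) * qexp z ^ n) sums 0" if "Im z > 0" for z
    using sums_diff[OF b[OF that] c[OF that]] by (simp add: algebra_simps)
  have "b n - c n = 0"
  proof (rule qexpansion_eq_0[where y = 1 and c = "\<lambda>n. b n - c n"])
    show "summable (\<lambda>n. norm (b n - c n) * exp (- 2 * pi * 1) ^ n)"
      using qexpansion_abs_summable[of "\<lambda>n. b n - c n" "complex_of_real (exp (- 2 * pi))"] d[THEN sums_summable] by simp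
  qed (use d in \<open>auto simp: sums_iff\<close>)
  thus ?thesis by simp
qed

section \<open>Hecke relations between the Fourier coefficients\<close>

locale cusp_eigenform =
  fixes k :: nat and h :: "complex \<Rightarrow> complex" and a :: "nat \<Rightarrow> complex"
  assumes k_ge_1: "k \<ge> 1"
    and cusp: "cusp_form k h"
    and eigen: "hecke_eigenform k h"
    and expansion: "cusp_q_expansion h a"
    and a_1: "a 1 = 1"
begin

lemma a_Suc_0 [simp]: "a (Suc 0) = 1"
  using a_1 by simp

lemma a_0 [simp]: "a 0 = 0"
  using expansion by (simp add: cusp_q_expansion_def)

lemma h_sums: "Im z > 0 \<Longrightarrow> (\<lambda>n. a n * qexp z ^ n) sums h z"
  using expansion unfolding cusp_q_expansion_def upper_half_plane_def qexp_mult_of_nat[symmetric]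
  by (auto simp: qexp_def mult_ac)

lemma summable_a: "norm (x :: complex) < 1 \<Longrightarrow> summable (\<lambda>n. norm (a n) * norm x ^ n)"
  by (rule qexpansion_abs_summable) (auto intro: sums_summable[OF h_sums])

lemma h_holomorphic: "h holomorphic_on {z. Im z > 0}"
  using cusp by (simp add: cusp_form_def upper_half_plane_def)

lemma h_mob:
  assumes "mdet M = 1" "Im z > 0"
  shows "h (mob M z) = aut M z ^ k * h z"
  using assms cusp by (cases M) (auto simp: cusp_form_def modular_transform_invariant_def upper_half_plane_def)

lemma h_nonzero: "\<exists>x. h (Complex x y) \<noteq> 0" if "y > 0"
proof (rule ccontr)
  assume *: "\<nexists>x. h (Complex x y) \<noteq> 0"
  have "a 1 = 0"
  proof (rule qexpansion_eq_0[where y = y])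
    show "summable (\<lambda>n. norm (a n) * exp (- 2 * pi * y) ^ n)"
      using summable_a[of "complex_of_real (exp (- 2 * pi * y))"] that by simp
    show "(\<Sum>n. a n * qexp (Complex x y) ^ n) = 0" for x
      using h_sums[of "Complex x y"] * that by (simp add: sums_iff)
  qed
  thus False by simp
qed

text \<open>The matrix \<open>-I\<close> fixes every point and has automorphy factor
  \<open>-1\<close>, so an odd weight would force \<open>h = 0\<close>.\<close>

lemma even_k: "even k"
proof -
  obtain x where x: "h (Complex x 1) \<noteq> 0" using h_nonzero[of 1] by auto
  have "h (Complex x 1) = (- 1) ^ k * h (Complex x 1)"
    using h_mob[of "(- 1, 0, 0, - 1)" "Complex x 1"] by simp
  thus ?thesis using x by (cases "even k") auto
qed

lemma k_ge_2: "k \<ge> 2"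
  using even_k k_ge_1 by (cases "k = 1") auto

text \<open>The sum over the translates \<open>b\<close> is a sum over \<open>d\<close>-th roots of
  unity, which keeps only the indices divisible by \<open>d\<close>. The index is then changed from
  \<open>d * s\<close> to \<open>g * s\<close>, which gives an expansion in
  \<open>qexp z\<close>.\<close>

lemma hecke_coset_expansion:
  assumes "d > 0" "g > 0" "Im z > 0"
  shows "(\<lambda>m. if g dvd m then of_nat d * a (d * (m div g)) * qexp z ^ m else 0) sums
           (\<Sum>b<d. h ((of_nat g * z + of_nat b) / of_nat d))"
proof -
  let ?w = "\<lambda>b. (of_nat g * z + of_nat b) / of_nat d"
  have im: "Im (?w b) > 0" for b using assms by (simp add: Im_divide_of_nat)
  have w: "?w b = of_nat g * z / of_nat d + of_real (real b / real d)" for b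
    by (simp add: add_divide_distrib)
  have "(\<lambda>r. \<Sum>b<d. a r * qexp (?w b) ^ r) sums (\<Sum>b<d. h (?w b))"
    by (rule sums_sum) (rule h_sums[OF im])
  also have "(\<lambda>r. \<Sum>b<d. a r * qexp (?w b) ^ r) =
     (\<lambda>r. if d dvd r then of_nat d * a r * qexp (of_nat g * z / of_nat d) ^ r else 0)"
  proof
    fix r
    have "(\<Sum>b<d. a r * qexp (?w b) ^ r) = a r * qexp (of_nat g * z / of_nat d) ^ r *
        (\<Sum>b<d. cis (2 * pi * real_of_int (int r) * real b / real d))"
      unfolding w qexp_add qexp_of_real power_mult_distrib Complex.DeMoivre sum_distrib_left
      by (intro sum.cong refl) (simp add: mult_ac)
    thus "(\<Sum>b<d. a r * qexp (?w b) ^ r) =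
      (if d dvd r then of_nat d * a r * qexp (of_nat g * z / of_nat d) ^ r else 0)"
      using sum_root_of_unity_power[OF assms(1), of "int r"] by (simp add: mult_ac)
  qed
  finally have "(\<lambda>s. if d dvd d * s then of_nat d * a (d * s) * qexp (of_nat g * z / of_nat d) ^ (d * s) else 0)
      sums (\<Sum>b<d. h (?w b))"
    by (subst sums_mono_reindex[where g = "\<lambda>s. d * s"]) (use assms in \<open>auto simp: strict_mono_def elim!: dvdE\<close>)
  also have "(\<lambda>s. if d dvd d * s then of_nat d * a (d * s) * qexp (of_nat g * z / of_nat d) ^ (d * s) else 0)
     = (\<lambda>s. if g dvd g * s then of_nat d * a (d * (g * s div g)) * qexp z ^ (g * s) else 0)"
  proof
    fix s
    have "qexp (of_nat g * z / of_nat d) ^ (d * s) = qexp z ^ (g * s)"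
      unfolding qexp_mult_of_nat[symmetric] using assms by (simp add: mult_ac)
    thus "(if d dvd d * s then of_nat d * a (d * s) * qexp (of_nat g * z / of_nat d) ^ (d * s) else 0)
     = (if g dvd g * s then of_nat d * a (d * (g * s div g)) * qexp z ^ (g * s) else 0)"
      using assms by simp
  qed
  finally show ?thesis
    by (subst (asm) sums_mono_reindex[where g = "\<lambda>s. g * s"
          and f = "\<lambda>m. if g dvd m then of_nat d * a (d * (m div g)) * qexp z ^ m else 0"])
       (use assms in \<open>auto simp: strict_mono_def elim!: dvdE\<close>)
qed

text \<open>With \<open>g = n div d\<close> this is the classical sum of
  \<open>g^(k-1) a(n m / g^2)\<close> over the common divisors \<open>g\<close> of \<open>n\<close>
  and \<open>m\<close>.\<close>

definition hecke_coeff :: "nat \<Rightarrow> nat \<Rightarrow> complex" where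
  "hecke_coeff n m = (\<Sum>d | d dvd n. if n div d dvd m then of_nat (n div d) ^ (k - 1) * a (d * (m div (n div d))) else 0)"

lemma hecke_op_sums:
  assumes "n > 0" "Im z > 0"
  shows "(\<lambda>m. hecke_coeff n m * qexp z ^ m) sums hecke_op k n h z"
proof -
  have "(\<lambda>m. \<Sum>d | d dvd n. of_nat n ^ (k - 1) / of_nat d ^ k *
      (if n div d dvd m then of_nat d * a (d * (m div (n div d))) * qexp z ^ m else 0)) sums
     (\<Sum>d | d dvd n. of_nat n ^ (k - 1) / of_nat d ^ k * (\<Sum>b<d. h ((of_nat (n div d) * z + of_nat b) / of_nat d)))"
    using assms by (intro sums_sum sums_mult hecke_coset_expansion) (auto elim!: dvdE)
  also have "(\<Sum>d | d dvd n. of_nat n ^ (k - 1) / of_nat d ^ k * (\<Sum>b<d. h ((of_nat (n div d) * z + of_nat b) / of_nat d))) = hecke_op k n h z"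
    by (simp add: hecke_op_def sum_distrib_left sum_divide_distrib)
  also have "(\<lambda>m. \<Sum>d | d dvd n. of_nat n ^ (k - 1) / of_nat d ^ k *
      (if n div d dvd m then of_nat d * a (d * (m div (n div d))) * qexp z ^ m else 0)) = (\<lambda>m. hecke_coeff n m * qexp z ^ m)"
  proof
    fix m
    have "of_nat n ^ (k - 1) / of_nat d ^ k * (of_nat d * x) = of_nat (n div d) ^ (k - 1) * x"
      if "d dvd n" for d and x :: complex
    proof -
      from that obtain g where g: "n = d * g" by blast
      have "k = Suc (k - 1)" using k_ge_1 by simp
      hence "(of_nat d :: complex) ^ k = of_nat d * of_nat d ^ (k - 1)" by (metis power_Suc)
      thus ?thesis using g assms by (simp add: power_mult_distrib)
    qed
    thus "(\<Sum>d | d dvd n. of_nat n ^ (k - 1) / of_nat d ^ k *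
      (if n div d dvd m then of_nat d * a (d * (m div (n div d))) * qexp z ^ m else 0)) = hecke_coeff n m * qexp z ^ m"
      unfolding hecke_coeff_def sum_distrib_right by (intro sum.cong refl) (simp add: mult.assoc)
  qed
  finally show ?thesis .
qed

text \<open>Uniqueness of expansions makes the coefficients proportional to \<open>a m\<close>. At
  \<open>m = 1\<close> only the term \<open>d = n\<close> survives, which identifies the eigenvalue
  as \<open>a n\<close> because \<open>a 1 = 1\<close>.\<close>

lemma hecke_eigenvalue:
  assumes "n > 0"
  shows "hecke_coeff n m = a n * a m" and "Im z > 0 \<Longrightarrow> hecke_op k n h z = a n * h z"
proof -
  obtain c where c: "\<And>z. Im z > 0 \<Longrightarrow> hecke_op k n h z = c * h z"
    using eigen assms unfolding hecke_eigenform_def upper_half_plane_def by (metis Suc_leI One_nat_def mem_Collect_eq)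
  have *: "hecke_coeff n m = c * a m" for m
  proof (rule qexpansion_unique)
    show "(\<lambda>m. hecke_coeff n m * qexp z ^ m) sums hecke_op k n h z" if "Im z > 0" for z
      by (rule hecke_op_sums[OF assms that])
    show "(\<lambda>m. c * a m * qexp z ^ m) sums hecke_op k n h z" if "Im z > 0" for z
      using sums_mult[OF h_sums[OF that], of c] c[OF that] by (simp add: mult_ac)
  qed
  have "hecke_coeff n 1 = (\<Sum>d\<in>{n}. a n)"
    unfolding hecke_coeff_def
    by (rule sum.mono_neutral_cong_right) (use assms in \<open>auto simp: div_eq_dividend_iff elim!: dvdE\<close>)
  hence "c = a n" using *[of 1] by simp
  thus "hecke_coeff n m = a n * a m" "Im z > 0 \<Longrightarrow> hecke_op k n h z = a n * h z" using * c by auto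
qed

lemma a_mult_coprime:
  assumes "coprime m n"
  shows "a (m * n) = a m * a n"
proof (cases "m > 0")
  case True
  have "hecke_coeff m n = (\<Sum>d\<in>{m}. a (m * n))"
    unfolding hecke_coeff_def
  proof (rule sum.mono_neutral_cong_right)
    show "\<forall>i\<in>{d. d dvd m} - {m}. (if m div i dvd n then of_nat (m div i) ^ (k - 1) * a (i * (n div (m div i))) else 0) = 0"
    proof
      fix d assume d: "d \<in> {d. d dvd m} - {m}"
      then obtain g where g: "m = d * g" by auto
      hence "g \<noteq> 1" "d > 0" using d True by auto
      moreover have "g dvd m" using g by simp
      ultimately have "\<not> g dvd n" using assms coprime_common_divisor_nat by blast
      thus "(if m div d dvd n then of_nat (m div d) ^ (k - 1) * a (d * (n div (m div d))) else 0) = 0"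
        using g \<open>d > 0\<close> by simp
    qed
  qed (use True in auto)
  thus ?thesis using hecke_eigenvalue(1)[OF True, of n] by simp
next
  case False
  thus ?thesis using assms by simp
qed

lemma a_prime_power_Suc:
  assumes "prime p"
  shows "a (p ^ Suc (Suc n)) = a p * a (p ^ Suc n) - of_nat p ^ (k - 1) * a (p ^ n)"
proof -
  have p: "p > 0" "p \<noteq> 1" using assms by (auto simp: prime_gt_0_nat)
  have "{d. d dvd p} = {1, p}" using assms by (auto simp: prime_nat_iff)
  hence "hecke_coeff p (p ^ Suc n) = of_nat p ^ (k - 1) * a (p ^ n) + a (p * p ^ Suc n)"
    using p by (simp add: hecke_coeff_def)
  thus ?thesis using hecke_eigenvalue(1)[OF p(1), of "p ^ Suc n"] by (simp add: algebra_simps)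
qed

lemma hecke_prime:
  assumes "prime p" "Im z > 0"
  shows "a p * h z = of_nat p ^ (k - 1) * h (of_nat p * z) + (\<Sum>b<p. h ((z + of_nat b) / of_nat p)) / of_nat p"
proof -
  have p: "p > 0" "p \<noteq> 1" using assms by (auto simp: prime_gt_0_nat)
  have dv: "{d. d dvd p} = {1, p}" using assms by (auto simp: prime_nat_iff)
  have "k = Suc (k - 1)" using k_ge_1 by simp
  hence pk: "(of_nat p :: complex) ^ k = of_nat p * of_nat p ^ (k - 1)" by (metis power_Suc)
  have "hecke_op k p h z = of_nat p ^ (k - 1) * (h (of_nat p * z) + (\<Sum>b<p. h ((z + of_nat b) / of_nat p)) / of_nat p ^ k)"
    using p by (simp add: hecke_op_def dv sum_divide_distrib)
  also have "\<dots> = of_nat p ^ (k - 1) * h (of_nat p * z) + (\<Sum>b<p. h ((z + of_nat b) / of_nat p)) / of_nat p"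
    using p by (simp add: pk ring_distribs)
  finally show ?thesis using hecke_eigenvalue(2)[OF p(1) assms(2)] by simp
qed

end

subsection \<open>Reduction to a Siegel set and the Hecke bound\<close>

text \<open>Dirichlet approximation of \<open>Re z\<close> with denominators up to about
  \<open>1 / sqrt (Im z)\<close> yields a coprime bottom row with small automorphy factor. Its two
  squares contribute at most \<open>y\<close> and \<open>4 * y\<close>, which is where 1/5 comes
  from. A translation by the nearest integer then centres the real part.\<close>

lemma reduce_to_siegel_set:
  assumes "Im z > 0"
  obtains M where "mdet M = 1" "Im (mob M z) \<ge> 1 / 5" "\<bar>Re (mob M z)\<bar> \<le> 1 / 2"
proof -
  obtain M where M: "mdet M = 1" "Im (mob M z) \<ge> 1 / 5"
  proof (cases "Im z \<ge> 1")
    case True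
    thus ?thesis by (intro that[of "(1, 0, 0, 1)"]) auto
  next
    case False
    define y where "y = Im z"
    define N where "N = nat \<lceil>1 / sqrt y\<rceil>"
    have y: "0 < y" "y < 1" using False assms by (auto simp: y_def)
    have N1: "real N \<ge> 1 / sqrt y" and N2: "real N \<le> 1 / sqrt y + 1"
      using y by (auto simp: N_def of_nat_nat)
    have sy: "0 < sqrt y" "sqrt y < 1" using y by auto
    have N0: "N > 0"
      using N1 sy by (metis of_nat_0 of_nat_0_less_iff divide_pos_pos less_le_trans zero_less_one)
    have Ninv: "1 / real N \<le> sqrt y" using N1 sy N0 by (simp add: field_simps)
    have "real N * sqrt y \<le> 2"
    proof -
      have "real N * sqrt y \<le> (1 / sqrt y + 1) * sqrt y" using N2 sy by (intro mult_right_mono) auto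
      also have "(1 / sqrt y + 1) * sqrt y = 1 + sqrt y" using sy(1) by (simp add: distrib_right)
      finally show ?thesis using sy by linarith
    qed
    hence "(real N * sqrt y)\<^sup>2 \<le> 2\<^sup>2" using sy by (intro power_mono) auto
    hence Ny: "(real N)\<^sup>2 * y \<le> 4" using y by (simp add: power_mult_distrib)
    obtain d c :: int where dc: "coprime d c" "0 < c" "c \<le> int N" "\<bar>of_int c * Re z - of_int d\<bar> < 1 / N"
      using Dirichlet_approx_coprime[OF N0, of "Re z"] by blast
    obtain u v where uv: "u * d + v * c = 1"
      using bezout_int[of d c] dc(1) by auto
    define M where "M = (- u, - v, c, - d)"
    have M1: "mdet M = 1" using uv by (simp add: M_def mult_ac)
    have "(norm (aut M z))\<^sup>2 = (of_int c * Re z - of_int d)\<^sup>2 + (of_int c * y)\<^sup>2"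
      by (simp add: M_def cmod_power2 y_def)
    also have "\<dots> \<le> (sqrt y)\<^sup>2 + (real N * y)\<^sup>2"
    proof (intro add_mono)
      have "\<bar>of_int c * Re z - of_int d\<bar> \<le> sqrt y" using dc(4) Ninv by linarith
      thus "(of_int c * Re z - of_int d)\<^sup>2 \<le> (sqrt y)\<^sup>2" using sy by (intro abs_le_square_iff[THEN iffD1]) auto
      have "real_of_int c \<le> real N" using dc(3) by linarith
      thus "(of_int c * y)\<^sup>2 \<le> (real N * y)\<^sup>2" using dc(2) y by (intro power_mono mult_right_mono) auto
    qed
    also have "\<dots> \<le> 5 * y"
      using mult_right_mono[OF Ny, of y] y by (simp add: power2_eq_square mult_ac)
    finally have "(norm (aut M z))\<^sup>2 \<le> 5 * y" .
    moreover have "norm (aut M z) > 0" using aut_nonzero[of M z] M1 assms by simp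
    ultimately have "y / (5 * y) \<le> y / (norm (aut M z))\<^sup>2"
      using y by (intro divide_left_mono) auto
    hence "Im (mob M z) \<ge> 1 / 5"
      using Im_mob[of M z] M1 assms y by (simp add: y_def)
    thus ?thesis using M1 that by blast
  qed
  define n where "n = round (Re (mob M z))"
  have "mob (mmul (1, - n, 0, 1) M) z = mob (1, - n, 0, 1) (mob M z)"
    by (rule mob_mmul) (use M assms in auto)
  hence eq: "mob (mmul (1, - n, 0, 1) M) z = mob M z - of_int n" by simp
  show ?thesis
  proof (rule that)
    show "mdet (mmul (1, - n, 0, 1) M) = 1" using M by simp
    show "Im (mob (mmul (1, - n, 0, 1) M) z) \<ge> 1 / 5" using M by (simp only: eq) simp
    show "\<bar>Re (mob (mmul (1, - n, 0, 1) M) z)\<bar> \<le> 1 / 2"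
      using of_int_round_abs_le[of "Re (mob M z)"] by (simp only: eq) (simp add: n_def abs_minus_commute)
  qed
qed

text \<open>The constant term is absent, so every term carries at least one factor
  \<open>t = exp (- 2 * pi * (Im z - y0))\<close>; what remains is bounded by the sum of norms at
  height \<open>y0\<close>.\<close>

lemma qexpansion_decay:
  fixes c :: "nat \<Rightarrow> complex"
  assumes c: "\<And>z. Im z > 0 \<Longrightarrow> (\<lambda>n. c n * qexp z ^ n) sums f z" and c0: "c 0 = 0" and "y0 > 0"
  obtains C where "C \<ge> 0" "\<And>z. Im z \<ge> y0 \<Longrightarrow> norm (f z) \<le> C * exp (- 2 * pi * Im z)"
proof -
  define r where "r = exp (- 2 * pi * y0)"
  define S where "S = (\<Sum>n. norm (c n) * r ^ n)"
  have sm: "summable (\<lambda>n. norm (c n) * r ^ n)"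
    using qexpansion_abs_summable[of c "complex_of_real r"] sums_summable[OF c] assms(3) by (simp add: r_def)
  show ?thesis
  proof (rule that[of "S * exp (2 * pi * y0)"])
    show "S * exp (2 * pi * y0) \<ge> 0"
      unfolding S_def by (intro mult_nonneg_nonneg suminf_nonneg sm) (auto simp: r_def)
    fix z assume z: "Im z \<ge> y0"
    define t where "t = exp (- 2 * pi * (Im z - y0))"
    have t: "0 < t" "t \<le> 1" using z by (auto simp: t_def)
    have nq: "norm (qexp z) = r * t"
      by (simp add: norm_qexp r_def t_def flip: exp_add) (simp add: algebra_simps)
    have trm: "norm (c n * qexp z ^ n) \<le> norm (c n) * r ^ n * t" for n
    proof (cases n)
      case 0
      thus ?thesis using c0 by simp
    next
      case (Suc m)
      have "t ^ n \<le> t" using t power_decreasing[of 1 n t] Suc by simp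
      thus ?thesis using t
        by (simp add: norm_mult norm_power nq power_mult_distrib mult.assoc[symmetric] mult_left_mono r_def)
    qed
    have s2: "summable (\<lambda>n. norm (c n * qexp z ^ n))"
      by (rule summable_comparison_test'[OF summable_mult2[OF sm, of t], of 0]) (use trm in simp)
    have "norm (f z) \<le> (\<Sum>n. norm (c n * qexp z ^ n))"
      using summable_norm[OF s2] c[of z] z assms(3) by (simp add: sums_iff)
    also have "\<dots> \<le> (\<Sum>n. norm (c n) * r ^ n * t)"
      by (rule suminf_le[OF trm s2 summable_mult2[OF sm]])
    also have "\<dots> = S * t" unfolding S_def by (rule suminf_mult2[OF sm, symmetric])
    also have "t = exp (2 * pi * y0) * exp (- 2 * pi * Im z)"
      by (simp add: t_def flip: exp_add) (simp add: algebra_simps)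
    finally show "norm (f z) \<le> S * exp (2 * pi * y0) * exp (- 2 * pi * Im z)" by (simp add: mult.assoc)
  qed
qed

lemma power_le_fact_exp:
  fixes x :: real assumes "x \<ge> 0"
  shows "x ^ n \<le> fact n * exp x"
proof -
  have "(\<Sum>m\<in>{n}. x ^ m /\<^sub>R fact m) \<le> exp x"
    unfolding exp_def using assms by (intro sum_le_suminf summable_exp_generic) auto
  thus ?thesis by (simp add: field_simps)
qed

lemma power_exp_decay_bounded:
  assumes "v \<ge> (0::real)" "c \<ge> 1"
  shows "v ^ n * exp (- c * v) \<le> fact n"
proof -
  have "v ^ n * exp (- c * v) \<le> (fact n * exp v) * exp (- c * v)"
    by (intro mult_right_mono power_le_fact_exp assms) auto
  also have "\<dots> = fact n * exp (v - c * v)" by (simp add: exp_diff exp_minus field_simps)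
  also have "\<dots> \<le> fact n * 1" using assms using mult_right_mono[of 1 c v] by (intro mult_left_mono) auto
  finally show ?thesis by simp
qed

context cusp_eigenform
begin

lemma invariant_norm_mob:
  assumes "mdet M = 1" "Im z > 0"
  shows "(norm (h (mob M z)))\<^sup>2 * Im (mob M z) ^ k = (norm (h z))\<^sup>2 * Im z ^ k"
  using aut_nonzero[of M z] assms
  by (simp add: h_mob Im_mob norm_mult norm_power power_mult_distrib power_divide mult.commute[of 2 k] flip: power_mult)

text \<open>The function \<open>|h z|^2 (Im z)^k\<close> is invariant under the modular group, so it
  need be bounded only on the Siegel set, where exponential decay beats the power of
  \<open>Im z\<close>.\<close>

lemma hecke_bound:
  obtains B where "B \<ge> 0" "\<And>z. Im z > 0 \<Longrightarrow> (norm (h z))\<^sup>2 * Im z ^ k \<le> B"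
proof -
  obtain C where C: "C \<ge> 0" "\<And>z. Im z \<ge> 1/5 \<Longrightarrow> norm (h z) \<le> C * exp (- 2 * pi * Im z)"
    using qexpansion_decay[OF h_sums a_0, of "1/5"] by auto
  show ?thesis
  proof (rule that[of "C\<^sup>2 * fact k"])
    fix z assume z: "Im z > 0"
    obtain M where M: "mdet M = 1" "Im (mob M z) \<ge> 1 / 5" using reduce_to_siegel_set[OF z] by blast
    let ?v = "Im (mob M z)"
    have "(norm (h (mob M z)))\<^sup>2 * ?v ^ k \<le> (C * exp (- 2 * pi * ?v))\<^sup>2 * ?v ^ k"
      using C(2)[OF M(2)] M(2) by (intro mult_right_mono power_mono) auto
    also have "\<dots> = C\<^sup>2 * (?v ^ k * exp (- (4 * pi) * ?v))"
      by (simp add: power_mult_distrib mult_ac flip: exp_double)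
    also have "\<dots> \<le> C\<^sup>2 * fact k"
      using M(2) pi_gt3 by (intro mult_left_mono power_exp_decay_bounded) auto
    finally show "(norm (h z))\<^sup>2 * Im z ^ k \<le> C\<^sup>2 * fact k"
      using invariant_norm_mob[OF M(1) z] by simp
  qed simp
qed

lemma mean_square_bound:
  obtains B where "B \<ge> 0" "\<And>y N. y > 0 \<Longrightarrow> (\<Sum>n<N. (norm (a n))\<^sup>2 * exp (- 4 * pi * y * real n)) \<le> B / y ^ k"
proof -
  obtain B where B: "B \<ge> 0" "\<And>z. Im z > 0 \<Longrightarrow> (norm (h z))\<^sup>2 * Im z ^ k \<le> B" using hecke_bound by blast
  show ?thesis
  proof (rule that[OF B(1)])
    fix y :: real and N assume y: "y > 0"
    have "(\<Sum>n<N. (norm (a n))\<^sup>2 * exp (- 4 * pi * y * real n)) \<le> (sqrt (B / y ^ k))\<^sup>2"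
    proof (rule qexpansion_bessel)
      show "summable (\<lambda>n. norm (a n) * exp (- 2 * pi * y) ^ n)"
        using summable_a[of "complex_of_real (exp (- 2 * pi * y))"] y by simp
      fix x
      have "(norm (h (Complex x y)))\<^sup>2 \<le> B / y ^ k"
        using B(2)[of "Complex x y"] y by (simp add: field_simps)
      hence "norm (h (Complex x y)) \<le> sqrt (B / y ^ k)" by (rule real_le_rsqrt)
      thus "norm (\<Sum>n. a n * qexp (Complex x y) ^ n) \<le> sqrt (B / y ^ k)"
        using h_sums[of "Complex x y"] y by (simp add: sums_iff)
    qed
    thus "(\<Sum>n<N. (norm (a n))\<^sup>2 * exp (- 4 * pi * y * real n)) \<le> B / y ^ k"
      using B(1) y by simp
  qed
qed

end

subsection \<open>Binary forms\<close>

text \<open>A form is identified with the function it defines, which turns substitution into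
  composition. The coefficient set \<open>R\<close> is \<int> for the arithmetic and
  \<open>UNIV\<close> for the analysis.\<close>

definition form :: "complex set \<Rightarrow> nat \<Rightarrow> (complex \<Rightarrow> complex \<Rightarrow> complex) \<Rightarrow> bool" where
  "form R n F \<longleftrightarrow> (\<exists>c. (\<forall>m. c m \<in> R) \<and> (\<forall>x y. F x y = (\<Sum>m\<le>n. c m * x ^ m * y ^ (n - m))))"

fun act :: "mat2 \<Rightarrow> (complex \<Rightarrow> complex \<Rightarrow> complex) \<Rightarrow> complex \<Rightarrow> complex \<Rightarrow> complex" where
  "act (a, b, c, d) F x y = F (of_int a * x + of_int b * y) (of_int c * x + of_int d * y)"

lemma act_act: "act N (act M F) = act (mmul M N) F"
  by (cases M; cases N) (auto simp: fun_eq_iff algebra_simps intro!: arg_cong2[where f = F])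

definition subring :: "complex set \<Rightarrow> bool" where
  "subring R \<longleftrightarrow> \<int> \<subseteq> R \<and> (\<forall>x\<in>R. \<forall>y\<in>R. x + y \<in> R \<and> x * y \<in> R)"

lemma subring_Ints [simp]: "subring \<int>" and subring_UNIV [simp]: "subring UNIV"
  by (auto simp: subring_def)

lemma subringD:
  assumes "subring R"
  shows "of_int n \<in> R" "x \<in> R \<Longrightarrow> y \<in> R \<Longrightarrow> x + y \<in> R" "x \<in> R \<Longrightarrow> y \<in> R \<Longrightarrow> x * y \<in> R" "0 \<in> R"
  using assms by (auto simp: subring_def)

lemma form_const: "c \<in> R \<Longrightarrow> form R 0 (\<lambda>x y. c)"
  by (auto simp: form_def)

lemma form_add: "subring R \<Longrightarrow> form R n F \<Longrightarrow> form R n G \<Longrightarrow> form R n (\<lambda>x y. F x y + G x y)"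
  unfolding form_def
proof clarify
  fix c d assume "subring R" "\<forall>m. c m \<in> R" "\<forall>m. d m \<in> R"
    "\<forall>x y. F x y = (\<Sum>m\<le>n. c m * x ^ m * y ^ (n - m))" "\<forall>x y. G x y = (\<Sum>m\<le>n. d m * x ^ m * y ^ (n - m))"
  thus "\<exists>c. (\<forall>m. c m \<in> R) \<and> (\<forall>x y. F x y + G x y = (\<Sum>m\<le>n. c m * x ^ m * y ^ (n - m)))"
    by (intro exI[of _ "\<lambda>m. c m + d m"]) (auto simp: subringD ring_distribs sum.distrib)
qed

lemma form_scale: "subring R \<Longrightarrow> form R n F \<Longrightarrow> c \<in> R \<Longrightarrow> form R n (\<lambda>x y. c * F x y)"
  unfolding form_def
proof clarify
  fix d assume "subring R" "\<forall>m. d m \<in> R" "c \<in> R" "\<forall>x y. F x y = (\<Sum>m\<le>n. d m * x ^ m * y ^ (n - m))"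
  thus "\<exists>d. (\<forall>m. d m \<in> R) \<and> (\<forall>x y. c * F x y = (\<Sum>m\<le>n. d m * x ^ m * y ^ (n - m)))"
    by (intro exI[of _ "\<lambda>m. c * d m"]) (auto simp: subringD sum_distrib_left mult.assoc)
qed

lemma form_zero: "subring R \<Longrightarrow> form R n (\<lambda>x y. 0)"
  unfolding form_def by (intro exI[of _ "\<lambda>m. 0"]) (auto simp: subringD)

lemma form_sum:
  "subring R \<Longrightarrow> (\<And>i. i \<in> A \<Longrightarrow> form R n (F i)) \<Longrightarrow> form R n (\<lambda>x y. \<Sum>i\<in>A. F i x y)"
  by (induction A rule: infinite_finite_induct) (auto intro: form_add form_zero)

lemma form_mult_x: "subring R \<Longrightarrow> form R n F \<Longrightarrow> form R (Suc n) (\<lambda>x y. x * F x y)"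
  unfolding form_def
proof clarify
  fix c assume R: "subring R" "\<forall>m. c m \<in> R" "\<forall>x y. F x y = (\<Sum>m\<le>n. c m * x ^ m * y ^ (n - m))"
  show "\<exists>c. (\<forall>m. c m \<in> R) \<and> (\<forall>x y. x * F x y = (\<Sum>m\<le>Suc n. c m * x ^ m * y ^ (Suc n - m)))"
  proof (intro exI[of _ "\<lambda>m. case m of 0 \<Rightarrow> 0 | Suc i \<Rightarrow> c i"] conjI allI)
    fix x y
    show "x * F x y = (\<Sum>m\<le>Suc n. (case m of 0 \<Rightarrow> 0 | Suc i \<Rightarrow> c i) * x ^ m * y ^ (Suc n - m))"
      using R by (subst sum.atMost_Suc_shift) (simp add: sum_distrib_left mult_ac)
  qed (use R in \<open>auto simp: subringD split: nat.split\<close>)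
qed

lemma form_mult_y: "subring R \<Longrightarrow> form R n F \<Longrightarrow> form R (Suc n) (\<lambda>x y. y * F x y)"
  unfolding form_def
proof clarify
  fix c assume R: "subring R" "\<forall>m. c m \<in> R" "\<forall>x y. F x y = (\<Sum>m\<le>n. c m * x ^ m * y ^ (n - m))"
  show "\<exists>c. (\<forall>m. c m \<in> R) \<and> (\<forall>x y. y * F x y = (\<Sum>m\<le>Suc n. c m * x ^ m * y ^ (Suc n - m)))"
  proof (intro exI[of _ "\<lambda>m. if m \<le> n then c m else 0"] conjI allI)
    fix x y
    show "y * F x y = (\<Sum>m\<le>Suc n. (if m \<le> n then c m else 0) * x ^ m * y ^ (Suc n - m))"
      using R by (auto simp: sum_distrib_left mult_ac Suc_diff_le intro!: sum.cong)
  qed (use R in \<open>auto simp: subringD\<close>)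
qed

lemma form_monomial_mult:
  assumes "subring R" "form R n F"
  shows "form R (i + j + n) (\<lambda>x y. x ^ i * y ^ j * F x y)"
proof -
  have "form R (j + n) (\<lambda>x y. y ^ j * F x y)"
    by (induction j) (use assms form_mult_y[OF assms(1)] in \<open>auto simp: mult.assoc\<close>)
  hence "form R (i + (j + n)) (\<lambda>x y. x ^ i * (y ^ j * F x y))"
    by (induction i) (use assms form_mult_x[OF assms(1)] in \<open>auto simp: mult.assoc\<close>)
  thus ?thesis by (simp add: add.assoc mult.assoc)
qed

lemma form_mult:
  assumes R: "subring R" and "form R n F" and G: "form R m G"
  shows "form R (n + m) (\<lambda>x y. F x y * G x y)"
proof -
  obtain c where c: "\<forall>m. c m \<in> R" "\<forall>x y. F x y = (\<Sum>m\<le>n. c m * x ^ m * y ^ (n - m))"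
    using assms by (auto simp: form_def)
  have "form R (n + m) (\<lambda>x y. \<Sum>i\<le>n. c i * (x ^ i * y ^ (n - i) * G x y))"
  proof (intro form_sum[OF R] form_scale[OF R])
    fix i assume "i \<in> {..n}"
    thus "form R (n + m) (\<lambda>x y. x ^ i * y ^ (n - i) * G x y)"
      using form_monomial_mult[OF R G, of i "n - i"] by simp
  qed (use c in auto)
  thus ?thesis using c(2) by (simp add: sum_distrib_right mult.assoc)
qed

lemma form_power:
  assumes "subring R" "form R n F" shows "form R (n * m) (\<lambda>x y. F x y ^ m)"
  by (induction m) (use assms form_const[of 1 R] subringD(1)[OF assms(1), of 1] form_mult[OF assms] in auto)

lemma form_linear:
  assumes "subring R" "a \<in> R" "b \<in> R" shows "form R 1 (\<lambda>x y. a * x + b * y)"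
  unfolding form_def using assms
  by (intro exI[of _ "\<lambda>m. if m = 0 then b else a"]) auto

lemma form_monomial: "subring R \<Longrightarrow> m \<le> n \<Longrightarrow> form R n (\<lambda>x y. x ^ m * y ^ (n - m))"
  using form_monomial_mult[OF _ form_const[of 1 R], of m "n - m"] subringD(1)[of R 1] by simp

lemma form_act:
  assumes R: "subring R" and F: "form R n F"
  shows "form R n (act M F)"
proof (cases M)
  case (fields a b c d)
  obtain e where e: "\<forall>m. e m \<in> R" "\<forall>x y. F x y = (\<Sum>m\<le>n. e m * x ^ m * y ^ (n - m))"
    using F by (auto simp: form_def)
  have "form R n (\<lambda>x y. \<Sum>m\<le>n. e m * ((of_int a * x + of_int b * y) ^ m * (of_int c * x + of_int d * y) ^ (n - m)))"
  proof (intro form_sum[OF R] form_scale[OF R])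
    fix m assume "m \<in> {..n}"
    thus "form R n (\<lambda>x y. (of_int a * x + of_int b * y) ^ m * (of_int c * x + of_int d * y) ^ (n - m))"
      using form_mult[OF R form_power[OF R form_linear[OF R], of "of_int a" "of_int b" m]
         form_power[OF R form_linear[OF R], of "of_int c" "of_int d" "n - m"]] subringD(1)[OF R] by simp
  qed (use e in auto)
  moreover have "act M F = (\<lambda>x y. \<Sum>m\<le>n. e m * ((of_int a * x + of_int b * y) ^ m * (of_int c * x + of_int d * y) ^ (n - m)))"
    using e(2) by (auto simp: fields fun_eq_iff mult.assoc)
  ultimately show ?thesis by simp
qed

lemma form_homogeneous: "form R n F \<Longrightarrow> F (t * x) (t * y) = t ^ n * F x y"
proof -
  assume "form R n F"
  then obtain c where c: "\<And>x y. F x y = (\<Sum>m\<le>n. c m * x ^ m * y ^ (n - m))" by (auto simp: form_def)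
  have "t ^ n = t ^ m * t ^ (n - m)" if "m \<le> n" for m using that by (simp flip: power_add)
  thus ?thesis unfolding c by (auto simp: sum_distrib_left power_mult_distrib mult_ac intro!: sum.cong)
qed

lemma form_UNIV: "form R n F \<Longrightarrow> form UNIV n F"
  by (auto simp: form_def)

lemma form_poly:
  assumes "form R n F"
  obtains P where "degree P \<le> n" "\<And>z. F z 1 = poly P z"
proof -
  obtain c where c: "\<And>x y. F x y = (\<Sum>m\<le>n. c m * x ^ m * y ^ (n - m))" using assms by (auto simp: form_def)
  show ?thesis
  proof (rule that[of "\<Sum>m\<le>n. Polynomial.monom (c m) m"])
    show "degree (\<Sum>m\<le>n. Polynomial.monom (c m) m) \<le> n"
      by (intro degree_sum_le) (auto intro: order.trans[OF degree_monom_le])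
    show "F z 1 = poly (\<Sum>m\<le>n. Polynomial.monom (c m) m) z" for z by (simp add: c poly_sum poly_monom)
  qed
qed

subsection \<open>Eichler integrals and the period cocycle\<close>

lemma qexpansion_has_field_derivative:
  assumes c: "\<And>x::complex. norm x < 1 \<Longrightarrow> summable (\<lambda>n. norm (c n) * norm x ^ n)" and z: "Im z > 0"
  shows "((\<lambda>z. \<Sum>n. c n * qexp z ^ n) has_field_derivative (\<Sum>n. (2 * of_real pi * \<i> * of_nat n * c n) * qexp z ^ n)) (at z)"
proof -
  let ?x = "qexp z"
  define r where "r = (norm ?x + 1) / 2"
  have r: "norm ?x < r" "r < 1" "r > 0" using norm_qexp_less_1[OF z] by (auto simp: r_def add_nonneg_pos)
  have sm: "summable (\<lambda>n. c n * of_real r ^ n)"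
    by (rule summable_norm_cancel) (use c[of "of_real r"] r in \<open>simp add: norm_mult norm_power\<close>)
  have D: "((\<lambda>x. \<Sum>n. c n * x ^ n) has_field_derivative (\<Sum>n. diffs c n * ?x ^ n)) (at ?x)"
    by (rule termdiffs_strong[OF sm]) (use r in auto)
  have D': "((\<lambda>z. \<Sum>n. c n * qexp z ^ n) has_field_derivative (\<Sum>n. diffs c n * ?x ^ n) * (2 * of_real pi * \<i> * ?x)) (at z)"
  proof (rule DERIV_chain2[where f = "\<lambda>x. \<Sum>n. c n * x ^ n" and g = qexp])
    show "(qexp has_field_derivative 2 * of_real pi * \<i> * ?x) (at z)"
      using has_field_derivative_qexp[OF DERIV_ident, of z UNIV] by (simp only: mult_1_right)
  qed (rule D)
  have "summable (\<lambda>n. diffs c n * ?x ^ n)"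
  proof (rule termdiff_converges[where K = 1])
    fix x :: complex assume "norm x < 1"
    show "summable (\<lambda>n. c n * x ^ n)"
      by (rule summable_norm_cancel) (use c[of x] \<open>norm x < 1\<close> in \<open>simp add: norm_mult norm_power\<close>)
  qed (use norm_qexp_less_1[OF z] in auto)
  hence "(\<lambda>n. of_nat n * c n * ?x ^ (n - Suc 0)) sums (\<Sum>n. diffs c n * ?x ^ n)"
    by (rule diffs_equiv)
  hence "(\<lambda>n. of_nat n * c n * ?x ^ (n - Suc 0) * (2 * of_real pi * \<i> * ?x)) sums ((\<Sum>n. diffs c n * ?x ^ n) * (2 * of_real pi * \<i> * ?x))"
    by (rule sums_mult2)
  also have "(\<lambda>n. of_nat n * c n * ?x ^ (n - Suc 0) * (2 * of_real pi * \<i> * ?x)) = (\<lambda>n. (2 * of_real pi * \<i> * of_nat n * c n) * ?x ^ n)"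
  proof
    show "of_nat n * c n * ?x ^ (n - Suc 0) * (2 * of_real pi * \<i> * ?x) = (2 * of_real pi * \<i> * of_nat n * c n) * ?x ^ n" for n
      by (cases n) (simp_all add: mult_ac)
  qed
  finally have eq: "(\<Sum>n. (2 * of_real pi * \<i> * of_nat n * c n) * ?x ^ n) = (\<Sum>n. diffs c n * ?x ^ n) * (2 * of_real pi * \<i> * ?x)"
    by (rule sums_unique[symmetric])
  show ?thesis unfolding eq by (rule D')
qed

lemma higher_pderiv_eq_0: "degree (P :: complex poly) < n \<Longrightarrow> (pderiv ^^ n) P = 0"
proof (induction n arbitrary: P)
  case (Suc n)
  show ?case
  proof (cases "degree P = 0")
    case True
    then obtain c where "P = [:c:]" by (rule degree_eq_zeroE)
    moreover have "(pderiv ^^ n) (0 :: complex poly) = 0" by (induction n) auto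
    ultimately show ?thesis by (simp only: funpow_Suc_right o_apply) (simp add: pderiv_pCons)
  next
    case False
    hence "degree (pderiv P) < n" using Suc.prems by (simp add: degree_pderiv)
    from Suc.IH[OF this] show ?thesis by (simp only: funpow_Suc_right o_apply)
  qed
qed simp

lemma poly_times_exp_decay:
  fixes P :: "complex poly"
  assumes f: "\<And>t. t \<ge> 1 \<Longrightarrow> norm (f t) \<le> C * exp (- 2 * pi * t)"
  shows "((\<lambda>t. poly P (of_real x + \<i> * of_real t) * f t) \<longlongrightarrow> 0) at_top"
proof -
  define Q where "Q = pcompose P [:of_real x, \<i>:]"
  have "((\<lambda>t. Polynomial.coeff Q m * (of_real t ^ m * f t)) \<longlongrightarrow> Polynomial.coeff Q m * 0) at_top" for m
  proof (intro tendsto_mult tendsto_const)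
    show "((\<lambda>t. of_real t ^ m * f t) \<longlongrightarrow> 0) at_top"
    proof (rule Lim_null_comparison)
      show "\<forall>\<^sub>F t in at_top. norm (of_real t ^ m * f t) \<le> C * (t ^ m / exp t)"
        using eventually_ge_at_top[of 1]
      proof eventually_elim
        case (elim t)
        have "0 \<le> C * exp (- 2 * pi * 1)" using f[of 1] by (rule order.trans[OF norm_ge_zero]) simp
        hence C: "C \<ge> 0" by (simp add: zero_le_mult_iff)
        have "1 * t \<le> 2 * pi * t" using elim pi_gt3 by (intro mult_right_mono) auto
        hence "exp (- 2 * pi * t) \<le> exp (- t)" by simp
        hence "norm (f t) \<le> C * exp (- t)" using f[OF elim] C by (meson mult_left_mono order.trans)
        hence "t ^ m * norm (f t) \<le> t ^ m * (C * exp (- t))" using elim by (intro mult_left_mono) auto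
        thus ?case using elim by (simp add: norm_mult norm_power exp_minus field_simps)
      qed
      show "((\<lambda>t. C * (t ^ m / exp t)) \<longlongrightarrow> 0) at_top"
        using tendsto_mult[OF tendsto_const[of C] tendsto_power_div_exp_0[of m]] by simp
    qed
  qed
  hence "((\<lambda>t. \<Sum>m\<le>degree Q. Polynomial.coeff Q m * (of_real t ^ m * f t)) \<longlongrightarrow> 0) at_top"
    by (intro tendsto_null_sum) simp
  moreover have "poly P (of_real x + \<i> * of_real t) = poly Q (of_real t)" for t
    by (simp add: Q_def poly_pcompose mult.commute)
  ultimately show ?thesis by (simp add: poly_altdef sum_distrib_right mult.assoc)
qed

context cusp_eigenform
begin

section \<open>Iterated integrals of the cusp form\<close>

definition w :: nat where "w = k - 2"

lemma power_k: "x ^ k = x ^ w * (x :: complex)\<^sup>2"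
proof -
  have "w + 2 = k" using k_ge_2 by (simp add: w_def)
  thus ?thesis using power_add[of x w 2] by simp
qed

text \<open>The \<open>i\<close>-fold antiderivative of \<open>h\<close> that vanishes at the cusp.
  The term \<open>n = 0\<close> is zero whatever its denominator, since
  \<open>a 0 = 0\<close>.\<close>

definition eich :: "nat \<Rightarrow> complex \<Rightarrow> complex" where
  "eich i z = (\<Sum>n. a n / (2 * of_real pi * \<i> * of_nat n) ^ i * qexp z ^ n)"

lemma summable_eich:
  assumes "norm (x::complex) < 1"
  shows "summable (\<lambda>n. norm (a n / (2 * of_real pi * \<i> * of_nat n) ^ i) * norm x ^ n)"
proof (rule summable_comparison_test'[OF summable_a[OF assms], of 0])
  fix n
  show "norm (norm (a n / (2 * of_real pi * \<i> * of_nat n) ^ i) * norm x ^ n) \<le> norm (a n) * norm x ^ n"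
  proof (cases "n = 0")
    case False
    have "1 * 1 \<le> 2 * pi * real n" using False pi_gt3 by (intro mult_mono) auto
    hence "1 \<le> (2 * pi * real n) ^ i" by simp
    hence "norm (a n) / (2 * pi * real n) ^ i \<le> norm (a n)"
      by (simp add: divide_le_eq mult_le_cancel_left1)
    hence "norm (a n) / (2 * pi * real n) ^ i * norm x ^ n \<le> norm (a n) * norm x ^ n"
      by (rule mult_right_mono) simp
    thus ?thesis by (simp add: norm_divide norm_power norm_mult)
  qed simp
qed

lemma eich_sums:
  assumes "Im z > 0"
  shows "(\<lambda>n. a n / (2 * of_real pi * \<i> * of_nat n) ^ i * qexp z ^ n) sums eich i z"
  unfolding eich_def
  by (rule summable_sums, rule summable_norm_cancel)
     (use summable_eich[OF norm_qexp_less_1[OF assms], of i] in \<open>simp only: norm_mult norm_power\<close>)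

lemma eich_0: "Im z > 0 \<Longrightarrow> eich 0 z = h z"
  using eich_sums[of z 0] h_sums[of z] by (simp add: sums_iff)

lemma eich_deriv:
  assumes "Im z > 0"
  shows "(eich (Suc i) has_field_derivative eich i z) (at z)"
proof -
  have "((\<lambda>z. eich (Suc i) z) has_field_derivative
     (\<Sum>n. (2 * of_real pi * \<i> * of_nat n * (a n / (2 * of_real pi * \<i> * of_nat n) ^ Suc i)) * qexp z ^ n)) (at z)"
    unfolding eich_def by (rule qexpansion_has_field_derivative[OF summable_eich assms])
  also have "(\<lambda>n. (2 * of_real pi * \<i> * of_nat n * (a n / (2 * of_real pi * \<i> * of_nat n) ^ Suc i)) * qexp z ^ n)
     = (\<lambda>n. a n / (2 * of_real pi * \<i> * of_nat n) ^ i * qexp z ^ n)"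
  proof
    show "(2 * of_real pi * \<i> * of_nat n * (a n / (2 * of_real pi * \<i> * of_nat n) ^ Suc i)) * qexp z ^ n
      = a n / (2 * of_real pi * \<i> * of_nat n) ^ i * qexp z ^ n" for n
      by (cases "n = 0") auto
  qed
  finally show ?thesis unfolding eich_def .
qed

lemma eich_decay:
  assumes "y0 > 0"
  obtains C where "C \<ge> 0" "\<And>z. Im z \<ge> y0 \<Longrightarrow> norm (eich i z) \<le> C * exp (- 2 * pi * Im z)"
  using qexpansion_decay[OF eich_sums _ assms, of i] by auto

text \<open>Such a \<open>G\<close> is the integral of \<open>h z * F z 1\<close> from the cusp at
  infinity to \<open>z\<close>; the limit along vertical lines fixes the constant.\<close>

definition is_prim :: "(complex \<Rightarrow> complex \<Rightarrow> complex) \<Rightarrow> (complex \<Rightarrow> complex) \<Rightarrow> bool" where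
  "is_prim F G \<longleftrightarrow> (\<forall>z. Im z > 0 \<longrightarrow> (G has_field_derivative h z * F z 1) (at z)) \<and>
     (\<forall>x. ((\<lambda>t. G (of_real x + \<i> * of_real t)) \<longlongrightarrow> 0) at_top)"

text \<open>Repeated integration by parts. The derivatives telescope, and the last one is of order
  \<open>n + 1\<close> and kills \<open>P\<close>.\<close>

lemma is_prim_poly:
  assumes "degree P \<le> n" "\<And>z. F z 1 = poly P z"
  shows "is_prim F (\<lambda>z. \<Sum>i\<le>n. (-1) ^ i * poly ((pderiv ^^ i) P) z * eich (Suc i) z)"
  unfolding is_prim_def
proof (intro conjI allI impI)
  fix z assume z: "Im z > 0"
  have "((\<lambda>z. \<Sum>i\<le>n. (-1) ^ i * poly ((pderiv ^^ i) P) z * eich (Suc i) z) has_field_derivative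
     (poly P z * eich 0 z + (-1) ^ n * poly ((pderiv ^^ Suc n) P) z * eich (Suc n) z)) (at z)" for n
  proof (induction n)
    case 0
    show ?case by (auto intro!: derivative_eq_intros eich_deriv[OF z] simp: mult.commute)
  next
    case (Suc n)
    have "((\<lambda>z. (-1) ^ Suc n * (poly ((pderiv ^^ Suc n) P) z * eich (Suc (Suc n)) z)) has_field_derivative
      (-1) ^ Suc n * (poly ((pderiv ^^ Suc (Suc n)) P) z * eich (Suc (Suc n)) z + eich (Suc n) z * poly ((pderiv ^^ Suc n) P) z)) (at z)"
      by (intro DERIV_cmult DERIV_mult eich_deriv[OF z]) (simp add: poly_DERIV)
    from DERIV_add[OF Suc.IH this] show ?case by (simp add: algebra_simps)
  qed
  from this[of n] show "((\<lambda>z. \<Sum>i\<le>n. (-1) ^ i * poly ((pderiv ^^ i) P) z * eich (Suc i) z) has_field_derivative h z * F z 1) (at z)"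
    using assms higher_pderiv_eq_0[of P "Suc n"] eich_0[OF z] by (simp add: mult.commute)
next
  fix x
  have "((\<lambda>t. (-1) ^ i * (poly ((pderiv ^^ i) P) (of_real x + \<i> * of_real t) * eich (Suc i) (of_real x + \<i> * of_real t))) \<longlongrightarrow> (-1) ^ i * 0) at_top" for i
  proof -
    obtain C where "\<And>z. Im z \<ge> 1 \<Longrightarrow> norm (eich (Suc i) z) \<le> C * exp (- 2 * pi * Im z)"
      by (rule eich_decay[of 1 "Suc i"]) auto
    hence "\<And>t. t \<ge> 1 \<Longrightarrow> norm (eich (Suc i) (of_real x + \<i> * of_real t)) \<le> C * exp (- 2 * pi * t)"
      by (metis (no_types, lifting) Im_i_times Im_complex_of_real Re_complex_of_real add.left_neutral plus_complex.sel(2))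
    from poly_times_exp_decay[OF this] show ?thesis by (intro tendsto_mult tendsto_const)
  qed
  thus "((\<lambda>t. \<Sum>i\<le>n. (-1) ^ i * poly ((pderiv ^^ i) P) (of_real x + \<i> * of_real t) * eich (Suc i) (of_real x + \<i> * of_real t)) \<longlongrightarrow> 0) at_top"
    by (intro tendsto_null_sum) (simp add: mult.assoc)
qed

lemma prim_unique:
  assumes "\<And>z. Im z > 0 \<Longrightarrow> (G has_field_derivative g z) (at z)" "\<And>z. Im z > 0 \<Longrightarrow> (G' has_field_derivative g z) (at z)"
  obtains C where "\<And>z. Im z > 0 \<Longrightarrow> G z = G' z + C"
proof -
  have cv: "convex {z. Im z > 0}" by (rule convex_halfspace_Im_gt)
  have "((\<lambda>z. G z - G' z) has_field_derivative 0) (at z within {z. Im z > 0})" if "z \<in> {z. Im z > 0}" for z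
  proof -
    have "((\<lambda>z. G z - G' z) has_field_derivative (g z - g z)) (at z)"
      by (rule DERIV_diff; rule assms) (use that in auto)
    from has_field_derivative_at_within[OF this] show ?thesis by simp
  qed
  from has_field_derivative_zero_constant[OF cv this] obtain C
    where "\<And>z. z \<in> {z. Im z > 0} \<Longrightarrow> G z - G' z = C" by blast
  thus ?thesis by (intro that[of C]) (auto simp: algebra_simps)
qed

lemma is_prim_unique:
  assumes "is_prim F G" "is_prim F G'" "Im z > 0"
  shows "G z = G' z"
proof -
  have D: "(G has_field_derivative h z * F z 1) (at z)" "(G' has_field_derivative h z * F z 1) (at z)" if "Im z > 0" for z
    using assms that unfolding is_prim_def by blast+
  obtain C where C: "\<And>z. Im z > 0 \<Longrightarrow> G z = G' z + C"
    by (rule prim_unique[OF D]) auto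
  have "((\<lambda>t. G (of_real 0 + \<i> * of_real t) - G' (of_real 0 + \<i> * of_real t)) \<longlongrightarrow> 0 - 0) at_top"
    using assms unfolding is_prim_def by (intro tendsto_diff) blast+
  moreover have "\<forall>\<^sub>F t in at_top. G (of_real 0 + \<i> * of_real t) - G' (of_real 0 + \<i> * of_real t) = C"
    using eventually_gt_at_top[of 0] by eventually_elim (simp add: C)
  ultimately have "((\<lambda>t::real. C) \<longlongrightarrow> 0 - 0) at_top" by (rule Lim_transform_eventually)
  hence "C = 0" by (simp add: tendsto_const_iff)
  thus ?thesis using C assms(3) by simp
qed

text \<open>For forms a choice exists by \<open>is_prim_poly\<close>, and on the half plane it is
  unique by \<open>is_prim_unique\<close>.\<close>

definition prm :: "(complex \<Rightarrow> complex \<Rightarrow> complex) \<Rightarrow> complex \<Rightarrow> complex" where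
  "prm F = (SOME G. is_prim F G)"

lemma is_prim_prm:
  assumes "form R n F" shows "is_prim F (prm F)"
proof -
  obtain P where P: "degree P \<le> n" "\<And>z. F z 1 = poly P z" by (rule form_poly[OF assms]) blast
  show ?thesis unfolding prm_def by (rule someI[of "is_prim F"]) (rule is_prim_poly[OF P(1)], rule P(2))
qed

lemma prm_deriv: "form R n F \<Longrightarrow> Im z > 0 \<Longrightarrow> (prm F has_field_derivative h z * F z 1) (at z)"
  using is_prim_prm unfolding is_prim_def by blast

lemma prm_eqI: "form R n F \<Longrightarrow> is_prim F G \<Longrightarrow> Im z > 0 \<Longrightarrow> prm F z = G z"
  using is_prim_unique[OF is_prim_prm] by blast

lemma prm_add:
  assumes "form R n F" "form R' n' F'" "Im z > 0" "form UNIV n (\<lambda>x y. F x y + F' x y)"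
  shows "prm (\<lambda>x y. F x y + F' x y) z = prm F z + prm F' z"
proof (rule prm_eqI[OF assms(4) _ assms(3)])
  have D: "is_prim F (prm F)" "is_prim F' (prm F')" using assms is_prim_prm by blast+
  show "is_prim (\<lambda>x y. F x y + F' x y) (\<lambda>z. prm F z + prm F' z)"
    unfolding is_prim_def
  proof (intro conjI allI impI)
    fix z assume "Im z > 0"
    thus "((\<lambda>z. prm F z + prm F' z) has_field_derivative h z * (F z 1 + F' z 1)) (at z)"
      using D unfolding is_prim_def distrib_left by (intro DERIV_add) auto
  next
    fix x show "((\<lambda>t. prm F (of_real x + \<i> * of_real t) + prm F' (of_real x + \<i> * of_real t)) \<longlongrightarrow> 0) at_top"
      using D unfolding is_prim_def by (intro tendsto_add_zero) auto
  qed
qed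

lemma prm_scale:
  assumes "form R n F" "Im z > 0"
  shows "prm (\<lambda>x y. c * F x y) z = c * prm F z"
proof (rule prm_eqI[OF form_scale[OF subring_UNIV form_UNIV[OF assms(1)]] _ assms(2)])
  have D: "is_prim F (prm F)" using assms is_prim_prm by blast
  show "is_prim (\<lambda>x y. c * F x y) (\<lambda>z. c * prm F z)"
    unfolding is_prim_def
  proof (intro conjI allI impI)
    fix z assume "Im z > 0"
    thus "((\<lambda>z. c * prm F z) has_field_derivative h z * (c * F z 1)) (at z)"
      using D unfolding is_prim_def by (auto intro!: derivative_eq_intros)
  next
    fix x show "((\<lambda>t. c * prm F (of_real x + \<i> * of_real t)) \<longlongrightarrow> 0) at_top"
      using D unfolding is_prim_def by (intro tendsto_mult_right_zero) auto
  qed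
qed simp

text \<open>The integral of \<open>h z * F z 1\<close> from the cusp at infinity to the image of
  that cusp under \<open>M\<close>, computed through the base point \<open>\<i>\<close>. For
  \<open>Smat\<close> it runs along the imaginary axis and is a classical period of
  \<open>h\<close>.\<close>

definition coc :: "(complex \<Rightarrow> complex \<Rightarrow> complex) \<Rightarrow> mat2 \<Rightarrow> complex" where
  "coc F M = prm F (mob M \<i>) - prm (act M F) \<i>"

text \<open>The automorphy factor of weight \<open>k = w + 2\<close> splits: two powers cancel
  against the derivative of \<open>mob M\<close>, and \<open>w\<close> powers are absorbed by the
  homogeneity of \<open>F\<close>. The two primitives therefore have the same derivative.\<close>

lemma coc_eq:
  assumes F: "form UNIV w F" and M: "mdet M = 1" and z: "Im z > 0"
  shows "prm F (mob M z) = prm (act M F) z + coc F M"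
proof -
  have "((\<lambda>z. prm F (mob M z)) has_field_derivative h z * act M F z 1) (at z)" if z: "Im z > 0" for z
  proof -
    have iz: "Im (mob M z) > 0" using Im_mob_pos[of M z] M z by simp
    have nz: "aut M z \<noteq> 0" using aut_nonzero[of M z] M z by simp
    have "((\<lambda>z. prm F (mob M z)) has_field_derivative (h (mob M z) * F (mob M z) 1) * (of_int (mdet M) / (aut M z)\<^sup>2)) (at z)"
      by (rule DERIV_chain'[OF has_field_derivative_mob prm_deriv[OF F iz]]) (use M z in auto)
    also have "(h (mob M z) * F (mob M z) 1) * (of_int (mdet M) / (aut M z)\<^sup>2) = h z * (aut M z ^ w * F (mob M z) 1)"
    proof -
      have "h (mob M z) = aut M z ^ w * (aut M z)\<^sup>2 * h z" using h_mob[OF M z] by (simp add: power_k)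
      thus ?thesis using M nz by simp
    qed
    also have "aut M z ^ w * F (mob M z) 1 = act M F z 1"
    proof -
      have "aut M z ^ w * F (mob M z) 1 = F (aut M z * mob M z) (aut M z)"
        using form_homogeneous[OF F, of "aut M z" "mob M z" 1] by simp
      thus ?thesis using nz by (cases M) auto
    qed
    finally show ?thesis .
  qed
  moreover have "(prm (act M F) has_field_derivative h z * act M F z 1) (at z)" if "Im z > 0" for z
    using form_act[OF subring_UNIV F] that by (rule prm_deriv)
  ultimately obtain C where C: "\<And>z. Im z > 0 \<Longrightarrow> prm F (mob M z) = prm (act M F) z + C"
    by (rule prim_unique) auto
  have "coc F M = C" using C[of \<i>] by (simp add: coc_def)
  thus ?thesis using C[OF z] by simp
qed

lemma coc_add:
  assumes "form UNIV w F" "form UNIV w F'" "mdet M = 1"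
  shows "coc (\<lambda>x y. F x y + F' x y) M = coc F M + coc F' M"
proof -
  have "act M (\<lambda>x y. F x y + F' x y) = (\<lambda>x y. act M F x y + act M F' x y)"
    by (cases M) (auto simp: fun_eq_iff)
  thus ?thesis unfolding coc_def using Im_mob_pos[of M \<i>] assms
    by (simp add: prm_add[of UNIV w _ UNIV w] form_add form_act)
qed

lemma coc_scale:
  assumes "form UNIV w F" "mdet M = 1"
  shows "coc (\<lambda>x y. c * F x y) M = c * coc F M"
proof -
  have "act M (\<lambda>x y. c * F x y) = (\<lambda>x y. c * act M F x y)"
    by (cases M) (auto simp: fun_eq_iff)
  thus ?thesis unfolding coc_def using Im_mob_pos[of M \<i>] assms
    by (simp add: prm_scale[of UNIV w] form_act right_diff_distrib)
qed

lemma coc_sum: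
  assumes "finite A" "\<And>i. i \<in> A \<Longrightarrow> form UNIV w (F i)" "mdet M = 1"
  shows "coc (\<lambda>x y. \<Sum>i\<in>A. F i x y) M = (\<Sum>i\<in>A. coc (F i) M)"
  using assms
proof (induction A rule: finite_induct)
  case empty
  show ?case using coc_scale[OF form_zero[OF subring_UNIV], of M 0] assms(3) by simp
next
  case (insert i A)
  have "coc (\<lambda>x y. \<Sum>i\<in>insert i A. F i x y) M = coc (\<lambda>x y. F i x y + (\<Sum>i\<in>A. F i x y)) M"
    using insert.hyps by simp
  also have "\<dots> = coc (F i) M + coc (\<lambda>x y. \<Sum>i\<in>A. F i x y) M"
    by (rule coc_add) (use insert.prems in \<open>auto intro: form_sum\<close>)
  finally show ?case using insert by simp
qed

lemma coc_mmul:
  assumes F: "form UNIV w F" and "mdet M = 1" "mdet N = 1"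
  shows "coc F (mmul M N) = coc F M + coc (act M F) N"
proof -
  have "Im (mob N \<i>) > 0" using Im_mob_pos[of N \<i>] assms by simp
  hence "prm F (mob M (mob N \<i>)) = prm (act M F) (mob N \<i>) + coc F M"
    using coc_eq[OF F assms(2)] by blast
  moreover have "prm (act M F) (mob N \<i>) = prm (act N (act M F)) \<i> + coc (act M F) N"
    using coc_eq[OF form_act[OF subring_UNIV F] assms(3)] by simp
  moreover have "mob (mmul M N) \<i> = mob M (mob N \<i>)" by (rule mob_mmul) (use assms in auto)
  ultimately show ?thesis unfolding coc_def by (simp add: act_act)
qed

text \<open>Translations fix the cusp at infinity, where both primitives vanish.\<close>

lemma coc_translation:
  assumes F: "form UNIV w F"
  shows "coc F (1, n, 0, 1) = 0"
proof -
  have "((\<lambda>t. prm F (of_real (of_int n) + \<i> * of_real t) - prm (act (1, n, 0, 1) F) (of_real 0 + \<i> * of_real t)) \<longlongrightarrow> 0 - 0) at_top"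
    using is_prim_prm[OF F] is_prim_prm[OF form_act[OF subring_UNIV F, of "(1, n, 0, 1)"]]
    unfolding is_prim_def by (intro tendsto_diff) blast+
  moreover have "\<forall>\<^sub>F t in at_top. prm F (of_real (of_int n) + \<i> * of_real t) - prm (act (1, n, 0, 1) F) (of_real 0 + \<i> * of_real t) = coc F (1, n, 0, 1)"
    using eventually_gt_at_top[of 0]
  proof eventually_elim
    case (elim t)
    thus ?case using coc_eq[OF F, of "(1, n, 0, 1)" "\<i> * of_real t"] by (simp add: add.commute)
  qed
  ultimately have "((\<lambda>t::real. coc F (1, n, 0, 1)) \<longlongrightarrow> 0 - 0) at_top" by (rule Lim_transform_eventually)
  thus ?thesis by (simp add: tendsto_const_iff)
qed

lemma coc_neg_translation:
  assumes F: "form UNIV w F"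
  shows "coc F (- 1, n, 0, - 1) = 0"
proof -
  have "act (-1, n, 0, -1) F = act (1, - n, 0, 1) F"
  proof (intro ext)
    fix x y
    have "even w" using even_k k_ge_2 by (simp add: w_def)
    thus "act (-1, n, 0, -1) F x y = act (1, - n, 0, 1) F x y"
      using form_homogeneous[OF F, of "-1" "x - of_int n * y" y] by simp
  qed
  moreover have "mob (-1, n, 0, -1) \<i> = mob (1, - n, 0, 1) \<i>" by simp
  ultimately have "coc F (- 1, n, 0, - 1) = coc F (1, - n, 0, 1)" unfolding coc_def by presburger
  thus ?thesis using coc_translation[OF F] by simp
qed

end

subsection \<open>Hecke operators on periods\<close>

text \<open>The involution sending \<open>b\<close> to \<open>-1/b\<close> modulo \<open>p\<close>
  describes how \<open>Smat\<close> permutes the cosets of the Hecke correspondence.\<close>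

lemma neg_inverse_mod_prime:
  fixes p :: nat
  assumes "prime p"
  obtains f :: "nat \<Rightarrow> nat" where
    "\<forall>b\<in>{1..<p}. f b \<in> {1..<p} \<and> f (f b) = b \<and> int p dvd 1 + int b * int (f b)"
proof -
  have ex: "\<exists>c\<in>{1..<p}. int p dvd 1 + int b * int c" if b: "b \<in> {1..<p}" for b
  proof -
    have "coprime b p" using b assms
      by (metis atLeastLessThan_iff coprime_commute dvd_imp_le le_zero_eq not_less not_one_le_zero prime_imp_coprime_nat)
    hence "coprime (int b) (int p)" by simp
    then obtain x where x: "[int b * x = 1] (mod int p)" using cong_solve_coprime_int by blast
    define c where "c = nat ((- x) mod int p)"
    have p0: "int p > 0" using assms prime_gt_0_nat by simp
    have c: "int c = (- x) mod int p" using p0 by (simp add: c_def)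
    have "[1 + int b * int c = 1 + int b * (- x)] (mod int p)"
      unfolding c by (intro cong_add cong_mult cong_refl) (simp add: cong_def)
    also have "[1 + int b * (- x) = 1 - 1] (mod int p)"
      using cong_diff[OF cong_refl[of 1] x] by simp
    finally have d: "int p dvd 1 + int b * int c" by (simp add: cong_0_iff)
    have "c \<noteq> 0"
    proof
      assume "c = 0"
      hence "int p dvd 1" using d by simp
      thus False using assms by (metis int_dvd_int_iff of_nat_1 not_prime_unit)
    qed
    moreover have "c < p" using c p0 by (metis of_nat_less_iff pos_mod_bound)
    ultimately show ?thesis using d by auto
  qed
  define f where "f b = (SOME c. c \<in> {1..<p} \<and> int p dvd 1 + int b * int c)" for b
  have f: "f b \<in> {1..<p} \<and> int p dvd 1 + int b * int (f b)" if "b \<in> {1..<p}" for b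
    unfolding f_def by (rule someI_ex) (use ex[OF that] in auto)
  show ?thesis
  proof (rule that, rule ballI)
    fix b assume b: "b \<in> {1..<p}"
    let ?c = "f b"
    have c: "?c \<in> {1..<p}" "int p dvd 1 + int b * int ?c" using f[OF b] by auto
    have cc: "f ?c \<in> {1..<p}" "int p dvd 1 + int ?c * int (f ?c)" using f[OF c(1)] by auto
    have "int p dvd int ?c * (int b - int (f ?c))"
      using dvd_diff[OF c(2) cc(2)] by (simp add: algebra_simps)
    moreover have "\<not> int p dvd int ?c" using c(1) by (auto dest: dvd_imp_le)
    ultimately have "int p dvd int b - int (f ?c)"
      using assms by (meson prime_dvd_multD prime_int_nat_transfer prime_nat_int_transfer)
    moreover have "\<bar>int b - int (f ?c)\<bar> < int p" using b cc(1) by auto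
    ultimately have "f ?c = b"
      using dvd_imp_le_int[of "int b - int (f ?c)" "int p"] by (cases "int b - int (f ?c) = 0") auto
    thus "f b \<in> {1..<p} \<and> f (f b) = b \<and> int p dvd 1 + int b * int (f b)" using c by simp
  qed
qed

text \<open>Euclid's algorithm on the left column: with \<open>n = a div c\<close>, stripping off a
  translation and \<open>Smat\<close> replaces the lower left entry by \<open>- (a mod c)\<close>.
  The base cases are the matrices whose lower left entry is 0.\<close>

lemma sl2_induct [consumes 1, case_names translation neg_translation step]:
  assumes "mdet M = 1"
    and tr: "\<And>n. P (1, n, 0, 1)" and ntr: "\<And>n. P (-1, n, 0, -1)"
    and step: "\<And>n M. mdet M = 1 \<Longrightarrow> P M \<Longrightarrow> P (mmul (1, n, 0, 1) (mmul (0, -1, 1, 0) M))"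
  shows "P M"
  using assms(1)
proof (induction "nat \<bar>fst (snd (snd M))\<bar>" arbitrary: M rule: less_induct)
  case less
  obtain a b c d where M: "M = (a, b, c, d)" by (cases M)
  show ?case
  proof (cases "c = 0")
    case True
    hence ad: "a * d = 1" using less.prems M by simp
    hence "a = 1 \<and> d = 1 \<or> a = -1 \<and> d = -1" using zmult_eq_1_iff by blast
    thus ?thesis using tr[of b] ntr[of b] M True by auto
  next
    case False
    define n where "n = a div c"
    define M' where "M' = (c, d, - (a - n * c), - (b - n * d))"
    have amod: "a - n * c = a mod c" by (simp add: n_def minus_div_mult_eq_mod)
    have "\<bar>a mod c\<bar> < \<bar>c\<bar>" using False abs_mod_less by blast
    hence "nat \<bar>fst (snd (snd M'))\<bar> < nat \<bar>fst (snd (snd M))\<bar>"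
      by (simp add: M'_def M amod)
    moreover have d1: "mdet M' = 1" using less.prems by (simp add: M M'_def algebra_simps)
    ultimately have "P M'" by (rule less.hyps)
    moreover have "M = mmul (1, n, 0, 1) (mmul (0, -1, 1, 0) M')" by (simp add: M M'_def)
    ultimately show ?thesis using step[OF d1] by simp
  qed
qed

abbreviation Smat :: mat2 where "Smat \<equiv> (0, -1, 1, 0)"

context cusp_eigenform
begin

text \<open>The forms are moved by the adjugates of the Hecke matrices \<open>(p, 0, 0, 1)\<close>
  and \<open>(1, b, 0, p)\<close>. In the first case homogeneity and the chain rule give
  \<open>p^(w+1) = p^(k-1)\<close>, in the others just \<open>1 / p\<close>, so the derivative is
  the Hecke operator applied to \<open>h\<close>, times \<open>F z 1\<close>.\<close>

lemma prm_hecke: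
  assumes p: "prime p" and F: "form UNIV w F" and z: "Im z > 0"
  shows "a p * prm F z = prm (act (1, 0, 0, int p) F) (of_nat p * z) +
     (\<Sum>b<p. prm (act (int p, - int b, 0, 1) F) ((z + of_nat b) / of_nat p))"
proof -
  have p0: "p > 0" using p prime_gt_0_nat by simp
  let ?A = "act (1, 0, 0, int p) F" and ?B = "\<lambda>b. act (int p, - int b, 0, 1) F"
  have A: "form UNIV w ?A" and B: "form UNIV w (?B b)" for b by (intro form_act F subring_UNIV)+
  have "is_prim (\<lambda>x y. a p * F x y) (\<lambda>z. prm ?A (of_nat p * z) + (\<Sum>b<p. prm (?B b) ((z + of_nat b) / of_nat p)))"
    unfolding is_prim_def
  proof (intro conjI allI impI)
    fix z :: complex assume z: "Im z > 0"
    have "((\<lambda>z. prm ?A (of_nat p * z)) has_field_derivative (h (of_nat p * z) * ?A (of_nat p * z) 1) * of_nat p) (at z)"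
      by (rule DERIV_chain2[OF prm_deriv[OF A]]) (use z p0 in \<open>auto intro!: derivative_eq_intros\<close>)
    moreover have "((\<lambda>z. prm (?B b) ((z + of_nat b) / of_nat p)) has_field_derivative
        (h ((z + of_nat b) / of_nat p) * ?B b ((z + of_nat b) / of_nat p) 1) * (1 / of_nat p)) (at z)" for b
      by (rule DERIV_chain2[OF prm_deriv[OF B]]) (use z p0 in \<open>auto intro!: derivative_eq_intros simp: Im_divide_of_nat\<close>)
    ultimately have "((\<lambda>z. prm ?A (of_nat p * z) + (\<Sum>b<p. prm (?B b) ((z + of_nat b) / of_nat p))) has_field_derivative
       (h (of_nat p * z) * ?A (of_nat p * z) 1) * of_nat p +
       (\<Sum>b<p. (h ((z + of_nat b) / of_nat p) * ?B b ((z + of_nat b) / of_nat p) 1) * (1 / of_nat p))) (at z)"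
      by (intro DERIV_add DERIV_sum) auto
    also have "?A (of_nat p * z) 1 = of_nat p ^ w * F z 1"
      using form_homogeneous[OF F, of "of_nat p" z 1] by simp
    also have "(\<Sum>b<p. (h ((z + of_nat b) / of_nat p) * ?B b ((z + of_nat b) / of_nat p) 1) * (1 / of_nat p))
       = (\<Sum>b<p. h ((z + of_nat b) / of_nat p)) / of_nat p * F z 1"
      using p0 by (simp add: sum_divide_distrib sum_distrib_right)
    also have "h (of_nat p * z) * (of_nat p ^ w * F z 1) * of_nat p + (\<Sum>b<p. h ((z + of_nat b) / of_nat p)) / of_nat p * F z 1
       = h z * (a p * F z 1)"
    proof -
      have "k - 1 = Suc w" using k_ge_2 by (simp add: w_def)
      thus ?thesis using arg_cong[OF hecke_prime[OF p z], of "\<lambda>u. u * F z 1"] by (simp add: algebra_simps)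
    qed
    finally show "((\<lambda>z. prm ?A (of_nat p * z) + (\<Sum>b<p. prm (?B b) ((z + of_nat b) / of_nat p))) has_field_derivative
       h z * (a p * F z 1)) (at z)" .
  next
    fix x :: real
    have lim: "((\<lambda>t. prm G (of_real u + \<i> * of_real (c * t))) \<longlongrightarrow> 0) at_top"
      if "form UNIV w G" "c > 0" for G u c
    proof -
      have "((\<lambda>t. prm G (of_real u + \<i> * of_real t)) \<longlongrightarrow> 0) at_top"
        using is_prim_prm[OF that(1)] unfolding is_prim_def by blast
      moreover have "filterlim (\<lambda>t. c * t) at_top at_top"
        by (rule filterlim_tendsto_pos_mult_at_top[OF tendsto_const that(2) filterlim_ident])
      ultimately show ?thesis by (rule filterlim_compose)
    qed
    have "((\<lambda>t. prm ?A (of_real (real p * x) + \<i> * of_real (real p * t)) +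
       (\<Sum>b<p. prm (?B b) (of_real ((x + real b) / real p) + \<i> * of_real (1 / real p * t)))) \<longlongrightarrow> 0 + (\<Sum>b<p. 0)) at_top"
      by (intro tendsto_add tendsto_sum lim A B) (use p0 in auto)
    moreover have "of_nat p * (of_real x + \<i> * of_real t) = of_real (real p * x) + \<i> * of_real (real p * t)" for t
      by (simp add: algebra_simps)
    moreover have "(of_real x + \<i> * of_real t + of_nat b) / of_nat p = of_real ((x + real b) / real p) + \<i> * of_real (1 / real p * t)" for t b
      using p0 by (simp add: field_simps)
    ultimately show "((\<lambda>t. prm ?A (of_nat p * (of_real x + \<i> * of_real t)) +
       (\<Sum>b<p. prm (?B b) ((of_real x + \<i> * of_real t + of_nat b) / of_nat p))) \<longlongrightarrow> 0) at_top"
      by simp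
  qed
  hence "prm (\<lambda>x y. a p * F x y) z = prm ?A (of_nat p * z) + (\<Sum>b<p. prm (?B b) ((z + of_nat b) / of_nat p))"
    by (rule prm_eqI[OF form_scale[OF subring_UNIV F UNIV_I] _ z])
  thus ?thesis using prm_scale[OF F z] by simp
qed

text \<open>\<open>prm_hecke\<close> is used for \<open>F\<close> at \<open>mob Smat z\<close> and
  for \<open>act Smat F\<close> at \<open>z\<close>. \<open>Smat\<close> exchanges the dilation term
  with the term \<open>b = 0\<close> and sends \<open>b\<close> to \<open>f b\<close>. The
  primitives then cancel, and what is left are the cocycle values at the matrices effecting this
  permutation.\<close>

lemma coc_hecke:
  assumes p: "prime p" and F: "form UNIV w F"
    and f': "\<forall>b\<in>{1..<p}. f b \<in> {1..<p} \<and> f (f b) = b \<and> int p dvd 1 + int b * int (f b)"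
  shows "a p * coc F Smat = coc (act (1, 0, 0, int p) F) Smat + coc (act (int p, 0, 0, 1) F) Smat +
     (\<Sum>b\<in>{1..<p}. coc (act (int p, - int b, 0, 1) F) (int b, - ((1 + int b * int (f b)) div int p), int p, - int (f b)))"
proof -
  note f = bspec[OF f']
  have p0: "p > 0" using p prime_gt_0_nat by simp
  let ?A = "\<lambda>F. act (1, 0, 0, int p) F" and ?B = "\<lambda>F b. act (int p, - int b, 0, 1) F"
  let ?g = "\<lambda>b. (int b, - ((1 + int b * int (f b)) div int p), int p, - int (f b))"
  have fA: "form UNIV w (?A F)" and fB: "form UNIV w (?B F b)" for b by (intro form_act F subring_UNIV)+
  define z where "z = \<i>"
  have iz: "Im z > 0" "z \<noteq> 0" by (simp_all add: z_def)
  have Sz: "Im (mob Smat z) > 0" using Im_mob_pos[of Smat z] iz by simp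
  have split: "(\<Sum>b<p. g b) = g 0 + (\<Sum>b\<in>{1..<p}. g b)" for g :: "nat \<Rightarrow> complex"
    using p0 by (simp add: lessThan_atLeast0 sum.atLeast_Suc_lessThan)
  have 1: "prm (?A F) (of_nat p * mob Smat z) = prm (?B (act Smat F) 0) (z / of_nat p) + coc (?A F) Smat"
  proof -
    have "of_nat p * mob Smat z = mob Smat (z / of_nat p)" using iz p0 by (simp add: field_simps)
    moreover have "act Smat (?A F) = ?B (act Smat F) 0" by (simp add: act_act)
    ultimately show ?thesis using coc_eq[OF fA, of Smat "z / of_nat p"] iz p0 by (simp add: Im_divide_of_nat)
  qed
  have 2: "prm (?B F 0) ((mob Smat z + of_nat 0) / of_nat p) = prm (?A (act Smat F)) (of_nat p * z) + coc (?B F 0) Smat"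
  proof -
    have "(mob Smat z + of_nat 0) / of_nat p = mob Smat (of_nat p * z)" using iz p0 by (simp add: field_simps)
    moreover have "act Smat (?B F 0) = ?A (act Smat F)" by (simp add: act_act)
    ultimately show ?thesis using coc_eq[OF fB, of Smat "of_nat p * z" 0] iz p0 by (simp add: mult.commute)
  qed
  have 3: "prm (?B F b) ((mob Smat z + of_nat b) / of_nat p) =
     prm (?B (act Smat F) (f b)) ((z + of_nat (f b)) / of_nat p) + coc (?B F b) (?g b)" if b: "b \<in> {1..<p}" for b
  proof -
    let ?z = "(z + of_nat (f b)) / of_nat p"
    obtain q where q: "1 + int b * int (f b) = int p * q" using f[OF b] by (auto simp: dvd_def)
    have g: "?g b = (int b, - q, int p, - int (f b))" unfolding q using p0 by simp
    have det: "mdet (?g b) = 1" unfolding g mdet.simps using q by (simp add: algebra_simps)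
    have iz': "Im ?z > 0" using iz p0 by (simp add: Im_divide_of_nat)
    have "mob (?g b) ?z = (mob Smat z + of_nat b) / of_nat p"
    proof -
      have qc: "(1 + of_nat b * of_nat (f b) :: complex) = of_nat p * of_int q"
        using arg_cong[OF q, of "of_int :: int \<Rightarrow> complex"] by simp
      have "z \<noteq> 0" by (simp add: z_def)
      have "mob (?g b) ?z = ((of_nat b * z + of_nat b * of_nat (f b)) / of_nat p - of_int q) / z"
        using p0 by (simp add: g add_divide_distrib ring_distribs)
      also have "\<dots> = (of_nat b * z + of_nat b * of_nat (f b) - of_nat p * of_int q) / (of_nat p * z)"
        using p0 \<open>z \<noteq> 0\<close> by (simp add: field_simps)
      also have "\<dots> = (of_nat b * z - 1) / (of_nat p * z)" unfolding qc[symmetric] by simp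
      also have "\<dots> = (mob Smat z + of_nat b) / of_nat p"
        using p0 \<open>z \<noteq> 0\<close> by (simp add: field_simps)
      finally show ?thesis .
    qed
    moreover have "act (?g b) (?B F b) = ?B (act Smat F) (f b)"
    proof -
      \<comment> \<open>This identity is the permutation of the cosets; \<open>?g b\<close> is an
        integral matrix of determinant 1 because \<open>p\<close> divides
        \<open>1 + b * f b\<close>.\<close>
      have "mmul (int p, - int b, 0, 1) (?g b) = mmul Smat (int p, - int (f b), 0, 1)"
        using q by (simp only: g mmul.simps) (simp add: algebra_simps)
      thus ?thesis by (simp only: act_act)
    qed
    ultimately show ?thesis using coc_eq[OF fB det iz', of b] by simp
  qed
  have e1: "a p * coc F Smat = a p * prm F (mob Smat z) - a p * prm (act Smat F) z"
    by (simp add: coc_def z_def right_diff_distrib)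
  have "a p * prm F (mob Smat z) = prm (?A F) (of_nat p * mob Smat z) + prm (?B F 0) ((mob Smat z + of_nat 0) / of_nat p)
     + (\<Sum>b\<in>{1..<p}. prm (?B F b) ((mob Smat z + of_nat b) / of_nat p))"
    using prm_hecke[OF p F Sz] unfolding split by simp
  also have "\<dots> = prm (?B (act Smat F) 0) (z / of_nat p) + coc (?A F) Smat + (prm (?A (act Smat F)) (of_nat p * z) + coc (?B F 0) Smat)
     + ((\<Sum>b\<in>{1..<p}. prm (?B (act Smat F) (f b)) ((z + of_nat (f b)) / of_nat p)) + (\<Sum>b\<in>{1..<p}. coc (?B F b) (?g b)))"
    unfolding 1 2 sum.distrib[symmetric] by (simp only: sum.cong[OF refl 3])
  also have "(\<Sum>b\<in>{1..<p}. prm (?B (act Smat F) (f b)) ((z + of_nat (f b)) / of_nat p))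
     = (\<Sum>b\<in>{1..<p}. prm (?B (act Smat F) b) ((z + of_nat b) / of_nat p))"
    by (rule sum.reindex_bij_witness[where i = f and j = f]) (use f in auto)
  finally have e2: "a p * prm F (mob Smat z) = prm (?B (act Smat F) 0) (z / of_nat p) + coc (?A F) Smat + (prm (?A (act Smat F)) (of_nat p * z) + coc (?B F 0) Smat)
     + ((\<Sum>b\<in>{1..<p}. prm (?B (act Smat F) b) ((z + of_nat b) / of_nat p)) + (\<Sum>b\<in>{1..<p}. coc (?B F b) (?g b)))" .
  have e3: "a p * prm (act Smat F) z = prm (?A (act Smat F)) (of_nat p * z) + (prm (?B (act Smat F) 0) (z / of_nat p)
      + (\<Sum>b\<in>{1..<p}. prm (?B (act Smat F) b) ((z + of_nat b) / of_nat p)))"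
    using prm_hecke[OF p form_act[OF subring_UNIV F, of Smat] iz(1)] unfolding split by (simp only: of_nat_0 add_0_right)
  have ring: "u = cA + cB + t" if "u = x - y" "x = b + cA + (c + cB) + (s + t)" "y = c + (b + s)"
    for u x y b c cA cB s t :: complex using that by simp
  show ?thesis
    using ring[OF e1 e2 e3] by (simp only: of_nat_0 minus_zero)
qed

subsection \<open>Periods do not all vanish\<close>

lemma higher_pderiv_linear_power:
  "i \<le> n \<Longrightarrow> poly ((pderiv ^^ i) ([:- u, 1:] ^ n)) u = (if i = n then fact n else (0 :: complex))"
proof (induction i arbitrary: n)
  case (Suc i)
  then obtain m where m: "n = Suc m" "i \<le> m" by (cases n) auto
  have "pderiv ([:- u, 1:] ^ n) = Polynomial.smult (of_nat n) ([:- u, 1:] ^ m)"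
    unfolding m(1) pderiv_power_Suc by (simp add: pderiv_pCons)
  hence "poly ((pderiv ^^ Suc i) ([:- u, 1:] ^ n)) u = of_nat n * poly ((pderiv ^^ i) ([:- u, 1:] ^ m)) u"
    by (simp only: funpow_Suc_right o_apply higher_pderiv_smult poly_smult)
  thus ?case using Suc.IH[OF m(2)] m by simp
qed (auto simp: zero_power)

text \<open>If all monomial periods vanish, \<open>coc\<close> vanishes on the whole modular group,
  and the \<open>(k - 1)\<close>-fold integral \<open>K\<close> becomes modular of weight
  \<open>- w\<close>. A nonzero function of this kind cannot vanish at the cusp: for
  \<open>w > 0\<close> it would be too small near the real axis, and for \<open>w = 0\<close> the
  maximum principle makes it constant.\<close>

lemma periods_nonzero: "\<exists>m\<le>w. coc (\<lambda>x y. x ^ m * y ^ (w - m)) Smat \<noteq> 0"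
proof (rule ccontr)
  assume "\<not> (\<exists>m\<le>w. coc (\<lambda>x y. x ^ m * y ^ (w - m)) Smat \<noteq> 0)"
  hence mono0: "coc (\<lambda>x y. x ^ m * y ^ (w - m)) Smat = 0" if "m \<le> w" for m using that by blast
  have S0: "coc F Smat = 0" if F: "form UNIV w F" for F
  proof -
    obtain c where "\<And>x y. F x y = (\<Sum>m\<le>w. c m * x ^ m * y ^ (w - m))" using F by (auto simp: form_def)
    hence F': "F = (\<lambda>x y. \<Sum>m\<le>w. c m * (x ^ m * y ^ (w - m)))" by (simp add: fun_eq_iff mult.assoc)
    have "coc F Smat = (\<Sum>m\<le>w. coc (\<lambda>x y. c m * (x ^ m * y ^ (w - m))) Smat)"
      unfolding F' by (rule coc_sum) (auto intro!: form_scale form_monomial)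
    also have "\<dots> = 0"
      by (intro sum.neutral ballI) (simp add: coc_scale form_monomial mono0)
    finally show ?thesis .
  qed
  have coc0: "coc F M = 0" if "form UNIV w F" "mdet M = 1" for F M
    using that(2,1)
  proof (induction M arbitrary: F rule: sl2_induct)
    case (step n M)
    have "coc F (mmul (1, n, 0, 1) (mmul Smat M)) = coc F (1, n, 0, 1) + (coc (act (1, n, 0, 1) F) Smat + coc (act Smat (act (1, n, 0, 1) F)) M)"
      using step by (simp add: coc_mmul form_act)
    thus ?case using step coc_translation[of F n] S0[of "act (1, n, 0, 1) F"]
      step.IH[of "act Smat (act (1, n, 0, 1) F)"] by (simp only: form_act subring_UNIV add_0_right)
  qed (auto simp: coc_translation coc_neg_translation)
  define K where "K = eich (Suc w)"
  \<comment> \<open>Evaluated at its own root \<open>u\<close>, this form kills every term of the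
    integration by parts except the last, which isolates \<open>K u\<close>.\<close>
  let ?F = "\<lambda>u x y. (x - u * y) ^ w"
  have fF: "form UNIV w (?F u)" for u
    using form_power[OF subring_UNIV form_linear[OF subring_UNIV, of 1 "- u"], of w] by simp
  have prmF: "prm (?F u) u = (-1) ^ w * fact w * K u" if "Im u > 0" for u
  proof -
    have "prm (?F u) u = (\<Sum>i\<le>w. (-1) ^ i * poly ((pderiv ^^ i) ([:- u, 1:] ^ w)) u * eich (Suc i) u)"
      by (rule prm_eqI[OF fF is_prim_poly that]) (auto simp: degree_linear_power)
    also have "\<dots> = (\<Sum>i\<le>w. if i = w then (-1) ^ w * fact w * K u else 0)"
      by (intro sum.cong refl) (auto simp: higher_pderiv_linear_power K_def)
    finally show ?thesis by simp
  qed
  have K_mob: "K z = aut M z ^ w * K (mob M z)" if M: "mdet M = 1" and z: "Im z > 0" for M z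
  proof -
    let ?t = "inverse (aut M z) ^ w"
    have nz: "aut M z \<noteq> 0" using aut_nonzero[of M z] M z by simp
    \<comment> \<open>Substitution by \<open>M\<close> carries the linear form with root
      \<open>mob M z\<close> to the one with root \<open>z\<close>, divided by the automorphy
      factor; this is what gives \<open>K\<close> the weight \<open>- w\<close>.\<close>
    have act: "act M (?F (mob M z)) = (\<lambda>x y. ?t * ?F z x y)"
    proof (intro ext)
      fix x y
      obtain a b c d where [simp]: "M = (a, b, c, d)" by (cases M)
      have "of_int a * of_int d - of_int b * of_int c = (1 :: complex)"
        using arg_cong[OF M, of "of_int :: int \<Rightarrow> complex"] by simp
      hence ad: "of_int a * of_int d = 1 + of_int b * (of_int c :: complex)" by (simp add: algebra_simps)
      have nz': "of_int c * z + of_int d \<noteq> 0" using nz by simp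
      have "(of_int a * x + of_int b * y) - mob M z * (of_int c * x + of_int d * y) =
         ((of_int a * x + of_int b * y) * (of_int c * z + of_int d) - (of_int a * z + of_int b) * (of_int c * x + of_int d * y)) / aut M z"
        using nz' by (simp add: diff_divide_distrib)
      also have "(of_int a * x + of_int b * y) * (of_int c * z + of_int d) - (of_int a * z + of_int b) * (of_int c * x + of_int d * y)
          = (of_int a * of_int d - of_int b * of_int c) * (x - z * y)" by (simp add: algebra_simps)
      also have "\<dots> = x - z * y" by (simp add: ad)
      finally show "act M (?F (mob M z)) x y = ?t * ?F z x y"
        by (simp add: divide_inverse power_mult_distrib mult.commute)
    qed
    have iz: "Im (mob M z) > 0" using Im_mob_pos[of M z] M z by simp
    have "prm (?F (mob M z)) (mob M z) = ?t * prm (?F z) z"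
      using coc_eq[OF fF M z, of "mob M z"] coc0[OF fF M, of "mob M z"] prm_scale[OF fF z, of ?t z]
      by (simp only: act add_0_right)
    hence "K (mob M z) = ?t * K z" using prmF[OF z] prmF[OF iz] by simp
    thus ?thesis using nz by (simp add: power_inverse)
  qed
  define b1 where "b1 = a 1 / (2 * of_real pi * \<i> * of_nat 1) ^ Suc w"
  have b1: "b1 \<noteq> 0" by (simp add: b1_def)
  obtain C where C: "C \<ge> 0" "\<And>z. Im z \<ge> 1/5 \<Longrightarrow> norm (K z) \<le> C * exp (- 2 * pi * Im z)"
    using eich_decay[of "1/5" "Suc w"] unfolding K_def by auto
  \<comment> \<open>\<open>K\<close> is bounded on the Siegel set; the negative weight turns this
    into a bound that tends to 0 with \<open>Im z\<close> when \<open>w > 0\<close>.\<close>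
  have Kbound: "(norm (K z))\<^sup>2 \<le> C\<^sup>2 * (5 * Im z) ^ w" if z: "Im z > 0" for z
  proof -
    obtain M where M: "mdet M = 1" "Im (mob M z) \<ge> 1 / 5" using reduce_to_siegel_set[OF z] by blast
    have "aut M z \<noteq> 0" using aut_nonzero[of M z] M z by simp
    hence "(norm (aut M z))\<^sup>2 * (1 / 5) \<le> (norm (aut M z))\<^sup>2 * Im (mob M z)" using M by (intro mult_left_mono) auto
    also have "\<dots> = Im z" using Im_mob[of M z] M z \<open>aut M z \<noteq> 0\<close> by simp
    finally have 1: "((norm (aut M z))\<^sup>2) ^ w \<le> (5 * Im z) ^ w" by (intro power_mono) auto
    have "exp (- 2 * pi * Im (mob M z)) \<le> 1" using M by simp
    hence "norm (K (mob M z)) \<le> C" using C(2)[OF M(2)] C(1) by (meson mult_left_le order_trans)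
    hence 2: "(norm (K (mob M z)))\<^sup>2 \<le> C\<^sup>2" by (intro power_mono) auto
    have "(norm (K z))\<^sup>2 = ((norm (aut M z))\<^sup>2) ^ w * (norm (K (mob M z)))\<^sup>2"
      using K_mob[OF M(1) z] by (simp add: norm_mult norm_power power_mult_distrib mult.commute flip: power_mult)
    also have "\<dots> \<le> (5 * Im z) ^ w * C\<^sup>2" using z by (intro mult_mono 1 2) auto
    finally show ?thesis by (simp add: mult.commute)
  qed
  have coeff: "(norm b1)\<^sup>2 * exp (- 4 * pi * y) \<le> B" if y: "y > 0" and B: "\<And>x. (norm (K (Complex x y)))\<^sup>2 \<le> B" for y B
  proof -
    have "B \<ge> 0" using B[of 0] zero_le_power2 order_trans by blast
    have "(\<Sum>n<2. (norm (a n / (2 * of_real pi * \<i> * of_nat n) ^ Suc w))\<^sup>2 * exp (- 4 * pi * y * real n)) \<le> (sqrt B)\<^sup>2"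
    proof (rule qexpansion_bessel)
      show "summable (\<lambda>n. norm (a n / (2 * of_real pi * \<i> * of_nat n) ^ Suc w) * exp (- 2 * pi * y) ^ n)"
        using summable_eich[of "complex_of_real (exp (- 2 * pi * y))" "Suc w"] y by simp
      show "norm (\<Sum>n. a n / (2 * of_real pi * \<i> * of_nat n) ^ Suc w * qexp (Complex x y) ^ n) \<le> sqrt B" for x
        using B[of x] unfolding K_def eich_def by (rule real_le_rsqrt)
    qed
    thus ?thesis using \<open>B \<ge> 0\<close> by (simp add: numeral_2_eq_2 b1_def)
  qed
  show False
  proof (cases "w = 0")
    case False
    \<comment> \<open>The first Fourier coefficient does not depend on the height, so letting
      \<open>y\<close> tend to 0 forces \<open>b1 = 0\<close>.\<close>
    have "(norm b1)\<^sup>2 * exp (- 4 * pi * y) \<le> C\<^sup>2 * (5 * y) ^ w" if "y > 0" for y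
      by (rule coeff[OF that]) (use Kbound[of "Complex _ y"] that in simp)
    hence "\<forall>\<^sub>F y in at_right 0. (norm b1)\<^sup>2 * exp (- 4 * pi * y) \<le> C\<^sup>2 * (5 * y) ^ w"
      by (auto simp: eventually_at_right_less intro!: eventually_mono[OF eventually_at_right_less])
    moreover have "((\<lambda>y. (norm b1)\<^sup>2 * exp (- 4 * pi * y)) \<longlongrightarrow> (norm b1)\<^sup>2 * exp (- 4 * pi * 0)) (at_right 0)"
      by (intro tendsto_intros)
    moreover have "((\<lambda>y. C\<^sup>2 * (5 * y) ^ w) \<longlongrightarrow> C\<^sup>2 * (5 * 0) ^ w) (at_right 0)"
      by (intro tendsto_intros)
    ultimately have "(norm b1)\<^sup>2 * exp (- 4 * pi * 0) \<le> C\<^sup>2 * (5 * 0) ^ w"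
      by (intro tendsto_le[OF trivial_limit_at_right_real])
    thus False using b1 False by (simp add: zero_power)
  next
    case True
    have inv: "K (mob M z) = K z" if "mdet M = 1" "Im z > 0" for M z using K_mob[OF that] True by simp
    have "\<exists>z. Im z > 0 \<and> K z \<noteq> 0"
    proof (rule ccontr)
      assume "\<not> ?thesis"
      hence "(norm b1)\<^sup>2 * exp (- 4 * pi * 1) \<le> 0" by (intro coeff) auto
      thus False using b1 by (simp add: mult_le_0_iff)
    qed
    then obtain z' where z': "Im z' > 0" "K z' \<noteq> 0" by blast
    obtain M where M: "mdet M = 1" "Im (mob M z') \<ge> 1 / 5" "\<bar>Re (mob M z')\<bar> \<le> 1 / 2"
      using reduce_to_siegel_set[OF z'(1)] by blast
    define z0 where "z0 = mob M z'"
    have K0: "K z0 \<noteq> 0" using inv[OF M(1) z'(1)] z'(2) by (simp add: z0_def)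
    have "((\<lambda>t. poly [:1:] (of_real 0 + \<i> * of_real t) * K (\<i> * of_real t)) \<longlongrightarrow> 0) at_top"
      by (rule poly_times_exp_decay[where C = C]) (use C(2)[of "\<i> * of_real _"] in simp)
    hence lim0: "((\<lambda>t. K (\<i> * of_real t)) \<longlongrightarrow> 0) at_top" by simp
    have "((\<lambda>t. poly [:1:] (of_real 0 + \<i> * of_real t) * of_real (C * exp (- 2 * pi * t))) \<longlongrightarrow> 0) at_top"
      by (rule poly_times_exp_decay[where C = C]) (use C(1) in \<open>simp add: norm_mult\<close>)
    hence "((\<lambda>t. complex_of_real (C * exp (- 2 * pi * t))) \<longlongrightarrow> of_real 0) at_top" by simp
    hence "((\<lambda>t. C * exp (- 2 * pi * t)) \<longlongrightarrow> 0) at_top" by (simp only: tendsto_of_real_iff)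
    hence "\<forall>\<^sub>F t in at_top. C * exp (- 2 * pi * t) < norm (K z0)"
      by (rule order_tendstoD) (use K0 in simp)
    hence "\<exists>Y. Y \<ge> Im z0 \<and> C * exp (- 2 * pi * Y) < norm (K z0)"
      by (metis (mono_tags, lifting) eventually_at_top_linorder max.cobounded1 max.cobounded2)
    then obtain Y where Y: "Y \<ge> Im z0" "C * exp (- 2 * pi * Y) < norm (K z0)" by blast
    \<comment> \<open>Above height \<open>Y\<close> the decay keeps \<open>norm (K z)\<close> below
      \<open>norm (K z0)\<close>. By invariance the maximum over this compact rectangle is therefore
      the maximum over the half plane.\<close>
    let ?R = "cbox (Complex (-1/2) (1/5)) (Complex (1/2) Y)"
    have z0R: "z0 \<in> ?R" using M Y by (auto simp: in_cbox_complex_iff z0_def)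
    have holK: "K holomorphic_on {z. Im z > 0}"
      unfolding K_def by (auto simp: holomorphic_on_def field_differentiable_def intro!: exI has_field_derivative_at_within[OF eich_deriv])
    have "continuous_on ?R (\<lambda>z. norm (K z))"
      by (intro continuous_on_norm holomorphic_on_imp_continuous_on holomorphic_on_subset[OF holK])
         (auto simp: in_cbox_complex_iff)
    then obtain \<xi> where \<xi>: "\<xi> \<in> ?R" "\<And>z. z \<in> ?R \<Longrightarrow> norm (K z) \<le> norm (K \<xi>)"
      using continuous_attains_sup[of ?R "\<lambda>z. norm (K z)"] compact_cbox z0R by blast
    have mx: "norm (K z) \<le> norm (K \<xi>)" if z: "z \<in> {z. Im z > 0}" for z
    proof -
      obtain N where N: "mdet N = 1" "Im (mob N z) \<ge> 1 / 5" "\<bar>Re (mob N z)\<bar> \<le> 1 / 2"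
        using reduce_to_siegel_set[of z] z by blast
      have "norm (K (mob N z)) \<le> norm (K \<xi>)"
      proof (cases "Im (mob N z) \<le> Y")
        case True
        thus ?thesis using N by (intro \<xi>(2)) (auto simp: in_cbox_complex_iff)
      next
        case False
        hence "C * exp (- 2 * pi * Im (mob N z)) \<le> C * exp (- 2 * pi * Y)" using C(1) by (intro mult_left_mono) auto
        thus ?thesis using C(2)[OF N(2)] Y(2) \<xi>(2)[OF z0R] by linarith
      qed
      thus ?thesis using inv[OF N(1)] z by simp
    qed
    have "K constant_on {z. Im z > 0}"
    proof (rule maximum_modulus_principle[OF holK _ _ _ subset_refl _ mx])
      show "open {z. Im z > 0}" "open {z. Im z > 0}" by (simp_all add: open_halfspace_Im_gt)
      show "connected {z. Im z > 0}" by (intro convex_connected convex_halfspace_Im_gt)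
      show "\<xi> \<in> {z. Im z > 0}" using \<xi>(1) by (auto simp: in_cbox_complex_iff)
    qed
    then obtain c where c: "\<And>z. Im z > 0 \<Longrightarrow> K z = c" unfolding constant_on_def by auto
    have "\<forall>\<^sub>F t in at_top. K (\<i> * of_real t) = c"
      using eventually_gt_at_top[of 0] by eventually_elim (simp add: c)
    from Lim_transform_eventually[OF lim0 this] have "c = 0" by (simp add: tendsto_const_iff)
    thus False using c[of z'] z' by simp
  qed
qed

end

subsection \<open>Relations among monomial periods modulo 2 and 3\<close>

lemma form_int_value: "form \<int> n F \<Longrightarrow> x \<in> \<int> \<Longrightarrow> y \<in> \<int> \<Longrightarrow> F x y \<in> \<int>"
  unfolding form_def by (auto intro!: Ints_sum Ints_mult Ints_power)

lemma act_fun: "act (a, b, c, d) F = (\<lambda>x y. F (of_int a * x + of_int b * y) (of_int c * x + of_int d * y))"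
  by (simp add: fun_eq_iff)

lemma form_uminus: "form \<int> n F \<Longrightarrow> form \<int> n (\<lambda>x y. - F x y)"
  using form_scale[of \<int> n F "-1"] by simp

text \<open>A subgroup of the complex numbers; membership in it plays the part of congruence to
  zero.\<close>

locale int_module =
  fixes N :: "complex set"
  assumes zero_mem [simp]: "0 \<in> N"
    and add_mem: "x \<in> N \<Longrightarrow> y \<in> N \<Longrightarrow> x + y \<in> N"
    and uminus_mem: "x \<in> N \<Longrightarrow> - x \<in> N"
begin

lemma diff_mem: "x \<in> N \<Longrightarrow> y \<in> N \<Longrightarrow> x - y \<in> N"
  using add_mem[of x "- y"] uminus_mem[of y] by simp

lemma of_nat_mem: "x \<in> N \<Longrightarrow> of_nat n * x \<in> N"
  by (induction n) (auto simp: distrib_right intro: add_mem)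

lemma Ints_mem: "c \<in> \<int> \<Longrightarrow> x \<in> N \<Longrightarrow> c * x \<in> N"
proof (elim Ints_cases)
  fix n assume "x \<in> N" "c = of_int n"
  thus ?thesis using of_nat_mem[of x "nat \<bar>n\<bar>"] uminus_mem[of "of_nat (nat \<bar>n\<bar>) * x"]
    by (cases "n \<ge> 0") (auto simp: of_nat_nat)
qed

lemma sum_mem: "(\<And>i. i \<in> A \<Longrightarrow> f i \<in> N) \<Longrightarrow> sum f A \<in> N"
  by (induction A rule: infinite_finite_induct) (auto intro: add_mem)

lemma coprime_mem:
  assumes "of_nat m * x \<in> N" "of_nat n * x \<in> N" "coprime m n"
  shows "x \<in> N"
proof -
  obtain u v where uv: "u * int m + v * int n = 1"
    using bezout_int[of "int m" "int n"] assms(3) by auto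
  have "(of_int u * of_nat m + of_int v * of_nat n :: complex) = of_int (u * int m + v * int n)" by simp
  also have "\<dots> = 1" unfolding uv by simp
  finally have "x = of_int u * (of_nat m * x) + of_int v * (of_nat n * x)"
    by (simp flip: mult.assoc distrib_right)
  moreover have "of_int u * (of_nat m * x) + of_int v * (of_nat n * x) \<in> N"
    by (intro add_mem[OF Ints_mem[OF Ints_of_int assms(1)] Ints_mem[OF Ints_of_int assms(2)]])
  ultimately show ?thesis by simp
qed

end

text \<open>An abstraction of one layer of the filtration of the period group: an additive map
  \<open>G\<close> on integral forms of degree \<open>v\<close>, considered modulo \<open>N\<close>,
  where \<open>l\<close> kills it. \<open>G_S\<close> and \<open>G_U\<close> are the Eichler-Shimura
  relations for the elements of order 4 and 6 of the modular group, and \<open>G_D\<close> makes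
  multiples of Dickson's invariant trivial.\<close>

locale period_relations = int_module N
  for N :: "complex set" +
  fixes G :: "(complex \<Rightarrow> complex \<Rightarrow> complex) \<Rightarrow> complex" and l v :: nat
  assumes l: "l = 2 \<or> l = 3 \<and> even v"
    and G_add: "form \<int> v F \<Longrightarrow> form \<int> v F' \<Longrightarrow> G (\<lambda>x y. F x y + F' x y) = G F + G F'"
    and G_scale: "form \<int> v F \<Longrightarrow> c \<in> \<int> \<Longrightarrow> G (\<lambda>x y. c * F x y) = c * G F"
    and G_l: "form \<int> v F \<Longrightarrow> of_nat l * G F \<in> N"
    and G_S: "form \<int> v F \<Longrightarrow> G F + G (act Smat F) \<in> N"
    and G_U: "form \<int> v F \<Longrightarrow> G F + G (act (0, -1, 1, 1) F) + G (act (-1, -1, 1, 0) F) \<in> N"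
    and G_D: "form \<int> v' F \<Longrightarrow> v = l + 1 + v' \<Longrightarrow> G (\<lambda>x y. (x ^ l * y - x * y ^ l) * F x y) \<in> N"
begin

definition t :: "nat \<Rightarrow> complex" where "t m = G (\<lambda>x y. x ^ m * y ^ (v - m))"

lemma G_sum:
  "finite A \<Longrightarrow> (\<And>i. i \<in> A \<Longrightarrow> form \<int> v (F i)) \<Longrightarrow> G (\<lambda>x y. \<Sum>i\<in>A. F i x y) = (\<Sum>i\<in>A. G (F i))"
proof (induction A rule: finite_induct)
  case empty
  show ?case using G_scale[OF form_zero[OF subring_Ints], of 0] by simp
next
  case (insert i A)
  have "G (\<lambda>x y. \<Sum>i\<in>insert i A. F i x y) = G (\<lambda>x y. F i x y + (\<Sum>i\<in>A. F i x y))"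
    using insert.hyps by simp
  also have "\<dots> = G (F i) + G (\<lambda>x y. \<Sum>i\<in>A. F i x y)"
    by (rule G_add) (use insert.prems in \<open>auto intro: form_sum\<close>)
  finally show ?case using insert by simp
qed

lemma G_expand:
  assumes "\<And>m. m \<le> v \<Longrightarrow> c m \<in> \<int>"
  shows "G (\<lambda>x y. \<Sum>m\<le>v. c m * (x ^ m * y ^ (v - m))) = (\<Sum>m\<le>v. c m * t m)"
  by (subst G_sum) (use assms in \<open>auto simp: G_scale form_monomial t_def intro!: form_scale\<close>)

lemma neg_monomial:
  assumes "i \<le> v"
  shows "form \<int> v (\<lambda>x y. (-1) * (x ^ i * y ^ (v - i)))" "G (\<lambda>x y. (-1) * (x ^ i * y ^ (v - i))) = - t i"
proof -
  show "form \<int> v (\<lambda>x y. (-1) * (x ^ i * y ^ (v - i)))"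
    using assms by (intro form_scale form_monomial) auto
  show "G (\<lambda>x y. (-1) * (x ^ i * y ^ (v - i))) = - t i"
    using G_scale[OF form_monomial[of \<int> i v], of "-1"] assms by (simp add: t_def)
qed

lemma l_t: "m \<le> v \<Longrightarrow> of_nat l * t m \<in> N"
  unfolding t_def by (intro G_l form_monomial) auto

lemma t_ends: "t 0 + t v \<in> N"
  using G_S[OF form_monomial[of \<int> 0 v]] by (simp add: t_def act_fun)

text \<open>Dickson's invariant times a monomial is a difference of two monomials whose exponents of
  \<open>x\<close> differ by \<open>l - 1\<close>.\<close>

lemma t_shift:
  assumes "0 < m" "m + l - 1 < v"
  shows "t (m + l - 1) - t m \<in> N"
proof -
  have l0: "l \<ge> 1" using l by auto
  define v' where "v' = v - l - 1"
  have v: "v = l + 1 + v'" using assms by (simp add: v'_def)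
  have m': "m - 1 \<le> v'" using assms v by simp
  have "G (\<lambda>x y. (x ^ l * y - x * y ^ l) * (x ^ (m - 1) * y ^ (v' - (m - 1)))) \<in> N"
    by (rule G_D[OF form_monomial v]) (use m' in auto)
  also have "(\<lambda>x y :: complex. (x ^ l * y - x * y ^ l) * (x ^ (m - 1) * y ^ (v' - (m - 1))))
     = (\<lambda>x y. x ^ (m + l - 1) * y ^ (v - (m + l - 1)) + (- 1) * (x ^ m * y ^ (v - m)))"
  proof (intro ext)
    fix x y :: complex
    have e: "m + l - 1 = l + (m - 1)" "v - (m + l - 1) = Suc (v' - (m - 1))" "v - m = l + (v' - (m - 1))"
      "m = Suc (m - 1)" using assms l0 v by auto
    have "x ^ (m + l - 1) * y ^ (v - (m + l - 1)) = x ^ l * y * (x ^ (m - 1) * y ^ (v' - (m - 1)))"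
      unfolding e(2) by (simp only: e(1) power_add power_Suc mult_ac)
    moreover have "x ^ m * y ^ (v - m) = x * y ^ l * (x ^ (m - 1) * y ^ (v' - (m - 1)))"
      unfolding e(3) by (subst e(4)) (simp only: power_add power_Suc mult_ac)
    ultimately show "(x ^ l * y - x * y ^ l) * (x ^ (m - 1) * y ^ (v' - (m - 1)))
       = x ^ (m + l - 1) * y ^ (v - (m + l - 1)) + (- 1) * (x ^ m * y ^ (v - m))"
      by (simp add: algebra_simps)
  qed
  also have "G \<dots> = t (m + l - 1) + - t m"
  proof -
    have le: "m + l - 1 \<le> v" "m \<le> v" using assms l0 by auto
    show ?thesis
      unfolding G_add[OF form_monomial[OF subring_Ints le(1)] neg_monomial(1)[OF le(2)]] neg_monomial(2)[OF le(2)]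
      by (simp only: t_def)
  qed
  finally show ?thesis by simp
qed

lemma t_shifts:
  assumes "0 < m" "m + n * (l - 1) < v"
  shows "t (m + n * (l - 1)) - t m \<in> N"
  using assms(2)
proof (induction n)
  case (Suc n)
  have l0: "l \<ge> 1" using l by auto
  have "t (m + n * (l - 1) + l - 1) - t (m + n * (l - 1)) \<in> N"
    by (rule t_shift) (use assms Suc.prems l0 in auto)
  moreover have "t (m + n * (l - 1)) - t m \<in> N" using Suc by auto
  moreover have "m + n * (l - 1) + l - 1 = m + Suc n * (l - 1)" using l0 by simp
  ultimately show ?case using add_mem by fastforce
qed simp

text \<open>For \<open>l = 2\<close> all middle monomials agree with \<open>t 1\<close>. The
  relation \<open>G_U\<close> for \<open>x * y ^ (v - 1)\<close> then says, up to sign and the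
  trivial \<open>t 0 + t v\<close>, that \<open>(2 ^ (v - 1) - 1) * t 1\<close> is trivial. This
  multiple is odd, while \<open>2 * t 1\<close> is trivial as well.\<close>

lemma t_middle_2:
  assumes l2: "l = 2" and m: "0 < m" "m < v"
  shows "t m \<in> N"
proof -
  have v2: "v \<ge> 2" using m by simp
  have eq1: "t m - t 1 \<in> N" if "0 < m" "m < v" for m
    using t_shifts[of 1 "m - 1"] that l2 by simp
  let ?F = "\<lambda>x y :: complex. x ^ 1 * y ^ (v - 1)"
  have "G ?F + G (act (0, -1, 1, 1) ?F) + G (act (-1, -1, 1, 0) ?F) \<in> N"
    by (rule G_U, rule form_monomial) (use v2 in auto)
  also have "act (0, -1, 1, 1) ?F = (\<lambda>x y. \<Sum>m\<le>v. (if m < v then - of_nat ((v - 1) choose m) else 0) * (x ^ m * y ^ (v - m)))"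
  proof (intro ext)
    fix x y :: complex
    have "act (0, -1, 1, 1) ?F x y = - y * (\<Sum>m\<le>v - 1. of_nat ((v - 1) choose m) * x ^ m * y ^ (v - 1 - m))"
      by (simp add: binomial_ring)
    also have "\<dots> = (\<Sum>m\<le>v - 1. - of_nat ((v - 1) choose m) * (x ^ m * y ^ (v - m)))"
      unfolding sum_distrib_left
    proof (intro sum.cong refl)
      fix i assume "i \<in> {..v - 1}"
      hence "v - i = Suc (v - 1 - i)" using v2 by auto
      thus "- y * (of_nat ((v - 1) choose i) * x ^ i * y ^ (v - 1 - i)) = - of_nat ((v - 1) choose i) * (x ^ i * y ^ (v - i))"
        by (simp add: mult_ac)
    qed
    also have "\<dots> = (\<Sum>m\<le>v. (if m < v then - of_nat ((v - 1) choose m) else 0) * (x ^ m * y ^ (v - m)))"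
      by (rule sum.mono_neutral_cong_left) (use v2 in auto)
    finally show "act (0, -1, 1, 1) ?F x y = \<dots>" .
  qed
  also have "G \<dots> = (\<Sum>m\<le>v. (if m < v then - of_nat ((v - 1) choose m) else 0) * t m)"
    by (rule G_expand) auto
  also have "\<dots> = - (\<Sum>m\<le>v - 1. of_nat ((v - 1) choose m) * t m)"
    unfolding sum_negf[symmetric] by (rule sum.mono_neutral_cong_right) (use v2 in auto)
  also have "act (-1, -1, 1, 0) ?F = (\<lambda>x y. (-1) * (x ^ v * y ^ (v - v)) + (-1) * (x ^ (v - 1) * y ^ (v - (v - 1))))"
  proof (intro ext)
    fix x y :: complex
    have "x ^ v = x * x ^ (v - 1)" using v2 by (simp flip: power_Suc)
    thus "act (-1, -1, 1, 0) ?F x y = (-1) * (x ^ v * y ^ (v - v)) + (-1) * (x ^ (v - 1) * y ^ (v - (v - 1)))"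
      using v2 by (simp add: algebra_simps)
  qed
  also have "G \<dots> = - t v - t (v - 1)"
    unfolding G_add[OF neg_monomial(1)[OF order.refl] neg_monomial(1)[OF diff_le_self]]
      neg_monomial(2)[OF order.refl] neg_monomial(2)[OF diff_le_self] by simp
  finally have U: "t 1 + - (\<Sum>m\<le>v - 1. of_nat ((v - 1) choose m) * t m) + (- t v - t (v - 1)) \<in> N"
    by (simp add: t_def)
  have "(\<Sum>m\<le>v - 1. of_nat ((v - 1) choose m) * (t m - (if m = 0 then t 0 else t 1))) \<in> N"
    by (intro sum_mem of_nat_mem) (use eq1 v2 in auto)
  also have "(\<Sum>m\<le>v - 1. of_nat ((v - 1) choose m) * (t m - (if m = 0 then t 0 else t 1)))
      = (\<Sum>m\<le>v - 1. of_nat ((v - 1) choose m) * t m) - (\<Sum>m\<le>v - 1. of_nat ((v - 1) choose m) * (if m = 0 then t 0 else t 1))"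
    by (simp add: right_diff_distrib sum_subtractf)
  also have "(\<Sum>m\<le>v - 1. of_nat ((v - 1) choose m) * (if m = 0 then t 0 else t 1))
      = (\<Sum>m\<le>v - 1. of_nat ((v - 1) choose m) * t 1) + (\<Sum>m\<le>v - 1. if m = 0 then t 0 - t 1 else 0)"
    unfolding sum.distrib[symmetric] by (intro sum.cong refl) (auto simp: algebra_simps)
  also have "(\<Sum>m\<le>v - 1. of_nat ((v - 1) choose m) * t 1) = of_nat (2 ^ (v - 1)) * t 1"
    unfolding sum_distrib_right[symmetric] of_nat_sum[symmetric] choose_row_sum ..
  also have "(\<Sum>m\<le>v - 1. if m = 0 then t 0 - t 1 else 0) = t 0 - t 1" by simp
  finally have A: "(\<Sum>m\<le>v - 1. of_nat ((v - 1) choose m) * t m) - (of_nat (2 ^ (v - 1)) * t 1 + (t 0 - t 1)) \<in> N" .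
  have B: "t (v - 1) - t 1 \<in> N" using eq1[of "v - 1"] v2 by simp
  from add_mem[OF add_mem[OF U A] add_mem[OF B t_ends]]
  have "- (of_nat (2 ^ (v - 1)) * t 1 - t 1) \<in> N" by (simp add: algebra_simps)
  hence "of_nat (2 ^ (v - 1)) * t 1 - t 1 \<in> N" using uminus_mem by fastforce
  hence C: "of_nat (2 ^ (v - 1) - 1) * t 1 \<in> N" by (simp add: of_nat_diff left_diff_distrib)
  have "coprime (2 ^ (v - 1) - 1) (2::nat)"
  proof -
    have "odd (2 ^ (v - 1) - 1 :: nat)" using v2 by (simp add: even_diff_nat)
    thus ?thesis by simp
  qed
  moreover have "of_nat 2 * t 1 \<in> N" using l_t[of 1] l2 v2 by simp
  ultimately have "t 1 \<in> N" using coprime_mem[OF C] by blast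
  thus ?thesis using add_mem[OF eq1[OF m]] by fastforce
qed

text \<open>For \<open>l = 3\<close> the class of a middle monomial depends only on the parity of
  its exponent. For even exponents \<open>G_S\<close> makes twice the class trivial, since
  \<open>v\<close> is even. For odd ones \<open>G_U\<close> applied to \<open>y ^ v\<close> does so
  for \<open>2 ^ (v - 1)\<close> times the class, the sum of the odd binomial coefficients. Both
  multiples are prime to 3.\<close>

lemma t_middle_3:
  assumes l3: "l = 3" and m: "0 < m" "m < v"
  shows "t m \<in> N"
proof -
  have ev: "even v" using l l3 by auto
  have v2: "v \<ge> 2" using m by simp
  have per: "t m - t m' \<in> N" if "0 < m'" "m' \<le> m" "m < v" "even (m - m')" for m m'
  proof -
    from that(4) obtain n where "m - m' = 2 * n" by (rule evenE)
    hence "m = m' + n * 2" using that by simp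
    thus ?thesis using t_shifts[of m' n] that l3 by simp
  qed
  have even_t: "t m \<in> N" if m: "0 < m" "m < v" "even m" for m
  proof -
    let ?F = "\<lambda>x y :: complex. x ^ m * y ^ (v - m)"
    have "G ?F + G (act Smat ?F) \<in> N" by (rule G_S) (use m in \<open>auto intro: form_monomial\<close>)
    also have "act Smat ?F = (\<lambda>x y. x ^ (v - m) * y ^ (v - (v - m)))"
      using m by (auto simp: fun_eq_iff mult.commute)
    finally have s: "t m + t (v - m) \<in> N" by (simp add: t_def)
    have d: "t m - t (v - m) \<in> N"
    proof (cases "v - m \<le> m")
      case True thus ?thesis using per[of "v - m" m] m ev by simp
    next
      case False
      hence "t (v - m) - t m \<in> N" using per[of m "v - m"] m ev by simp
      from uminus_mem[OF this] show ?thesis by simp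
    qed
    have "of_nat 2 * t m \<in> N" using add_mem[OF s d] by simp
    moreover have "of_nat 3 * t m \<in> N" using l_t[of m] m l3 by simp
    ultimately show ?thesis by (rule coprime_mem) simp
  qed
  let ?F = "\<lambda>x y :: complex. x ^ 0 * y ^ (v - 0)"
  have "G ?F + G (act (0, -1, 1, 1) ?F) + G (act (-1, -1, 1, 0) ?F) \<in> N"
    by (rule G_U, rule form_monomial) auto
  also have "act (0, -1, 1, 1) ?F = (\<lambda>x y. \<Sum>m\<le>v. of_nat (v choose m) * (x ^ m * y ^ (v - m)))"
    by (auto simp: fun_eq_iff binomial_ring mult.assoc)
  also have "G \<dots> = (\<Sum>m\<le>v. of_nat (v choose m) * t m)" by (rule G_expand) auto
  also have "act (-1, -1, 1, 0) ?F = (\<lambda>x y. x ^ v * y ^ (v - v))" by (auto simp: fun_eq_iff)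
  finally have "t 0 + (\<Sum>m\<le>v. of_nat (v choose m) * t m) + t v \<in> N" by (simp add: t_def)
  from diff_mem[OF this t_ends] have U: "(\<Sum>m\<le>v. of_nat (v choose m) * t m) \<in> N" by (simp add: algebra_simps)
  let ?u = "\<lambda>m. if m = 0 then t 0 else if m = v then t v else if odd m then t 1 else 0"
  have "(\<Sum>m\<le>v. of_nat (v choose m) * (t m - ?u m)) \<in> N"
  proof (intro sum_mem of_nat_mem)
    fix m assume "m \<in> {..v}"
    moreover have "t m - t 1 \<in> N" if "0 < m" "m < v" "odd m" using per[of 1 m] that by simp
    ultimately show "t m - ?u m \<in> N" using even_t[of m] by auto
  qed
  from diff_mem[OF U this] have "(\<Sum>m\<le>v. of_nat (v choose m) * ?u m) \<in> N"
    by (simp add: right_diff_distrib sum_subtractf)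
  also have "(\<Sum>m\<le>v. of_nat (v choose m) * ?u m)
     = (\<Sum>m\<le>v. (if odd m then of_nat (v choose m) else 0) * t 1) + (\<Sum>m\<le>v. if m = 0 then t 0 else 0) + (\<Sum>m\<le>v. if m = v then t v else 0)"
    unfolding sum.distrib[symmetric] using v2 ev by (intro sum.cong refl) auto
  also have "\<dots> = (\<Sum>m\<le>v. (if odd m then of_nat (v choose m) else 0)) * t 1 + (t 0 + t v)"
    by (simp add: sum_distrib_right)
  also have "(\<Sum>m\<le>v. (if odd m then of_nat (v choose m) else 0)) = (of_nat (2 ^ (v - 1)) :: complex)"
  proof -
    have "2 * (\<Sum>m\<le>v. (if odd m then of_nat (v choose m) else 0)) = (2 :: complex) ^ v"
      by (rule choose_odd_sum) (use v2 in simp)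
    also have "\<dots> = 2 * 2 ^ (v - 1)" using v2 by (simp flip: power_Suc)
    finally show ?thesis by simp
  qed
  finally have "of_nat (2 ^ (v - 1)) * t 1 + (t 0 + t v) \<in> N" .
  from diff_mem[OF this t_ends] have C: "of_nat (2 ^ (v - 1)) * t 1 \<in> N" by simp
  have "coprime (2 ^ (v - 1)) (3::nat)" by simp
  moreover have "of_nat 3 * t 1 \<in> N" using l_t[of 1] l3 v2 by simp
  ultimately have t1: "t 1 \<in> N" using coprime_mem[OF C] by blast
  show ?thesis
  proof (cases "even m")
    case False
    hence "t m - t 1 \<in> N" using per[of 1 m] m by simp
    from add_mem[OF this t1] show ?thesis by simp
  qed (use even_t m in auto)
qed

lemma t_middle: "0 < m \<Longrightarrow> m < v \<Longrightarrow> t m \<in> N"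
  using l t_middle_2 t_middle_3 by blast

text \<open>In degree 0 substitutions fix the form, so \<open>G_S\<close> and \<open>G_U\<close>
  give the coprime multiples 2 and 3.\<close>

lemma t_degree_0: "v = 0 \<Longrightarrow> t 0 \<in> N"
proof -
  assume v: "v = 0"
  have f: "form \<int> v (\<lambda>x y. 1)" using v form_const[of 1 \<int>] by simp
  have "t 0 = G (\<lambda>x y. 1)" unfolding t_def using v by simp
  hence "of_nat 3 * t 0 \<in> N" using G_U[OF f] by (simp add: act_fun)
  moreover have "of_nat 2 * t 0 \<in> N" using t_ends v by simp
  ultimately show ?thesis by (rule coprime_mem) simp
qed

text \<open>Only the two end monomials survive, and they are opposite by \<open>t_ends\<close>;
  their coefficients in \<open>Q\<close> are \<open>Q 0 1\<close> and \<open>Q 1 0\<close>.\<close>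

theorem G_eval:
  assumes Q: "form \<int> v Q"
  shows "G Q - (Q 0 1 - Q 1 0) * t 0 \<in> N"
proof -
  obtain c where c: "\<forall>m. c m \<in> \<int>" "\<And>x y. Q x y = (\<Sum>m\<le>v. c m * x ^ m * y ^ (v - m))"
    using Q by (auto simp: form_def)
  have GQ: "G Q = (\<Sum>m\<le>v. c m * t m)"
  proof -
    have "Q = (\<lambda>x y. \<Sum>m\<le>v. c m * (x ^ m * y ^ (v - m)))" by (simp add: fun_eq_iff c(2) mult.assoc)
    thus ?thesis using G_expand[of c] c(1) by simp
  qed
  have Q01: "Q 0 1 = c 0"
  proof -
    have "Q 0 1 = (\<Sum>m\<le>v. if m = 0 then c 0 else 0)" unfolding c(2) by (intro sum.cong refl) (auto simp: zero_power)
    thus ?thesis by simp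
  qed
  have Q10: "Q 1 0 = c v"
  proof -
    have "Q 1 0 = (\<Sum>m\<le>v. if m = v then c v else 0)" unfolding c(2) by (intro sum.cong refl) (auto simp: zero_power)
    thus ?thesis by simp
  qed
  show ?thesis
  proof (cases "v = 0")
    case True
    thus ?thesis using GQ Q01 Q10 c(1) t_degree_0 by (auto intro: Ints_mem)
  next
    case False
    have "(\<Sum>m\<le>v. c m * t m) - c 0 * t 0 - c v * t v = (\<Sum>m\<in>{..v} - {0} - {v}. c m * t m)"
      using False by (simp add: sum_diff1)
    also have "\<dots> \<in> N" by (intro sum_mem Ints_mem t_middle) (use c(1) in auto)
    finally have "(\<Sum>m\<le>v. c m * t m) - c 0 * t 0 - c v * t v + c v * (t 0 + t v) \<in> N"
      by (rule add_mem[OF _ Ints_mem[OF _ t_ends]]) (use c(1) in auto)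
    thus ?thesis by (simp add: GQ Q01 Q10 algebra_simps)
  qed
qed

end

subsection \<open>Dickson's invariant and Nakayama's lemma\<close>

text \<open>Modulo a prime \<open>l\<close> this is, up to a scalar, the product of
  \<open>l + 1\<close> linear forms over the field with \<open>l\<close> elements, one for each
  point of the projective line; hence its invariance.\<close>

definition dick :: "nat \<Rightarrow> complex \<Rightarrow> complex \<Rightarrow> complex" where
  "dick l x y = x ^ l * y - x * y ^ l"

lemma form_diff: "form \<int> n F \<Longrightarrow> form \<int> n G \<Longrightarrow> form \<int> n (\<lambda>x y. F x y - G x y)"
  using form_add[OF subring_Ints, of n F "\<lambda>x y. - G x y"] form_uminus[of n G] by simp

lemma form_dick: "form \<int> (l + 1) (dick l)"
  unfolding dick_def
  using form_monomial[of \<int> l "l + 1"] form_monomial[of \<int> 1 "l + 1"] by (intro form_diff) simp_all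

text \<open>The \<open>l\<close>-th power is additive modulo \<open>l\<close> and fixes integers
  modulo \<open>l\<close>. Both primes are expanded explicitly to exhibit the integral remainder
  \<open>R\<close>.\<close>

lemma frobenius_form:
  assumes "l = 2 \<or> l = 3"
  obtains R where "form \<int> l R" "\<And>x y. (of_int a * x + of_int b * y) ^ l = of_int a * x ^ l + of_int b * y ^ l + of_nat l * R x y"
  using assms
proof
  assume l: "l = 2"
  have "even (c\<^sup>2 - c)" for c :: int by simp
  then obtain u v where "a\<^sup>2 - a = 2 * u" "b\<^sup>2 - b = 2 * v" by (metis evenE)
  hence "a\<^sup>2 = a + 2 * u" "b\<^sup>2 = b + 2 * v" by auto
  from this[THEN arg_cong[where f = "of_int :: int \<Rightarrow> complex"]]
  have ab: "of_int a ^ 2 = (of_int a + 2 * of_int u :: complex)" "of_int b ^ 2 = (of_int b + 2 * of_int v :: complex)" by auto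
  let ?R = "\<lambda>x y. of_int u * (x ^ 2 * y ^ (2 - 2)) + (of_int (a * b) * (x ^ 1 * y ^ (2 - 1)) + of_int v * (x ^ 0 * y ^ (2 - 0))) :: complex"
  show ?thesis
  proof (rule that[of ?R])
    show "form \<int> l ?R" unfolding l by (intro form_add form_scale form_monomial) auto
    show "(of_int a * x + of_int b * y) ^ l = of_int a * x ^ l + of_int b * y ^ l + of_nat l * ?R x y" for x y
    proof -
      have "(of_int a * x + of_int b * y) ^ l = of_int a ^ 2 * x ^ 2 + of_int b ^ 2 * y ^ 2 + 2 * of_int a * of_int b * x * y"
        unfolding l by (simp add: power2_eq_square algebra_simps)
      thus ?thesis unfolding ab l by (simp add: algebra_simps)
    qed
  qed
next
  assume l: "l = 3"
  have "3 dvd c ^ 3 - c" for c :: int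
  proof -
    define q where "q = c div 3"
    have "c = 3 * q \<or> c = 3 * q + 1 \<or> c = 3 * q + 2" unfolding q_def by presburger
    moreover have "(3 * q) ^ 3 - 3 * q = 3 * (9 * q ^ 3 - q)"
      "(3 * q + 1) ^ 3 - (3 * q + 1) = 3 * (9 * q ^ 3 + 9 * q ^ 2 + 2 * q)"
      "(3 * q + 2) ^ 3 - (3 * q + 2) = 3 * (9 * q ^ 3 + 18 * q ^ 2 + 11 * q + 2)"
      by (simp_all add: power3_eq_cube power2_eq_square algebra_simps)
    ultimately show ?thesis by (metis dvd_triv_left)
  qed
  then obtain u v where "a ^ 3 - a = 3 * u" "b ^ 3 - b = 3 * v" by (meson dvdE)
  hence "a ^ 3 = a + 3 * u" "b ^ 3 = b + 3 * v" by auto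
  from this[THEN arg_cong[where f = "of_int :: int \<Rightarrow> complex"]]
  have ab: "of_int a ^ 3 = (of_int a + 3 * of_int u :: complex)" "of_int b ^ 3 = (of_int b + 3 * of_int v :: complex)" by auto
  let ?R = "\<lambda>x y. of_int u * (x ^ 3 * y ^ (3 - 3)) + (of_int (a * a * b) * (x ^ 2 * y ^ (3 - 2))
      + (of_int (a * b * b) * (x ^ 1 * y ^ (3 - 1)) + of_int v * (x ^ 0 * y ^ (3 - 0)))) :: complex"
  show ?thesis
  proof (rule that[of ?R])
    show "form \<int> l ?R" unfolding l by (intro form_add form_scale form_monomial) auto
    show "(of_int a * x + of_int b * y) ^ l = of_int a * x ^ l + of_int b * y ^ l + of_nat l * ?R x y" for x y
    proof -
      have "(of_int a * x + of_int b * y) ^ l = of_int a ^ 3 * x ^ 3 + of_int b ^ 3 * y ^ 3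
         + 3 * (of_int a * of_int a * of_int b * x ^ 2 * y + of_int a * of_int b * of_int b * x * y ^ 2)"
        unfolding l by (simp add: power2_eq_square power3_eq_cube algebra_simps)
      thus ?thesis unfolding ab l by (simp add: algebra_simps)
    qed
  qed
qed

text \<open>After the Frobenius congruence, \<open>dick\<close> is a two-by-two determinant in
  \<open>x\<close>, \<open>y\<close> and their \<open>l\<close>-th powers, both pairs being
  transformed by the same matrix.\<close>

lemma act_dick:
  assumes l: "l = 2 \<or> l = 3"
  obtains E where "form \<int> (l + 1) E" "\<And>x y. act M (dick l) x y = of_int (mdet M) * dick l x y + of_nat l * E x y"
proof -
  obtain a b c d where M: "M = (a, b, c, d)" by (cases M)
  obtain R where R: "form \<int> l R" "\<And>x y. (of_int a * x + of_int b * y) ^ l = of_int a * x ^ l + of_int b * y ^ l + of_nat l * R x y"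
    using frobenius_form[OF l] by blast
  obtain R' where R': "form \<int> l R'" "\<And>x y. (of_int c * x + of_int d * y) ^ l = of_int c * x ^ l + of_int d * y ^ l + of_nat l * R' x y"
    using frobenius_form[OF l] by blast
  have lin: "form \<int> 1 (\<lambda>x y. of_int a * x + of_int b * y)" for a b by (intro form_linear) auto
  let ?E = "\<lambda>x y. R x y * (of_int c * x + of_int d * y) - R' x y * (of_int a * x + of_int b * y)"
  show ?thesis
  proof (rule that[of ?E])
    show "form \<int> (l + 1) ?E" by (intro form_diff form_mult R R' lin) auto
    show "act M (dick l) x y = of_int (mdet M) * dick l x y + of_nat l * ?E x y" for x y
    proof -
      have "act M (dick l) x y = (of_int a * x + of_int b * y) ^ l * (of_int c * x + of_int d * y) - (of_int a * x + of_int b * y) * (of_int c * x + of_int d * y) ^ l"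
        by (simp add: M dick_def)
      thus ?thesis unfolding R R' M mdet.simps by (simp add: dick_def algebra_simps)
    qed
  qed
qed

section \<open>Congruence of integral forms and the action modulo \<open>l\<close>\<close>

definition fcong :: "nat \<Rightarrow> nat \<Rightarrow> (complex \<Rightarrow> complex \<Rightarrow> complex) \<Rightarrow> (complex \<Rightarrow> complex \<Rightarrow> complex) \<Rightarrow> bool" where
  "fcong l n F G \<longleftrightarrow> (\<exists>R. form \<int> n R \<and> (\<forall>x y. F x y = G x y + of_nat l * R x y))"

lemma fcong_refl: "fcong l n F F"
  unfolding fcong_def by (intro exI[of _ "\<lambda>x y. 0"]) (simp add: form_zero)

lemma fcong_mult:
  assumes "fcong l n F G" "fcong l m F' G'" "form \<int> m F'" "form \<int> n G"
  shows "fcong l (n + m) (\<lambda>x y. F x y * F' x y) (\<lambda>x y. G x y * G' x y)"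
proof -
  obtain R where R: "form \<int> n R" "\<And>x y. F x y = G x y + of_nat l * R x y" using assms(1) by (auto simp: fcong_def)
  obtain R' where R': "form \<int> m R'" "\<And>x y. F' x y = G' x y + of_nat l * R' x y" using assms(2) by (auto simp: fcong_def)
  have "form \<int> (n + m) (\<lambda>x y. R x y * F' x y + G x y * R' x y)"
    by (intro form_add form_mult R R' assms) auto
  moreover have "F x y * F' x y = G x y * G' x y + of_nat l * (R x y * F' x y + G x y * R' x y)" for x y
    unfolding R(2) by (simp add: R'(2) algebra_simps)
  ultimately show ?thesis unfolding fcong_def by blast
qed

lemma fcong_power:
  assumes "fcong l n F G" "form \<int> n F" "form \<int> n G"
  shows "fcong l (n * i) (\<lambda>x y. F x y ^ i) (\<lambda>x y. G x y ^ i)"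
proof (induction i)
  case (Suc i)
  have "fcong l (n + n * i) (\<lambda>x y. F x y * F x y ^ i) (\<lambda>x y. G x y * G x y ^ i)"
    by (intro fcong_mult assms Suc form_power) auto
  thus ?case by simp
qed (auto simp: fcong_refl)

lemma act_dick_cong:
  assumes l: "l = 2 \<or> l = 3" and M: "int l dvd mdet M - 1" and Q: "form \<int> v Q"
  shows "fcong l ((l + 1) * i + v) (act M (\<lambda>x y. dick l x y ^ i * Q x y)) (\<lambda>x y. dick l x y ^ i * act M Q x y)"
proof -
  obtain E where E: "form \<int> (l + 1) E" "\<And>x y. act M (dick l) x y = of_int (mdet M) * dick l x y + of_nat l * E x y"
    using act_dick[OF l] by blast
  obtain u where "mdet M - 1 = int l * u" using M by blast
  hence "mdet M = 1 + int l * u" by simp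
  hence "(of_int (mdet M) :: complex) = 1 + of_nat l * of_int u" by simp
  hence "act M (dick l) x y = dick l x y + of_nat l * (of_int u * dick l x y + E x y)" for x y
    unfolding E(2) by (simp add: algebra_simps)
  moreover have "form \<int> (l + 1) (\<lambda>x y. of_int u * dick l x y + E x y)"
    by (intro form_add form_scale form_dick E) auto
  ultimately have 1: "fcong l (l + 1) (act M (dick l)) (dick l)" unfolding fcong_def by blast
  have "fcong l ((l + 1) * i + v) (\<lambda>x y. act M (dick l) x y ^ i * act M Q x y) (\<lambda>x y. dick l x y ^ i * act M Q x y)"
    by (intro fcong_mult fcong_power 1 fcong_refl form_act form_power form_dick Q) auto
  moreover have "act M (\<lambda>x y. dick l x y ^ i * Q x y) = (\<lambda>x y. act M (dick l) x y ^ i * act M Q x y)"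
    by (cases M) (simp add: fun_eq_iff)
  ultimately show ?thesis by simp
qed

section \<open>The localization of the integers at \<open>l\<close>\<close>

definition localization :: "nat \<Rightarrow> complex set" where
  "localization l = {of_int x / of_int y | x y. \<not> int l dvd y}"

lemma localizationI: "\<not> int l dvd y \<Longrightarrow> of_int x / of_int y \<in> localization l"
  unfolding localization_def by blast

lemma
  assumes "prime l"
  shows localization_add: "s \<in> localization l \<Longrightarrow> s' \<in> localization l \<Longrightarrow> s + s' \<in> localization l"
    and localization_mult: "s \<in> localization l \<Longrightarrow> s' \<in> localization l \<Longrightarrow> s * s' \<in> localization l"
    and localization_of_int: "of_int n \<in> localization l"
    and localization_inverse: "s \<in> localization l \<Longrightarrow> 1 - of_nat l * s \<noteq> 0 \<and> 1 / (1 - of_nat l * s) \<in> localization l"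
proof -
  have pr: "\<not> int l dvd y * y'" if "\<not> int l dvd y" "\<not> int l dvd y'" for y y'
    using that assms by (simp add: prime_dvd_mult_iff)
  have nz: "(of_int y :: complex) \<noteq> 0" if "\<not> int l dvd y" for y using that by auto
  {
    assume "s \<in> localization l" "s' \<in> localization l"
    then obtain x y x' y' where s: "s = of_int x / of_int y" "\<not> int l dvd y" "s' = of_int x' / of_int y'" "\<not> int l dvd y'"
      unfolding localization_def by blast
    have "s + s' = of_int (x * y' + x' * y) / of_int (y * y')" using s nz by (simp add: field_simps)
    thus "s + s' \<in> localization l" using localizationI[OF pr[OF s(2,4)]] by metis
    have "s * s' = of_int (x * x') / of_int (y * y')" using s by simp
    thus "s * s' \<in> localization l" using localizationI[OF pr[OF s(2,4)]] by metis
  }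
  have "\<not> int l dvd 1" using assms by (metis int_dvd_int_iff of_nat_1 not_prime_unit)
  thus "of_int n \<in> localization l" using localizationI[of l 1 n] by simp
  assume "s \<in> localization l"
  then obtain x y where s: "s = of_int x / of_int y" "\<not> int l dvd y" unfolding localization_def by blast
  have y': "\<not> int l dvd y - int l * x" using s(2) by (simp add: dvd_diff_left_iff)
  have e: "1 - of_nat l * s = of_int (y - int l * x) / of_int y" using s nz by (simp add: field_simps)
  show "1 - of_nat l * s \<noteq> 0 \<and> 1 / (1 - of_nat l * s) \<in> localization l"
    unfolding e using nz[OF y'] nz[OF s(2)] localizationI[OF y', of y] by simp
qed

text \<open>Induction on the number of generators: the relation for one generator is solved for it,
  since \<open>1 - l c\<close> is a unit of the localization, and the result is substituted in the
  others, where the factor \<open>l\<close> persists.\<close>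

lemma nakayama:
  fixes \<tau> :: "'i \<Rightarrow> complex"
  assumes l: "prime l" and "finite I"
    and "\<And>i. i \<in> I \<Longrightarrow> \<exists>c. (\<forall>j\<in>I. c j \<in> localization l) \<and> \<tau> i = of_nat l * (\<Sum>j\<in>I. c j * \<tau> j)"
  shows "\<forall>i\<in>I. \<tau> i = 0"
  using assms(2,3)
proof (induction I rule: finite_induct)
  case (insert i I)
  obtain c where c: "\<forall>j\<in>insert i I. c j \<in> localization l" "\<tau> i = of_nat l * (\<Sum>j\<in>insert i I. c j * \<tau> j)"
    using insert.prems[of i] by auto
  define s where "s = 1 / (1 - of_nat l * c i)"
  have s: "1 - of_nat l * c i \<noteq> 0" "s \<in> localization l"
    using localization_inverse[OF l, of "c i"] c(1) by (auto simp: s_def)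
  have "(1 - of_nat l * c i) * \<tau> i = of_nat l * (\<Sum>j\<in>I. c j * \<tau> j)"
    using c(2) insert.hyps by (simp add: algebra_simps)
  hence "\<tau> i = s * (of_nat l * (\<Sum>j\<in>I. c j * \<tau> j))" using s(1) by (simp add: s_def field_simps)
  hence ti: "\<tau> i = of_nat l * (\<Sum>j\<in>I. s * c j * \<tau> j)" by (simp add: sum_distrib_left mult_ac)
  have "\<forall>j\<in>I. \<tau> j = 0"
  proof (rule insert.IH)
    fix j assume j: "j \<in> I"
    obtain e where e: "\<forall>j\<in>insert i I. e j \<in> localization l" "\<tau> j = of_nat l * (\<Sum>j\<in>insert i I. e j * \<tau> j)"
      using insert.prems[of j] j by auto
    have "\<tau> j = of_nat l * (e i * \<tau> i + (\<Sum>j\<in>I. e j * \<tau> j))" using e(2) insert.hyps by simp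
    also have "\<dots> = of_nat l * (\<Sum>j\<in>I. (of_nat l * e i * s * c j + e j) * \<tau> j)"
      by (subst ti) (simp add: sum_distrib_left sum.distrib distrib_left distrib_right mult_ac)
    finally have "\<tau> j = \<dots>" .
    moreover have "\<forall>j\<in>I. of_nat l * e i * s * c j + e j \<in> localization l"
      using localization_of_int[OF l, of "int l"] c(1) e(1) s(2)
      by (auto intro!: localization_add[OF l] localization_mult[OF l])
    ultimately show "\<exists>c. (\<forall>j\<in>I. c j \<in> localization l) \<and> \<tau> j = of_nat l * (\<Sum>j\<in>I. c j * \<tau> j)"
      by (intro exI[of _ "\<lambda>m. of_nat l * e i * s * c m + e m"] conjI)
  qed
  thus ?case using ti by simp
qed simp

subsection \<open>Eisenstein congruences for Hecke eigenvalues\<close>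

context cusp_eigenform
begin

text \<open>The group generated by the monomial periods along the imaginary axis.\<close>

definition Lam :: "complex set" where "Lam = {coc F Smat | F. form \<int> w F}"

lemma Lam_memI: "form \<int> w F \<Longrightarrow> coc F Smat \<in> Lam"
  by (auto simp: Lam_def)

sublocale Lam: int_module Lam
proof
  have "coc (\<lambda>x y. 0 * 0) Smat \<in> Lam" by (intro Lam_memI form_scale form_zero) auto
  thus "0 \<in> Lam" using coc_scale[OF form_zero[OF subring_UNIV], of Smat 0] by simp
  fix x y assume "x \<in> Lam"
  then obtain F where F: "x = coc F Smat" "form \<int> w F" by (auto simp: Lam_def)
  have "coc (\<lambda>x y. (-1) * F x y) Smat \<in> Lam" by (intro Lam_memI form_scale F) auto
  thus "- x \<in> Lam" using coc_scale[OF form_UNIV[OF F(2)], of Smat "-1"] F(1) by simp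
  assume "y \<in> Lam"
  then obtain G where G: "y = coc G Smat" "form \<int> w G" by (auto simp: Lam_def)
  have "coc (\<lambda>x y. F x y + G x y) Smat \<in> Lam" by (intro Lam_memI form_add F G) auto
  thus "x + y \<in> Lam" using coc_add[OF form_UNIV[OF F(2)] form_UNIV[OF G(2)], of Smat] F(1) G(1) by simp
qed

lemma coc_step:
  assumes F: "form UNIV w F" and M: "mdet M = 1"
  shows "coc F (mmul (1, n, 0, 1) (mmul Smat M)) = coc (act (1, n, 0, 1) F) Smat + coc (act Smat (act (1, n, 0, 1) F)) M"
proof -
  have f: "form UNIV w (act (1, n, 0, 1) F)" by (intro form_act F) auto
  have "coc F (mmul (1, n, 0, 1) (mmul Smat M)) = coc F (1, n, 0, 1) + coc (act (1, n, 0, 1) F) (mmul Smat M)"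
    by (rule coc_mmul[OF F]) (use M in simp_all)
  also have "coc (act (1, n, 0, 1) F) (mmul Smat M) = coc (act (1, n, 0, 1) F) Smat + coc (act Smat (act (1, n, 0, 1) F)) M"
    by (rule coc_mmul[OF f]) (use M in simp_all)
  finally show ?thesis using coc_translation[OF F] by simp
qed

text \<open>The modular group reduces to \<open>Smat\<close> and to translations up to sign, on
  which the cocycle vanishes, so no values beyond those at \<open>Smat\<close> arise.\<close>

lemma coc_mem_Lam: "mdet M = 1 \<Longrightarrow> form \<int> w F \<Longrightarrow> coc F M \<in> Lam"
proof (induction M arbitrary: F rule: sl2_induct)
  case (step n M)
  show ?case
    unfolding coc_step[OF form_UNIV[OF step.prems] step.hyps]
    by (intro Lam.add_mem Lam_memI step.IH form_act step.prems) auto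
qed (auto simp: coc_translation coc_neg_translation form_UNIV)

lemma hecke_matrix_det:
  assumes "p > 0" "int p dvd 1 + int b * int c"
  shows "mdet (int b, - ((1 + int b * int c) div int p), int p, - int c) = 1"
proof -
  obtain q where q: "1 + int b * int c = int p * q" using assms(2) by blast
  show ?thesis unfolding q using assms(1) q by (simp add: algebra_simps)
qed

text \<open>All terms of \<open>coc_hecke\<close> are cocycle values of integral forms at matrices
  of determinant 1.\<close>

lemma hecke_mem_Lam:
  assumes p: "prime p" and x: "x \<in> Lam"
  shows "a p * x \<in> Lam"
proof -
  obtain F where F: "x = coc F Smat" "form \<int> w F" using x by (auto simp: Lam_def)
  obtain f where f': "\<forall>b\<in>{1..<p}. f b \<in> {1..<p} \<and> f (f b) = b \<and> int p dvd 1 + int b * int (f b)"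
    using neg_inverse_mod_prime[OF p] by blast
  note f = bspec[OF f']
  have p0: "p > 0" using p prime_gt_0_nat by simp
  have S: "mdet Smat = 1" by simp
  show ?thesis unfolding F(1) coc_hecke[OF p form_UNIV[OF F(2)] f']
    using f p0
    by (intro Lam.add_mem Lam.sum_mem coc_mem_Lam form_act F subring_Ints hecke_matrix_det S) auto
qed

text \<open>Filtration of the period module by powers of the Dickson invariant; the successive quotients
  only see values of forms on the projective line over the field with \<open>l\<close> elements.\<close>

definition filt :: "nat \<Rightarrow> nat \<Rightarrow> complex set" where
  "filt l i = {x. \<exists>u\<in>Lam. x = of_nat l * u \<or>
     (\<exists>v Q. (l + 1) * i + v = w \<and> form \<int> v Q \<and> x = coc (\<lambda>x y. dick l x y ^ i * Q x y) Smat + of_nat l * u)}"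

lemma form_dick_power: "form \<int> v Q \<Longrightarrow> form \<int> ((l + 1) * i + v) (\<lambda>x y. dick l x y ^ i * Q x y)"
  by (intro form_mult form_power form_dick) auto

lemma filt_l: "u \<in> Lam \<Longrightarrow> of_nat l * u \<in> filt l i"
  unfolding filt_def by blast

lemma filt_dick: "(l + 1) * i + v = w \<Longrightarrow> form \<int> v Q \<Longrightarrow> u \<in> Lam \<Longrightarrow>
   coc (\<lambda>x y. dick l x y ^ i * Q x y) Smat + of_nat l * u \<in> filt l i"
  unfolding filt_def by blast

lemma filtE:
  assumes "x \<in> filt l i"
  obtains u where "u \<in> Lam" "x = of_nat l * u"
  | u v Q where "u \<in> Lam" "(l + 1) * i + v = w" "form \<int> v Q" "x = coc (\<lambda>x y. dick l x y ^ i * Q x y) Smat + of_nat l * u"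
  using assms unfolding filt_def by blast

lemma coc_dick_add:
  assumes "(l + 1) * i + v = w" "form \<int> v Q" "form \<int> v Q'"
  shows "coc (\<lambda>x y. dick l x y ^ i * (Q x y + Q' x y)) Smat =
    coc (\<lambda>x y. dick l x y ^ i * Q x y) Smat + coc (\<lambda>x y. dick l x y ^ i * Q' x y) Smat"
  using coc_add[OF form_UNIV[OF form_dick_power[OF assms(2), of l i, unfolded assms(1)]]
      form_UNIV[OF form_dick_power[OF assms(3), of l i, unfolded assms(1)]], of Smat]
  by (simp add: distrib_left)

lemma coc_dick_scale:
  assumes "(l + 1) * i + v = w" "form \<int> v Q"
  shows "coc (\<lambda>x y. dick l x y ^ i * (c * Q x y)) Smat = c * coc (\<lambda>x y. dick l x y ^ i * Q x y) Smat"
  using coc_scale[OF form_UNIV[OF form_dick_power[OF assms(2), of l i, unfolded assms(1)]], of Smat c]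
  by (simp add: mult.left_commute)

lemma filt_int_module: "int_module (filt l i)"
proof
  show "0 \<in> filt l i" using filt_l[OF Lam.zero_mem, of l i] by simp
  fix x y assume x: "x \<in> filt l i"
  show "- x \<in> filt l i"
    using x
  proof (cases rule: filtE)
    case (1 u)
    thus ?thesis using filt_l[OF Lam.uminus_mem[of u], of l i] by simp
  next
    case (2 u v Q)
    thus ?thesis using filt_dick[OF 2(2) form_scale[OF subring_Ints 2(3), of "-1"] Lam.uminus_mem[OF 2(1)]]
        coc_dick_scale[OF 2(2,3), of "-1"] by simp
  qed
  assume y: "y \<in> filt l i"
  show "x + y \<in> filt l i"
    using x
  proof (cases rule: filtE)
    case u: (1 u)
    show ?thesis using y
    proof (cases rule: filtE)
      case (1 u')
      thus ?thesis using filt_l[OF Lam.add_mem[OF u(1) 1(1)], of l i] u by (simp add: distrib_left)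
    next
      case (2 u' v Q)
      thus ?thesis using filt_dick[OF 2(2,3) Lam.add_mem[OF u(1) 2(1)]] u by (simp add: algebra_simps)
    qed
  next
    case u: (2 u v Q)
    show ?thesis using y
    proof (cases rule: filtE)
      case (1 u')
      thus ?thesis using filt_dick[OF u(2,3) Lam.add_mem[OF u(1) 1(1)]] u by (simp add: algebra_simps)
    next
      case (2 u' v' Q')
      hence v: "v' = v" using u(2) by simp
      show ?thesis using filt_dick[OF u(2) form_add[OF subring_Ints u(3) 2(3)[unfolded v]] Lam.add_mem[OF u(1) 2(1)]]
          coc_dick_add[OF u(2,3) 2(3)[unfolded v]] u 2 by (simp add: algebra_simps)
    qed
  qed
qed

lemma Lam_subset_filt_0: "Lam \<subseteq> filt l 0"
proof
  fix x assume "x \<in> Lam"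
  then obtain F where F: "x = coc F Smat" "form \<int> w F" by (auto simp: Lam_def)
  show "x \<in> filt l 0" using filt_dick[OF _ F(2) Lam.zero_mem, of l 0] F(1) by simp
qed

text \<open>The power of Dickson's invariant would have degree above \<open>w\<close>, so only
  multiples of \<open>l\<close> remain.\<close>

lemma filt_eventually: "(l + 1) * i > w \<Longrightarrow> x \<in> filt l i \<Longrightarrow> \<exists>u\<in>Lam. x = of_nat l * u"
  by (erule filtE) auto

lemma coc_fcong:
  assumes "fcong l w F G" "form \<int> w G" "mdet M = 1"
  obtains u where "u \<in> Lam" "coc F M = coc G M + of_nat l * u"
proof -
  obtain R where R: "form \<int> w R" "\<And>x y. F x y = G x y + of_nat l * R x y" using assms(1) by (auto simp: fcong_def)
  have "coc F M = coc (\<lambda>x y. G x y + of_nat l * R x y) M" using R(2) by presburger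
  also have "\<dots> = coc G M + of_nat l * coc R M"
    using assms R(1) by (simp add: coc_add coc_scale form_UNIV form_scale)
  finally show ?thesis using coc_mem_Lam[OF assms(3) R(1)] that by blast
qed

text \<open>A matrix whose determinant is 1 modulo \<open>l\<close> passes through the power of
  Dickson's invariant modulo \<open>l\<close>. The error is in \<open>l\<close> times
  \<open>Lam\<close>, which every step of the filtration contains.\<close>

lemma coc_act_dick:
  assumes l: "l = 2 \<or> l = 3" and iv: "(l + 1) * i + v = w" and Q: "form \<int> v Q" and M: "int l dvd mdet M - 1" and N: "mdet N = 1"
  shows "coc (act M (\<lambda>x y. dick l x y ^ i * Q x y)) N - coc (\<lambda>x y. dick l x y ^ i * act M Q x y) N \<in> filt l j"
proof -
  have c: "fcong l w (act M (\<lambda>x y. dick l x y ^ i * Q x y)) (\<lambda>x y. dick l x y ^ i * act M Q x y)"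
    using act_dick_cong[OF l M Q, of i] unfolding iv .
  have f: "form \<int> w (\<lambda>x y. dick l x y ^ i * act M Q x y)"
    using form_dick_power[OF form_act[OF subring_Ints Q], of l i M] unfolding iv .
  show ?thesis by (rule coc_fcong[OF c f N]) (use filt_l in simp)
qed

lemma even_w: "even w"
  using even_k k_ge_2 by (simp add: w_def)

text \<open>The square of \<open>Smat\<close> and the cube of \<open>(0, -1, 1, 1)\<close> are
  \<open>-I\<close>, where the cocycle vanishes; expanding by the cocycle rule gives
  \<open>G_S\<close> and \<open>G_U\<close>. \<open>G_D\<close> is the passage to the next power of
  Dickson's invariant.\<close>

lemma period_relations_filt:
  assumes l: "l = 2 \<or> l = 3" and iv: "(l + 1) * i + v = w"
  shows "period_relations (filt l (Suc i)) (\<lambda>Q. coc (\<lambda>x y. dick l x y ^ i * Q x y) Smat) l v"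
proof -
  interpret N: int_module "filt l (Suc i)" by (rule filt_int_module)
  let ?D = "\<lambda>Q x y. dick l x y ^ i * Q x y"
  have fD: "form \<int> w (?D Q)" if "form \<int> v Q" for Q
    using form_dick_power[OF that, of l i] unfolding iv .
  have S: "coc F Smat + coc (act Smat F) Smat = 0" if F: "form UNIV w F" for F
    using coc_mmul[OF F, of Smat Smat] coc_neg_translation[OF F, of 0] by simp
  have U: "coc F Smat + coc (act (0, -1, 1, 1) F) Smat + coc (act (-1, -1, 1, 0) F) Smat = 0" if F: "form UNIV w F" for F
  proof -
    have SU: "coc G (0, -1, 1, 1) = coc G Smat" if G: "form UNIV w G" for G
      using coc_mmul[OF G, of Smat "(1, 1, 0, 1)"] coc_translation[OF form_act[OF subring_UNIV G], of Smat 1] by simp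
    have f1: "form UNIV w (act (0, -1, 1, 1) F)" "form UNIV w (act (-1, -1, 1, 0) F)" by (intro form_act F subring_UNIV)+
    have "coc F (mmul (0, -1, 1, 1) (mmul (0, -1, 1, 1) (0, -1, 1, 1))) =
      coc F (0, -1, 1, 1) + (coc (act (0, -1, 1, 1) F) (0, -1, 1, 1) + coc (act (0, -1, 1, 1) (act (0, -1, 1, 1) F)) (0, -1, 1, 1))"
      using coc_mmul[OF F, of "(0, -1, 1, 1)" "mmul (0, -1, 1, 1) (0, -1, 1, 1)"]
        coc_mmul[OF f1(1), of "(0, -1, 1, 1)" "(0, -1, 1, 1)"] by simp
    also have "act (0, -1, 1, 1) (act (0, -1, 1, 1) F) = act (-1, -1, 1, 0) F" unfolding act_act by simp
    also have "mmul (0, -1, 1, 1) (mmul (0, -1, 1, 1) (0, -1, 1, 1)) = (-1, 0, 0, -1)" by simp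
    finally have "coc F (-1, 0, 0, -1) = coc F (0, -1, 1, 1) + (coc (act (0, -1, 1, 1) F) (0, -1, 1, 1) + coc (act (-1, -1, 1, 0) F) (0, -1, 1, 1))" .
    thus ?thesis unfolding SU[OF F] SU[OF f1(1)] SU[OF f1(2)] coc_neg_translation[OF F] add.assoc by (rule sym)
  qed
  show ?thesis
  proof
    have "even v" if "l = 3"
    proof -
      have "w = 4 * i + v" using iv that by simp
      thus ?thesis using even_w by simp
    qed
    thus "l = 2 \<or> l = 3 \<and> even v" using l by blast
  next
    fix F F' assume "form \<int> v F" "form \<int> v F'"
    thus "coc (?D (\<lambda>x y. F x y + F' x y)) Smat = coc (?D F) Smat + coc (?D F') Smat" by (rule coc_dick_add[OF iv])
  next
    fix F c assume "form \<int> v F"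
    thus "coc (?D (\<lambda>x y. c * F x y)) Smat = c * coc (?D F) Smat" by (rule coc_dick_scale[OF iv])
  next
    fix F assume "form \<int> v F"
    thus "of_nat l * coc (?D F) Smat \<in> filt l (Suc i)" by (intro filt_l Lam_memI fD)
  next
    fix F assume F: "form \<int> v F"
    have "0 - (coc (act Smat (?D F)) Smat - coc (?D (act Smat F)) Smat) \<in> filt l (Suc i)"
      by (intro N.diff_mem N.zero_mem coc_act_dick[OF l iv F]) simp_all
    thus "coc (?D F) Smat + coc (?D (act Smat F)) Smat \<in> filt l (Suc i)"
      using S[OF form_UNIV[OF fD[OF F]]] by (simp add: add_eq_0_iff add.commute)
  next
    fix F assume F: "form \<int> v F"
    have "0 - (coc (act (0, -1, 1, 1) (?D F)) Smat - coc (?D (act (0, -1, 1, 1) F)) Smat)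
       - (coc (act (-1, -1, 1, 0) (?D F)) Smat - coc (?D (act (-1, -1, 1, 0) F)) Smat) \<in> filt l (Suc i)"
      by (intro N.diff_mem N.zero_mem coc_act_dick[OF l iv F]) simp_all
    also have "0 - (coc (act (0, -1, 1, 1) (?D F)) Smat - coc (?D (act (0, -1, 1, 1) F)) Smat)
       - (coc (act (-1, -1, 1, 0) (?D F)) Smat - coc (?D (act (-1, -1, 1, 0) F)) Smat) =
       coc (?D F) Smat + coc (?D (act (0, -1, 1, 1) F)) Smat + coc (?D (act (-1, -1, 1, 0) F)) Smat
       - (coc (?D F) Smat + coc (act (0, -1, 1, 1) (?D F)) Smat + coc (act (-1, -1, 1, 0) (?D F)) Smat)"
      by (simp only: diff_conv_add_uminus minus_add_distrib minus_minus add_0_left add_ac) simp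
    finally show "coc (?D F) Smat + coc (?D (act (0, -1, 1, 1) F)) Smat + coc (?D (act (-1, -1, 1, 0) F)) Smat \<in> filt l (Suc i)"
      unfolding U[OF form_UNIV[OF fD[OF F]]] by simp
  next
    fix v' F assume F: "form \<int> v' F" "v = l + 1 + v'"
    have "?D (\<lambda>x y. (x ^ l * y - x * y ^ l) * F x y) = (\<lambda>x y. dick l x y ^ Suc i * F x y)"
      by (simp add: fun_eq_iff dick_def mult_ac)
    moreover have "coc (\<lambda>x y. dick l x y ^ Suc i * F x y) Smat + of_nat l * 0 \<in> filt l (Suc i)"
      by (rule filt_dick[OF _ F(1) Lam.zero_mem]) (use iv F(2) in simp)
    ultimately show "coc (?D (\<lambda>x y. (x ^ l * y - x * y ^ l) * F x y)) Smat \<in> filt l (Suc i)" by simp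
  qed
qed

text \<open>On one layer of the filtration the cocycle sees a matrix only through the value of
  \<open>Q\<close> at its first column. For \<open>Smat\<close> this is \<open>G_eval\<close>; it
  extends to all matrices by induction, because the intermediate value cancels between the two terms
  of \<open>coc_step\<close>.\<close>

lemma coc_dick_eval:
  assumes l: "l = 2 \<or> l = 3" and iv: "(l + 1) * i + v = w"
  obtains e where "of_nat l * e \<in> filt l (Suc i)"
    "\<And>Q b c d a'. form \<int> v Q \<Longrightarrow> a' * d - b * c = (1 :: int) \<Longrightarrow>
       coc (\<lambda>x y. dick l x y ^ i * Q x y) (a', b, c, d) - (Q (of_int a') (of_int c) - Q 1 0) * e \<in> filt l (Suc i)"
proof -
  interpret P: period_relations "filt l (Suc i)" "\<lambda>Q. coc (\<lambda>x y. dick l x y ^ i * Q x y) Smat" l v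
    by (rule period_relations_filt[OF l iv])
  let ?D = "\<lambda>Q x y. dick l x y ^ i * Q x y"
  let ?e = "P.t 0"
  have fD: "form \<int> w (?D Q)" if "form \<int> v Q" for Q
    using form_dick_power[OF that, of l i] unfolding iv .
  have main: "coc (?D Q) M - (Q (of_int (fst M)) (of_int (fst (snd (snd M)))) - Q 1 0) * ?e \<in> filt l (Suc i)"
    if "mdet M = 1" "form \<int> v Q" for M Q
    using that
  proof (induction M arbitrary: Q rule: sl2_induct)
    case (translation n)
    thus ?case by (simp add: coc_translation form_UNIV[OF fD])
  next
    case (neg_translation n)
    have "Q (-1) 0 = (-1) ^ v * Q 1 0" using form_homogeneous[OF neg_translation, of "-1" 1 0] by simp
    moreover have "((-1) ^ v * Q 1 0 - Q 1 0) * ?e \<in> filt l (Suc i)"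
    proof (cases "even v")
      \<comment> \<open>For odd \<open>v\<close> the two values of \<open>Q\<close> differ by a
        sign, which is invisible because \<open>l = 2\<close> and \<open>l\<close> times
        \<open>?e\<close> is trivial.\<close>
      case False
      hence "l = 2" using P.l by auto
      hence "(-1) * Q 1 0 * (of_nat l * ?e) \<in> filt l (Suc i)"
        using form_int_value[OF neg_translation, of 1 0] by (intro P.Ints_mem P.l_t) auto
      thus ?thesis using False \<open>l = 2\<close> by (simp add: algebra_simps)
    qed simp
    ultimately have "- ((Q (-1) 0 - Q 1 0) * ?e) \<in> filt l (Suc i)" using P.uminus_mem by simp
    thus ?case using neg_translation by (simp add: coc_neg_translation form_UNIV[OF fD])
  next
    case (step n M)
    let ?Q1 = "act (1, n, 0, 1) Q"
    let ?Q2 = "act Smat ?Q1"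
    have Q1: "form \<int> v ?Q1" and Q2: "form \<int> v ?Q2" by (intro form_act step.prems subring_Ints)+
    have T: "mdet (1, n, 0, 1) = 1" "mdet Smat = 1" "mdet (mmul (1, n, 0, 1) Smat) = 1" by simp_all
    have A: "coc (act (1, n, 0, 1) (?D Q)) Smat - coc (?D ?Q1) Smat \<in> filt l (Suc i)"
      by (rule coc_act_dick[OF l iv step.prems _ T(2)]) simp
    have "coc (act (mmul (1, n, 0, 1) Smat) (?D Q)) M - coc (?D (act (mmul (1, n, 0, 1) Smat) Q)) M \<in> filt l (Suc i)"
      by (rule coc_act_dick[OF l iv step.prems _ step.hyps]) simp
    hence B: "coc (act Smat (act (1, n, 0, 1) (?D Q))) M - coc (?D ?Q2) M \<in> filt l (Suc i)"
      by (simp only: act_act)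
    have C: "coc (?D ?Q1) Smat - (?Q1 0 1 - ?Q1 1 0) * ?e \<in> filt l (Suc i)" by (rule P.G_eval[OF Q1])
    have E: "coc (?D ?Q2) M - (?Q2 (of_int (fst M)) (of_int (fst (snd (snd M)))) - ?Q2 1 0) * ?e \<in> filt l (Suc i)"
      by (rule step.IH[OF Q2])
    have v1: "?Q1 1 0 = Q 1 0" "?Q2 1 0 = ?Q1 0 1" by simp_all
    have v2: "?Q2 (of_int (fst M)) (of_int (fst (snd (snd M)))) =
       Q (of_int (fst (mmul (1, n, 0, 1) (mmul Smat M)))) (of_int (fst (snd (snd (mmul (1, n, 0, 1) (mmul Smat M))))))"
      by (cases M) (simp add: algebra_simps)
    have ring: "s + t - (q - r) * e \<in> filt l (Suc i)"
      if "s - s' \<in> filt l (Suc i)" "t - t' \<in> filt l (Suc i)" "s' - (u - r) * e \<in> filt l (Suc i)" "t' - (q - u) * e \<in> filt l (Suc i)"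
      for s s' t t' q r u e
      using P.add_mem[OF P.add_mem[OF that(1,2)] P.add_mem[OF that(3,4)]] by (simp add: algebra_simps)
    show ?case
      unfolding coc_step[OF form_UNIV[OF fD[OF step.prems]] step.hyps] v2[symmetric]
      by (rule ring[OF A B C[unfolded v1(1)] E[unfolded v1(2)]])
  qed
  show ?thesis
  proof (rule that[of ?e])
    show "of_nat l * ?e \<in> filt l (Suc i)" by (rule P.l_t) simp
    fix Q b c d a' assume "form \<int> v Q" "a' * d - b * c = (1 :: int)"
    thus "coc (?D Q) (a', b, c, d) - (Q (of_int a') (of_int c) - Q 1 0) * ?e \<in> filt l (Suc i)"
      using main[of "(a', b, c, d)" Q] by simp
  qed
qed

text \<open>For \<open>p\<close> congruent to 1 modulo \<open>l\<close>, the powers of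
  \<open>p\<close> produced by homogeneity count as 1, so each of the \<open>p + 1\<close> terms of
  the Hecke formula has the same class \<open>?\<delta>\<close>, which is also the class of the
  period itself. The eigenvalue on the layer is therefore \<open>p + 1\<close>, that is 2, modulo
  \<open>l\<close>.\<close>

lemma hecke_filt_step:
  assumes l: "l = 2 \<or> l = 3" and p: "prime p" and pl: "int l dvd int p - 1" and x: "x \<in> filt l i"
  shows "(a p - 2) * x \<in> filt l (Suc i)"
  using x
proof (cases rule: filtE)
  case (1 u)
  have "a p * u - of_nat 2 * u \<in> Lam" by (intro Lam.diff_mem hecke_mem_Lam[OF p] Lam.of_nat_mem 1)
  from filt_l[OF this, of l "Suc i"] show ?thesis using 1 by (simp add: algebra_simps)
next
  case (2 u v Q)
  interpret N: int_module "filt l (Suc i)" by (rule filt_int_module)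
  obtain e where e: "of_nat l * e \<in> filt l (Suc i)"
    "\<And>Q b c d a'. form \<int> v Q \<Longrightarrow> a' * d - b * c = (1 :: int) \<Longrightarrow>
       coc (\<lambda>x y. dick l x y ^ i * Q x y) (a', b, c, d) - (Q (of_int a') (of_int c) - Q 1 0) * e \<in> filt l (Suc i)"
    using coc_dick_eval[OF l 2(2)] by blast
  note iv = 2(2) and Q = 2(3)
  let ?D = "\<lambda>Q x y. dick l x y ^ i * Q x y"
  let ?\<delta> = "(Q 0 1 - Q 1 0) * e"
  have fD: "form \<int> w (?D Q)" using form_dick_power[OF Q, of l i] unfolding iv .
  have p0: "p > 0" using p prime_gt_0_nat by simp
  obtain q where q: "int p - 1 = int l * q" using pl by blast
  \<comment> \<open>Powers of \<open>p\<close> act as 1 on integral multiples of \<open>e\<close>: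
    \<open>l\<close> divides \<open>p ^ m - 1\<close>, and \<open>l * e\<close> is trivial.\<close>
  have pm: "(of_nat p ^ m - 1) * (z * e) \<in> filt l (Suc i)" if "z \<in> \<int>" for m z
  proof -
    have "int l dvd int p ^ m - 1"
      using pl by (metis cong_iff_dvd_diff cong_pow power_one)
    then obtain s where "int p ^ m - 1 = int l * s" by blast
    from arg_cong[OF this, of "of_int :: int \<Rightarrow> complex"]
    have "of_nat p ^ m - 1 = (of_nat l * of_int s :: complex)" by simp
    hence eq: "(of_nat p ^ m - 1) * (z * e) = of_int s * z * (of_nat l * e)" by (simp only: mult_ac)
    have "of_int s * z * (of_nat l * e) \<in> filt l (Suc i)"
      by (rule N.Ints_mem[OF _ e(1)]) (use that in auto)
    thus ?thesis by (simp only: eq)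
  qed
  have Qv: "Q 0 (of_nat p) = of_nat p ^ v * Q 0 1" "Q (of_nat p) 0 = of_nat p ^ v * Q 1 0"
    using form_homogeneous[OF Q, of "of_nat p" 0 1] form_homogeneous[OF Q, of "of_nat p" 1 0] by simp_all
  have Qi: "Q 0 1 \<in> \<int>" "Q 1 0 \<in> \<int>" by (intro form_int_value[OF Q]; simp)+
  have trm: "coc (act M (?D Q)) (b, c, d, g) - ?\<delta> \<in> filt l (Suc i)"
    if M: "mdet M = int p" and det: "b * g - c * d = 1"
      and v: "act M Q (of_int b) (of_int d) = of_nat p ^ m * Q 0 1" "act M Q 1 0 = of_nat p ^ m' * Q 1 0" for M b c d g m m'
  proof -
    have A: "coc (act M (?D Q)) (b, c, d, g) - coc (?D (act M Q)) (b, c, d, g) \<in> filt l (Suc i)"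
      by (rule coc_act_dick[OF l iv Q]) (use M pl det in simp_all)
    have B: "coc (?D (act M Q)) (b, c, d, g) - (of_nat p ^ m * Q 0 1 - of_nat p ^ m' * Q 1 0) * e \<in> filt l (Suc i)"
      using e(2)[OF form_act[OF subring_Ints Q, of M] det] unfolding v .
    have "coc (act M (?D Q)) (b, c, d, g) - ?\<delta> =
      (coc (act M (?D Q)) (b, c, d, g) - coc (?D (act M Q)) (b, c, d, g)) +
      (coc (?D (act M Q)) (b, c, d, g) - (of_nat p ^ m * Q 0 1 - of_nat p ^ m' * Q 1 0) * e) +
      ((of_nat p ^ m - 1) * (Q 0 1 * e) - (of_nat p ^ m' - 1) * (Q 1 0 * e))"
      by (simp add: algebra_simps)
    also have "\<dots> \<in> filt l (Suc i)" by (intro N.add_mem N.diff_mem A B pm Qi)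
    finally show ?thesis .
  qed
  obtain f where f': "\<forall>b\<in>{1..<p}. f b \<in> {1..<p} \<and> f (f b) = b \<and> int p dvd 1 + int b * int (f b)"
    using neg_inverse_mod_prime[OF p] by blast
  note f = bspec[OF f']
  let ?g = "\<lambda>b. (int b, - ((1 + int b * int (f b)) div int p), int p, - int (f b))"
  have t1: "coc (act (1, 0, 0, int p) (?D Q)) Smat - ?\<delta> \<in> filt l (Suc i)"
    by (rule trm[where m = v and m' = 0]) (simp_all add: Qv)
  have t2: "coc (act (int p, 0, 0, 1) (?D Q)) Smat - ?\<delta> \<in> filt l (Suc i)"
    by (rule trm[where m = 0 and m' = v]) (simp_all add: Qv)
  have t3: "(\<Sum>b\<in>{1..<p}. coc (act (int p, - int b, 0, 1) (?D Q)) (?g b) - ?\<delta>) \<in> filt l (Suc i)"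
  proof (rule N.sum_mem)
    fix b assume b: "b \<in> {1..<p}"
    have det: "mdet (?g b) = 1" using hecke_matrix_det[OF p0, of b "f b"] f[OF b] by blast
    show "coc (act (int p, - int b, 0, 1) (?D Q)) (?g b) - ?\<delta> \<in> filt l (Suc i)"
      by (rule trm[where m = v and m' = v]) (use det in \<open>simp_all add: Qv mult.commute\<close>)
  qed
  have t4: "coc (?D Q) Smat - ?\<delta> \<in> filt l (Suc i)"
    using e(2)[OF Q, of 0 0 "-1" 1] by simp
  have t5: "(of_nat p - 1) * ?\<delta> \<in> filt l (Suc i)"
    using pm[of "Q 0 1 - Q 1 0" 1] Qi by simp
  \<comment> \<open>Of the \<open>p + 1\<close> copies of \<open>?\<delta>\<close>, two are matched
    by twice the period, and the remaining \<open>p - 1\<close> are trivial by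
    \<open>t5\<close>.\<close>
  have "a p * coc (?D Q) Smat - of_nat 2 * coc (?D Q) Smat =
     (coc (act (1, 0, 0, int p) (?D Q)) Smat - ?\<delta>) + (coc (act (int p, 0, 0, 1) (?D Q)) Smat - ?\<delta>) +
     (\<Sum>b\<in>{1..<p}. coc (act (int p, - int b, 0, 1) (?D Q)) (?g b) - ?\<delta>) + (of_nat p - 1) * ?\<delta> - of_nat 2 * (coc (?D Q) Smat - ?\<delta>)"
  proof -
    have "(\<Sum>b\<in>{1..<p}. coc (act (int p, - int b, 0, 1) (?D Q)) (?g b) - ?\<delta>) =
      (\<Sum>b\<in>{1..<p}. coc (act (int p, - int b, 0, 1) (?D Q)) (?g b)) - (of_nat p - 1) * ?\<delta>"
      using p0 by (simp add: sum_subtractf of_nat_diff)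
    moreover have "x + y + s - of_nat 2 * c = (x - d) + (y - d) + (s - q * d) + q * d - of_nat 2 * (c - d)"
      for x y s c d q :: complex by (simp add: algebra_simps)
    ultimately show ?thesis unfolding coc_hecke[OF p form_UNIV[OF fD] f'] by simp
  qed
  also have "\<dots> \<in> filt l (Suc i)"
    by (intro N.diff_mem N.add_mem N.of_nat_mem t1 t2 t3 t4 t5)
  finally have A: "a p * coc (?D Q) Smat - of_nat 2 * coc (?D Q) Smat \<in> filt l (Suc i)" .
  have "a p * u - of_nat 2 * u \<in> Lam" by (intro Lam.diff_mem hecke_mem_Lam[OF p] Lam.of_nat_mem 2)
  from N.add_mem[OF A filt_l[OF this, of l "Suc i"]]
  show ?thesis using 2(4) by (simp add: algebra_simps)
qed

text \<open>Each factor \<open>a p - 2\<close> moves one step down the filtration, and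
  \<open>w + 1\<close> steps lead into \<open>l\<close> times \<open>Lam\<close>.\<close>

lemma hecke_nilpotent:
  assumes l: "l = 2 \<or> l = 3" and p: "prime p" and pl: "int l dvd int p - 1" and x: "x \<in> Lam"
  shows "\<exists>u\<in>Lam. (a p - 2) ^ Suc w * x = of_nat l * u"
proof -
  have "(a p - 2) ^ i * x \<in> filt l i" for i
  proof (induction i)
    case 0
    show ?case using x Lam_subset_filt_0 by auto
  next
    case (Suc i)
    from hecke_filt_step[OF l p pl this] show ?case by (simp add: mult.assoc)
  qed
  from this[of "Suc w"] show ?thesis by (rule filt_eventually[rotated]) simp
qed

text \<open>The multipliers of the period group: a ring containing the integers and all
  \<open>a p\<close>, used in place of a ring of algebraic integers.\<close>

definition mults :: "complex set" where "mults = {c. \<forall>x\<in>Lam. c * x \<in> Lam}"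

lemma mults_add: "c \<in> mults \<Longrightarrow> d \<in> mults \<Longrightarrow> c + d \<in> mults"
  and mults_mult: "c \<in> mults \<Longrightarrow> d \<in> mults \<Longrightarrow> c * d \<in> mults"
  and mults_Ints: "c \<in> \<int> \<Longrightarrow> c \<in> mults"
  and mults_a: "prime p \<Longrightarrow> a p \<in> mults"
  by (auto simp: mults_def distrib_right mult.assoc intro: Lam.add_mem Lam.Ints_mem hecke_mem_Lam)

text \<open>With \<open>a p\<close> replaced by 2 and \<open>p ^ (k - 1)\<close> by 1, the Hecke
  recursion is the one satisfied by \<open>m + 1\<close>. It has order two, so two consecutive
  exponents are carried through the induction.\<close>

lemma a_prime_power_expansion:
  assumes p: "prime p" and pl: "int l dvd int p - 1"
  shows "(\<exists>g\<in>mults. \<exists>g'\<in>mults. a (p ^ m) = of_nat (m + 1) + (a p - 2) * g + of_nat l * g') \<and>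
    (\<exists>g\<in>mults. \<exists>g'\<in>mults. a (p ^ Suc m) = of_nat (m + 2) + (a p - 2) * g + of_nat l * g')"
proof (induction m)
  case 0
  have "0 \<in> mults" "1 \<in> mults" by (rule mults_Ints; simp)+
  moreover have "a (p ^ 0) = of_nat (0 + 1) + (a p - 2) * 0 + of_nat l * 0" by simp
  moreover have "a (p ^ Suc 0) = of_nat (0 + 2) + (a p - 2) * 1 + of_nat l * 0" by simp
  ultimately show ?case by blast
next
  case (Suc m)
  obtain g0 g0' where g0: "g0 \<in> mults" "g0' \<in> mults" "a (p ^ m) = of_nat (m + 1) + (a p - 2) * g0 + of_nat l * g0'"
    using Suc by blast
  obtain g1 g1' where g1: "g1 \<in> mults" "g1' \<in> mults" "a (p ^ Suc m) = of_nat (m + 2) + (a p - 2) * g1 + of_nat l * g1'"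
    using Suc by blast
  have "int l dvd int p ^ (k - 1) - 1"
    using pl by (metis cong_iff_dvd_diff cong_pow power_one)
  then obtain s where "int p ^ (k - 1) - 1 = int l * s" by blast
  from arg_cong[OF this, of "of_int :: int \<Rightarrow> complex"]
  have pk: "of_nat p ^ (k - 1) = (1 + of_nat l * of_int s :: complex)" by (simp add: diff_eq_eq add.commute)
  define \<nu> where "\<nu> = a p - 2"
  have ap: "a p = 2 + \<nu>" by (simp add: \<nu>_def)
  let ?G = "of_nat (m + 2) + (2 + \<nu>) * g1 + - 1 * g0"
  let ?G' = "(2 + \<nu>) * g1' + - 1 * g0' + - of_int s * (of_nat (m + 1) + \<nu> * g0 + of_nat l * g0')"
  have "a (p ^ Suc (Suc m)) = (2 + \<nu>) * (of_nat (m + 2) + \<nu> * g1 + of_nat l * g1') - (1 + of_nat l * of_int s) * (of_nat (m + 1) + \<nu> * g0 + of_nat l * g0')"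
    unfolding a_prime_power_Suc[OF p] g0(3) g1(3) pk ap by simp
  also have "\<dots> = of_nat (Suc m + 2) + \<nu> * ?G + of_nat l * ?G'"
    by (simp add: algebra_simps)
  finally have E: "a (p ^ Suc (Suc m)) = of_nat (Suc m + 2) + (a p - 2) * ?G + of_nat l * ?G'" unfolding \<nu>_def .
  have nu: "2 + \<nu> \<in> mults" "\<nu> \<in> mults"
    using mults_a[OF p] mults_add[OF mults_a[OF p] mults_Ints[of "-2"]] by (auto simp: \<nu>_def)
  have n: "of_nat j \<in> mults" "- of_int s \<in> mults" "- 1 \<in> mults" for j by (rule mults_Ints; simp)+
  have "?G \<in> mults" "?G' \<in> mults" by (intro mults_add mults_mult nu n g0 g1)+
  with E Suc show ?case by (auto simp del: power_Suc of_nat_add) 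
qed

text \<open>If \<open>Lam\<close> were equal to \<open>l\<close> times itself, Nakayama's lemma over
  the localization would kill the finitely many monomial periods, against
  \<open>periods_nonzero\<close>.\<close>

lemma Lam_not_divisible:
  assumes l: "prime l"
  shows "\<exists>x\<in>Lam. \<nexists>u. u \<in> Lam \<and> x = of_nat l * u"
proof (rule ccontr)
  assume "\<not> ?thesis"
  hence dv: "\<And>x. x \<in> Lam \<Longrightarrow> \<exists>u\<in>Lam. x = of_nat l * u" by blast
  let ?\<tau> = "\<lambda>m. coc (\<lambda>x y. x ^ m * y ^ (w - m)) Smat"
  have "\<forall>m\<in>{..w}. ?\<tau> m = 0"
  proof (rule nakayama[OF l])
    fix m assume "m \<in> {..w}"
    hence "?\<tau> m \<in> Lam" by (intro Lam_memI form_monomial) auto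
    then obtain F where F: "form \<int> w F" "?\<tau> m = of_nat l * coc F Smat" using dv[of "?\<tau> m"] by (auto simp: Lam_def)
    obtain c where c: "\<forall>m. c m \<in> \<int>" "\<And>x y. F x y = (\<Sum>m\<le>w. c m * x ^ m * y ^ (w - m))"
      using F(1) by (auto simp: form_def)
    have F': "F = (\<lambda>x y. \<Sum>m\<le>w. c m * (x ^ m * y ^ (w - m)))" by (simp add: fun_eq_iff c(2) mult.assoc)
    have "coc F Smat = (\<Sum>m\<le>w. coc (\<lambda>x y. c m * (x ^ m * y ^ (w - m))) Smat)"
      unfolding F' by (rule coc_sum) (auto intro!: form_scale form_monomial)
    also have "\<dots> = (\<Sum>m\<le>w. c m * ?\<tau> m)"
      by (intro sum.cong refl coc_scale form_monomial) auto
    finally have "?\<tau> m = of_nat l * (\<Sum>m\<le>w. c m * ?\<tau> m)" using F(2) by simp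
    moreover have "\<forall>m\<in>{..w}. c m \<in> localization l"
      using c(1) localization_of_int[OF l] by (metis Ints_cases)
    ultimately show "\<exists>c. (\<forall>j\<in>{..w}. c j \<in> localization l) \<and> ?\<tau> m = of_nat l * (\<Sum>j\<in>{..w}. c j * ?\<tau> j)" by blast
  qed simp
  thus False using periods_nonzero by auto
qed

text \<open>Were \<open>a (p ^ m) = 0\<close>, multiplication by \<open>m + 1\<close> on
  \<open>Lam\<close> would agree modulo \<open>l\<close> with a multiple of the nilpotent
  \<open>a p - 2\<close>, so a power of \<open>m + 1\<close> would carry \<open>Lam\<close> into
  \<open>l\<close> times \<open>Lam\<close>. As \<open>m + 1\<close> is prime to \<open>l\<close>,
  all of \<open>Lam\<close> would be divisible by \<open>l\<close>.\<close>

theorem a_prime_power_nonzero: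
  assumes l: "l = 2 \<or> l = 3" and p: "prime p" and pl: "int l dvd int p - 1" and m: "\<not> l dvd m + 1"
  shows "a (p ^ m) \<noteq> 0"
proof
  assume 0: "a (p ^ m) = 0"
  have pl': "prime l" using l by auto
  define \<nu> where "\<nu> = a p - 2"
  obtain g g' where g: "g \<in> mults" "g' \<in> mults" "of_nat (m + 1) + \<nu> * g + of_nat l * g' = 0"
    using a_prime_power_expansion[OF p pl, of m] 0 unfolding \<nu>_def by metis
  have nu: "\<nu> \<in> mults" using mults_add[OF mults_a[OF p] mults_Ints[of "-2"]] by (simp add: \<nu>_def)
  have step: "\<exists>u\<in>Lam. \<exists>v\<in>Lam. of_nat (m + 1) ^ r * x = \<nu> ^ r * u + of_nat l * v" if x: "x \<in> Lam" for x r
  proof (induction r)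
    case 0
    show ?case using x Lam.zero_mem by (intro bexI[of _ x] bexI[of _ 0]) auto
  next
    case (Suc r)
    then obtain u v where uv: "u \<in> Lam" "v \<in> Lam" "of_nat (m + 1) ^ r * x = \<nu> ^ r * u + of_nat l * v" by blast
    have "of_nat (m + 1) = (of_nat (m + 1) + \<nu> * g + of_nat l * g') - \<nu> * g - of_nat l * g'" by simp
    hence M: "of_nat (m + 1) = - (\<nu> * g) - of_nat l * g'" unfolding g(3) by simp
    have "of_nat (m + 1) ^ Suc r * x = of_nat (m + 1) * (\<nu> ^ r * u + of_nat l * v)"
      using uv(3) by (simp add: mult.assoc)
    also have "\<dots> = of_nat (m + 1) * (\<nu> ^ r * u) + of_nat l * (of_nat (m + 1) * v)" by (simp add: algebra_simps)
    also have "of_nat (m + 1) * (\<nu> ^ r * u) = (- (\<nu> * g) - of_nat l * g') * (\<nu> ^ r * u)" unfolding M ..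
    also have "\<dots> + of_nat l * (of_nat (m + 1) * v) = \<nu> ^ Suc r * (- 1 * (g * u)) + of_nat l * (of_nat (m + 1) * v + - 1 * (g' * (\<nu> ^ r * u)))"
      by (simp add: algebra_simps)
    finally have "of_nat (m + 1) ^ Suc r * x = \<dots>" .
    moreover have "- 1 * (g * u) \<in> Lam" "of_nat (m + 1) * v + - 1 * (g' * (\<nu> ^ r * u)) \<in> Lam"
    proof -
      have "\<nu> ^ r * u \<in> Lam" by (induction r) (use nu uv(1) in \<open>auto simp: mults_def mult.assoc\<close>)
      hence gu: "g * u \<in> Lam" "g' * (\<nu> ^ r * u) \<in> Lam" using g(1,2) uv(1) by (simp_all add: mults_def)
      show "- 1 * (g * u) \<in> Lam" using Lam.uminus_mem[OF gu(1)] by simp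
      show "of_nat (m + 1) * v + - 1 * (g' * (\<nu> ^ r * u)) \<in> Lam"
        using Lam.add_mem[OF Lam.of_nat_mem[OF uv(2), of "m + 1"] Lam.uminus_mem[OF gu(2)]] by simp
    qed
    ultimately show ?case by blast
  qed
  obtain x where x: "x \<in> Lam" "\<nexists>u. u \<in> Lam \<and> x = of_nat l * u" using Lam_not_divisible[OF pl'] by blast
  obtain u v where uv: "u \<in> Lam" "v \<in> Lam" "of_nat (m + 1) ^ Suc w * x = \<nu> ^ Suc w * u + of_nat l * v"
    using step[OF x(1)] by blast
  obtain u' where u': "u' \<in> Lam" "\<nu> ^ Suc w * u = of_nat l * u'"
    using hecke_nilpotent[OF l p pl uv(1)] unfolding \<nu>_def by blast
  \<comment> \<open>The elements divisible by \<open>l\<close> form a subgroup containing both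
    \<open>l * x\<close> and a multiple of \<open>x\<close> prime to \<open>l\<close>, hence
    \<open>x\<close> itself.\<close>
  define L where "L = {y. \<exists>u\<in>Lam. y = of_nat l * u}"
  interpret L: int_module L
  proof
    show "0 \<in> L" unfolding L_def using Lam.zero_mem by force
    fix x y assume "x \<in> L" "y \<in> L"
    then obtain u v where "u \<in> Lam" "v \<in> Lam" "x = of_nat l * u" "y = of_nat l * v" unfolding L_def by blast
    hence "u + v \<in> Lam" "x + y = of_nat l * (u + v)" by (simp_all add: Lam.add_mem distrib_left)
    thus "x + y \<in> L" unfolding L_def by blast
  next
    fix x assume "x \<in> L"
    then obtain u where "u \<in> Lam" "x = of_nat l * u" unfolding L_def by blast
    hence "- u \<in> Lam" "- x = of_nat l * - u" by (simp_all add: Lam.uminus_mem)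
    thus "- x \<in> L" unfolding L_def by blast
  qed
  have "of_nat ((m + 1) ^ Suc w) * x = of_nat l * (u' + v)"
    using uv(3) unfolding u'(2) of_nat_power distrib_left .
  hence "of_nat ((m + 1) ^ Suc w) * x \<in> L" unfolding L_def using Lam.add_mem[OF u'(1) uv(2)] by blast
  moreover have "of_nat l * x \<in> L" unfolding L_def using x(1) by blast
  moreover have "coprime ((m + 1) ^ Suc w) l"
    using m pl' by (metis coprime_commute coprime_power_left_iff prime_imp_coprime_nat)
  ultimately have "x \<in> L" by (rule L.coprime_mem)
  thus False using x(2) unfolding L_def by blast
qed

end

subsection \<open>The invariant measure on the upper half plane\<close>

text \<open>In the coordinates \<open>z = exp s * (t + i)\<close> the hyperbolic area \<open>dx dy / y^2\<close> becomes \<open>dt ds\<close>,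
  and translations, dilations and the inversion all become shears or reflections.\<close>

definition hcoord :: "real \<times> real \<Rightarrow> complex" where
  "hcoord = (\<lambda>(t, s). Complex (exp s * t) (exp s))"

definition hmeasure :: "complex measure" where
  "hmeasure = distr lborel borel hcoord"

lemma hcoord_eq: "hcoord x = of_real (exp (snd x)) * (of_real (fst x) + \<i>)"
  by (cases x) (simp add: hcoord_def complex_eq_iff)

lemma hcoord_measurable [measurable]: "hcoord \<in> borel_measurable borel"
  unfolding hcoord_eq[abs_def] by (intro borel_measurable_continuous_onI continuous_intros)

lemma Im_hcoord: "Im (hcoord x) > 0"
  by (cases x) (simp add: hcoord_def)

lemma sets_hmeasure [measurable_cong, simp]: "sets hmeasure = sets borel"
  by (simp add: hmeasure_def)

lemma AE_hmeasure: "AE z in hmeasure. Im z > 0"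
  unfolding hmeasure_def by (subst AE_distr_iff) (auto simp: Im_hcoord)

text \<open>Tonelli's theorem reduces the claim to the inner integral over \<open>t\<close>, where
  for fixed \<open>s\<close> the map is a translation or a reflection of the line.\<close>

lemma distr_lborel_shear_fst:
  assumes [measurable]: "f \<in> borel_measurable borel" and u: "\<bar>u\<bar> = (1::real)"
  shows "distr lborel borel (\<lambda>(t, s). (f s + u * t, s)) = (lborel :: (real \<times> real) measure)"
proof (rule measure_eqI)
  fix A :: "(real \<times> real) set"
  assume "A \<in> sets (distr lborel borel (\<lambda>(t, s). (f s + u * t, s)))"
  hence [measurable]: "A \<in> sets borel" by simp
  have [measurable]: "(\<lambda>(t, s). (f s + u * t, s)) \<in> borel_measurable (borel :: (real \<times> real) measure)"
    unfolding borel_prod[symmetric] by measurable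
  have i: "(\<integral>\<^sup>+x. g x \<partial>(lborel :: (real \<times> real) measure)) = (\<integral>\<^sup>+s. \<integral>\<^sup>+t. g (t, s) \<partial>lborel \<partial>lborel)"
    if g: "g \<in> borel_measurable borel" for g :: "real \<times> real \<Rightarrow> ennreal"
    unfolding lborel_prod[symmetric] by (rule lborel_pair.nn_integral_snd[symmetric]) (use g in \<open>simp add: lborel_prod\<close>)
  have [measurable]: "(\<lambda>t. (t, s)) \<in> borel_measurable (borel :: real measure)" for s :: real
    by (intro borel_measurable_continuous_onI continuous_intros)
  have "emeasure (distr lborel borel (\<lambda>(t, s). (f s + u * t, s))) A = (\<integral>\<^sup>+x. indicator A x \<partial>distr lborel borel (\<lambda>(t, s). (f s + u * t, s)))"
    by simp
  also have "\<dots> = (\<integral>\<^sup>+x. indicator A (case x of (t, s) \<Rightarrow> (f s + u * t, s)) \<partial>lborel)"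
    by (subst nn_integral_distr) auto
  also have "\<dots> = (\<integral>\<^sup>+s. \<integral>\<^sup>+t. indicator A (f s + u * t, s) \<partial>lborel \<partial>lborel)"
    by (subst i) auto
  also have "\<dots> = (\<integral>\<^sup>+s. \<integral>\<^sup>+t. indicator A (t, s) \<partial>lborel \<partial>lborel)"
  proof (rule nn_integral_cong)
    fix s :: real
    have "(\<lambda>t. indicator A (t, s) :: ennreal) \<in> borel_measurable borel" by measurable
    from nn_integral_real_affine[OF this, of u "f s"] u
    show "(\<integral>\<^sup>+t. indicator A (f s + u * t, s) \<partial>lborel) = (\<integral>\<^sup>+t. indicator A (t, s) \<partial>lborel)" by auto
  qed
  also have "\<dots> = emeasure lborel A" by (subst i[symmetric]) auto
  finally show "emeasure (distr lborel borel (\<lambda>(t, s). (f s + u * t, s))) A = emeasure lborel A" .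
qed simp

lemma distr_lborel_shear_snd:
  assumes [measurable]: "f \<in> borel_measurable borel" and u: "\<bar>u\<bar> = (1::real)"
  shows "distr lborel borel (\<lambda>(t, s). (t, f t + u * s)) = (lborel :: (real \<times> real) measure)"
proof (rule measure_eqI)
  fix A :: "(real \<times> real) set"
  assume "A \<in> sets (distr lborel borel (\<lambda>(t, s). (t, f t + u * s)))"
  hence [measurable]: "A \<in> sets borel" by simp
  have [measurable]: "(\<lambda>(t, s). (t, f t + u * s)) \<in> borel_measurable (borel :: (real \<times> real) measure)"
    unfolding borel_prod[symmetric] by measurable
  have i: "(\<integral>\<^sup>+x. g x \<partial>(lborel :: (real \<times> real) measure)) = (\<integral>\<^sup>+t. \<integral>\<^sup>+s. g (t, s) \<partial>lborel \<partial>lborel)"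
    if g: "g \<in> borel_measurable borel" for g :: "real \<times> real \<Rightarrow> ennreal"
    unfolding lborel_prod[symmetric] by (rule lborel.nn_integral_fst[symmetric]) (use g in \<open>simp add: lborel_prod\<close>)
  have [measurable]: "(\<lambda>s. (t, s)) \<in> borel_measurable (borel :: real measure)" for t :: real
    by (intro borel_measurable_continuous_onI continuous_intros)
  have "emeasure (distr lborel borel (\<lambda>(t, s). (t, f t + u * s))) A = (\<integral>\<^sup>+x. indicator A x \<partial>distr lborel borel (\<lambda>(t, s). (t, f t + u * s)))"
    by simp
  also have "\<dots> = (\<integral>\<^sup>+x. indicator A (case x of (t, s) \<Rightarrow> (t, f t + u * s)) \<partial>lborel)"
    by (subst nn_integral_distr) auto
  also have "\<dots> = (\<integral>\<^sup>+t. \<integral>\<^sup>+s. indicator A (t, f t + u * s) \<partial>lborel \<partial>lborel)"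
    by (subst i) auto
  also have "\<dots> = (\<integral>\<^sup>+t. \<integral>\<^sup>+s. indicator A (t, s) \<partial>lborel \<partial>lborel)"
  proof (rule nn_integral_cong)
    fix t :: real
    have "(\<lambda>s. indicator A (t, s) :: ennreal) \<in> borel_measurable borel" by measurable
    from nn_integral_real_affine[OF this, of u "f t"] u
    show "(\<integral>\<^sup>+s. indicator A (t, f t + u * s) \<partial>lborel) = (\<integral>\<^sup>+s. indicator A (t, s) \<partial>lborel)" by auto
  qed
  also have "\<dots> = emeasure lborel A" by (subst i[symmetric]) auto
  finally show "emeasure (distr lborel borel (\<lambda>(t, s). (t, f t + u * s))) A = emeasure lborel A" .
qed simp

lemma hmeasure_conj:
  assumes [measurable]: "\<tau> \<in> borel_measurable borel" "\<tau>' \<in> borel_measurable borel"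
    and "distr lborel borel \<tau>' = (lborel :: (real \<times> real) measure)"
    and "\<And>x. \<tau> (hcoord x) = hcoord (\<tau>' x)"
  shows "distr hmeasure borel \<tau> = hmeasure"
proof -
  have "distr hmeasure borel \<tau> = distr lborel borel (\<tau> \<circ> hcoord)"
    unfolding hmeasure_def by (rule distr_distr) simp_all
  also have "\<tau> \<circ> hcoord = hcoord \<circ> \<tau>'" using assms(4) by (simp add: fun_eq_iff)
  also have "distr lborel borel (hcoord \<circ> \<tau>') = distr (distr lborel borel \<tau>') borel hcoord"
    by (rule distr_distr[symmetric]) simp_all
  finally show ?thesis unfolding assms(3) hmeasure_def .
qed

lemma hmeasure_translation: "distr hmeasure borel (\<lambda>z. z + of_real b) = hmeasure"
proof (rule hmeasure_conj)
  let ?t = "\<lambda>(t, s). (b * exp (- s) + 1 * t, s) :: real \<times> real"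
  show "distr lborel borel ?t = lborel" by (rule distr_lborel_shear_fst) simp_all
  show "?t \<in> borel_measurable borel" unfolding borel_prod[symmetric] by measurable
  fix x :: "real \<times> real" show "hcoord x + of_real b = hcoord (?t x)"
    by (cases x) (simp add: hcoord_def complex_eq_iff distrib_left exp_minus field_simps)
qed simp

lemma hmeasure_dilation: "r > 0 \<Longrightarrow> distr hmeasure borel (\<lambda>z. of_real r * z) = hmeasure"
proof (rule hmeasure_conj)
  assume r: "r > 0"
  let ?t = "\<lambda>(t, s). (t, ln r + 1 * s) :: real \<times> real"
  show "distr lborel borel ?t = lborel" by (rule distr_lborel_shear_snd) simp_all
  show "?t \<in> borel_measurable borel" unfolding borel_prod[symmetric] by measurable
  fix x :: "real \<times> real" show "of_real r * hcoord x = hcoord (?t x)"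
    using r by (cases x) (simp add: hcoord_def complex_eq_iff exp_add)
qed simp

lemma hmeasure_inversion: "distr hmeasure borel (\<lambda>z. - 1 / z) = hmeasure"
proof (rule hmeasure_conj)
  \<comment> \<open>Since \<open>- 1 / z\<close> equals
    \<open>exp (- s) / (1 + t^2) * (- t + \<i>)\<close>, the inversion negates \<open>t\<close> and
    sends \<open>s\<close> to \<open>- s\<close> minus a function of \<open>t\<close>;
    \<open>?t1\<close> and \<open>?t2\<close> carry out these two changes separately.\<close>
  let ?t = "\<lambda>(t, s). (- t, - ln (1 + t\<^sup>2) - s) :: real \<times> real"
  let ?t1 = "\<lambda>(t, s). (t, - ln (1 + t\<^sup>2) + (-1) * s) :: real \<times> real"
  let ?t2 = "\<lambda>(t, s). (0 + (-1) * t, s) :: real \<times> real"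
  have m: "?t1 \<in> borel_measurable borel" "?t2 \<in> borel_measurable borel"
    unfolding borel_prod[symmetric] by measurable
  have "distr lborel borel ?t = distr lborel borel (?t2 \<circ> ?t1)"
    by (rule arg_cong[where f = "distr lborel borel"]) (simp add: fun_eq_iff)
  also have "\<dots> = distr (distr lborel borel ?t1) borel ?t2"
    by (rule distr_distr[symmetric]) (use m in simp_all)
  also have "distr lborel borel ?t1 = lborel" by (rule distr_lborel_shear_snd) simp_all
  also have "distr lborel borel ?t2 = lborel" by (rule distr_lborel_shear_fst) simp_all
  finally show "distr lborel borel ?t = lborel" .
  show "?t \<in> borel_measurable borel" unfolding borel_prod[symmetric] by measurable
  fix x :: "real \<times> real" show "- 1 / hcoord x = hcoord (?t x)"
  proof (cases x)
    case (Pair t s)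
    have "1 + t\<^sup>2 > 0" by (simp add: add_pos_nonneg)
    hence e: "exp (- ln (1 + t\<^sup>2) - s) = exp (- s) / (1 + t\<^sup>2)" by (simp add: exp_diff exp_minus field_simps)
    have "hcoord x * hcoord (?t x) = of_real (exp s * exp (- s)) * ((of_real t + \<i>) * (\<i> - of_real t)) / of_real (1 + t\<^sup>2)"
      unfolding hcoord_eq by (simp add: Pair e)
    also have "(of_real t + \<i>) * (\<i> - of_real t) = - of_real (1 + t\<^sup>2)" by (simp add: algebra_simps power2_eq_square)
    also have "exp s * exp (- s) = 1" by (simp flip: exp_add)
    finally have "hcoord x * hcoord (?t x) = - (of_real (1 + t\<^sup>2) / of_real (1 + t\<^sup>2))"
      by (simp only: of_real_1 mult_1_left minus_divide_left)
    also have "of_real (1 + t\<^sup>2) / of_real (1 + t\<^sup>2) = (1 :: complex)"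
      using \<open>1 + t\<^sup>2 > 0\<close> by (metis divide_self less_irrefl of_real_eq_0_iff)
    finally have "hcoord x * hcoord (?t x) = - 1" .
    moreover have hne: "hcoord x \<noteq> 0" using Im_hcoord[of x] by auto
    ultimately show ?thesis unfolding nonzero_divide_eq_eq[OF hne] by (simp only: mult.commute)
  qed
qed simp

lemma mob_measurable [measurable]: "mob M \<in> borel_measurable borel"
  by (cases M) (simp add: mob.simps[abs_def])

lemma distr_comp_hmeasure:
  assumes [measurable]: "f \<in> borel_measurable borel" "g \<in> borel_measurable borel"
    and "distr hmeasure borel f = hmeasure" "distr hmeasure borel g = hmeasure"
  shows "distr hmeasure borel (\<lambda>z. f (g z)) = hmeasure"
proof -
  have "distr hmeasure borel (f \<circ> g) = distr (distr hmeasure borel g) borel f"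
    by (rule distr_distr[symmetric]) simp_all
  thus ?thesis using assms by (simp add: o_def)
qed

text \<open>For \<open>c \<noteq> 0\<close> the Bruhat decomposition
  \<open>M z = a / c - (det M / c^2) / (z + d / c)\<close> factors the map into a translation, the
  inversion and an affine map.\<close>

lemma hmeasure_mob:
  assumes "mdet M > 0"
  shows "distr hmeasure borel (mob M) = hmeasure"
proof -
  obtain a b c d where M: "M = (a, b, c, d)" by (cases M)
  have aff: "distr hmeasure borel (\<lambda>z. of_real r * z + of_real s) = hmeasure" if "r > 0" for r s
    by (rule distr_comp_hmeasure[OF _ _ hmeasure_translation[of s] hmeasure_dilation[OF that]]) simp_all
  show ?thesis
  proof (cases "c = 0")
    case True
    hence ad: "a * d > 0" using assms M by simp
    hence "real_of_int a / real_of_int d > 0" by (auto simp: zero_less_mult_iff zero_less_divide_iff)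
    moreover have "mob M = (\<lambda>z. of_real (real_of_int a / real_of_int d) * z + of_real (real_of_int b / real_of_int d))"
      using True by (simp add: M fun_eq_iff add_divide_distrib)
    ultimately show ?thesis by (simp only: aff)
  next
    case False
    define r where "r = real_of_int (mdet M) / (real_of_int c)\<^sup>2"
    have r: "r > 0" using False assms by (simp add: r_def)
    let ?f = "\<lambda>z. of_real r * (- 1 / (z + of_real (real_of_int d / real_of_int c))) + of_real (real_of_int a / real_of_int c)"
    have "distr hmeasure borel (\<lambda>z. - 1 / (z + of_real (real_of_int d / real_of_int c))) = hmeasure"
      by (rule distr_comp_hmeasure[OF _ _ hmeasure_inversion hmeasure_translation]) simp_all
    hence "distr hmeasure borel ?f = hmeasure"
      by (intro distr_comp_hmeasure[OF _ _ aff[OF r]]) simp_all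
    \<comment> \<open>The factorization is checked on the half plane, which carries the whole
      measure.\<close>
    moreover have "distr hmeasure borel (mob M) = distr hmeasure borel ?f"
    proof (rule distr_cong_AE)
      have eqz: "mob M z = ?f z" if z: "Im z > 0" for z
      proof -
        have nz: "of_int c * z + of_int d \<noteq> 0" using aut_nonzero[OF assms z] by (simp add: M)
        have c: "complex_of_int c \<noteq> 0" using False by simp
        have e1: "z + of_real (real_of_int d / real_of_int c) = (of_int c * z + of_int d) / of_int c"
          using c by (simp add: field_simps)
        have "?f z = (of_int a * (of_int c * z + of_int d) - of_int (mdet M)) / (of_int c * (of_int c * z + of_int d))"
          unfolding e1 using c nz by (simp add: r_def power2_eq_square divide_simps)
        also have "of_int a * (of_int c * z + of_int d) - of_int (mdet M) = of_int c * (of_int a * z + of_int b)"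
          by (simp add: M algebra_simps)
        finally show ?thesis using c by (simp add: M)
      qed
      show "AE z in hmeasure. mob M z = ?f z" using AE_hmeasure by eventually_elim (rule eqz)
    qed simp_all
    ultimately show ?thesis by simp
  qed
qed

lemma integral_hcoord_mob:
  fixes F :: "complex \<Rightarrow> complex"
  assumes M: "mdet M > 0" and [measurable]: "F \<in> borel_measurable borel"
  shows "(\<integral>x. F (mob M (hcoord x)) \<partial>lborel) = (\<integral>x. F (hcoord x) \<partial>lborel)"
proof -
  have "(\<integral>x. F (mob M (hcoord x)) \<partial>lborel) = (\<integral>z. F (mob M z) \<partial>hmeasure)"
    unfolding hmeasure_def by (subst integral_distr) simp_all
  also have "\<dots> = (\<integral>z. F z \<partial>distr hmeasure borel (mob M))"
    by (subst integral_distr) simp_all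
  also have "\<dots> = (\<integral>z. F z \<partial>hmeasure)" by (simp only: hmeasure_mob[OF M])
  also have "\<dots> = (\<integral>x. F (hcoord x) \<partial>lborel)"
    unfolding hmeasure_def by (subst integral_distr) simp_all
  finally show ?thesis .
qed

section \<open>The Siegel set and its area\<close>

definition siegel :: "complex set" where
  "siegel = {z. Im z \<ge> 1 / 5 \<and> \<bar>Re z\<bar> \<le> 1 / 2}"

lemma siegel_measurable [measurable]: "siegel \<in> sets borel"
  unfolding siegel_def by measurable

text \<open>In the coordinates the slice at \<open>s\<close> lies in an interval of length
  \<open>exp (- s)\<close>, and \<open>s\<close> is bounded below by \<open>- ln 5\<close>.\<close>

lemma emeasure_siegel: "emeasure lborel {x. hcoord x \<in> siegel} < \<infinity>"
proof -
  have [measurable]: "{x. hcoord x \<in> siegel} \<in> sets borel"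
    using measurable_sets[OF hcoord_measurable siegel_measurable] by (simp add: vimage_def)
  have "emeasure lborel {x. hcoord x \<in> siegel} = (\<integral>\<^sup>+x. indicator {x. hcoord x \<in> siegel} x \<partial>lborel)"
    by simp
  also have "\<dots> = (\<integral>\<^sup>+s. \<integral>\<^sup>+t. indicator {x. hcoord x \<in> siegel} (t, s) \<partial>lborel \<partial>lborel)"
    unfolding lborel_prod[symmetric] by (rule lborel_pair.nn_integral_snd[symmetric]) (simp add: lborel_prod)
  also have "\<dots> \<le> (\<integral>\<^sup>+s. ennreal (exp (- s)) * indicator {- ln 5..} s \<partial>lborel)"
  proof (intro nn_integral_mono)
    fix s :: real
    show "(\<integral>\<^sup>+t. indicator {x. hcoord x \<in> siegel} (t, s) \<partial>lborel) \<le> ennreal (exp (- s)) * indicator {- ln 5..} s"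
    proof (cases "s \<ge> - ln 5")
      case True
      have "(\<integral>\<^sup>+t. indicator {x. hcoord x \<in> siegel} (t, s) \<partial>lborel) \<le> (\<integral>\<^sup>+t. indicator {- exp (- s) / 2..exp (- s) / 2} t \<partial>lborel)"
      proof (intro nn_integral_mono)
        fix t :: real
        have "- exp (- s) / 2 \<le> t \<and> t \<le> exp (- s) / 2" if "hcoord (t, s) \<in> siegel"
        proof -
          have "\<bar>exp s * t\<bar> \<le> 1 / 2" using that by (simp add: siegel_def hcoord_def)
          hence "\<bar>t\<bar> \<le> exp (- s) / 2" by (simp add: abs_mult exp_minus field_simps)
          thus ?thesis by auto
        qed
        thus "indicator {x. hcoord x \<in> siegel} (t, s) \<le> (indicator {- exp (- s) / 2..exp (- s) / 2} t :: ennreal)"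
          by (auto simp: indicator_def)
      qed
      also have "\<dots> = ennreal (exp (- s))" by simp
      finally show ?thesis using True by simp
    next
      case False
      have "hcoord (t, s) \<notin> siegel" for t
      proof
        assume "hcoord (t, s) \<in> siegel"
        hence "1 / 5 \<le> exp s" by (simp add: siegel_def hcoord_def)
        hence "ln (1 / 5) \<le> ln (exp s)" by (subst ln_le_cancel_iff) simp_all
        thus False using False by (simp add: ln_div)
      qed
      thus ?thesis by simp
    qed
  qed
  also have "\<dots> = ennreal (0 - - exp (- (- ln 5)))"
  proof (rule nn_integral_FTC_atLeast)
    show "DERIV (\<lambda>s. - exp (- s)) s :> exp (- s)" for s :: real by (auto intro!: derivative_eq_intros)
    have "((\<lambda>s::real. exp (- s)) \<longlongrightarrow> 0) at_top"
      by (rule filterlim_compose[OF exp_at_bot filterlim_uminus_at_bot_at_top])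
    thus "((\<lambda>s::real. - exp (- s)) \<longlongrightarrow> 0) at_top" using tendsto_minus by fastforce
  qed simp_all
  also have "\<dots> < \<infinity>" by simp
  finally show ?thesis .
qed

subsection \<open>Hecke eigenvalues are real\<close>

lemma mmul_one [simp]: "mmul M (1, 0, 0, 1) = M" "mmul (1, 0, 0, 1) M = M"
  by (cases M; simp)+

lemma mmul_self_madj: "mdet M = 1 \<Longrightarrow> mmul M (madj M) = (1, 0, 0, 1)" "mdet M = 1 \<Longrightarrow> mmul (madj M) M = (1, 0, 0, 1)"
  using mmul_madj_self[of M] mmul_madj_self[of "madj M"] by simp_all

lemma mmul_madj_right:
  assumes "mdet g = 1"
  shows "mmul (mmul M g) (madj g) = M" "mmul (mmul M (madj g)) g = M"
  using mmul_self_madj[OF assms] by (simp_all add: mmul_assoc)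

lemma finite_lattice_ball:
  assumes "Im z > 0"
  shows "finite {(c, d). norm (of_int (c :: int) * z + of_int (d :: int)) \<le> A}"
proof (rule finite_subset)
  let ?K = "\<lceil>A / Im z\<rceil>" and ?L = "\<lceil>A + A / Im z * norm z\<rceil>"
  show "finite ({- ?K..?K} \<times> {- ?L..?L})" by simp
  show "{(c, d). norm (of_int (c :: int) * z + of_int (d :: int)) \<le> A} \<subseteq> {- ?K..?K} \<times> {- ?L..?L}"
  proof clarify
    fix c d :: int assume n: "norm (of_int c * z + of_int d) \<le> A"
    have "\<bar>of_int c * Im z\<bar> \<le> A" using abs_Im_le_cmod[of "of_int c * z + of_int d"] n by simp
    hence c: "\<bar>real_of_int c\<bar> \<le> A / Im z" using assms by (simp add: abs_mult pos_le_divide_eq)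
    have "norm (of_int d :: complex) \<le> norm (of_int c * z + of_int d) + norm (of_int c * z)"
      by (metis add_diff_cancel_left' norm_triangle_ineq4)
    also have "\<dots> \<le> A + A / Im z * norm z" using n mult_right_mono[OF c norm_ge_zero[of z]] by (simp add: norm_mult)
    finally have d: "\<bar>real_of_int d\<bar> \<le> A + A / Im z * norm z" by simp
    show "c \<in> {- ?K..?K} \<and> d \<in> {- ?L..?L}" using c d by (auto simp: abs_le_iff le_ceiling_iff ceiling_le_iff) linarith+
  qed
qed

text \<open>The lower bound for \<open>Im (mob M z)\<close> bounds the second row of
  \<open>M\<close> by \<open>A\<close>. Since \<open>|a z + b| = |M z| |c z + d|\<close> and
  \<open>m\<close> is a lower bound for \<open>|c z + d|\<close>, the first row is bounded by
  \<open>B\<close>.\<close>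

lemma finite_siegel_orbit:
  assumes z: "Im z > 0" and n: "n > 0"
  shows "finite {M. mdet M = n \<and> mob M z \<in> siegel}"
proof (rule finite_subset)
  define m where "m = min (Im z) 1"
  define A where "A = sqrt (5 * n * Im z)"
  define B where "B = A / 2 + n * Im z / m"
  let ?S = "\<lambda>A. {(c, d). norm (of_int (c :: int) * z + of_int (d :: int)) \<le> A}"
  let ?f = "\<lambda>((a :: int, b :: int), (c :: int, d :: int)). (a, b, c, d)"
  show "finite (?f ` (?S B \<times> ?S A))" by (intro finite_imageI finite_cartesian_product finite_lattice_ball z)
  have m: "m > 0" using z by (simp add: m_def)
  show "{M. mdet M = n \<and> mob M z \<in> siegel} \<subseteq> ?f ` (?S B \<times> ?S A)"
  proof
    fix M0 assume M0: "M0 \<in> {M. mdet M = n \<and> mob M z \<in> siegel}"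
    obtain a b c d where abcd: "M0 = (a, b, c, d)" by (cases M0)
    have M: "mdet (a, b, c, d) = n" "mob (a, b, c, d) z \<in> siegel" using M0 unfolding abcd by blast+
    let ?M = "(a, b, c, d)"
    let ?u = "of_int c * z + of_int d"
    have nz: "?u \<noteq> 0" using aut_nonzero[of ?M z] M n z by simp
    have im: "Im (mob ?M z) = n * Im z / (norm ?u)\<^sup>2"
      by (rule Im_mob[of ?M z, unfolded M(1) aut.simps, OF n z])
    have "1 / 5 \<le> n * Im z / (norm ?u)\<^sup>2" using M(2) unfolding im[symmetric] by (simp add: siegel_def)
    hence "(norm ?u)\<^sup>2 \<le> 5 * n * Im z" using nz by (simp add: field_simps)
    hence uA: "norm ?u \<le> A" unfolding A_def by (rule real_le_rsqrt)
    have um: "m \<le> norm ?u"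
    proof (cases "c = 0")
      case True
      hence "d \<noteq> 0" using nz by auto
      hence "1 \<le> \<bar>real_of_int d\<bar>" by linarith
      thus ?thesis using True by (simp add: m_def)
    next
      case False
      hence "1 \<le> \<bar>real_of_int c\<bar>" by linarith
      hence "1 * Im z \<le> \<bar>real_of_int c\<bar> * Im z" using z by (intro mult_right_mono) auto
      also have "\<dots> = \<bar>Im ?u\<bar>" using z by (simp add: abs_mult)
      also have "\<dots> \<le> norm ?u" by (rule abs_Im_le_cmod)
      finally show ?thesis by (simp add: m_def)
    qed
    have "norm (mob ?M z) \<le> \<bar>Re (mob ?M z)\<bar> + \<bar>Im (mob ?M z)\<bar>" by (rule cmod_le)
    also have "\<dots> \<le> 1 / 2 + n * Im z / (norm ?u)\<^sup>2"
      using M(2) n z unfolding im by (intro add_mono) (auto simp: siegel_def)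
    finally have "norm (mob ?M z) * norm ?u \<le> (1 / 2 + n * Im z / (norm ?u)\<^sup>2) * norm ?u"
      by (intro mult_right_mono) auto
    also have "\<dots> = norm ?u / 2 + n * Im z / norm ?u"
      using nz by (simp add: distrib_right power2_eq_square)
    also have "\<dots> \<le> B" unfolding B_def using uA um m n z mult_pos_pos[of "norm ?u" m] nz by (intro add_mono divide_left_mono) auto
    also have "norm (mob ?M z) * norm ?u = norm (of_int a * z + of_int b)" using nz by (simp add: norm_divide)
    finally have "((a, b), (c, d)) \<in> ?S B \<times> ?S A" using uA by simp
    thus "M0 \<in> ?f ` (?S B \<times> ?S A)" by (rule rev_image_eqI) (simp add: abcd)
  qed
qed

text \<open>The number of matrices of determinant 1 that carry \<open>z\<close> into the Siegel set,
  written as an integral against counting measure so that it is measurable in \<open>z\<close> as a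
  parameter integral.\<close>

definition orbit_count :: "complex \<Rightarrow> real" where
  "orbit_count z = enn2real (\<integral>\<^sup>+M. indicator siegel (mob M z) \<partial>count_space {M. mdet M = 1})"

lemma orbit_count_eq:
  assumes "Im z > 0"
  shows "orbit_count z = real (card {M. mdet M = 1 \<and> mob M z \<in> siegel})"
proof -
  let ?F = "{M. mdet M = 1 \<and> mob M z \<in> siegel}"
  have fin: "finite ?F" by (rule finite_siegel_orbit[OF assms]) simp
  have "(\<integral>\<^sup>+M. indicator siegel (mob M z) \<partial>count_space {M. mdet M = 1}) = (\<integral>\<^sup>+M. indicator ?F M \<partial>count_space {M. mdet M = 1})"
    by (intro nn_integral_cong) (auto simp: indicator_def)
  also have "\<dots> = emeasure (count_space {M. mdet M = 1}) ?F" by (rule nn_integral_indicator) auto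
  also have "\<dots> = of_nat (card ?F)" using fin by (subst emeasure_count_space_finite) auto
  finally show ?thesis by (simp add: orbit_count_def)
qed

lemma orbit_count_pos: "Im z > 0 \<Longrightarrow> orbit_count z \<ge> 1"
proof -
  assume z: "Im z > 0"
  obtain M where "mdet M = 1" "Im (mob M z) \<ge> 1 / 5" "\<bar>Re (mob M z)\<bar> \<le> 1 / 2" using reduce_to_siegel_set[OF z] by blast
  hence "M \<in> {M. mdet M = 1 \<and> mob M z \<in> siegel}" by (simp add: siegel_def)
  hence "{M. mdet M = 1 \<and> mob M z \<in> siegel} \<noteq> {}" by blast
  hence "card {M. mdet M = 1 \<and> mob M z \<in> siegel} > 0" using finite_siegel_orbit[OF z, of 1] by (simp add: card_gt_0_iff)
  thus ?thesis unfolding orbit_count_eq[OF z] by linarith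
qed

lemma orbit_count_mob:
  assumes g: "mdet g = 1" and z: "Im z > 0"
  shows "orbit_count (mob g z) = orbit_count z"
proof -
  have gz: "Im (mob g z) > 0" using Im_mob_pos[of g z] g z by simp
  have gz': "mob (mmul M g) z = mob M (mob g z)" for M by (rule mob_mmul) (use g z in auto)
  have gi: "mob (mmul M (madj g)) (mob g z) = mob M z" for M
    using mob_mmul[of "madj g" "mob g z" M] mob_madj_mob[of g z] g gz z by simp
  have "bij_betw (\<lambda>M. mmul M g) {M. mdet M = 1 \<and> mob M (mob g z) \<in> siegel} {M. mdet M = 1 \<and> mob M z \<in> siegel}"
    by (rule bij_betw_byWitness[where f' = "\<lambda>M. mmul M (madj g)"]) (auto simp: mmul_madj_right[OF g] gz' gi g)
  from bij_betw_same_card[OF this] show ?thesis by (simp add: orbit_count_eq gz z)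
qed

lemma orbit_count_measurable [measurable]: "orbit_count \<in> borel_measurable borel"
proof -
  interpret C: sigma_finite_measure "count_space {M. mdet M = 1}"
    by (rule sigma_finite_measure_count_space_countable) simp
  have "(\<lambda>(M, z). indicator siegel (mob M z) :: ennreal) \<in> borel_measurable (count_space {M. mdet M = 1} \<Otimes>\<^sub>M borel)"
    by (rule measurable_pair_measure_countable1) simp_all
  from measurable_pair_swap[OF this]
  have "(\<lambda>(z, M). indicator siegel (mob M z) :: ennreal) \<in> borel_measurable (borel \<Otimes>\<^sub>M count_space {M. mdet M = 1})"
    by (simp add: case_prod_beta')
  thus ?thesis unfolding orbit_count_def[abs_def] by measurable
qed

text \<open>Weights that sum to 1 over the modular group along each orbit. They let the Siegel set
  act as a fundamental domain although it meets orbits several times.\<close>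

definition psi :: "complex \<Rightarrow> real" where
  "psi z = indicator siegel z / orbit_count z"

lemma psi_measurable [measurable]: "psi \<in> borel_measurable borel"
  unfolding psi_def[abs_def] by measurable

lemma psi_bounds: "Im z > 0 \<Longrightarrow> 0 \<le> psi z \<and> psi z \<le> indicator siegel z"
  using orbit_count_pos[of z] by (auto simp: psi_def indicator_def)

section \<open>Matrices of determinant \<open>p\<close> modulo the modular group\<close>

definition hecke_reps :: "nat \<Rightarrow> mat2 set" where
  "hecke_reps p = insert (int p, 0, 0, 1) ((\<lambda>b. (1, int b, 0, int p)) ` {..<p})"

lemma mdet_hecke_reps: "r \<in> hecke_reps p \<Longrightarrow> mdet r = int p"
  by (auto simp: hecke_reps_def)

text \<open>The first column of \<open>M\<close> decides: it is divisible by \<open>p\<close>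
  exactly for the representative \<open>(p, 0, 0, 1)\<close>. Otherwise a linear congruence
  determines \<open>b\<close> modulo \<open>p\<close>, and dividing out the representative leaves
  determinant 1.\<close>

lemma hecke_reps_bij:
  assumes p: "prime p"
  shows "bij_betw (\<lambda>(g, r). mmul g r) ({g. mdet g = 1} \<times> hecke_reps p) {M. mdet M = int p}"
proof -
  have p0: "int p > 0" using p prime_gt_0_nat by simp
  have pp: "prime (int p)" using p by simp
  have red: "mmul g r \<noteq> mmul g' r'"
    if "mdet g = 1" "r = (int p, 0, 0, 1)" "r' = (1, int b, 0, int p)" "mdet g' = 1" for g g' r r' b
  proof
    obtain x y u v x' y' u' v' where g: "g = (x, y, u, v)" "g' = (x', y', u', v')" by (cases g; cases g')
    assume "mmul g r = mmul g' r'"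
    hence "x' = x * int p" "u' = u * int p" using that g by auto
    hence "int p dvd mdet g'" by (auto simp: g)
    thus False using that p by (metis int_dvd_int_iff of_nat_1 not_prime_unit)
  qed
  have beq: "b = b'" if "mdet g = 1" "mdet g' = 1" "b < p" "b' < p" "mmul g (1, int b, 0, int p) = mmul g' (1, int b', 0, int p)" for g g' b b'
  proof -
    obtain x y u v x' y' u' v' where g: "g = (x, y, u, v)" "g' = (x', y', u', v')" by (cases g; cases g')
    have e: "x' = x" "u' = u" "x * int b + y * int p = x * int b' + y' * int p" "u * int b + v * int p = u * int b' + v' * int p"
      using that(5) by (auto simp: g)
    have "x * (int b - int b') = int p * (y' - y)" "u * (int b - int b') = int p * (v' - v)"
      using e by (simp_all add: algebra_simps)
    hence d: "int p dvd x * (int b - int b')" "int p dvd u * (int b - int b')" by simp_all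
    have "int b - int b' = (x * v - y * u) * (int b - int b')" using that(1) by (simp add: g)
    also have "\<dots> = v * (x * (int b - int b')) - y * (u * (int b - int b'))" by (simp add: algebra_simps)
    finally have "int p dvd int b - int b'" using d by (metis dvd_diff dvd_mult)
    moreover have "\<bar>int b - int b'\<bar> < int p" using that(3,4) by auto
    ultimately show ?thesis using dvd_imp_le_int[of "int b - int b'" "int p"] by (cases "int b - int b' = 0") auto
  qed
  have cancel: "g = g'" if "mmul g r = mmul g' r" "r \<in> hecke_reps p" for g g' r
  proof -
    obtain x y u v x' y' u' v' where g: "g = (x, y, u, v)" "g' = (x', y', u', v')" by (cases g; cases g')
    from that(2) show ?thesis using that(1) p0 by (auto simp: hecke_reps_def g)
  qed
  show ?thesis
  proof (rule bij_betwI')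
    fix s t assume "s \<in> {g. mdet g = 1} \<times> hecke_reps p" "t \<in> {g. mdet g = 1} \<times> hecke_reps p"
    then obtain g r g' r' where st: "s = (g, r)" "t = (g', r')" "mdet g = 1" "mdet g' = 1" "r \<in> hecke_reps p" "r' \<in> hecke_reps p"
      by auto
    have "r = r'" if eq: "mmul g r = mmul g' r'"
    proof (cases "r = (int p, 0, 0, 1)")
      case True
      thus ?thesis using st eq red[of g r r' _ g'] by (auto simp: hecke_reps_def)
    next
      case False
      then obtain b where b: "r = (1, int b, 0, int p)" "b < p" using st(5) by (auto simp: hecke_reps_def)
      show ?thesis
      proof (cases "r' = (int p, 0, 0, 1)")
        case True
        thus ?thesis using red[of g' r' r b g] st eq b by auto
      next
        case False
        then obtain b' where "r' = (1, int b', 0, int p)" "b' < p" using st(6) by (auto simp: hecke_reps_def)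
        thus ?thesis using beq[of g g' b b'] st eq b by auto
      qed
    qed
    thus "((case s of (g, r) \<Rightarrow> mmul g r) = (case t of (g, r) \<Rightarrow> mmul g r)) = (s = t)"
      using cancel[of g r g'] st(5) unfolding st(1,2) prod.case prod.inject by blast
  next
    fix s assume "s \<in> {g. mdet g = 1} \<times> hecke_reps p"
    moreover obtain g r where "s = (g, r)" by (cases s)
    ultimately show "(case s of (g, r) \<Rightarrow> mmul g r) \<in> {M. mdet M = int p}"
      using mdet_hecke_reps[of r p] by simp
  next
    fix M assume "M \<in> {M. mdet M = int p}"
    moreover obtain a b c d where M: "M = (a, b, c, d)" by (cases M)
    ultimately have det: "a * d - b * c = int p" by simp
    show "\<exists>s\<in>{g. mdet g = 1} \<times> hecke_reps p. M = (case s of (g, r) \<Rightarrow> mmul g r)"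
    proof (cases "int p dvd a \<and> int p dvd c")
      case True
      then obtain x u where xu: "a = int p * x" "c = int p * u" by blast
      have "int p * (x * d - b * u) = int p * 1" using det xu by (simp add: algebra_simps)
      hence "x * d - b * u = 1" using p0 by (simp only: mult_cancel_left) simp
      thus ?thesis using xu M
        by (intro bexI[of _ "((x, b, u, d), (int p, 0, 0, 1))"]) (auto simp: hecke_reps_def)
    next
      case False
      have "\<exists>b0. int p dvd b - a * b0 \<and> int p dvd d - c * b0"
      proof (cases "int p dvd a")
        case a: False
        hence "coprime a (int p)" using pp prime_imp_coprime coprime_commute by blast
        then obtain e where e: "[a * e = 1] (mod int p)" using cong_solve_coprime_int by blast
        hence "[a * e * b = 1 * b] (mod int p)" by (rule cong_scalar_right)
        hence b: "int p dvd b - a * (e * b)" by (simp add: cong_iff_dvd_diff dvd_diff_commute mult.assoc)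
        have "a * (d - c * (e * b)) = int p + c * (b - a * (e * b))" using det by (simp add: algebra_simps)
        hence "int p dvd a * (d - c * (e * b))" using b by simp
        hence "int p dvd d - c * (e * b)" using a pp by (simp add: prime_dvd_mult_iff)
        thus ?thesis using b by blast
      next
        case True
        hence c: "\<not> int p dvd c" using False by simp
        hence "coprime c (int p)" using pp prime_imp_coprime coprime_commute by blast
        then obtain e where e: "[c * e = 1] (mod int p)" using cong_solve_coprime_int by blast
        hence "[c * e * d = 1 * d] (mod int p)" by (rule cong_scalar_right)
        hence d: "int p dvd d - c * (e * d)" by (simp add: cong_iff_dvd_diff dvd_diff_commute mult.assoc)
        have "c * (b - a * (e * d)) = a * (d - c * (e * d)) - int p" using det by (simp add: algebra_simps)
        hence "int p dvd c * (b - a * (e * d))" using d by simp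
        hence "int p dvd b - a * (e * d)" using c pp by (simp add: prime_dvd_mult_iff)
        thus ?thesis using d by blast
      qed
      then obtain b0 where b0: "int p dvd b - a * b0" "int p dvd d - c * b0" by blast
      define b1 where "b1 = nat (b0 mod int p)"
      have b1: "int b1 = b0 mod int p" "b1 < p" using p0 by (auto simp: b1_def nat_less_iff)
      have b0': "b0 = int b1 + int p * (b0 div int p)" unfolding b1 by simp
      have e: "b - a * int b1 = (b - a * b0) + int p * (a * (b0 div int p))" "d - c * int b1 = (d - c * b0) + int p * (c * (b0 div int p))"
        by (subst b0', simp add: algebra_simps)+
      have "int p dvd b - a * int b1" "int p dvd d - c * int b1"
        unfolding e by (intro dvd_add b0 dvd_triv_left)+
      then obtain y v where yv: "b - a * int b1 = int p * y" "d - c * int b1 = int p * v" by blast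
      have bd: "b = a * int b1 + int p * y" "d = c * int b1 + int p * v" using yv by simp_all
      have "int p * (a * v - y * c) = int p * 1" using det unfolding bd by (simp add: algebra_simps)
      hence "a * v - y * c = 1" using p0 by (simp only: mult_cancel_left) simp
      thus ?thesis using M bd b1(2)
        by (intro bexI[of _ "((a, y, c, v), (1, int b1, 0, int p))"]) (auto simp: hecke_reps_def mult.commute)
    qed
  qed
qed

text \<open>Each matrix is uniquely \<open>\<gamma> r\<close> with a representative
  \<open>r\<close>. For fixed \<open>r\<close> the weights \<open>psi\<close> sum to 1 over
  \<open>\<gamma>\<close>, and \<open>g\<close> does not depend on \<open>\<gamma>\<close>.\<close>

lemma psi_sum:
  fixes g :: "mat2 \<Rightarrow> complex"
  assumes p: "prime p" and z: "Im z > 0" and g: "\<And>\<gamma> r. mdet \<gamma> = 1 \<Longrightarrow> mdet r = int p \<Longrightarrow> g (mmul \<gamma> r) = g r"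
  shows "(\<Sum>M | mdet M = int p \<and> mob M z \<in> siegel. of_real (psi (mob M z)) * g M) = (\<Sum>r\<in>hecke_reps p. g r)"
proof -
  have p0: "int p > 0" using p prime_gt_0_nat by simp
  let ?A = "\<lambda>r. {\<gamma>. mdet \<gamma> = 1 \<and> mob \<gamma> (mob r z) \<in> siegel}"
  have mr: "mob (mmul \<gamma> r) z = mob \<gamma> (mob r z)" if "mdet r = int p" for \<gamma> r
    by (rule mob_mmul) (use that p0 z in auto)
  have iz: "Im (mob r z) > 0" if "mdet r = int p" for r using Im_mob_pos[of r z] that p0 z by simp
  have "bij_betw (\<lambda>(r, \<gamma>). mmul \<gamma> r) (Sigma (hecke_reps p) ?A) {M. mdet M = int p \<and> mob M z \<in> siegel}"
  proof -
    have "bij_betw prod.swap (Sigma (hecke_reps p) ?A) (prod.swap ` Sigma (hecke_reps p) ?A)"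
      by (intro bij_betw_imageI) auto
    moreover have "bij_betw (\<lambda>(g, r). mmul g r) (prod.swap ` Sigma (hecke_reps p) ?A) {M. mdet M = int p \<and> mob M z \<in> siegel}"
    proof (rule bij_betw_subset[OF hecke_reps_bij[OF p]])
      show "prod.swap ` Sigma (hecke_reps p) ?A \<subseteq> {g. mdet g = 1} \<times> hecke_reps p" by auto
      show "(\<lambda>(g, r). mmul g r) ` prod.swap ` Sigma (hecke_reps p) ?A = {M. mdet M = int p \<and> mob M z \<in> siegel}"
      proof (intro equalityI subsetI)
        fix M assume M: "M \<in> {M. mdet M = int p \<and> mob M z \<in> siegel}"
        hence "M \<in> (\<lambda>(g, r). mmul g r) ` ({g. mdet g = 1} \<times> hecke_reps p)"
          using bij_betw_imp_surj_on[OF hecke_reps_bij[OF p]] by blast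
        then obtain s where s: "s \<in> {g. mdet g = 1} \<times> hecke_reps p" "M = (\<lambda>(g, r). mmul g r) s" by blast
        obtain \<gamma> r where gr: "s = (\<gamma>, r)" by (cases s)
        have "(r, \<gamma>) \<in> Sigma (hecke_reps p) ?A" using s M mr[of r \<gamma>] mdet_hecke_reps[of r p] by (simp add: gr)
        hence "(\<gamma>, r) \<in> prod.swap ` Sigma (hecke_reps p) ?A" by (rule rev_image_eqI) simp
        thus "M \<in> (\<lambda>(g, r). mmul g r) ` prod.swap ` Sigma (hecke_reps p) ?A"
          by (rule rev_image_eqI) (simp add: s gr)
      next
        fix M assume "M \<in> (\<lambda>(g, r). mmul g r) ` prod.swap ` Sigma (hecke_reps p) ?A"
        then obtain s where "s \<in> Sigma (hecke_reps p) ?A" "M = (\<lambda>(g, r). mmul g r) (prod.swap s)" by blast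
        moreover obtain r \<gamma> where "s = (r, \<gamma>)" by (cases s)
        ultimately show "M \<in> {M. mdet M = int p \<and> mob M z \<in> siegel}"
          using mr[of r \<gamma>] mdet_hecke_reps[of r p] by simp
      qed
    qed
    ultimately have "bij_betw ((\<lambda>(g, r). mmul g r) \<circ> prod.swap) (Sigma (hecke_reps p) ?A) {M. mdet M = int p \<and> mob M z \<in> siegel}"
      by (rule bij_betw_trans)
    thus ?thesis by (simp add: o_def case_prod_beta')
  qed
  hence "(\<Sum>M | mdet M = int p \<and> mob M z \<in> siegel. of_real (psi (mob M z)) * g M)
    = (\<Sum>(r, \<gamma>)\<in>Sigma (hecke_reps p) ?A. of_real (psi (mob (mmul \<gamma> r) z)) * g (mmul \<gamma> r))"
    by (subst sum.reindex_bij_betw[symmetric]) (auto simp: case_prod_beta')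
  also have "\<dots> = (\<Sum>r\<in>hecke_reps p. \<Sum>\<gamma>\<in>?A r. of_real (psi (mob (mmul \<gamma> r) z)) * g (mmul \<gamma> r))"
  proof (rule sum.Sigma[symmetric])
    show "\<forall>r\<in>hecke_reps p. finite (?A r)" using finite_siegel_orbit iz mdet_hecke_reps by force
  qed (simp add: hecke_reps_def)
  also have "\<dots> = (\<Sum>r\<in>hecke_reps p. g r)"
  proof (rule sum.cong[OF refl])
    fix r assume r: "r \<in> hecke_reps p"
    have "(\<Sum>\<gamma>\<in>?A r. of_real (psi (mob (mmul \<gamma> r) z)) * g (mmul \<gamma> r)) = (\<Sum>\<gamma>\<in>?A r. of_real (1 / orbit_count (mob r z)) * g r)"
    proof (intro sum.cong refl)
      fix \<gamma> assume "\<gamma> \<in> ?A r"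
      thus "of_real (psi (mob (mmul \<gamma> r) z)) * g (mmul \<gamma> r) = of_real (1 / orbit_count (mob r z)) * g r"
        using g[of \<gamma> r] mdet_hecke_reps[OF r] by (simp add: psi_def mr orbit_count_mob iz)
    qed
    also have "\<dots> = of_real (orbit_count (mob r z) * (1 / orbit_count (mob r z))) * g r"
      by (simp add: orbit_count_eq[OF iz[OF mdet_hecke_reps[OF r]]])
    also have "orbit_count (mob r z) * (1 / orbit_count (mob r z)) = 1"
      using orbit_count_pos[OF iz[OF mdet_hecke_reps[OF r]]] by simp
    finally show "(\<Sum>\<gamma>\<in>?A r. of_real (psi (mob (mmul \<gamma> r) z)) * g (mmul \<gamma> r)) = g r" by simp
  qed
  finally show ?thesis .
qed

lemma count_space_finite_support:
  fixes f :: "'i \<Rightarrow> 'b :: {banach, second_countable_topology}"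
  assumes F: "finite F" "F \<subseteq> A" and f: "\<And>x. x \<in> A \<Longrightarrow> x \<notin> F \<Longrightarrow> f x = 0"
  shows "integrable (count_space A) f" "(\<integral>x. f x \<partial>count_space A) = (\<Sum>x\<in>F. f x)"
proof -
  have s: "{x \<in> A. f x \<noteq> 0} \<subseteq> F" using f by auto
  hence fin: "finite {x \<in> A. f x \<noteq> 0}" using F finite_subset by blast
  have "(\<integral>\<^sup>+x. norm (f x) \<partial>count_space A) = (\<Sum>x | x \<in> A \<and> 0 < ennreal (norm (f x)). ennreal (norm (f x)))"
    by (rule nn_integral_count_space) (use fin in simp)
  also have "\<dots> < \<infinity>" using fin by (simp add: sum_ennreal)
  finally show "integrable (count_space A) f" by (intro integrableI_bounded) simp_all
  have "(\<integral>x. f x \<partial>count_space A) = (\<Sum>x | x \<in> A \<and> f x \<noteq> 0. f x)"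
    by (rule lebesgue_integral_count_space_finite_support[OF fin])
  also have "\<dots> = (\<Sum>x\<in>F. f x)" by (rule sum.mono_neutral_left) (use F s in auto)
  finally show "(\<integral>x. f x \<partial>count_space A) = (\<Sum>x\<in>F. f x)" .
qed

lemma split_prime_power:
  fixes n :: nat
  assumes "n > 1"
  obtains p e m where "prime p" "e > 0" "n = p ^ e * m" "\<not> p dvd m" "m < n"
proof -
  obtain p where p: "prime p" "p dvd n" using prime_factor_nat[of n] assms by auto
  obtain m where m: "n = p ^ multiplicity p n * m" "\<not> p dvd m"
    by (rule multiplicity_decompose'[of n p]) (use p assms in auto)
  have e: "multiplicity p n > 0" using p assms by (simp add: prime_multiplicity_gt_zero_iff)
  have "m > 0" using m(1) assms by (cases m) auto
  have "p ^ multiplicity p n > 1" using p(1) e by (metis one_less_power prime_gt_1_nat)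
  hence "1 * m < p ^ multiplicity p n * m" using \<open>m > 0\<close> by (intro mult_strict_right_mono) auto
  hence "m < n" using m(1) by simp
  thus ?thesis using that[OF p(1) e m] by blast
qed

section \<open>The Petersson product and self-adjointness of Hecke operators\<close>

context cusp_eigenform
begin

text \<open>Extension by zero, which gives a Borel function on the whole plane.\<close>

definition hh :: "complex \<Rightarrow> complex" where "hh z = (if z \<in> {z. Im z > 0} then h z else 0)"

lemma hh_eq: "Im z > 0 \<Longrightarrow> hh z = h z"
  by (simp add: hh_def)

lemma hh_measurable [measurable]: "hh \<in> borel_measurable borel"
  unfolding hh_def[abs_def]
  by (intro borel_measurable_continuous_on_if holomorphic_on_imp_continuous_on h_holomorphic)
     (simp_all add: open_halfspace_Im_gt)

text \<open>The integrand, for the invariant measure, of the Petersson product of \<open>h\<close>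
  slashed by \<open>M\<close> with \<open>h\<close>; the slash carries no power of the
  determinant.\<close>

definition pker :: "mat2 \<Rightarrow> complex \<Rightarrow> complex" where
  "pker M z = hh (mob M z) / aut M z ^ k * cnj (hh z) * of_real (Im z ^ k)"

lemma aut_measurable [measurable]: "aut M \<in> borel_measurable borel"
  by (cases M) (simp add: aut.simps[abs_def])

lemma pker_measurable [measurable]: "pker M \<in> borel_measurable borel"
proof -
  have [measurable]: "(\<lambda>z. cnj (hh z)) \<in> borel_measurable borel"
    by (rule borel_measurable_continuous_on[OF _ hh_measurable]) (intro continuous_intros)
  have [measurable]: "(\<lambda>z. complex_of_real (Im z ^ k)) \<in> borel_measurable borel"
    by (intro borel_measurable_continuous_onI continuous_intros)
  show ?thesis unfolding pker_def[abs_def] by measurable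
qed

lemma pker_mmul:
  assumes "mdet g = 1" "mdet M > 0" "Im z > 0"
  shows "pker (mmul g M) z = pker M z"
proof -
  have iz: "Im (mob M z) > 0" by (rule Im_mob_pos) (use assms in auto)
  have "aut g (mob M z) \<noteq> 0" by (rule aut_nonzero) (use assms iz in auto)
  moreover have "Im (mob g (mob M z)) > 0" by (rule Im_mob_pos) (use assms iz in auto)
  ultimately show ?thesis
    using assms iz by (simp add: pker_def mob_mmul aut_mmul hh_eq h_mob power_mult_distrib)
qed

text \<open>Substituting \<open>mob (madj M) z\<close> moves the matrix to the other argument. The
  powers of \<open>mdet M\<close> coming from the automorphy factor and from the imaginary part
  cancel.\<close>

lemma pker_adjoint:
  assumes M: "mdet M > 0" and z: "Im z > 0"
  shows "pker M (mob (madj M) z) = cnj (pker (madj M) z)"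
proof -
  let ?N = "madj M"
  have N: "mdet ?N > 0" using M by simp
  have iz: "Im (mob ?N z) > 0" by (rule Im_mob_pos[OF N z])
  have nz: "aut ?N z \<noteq> 0" by (rule aut_nonzero[OF N z])
  have bk: "mob M (mob ?N z) = z" using mob_madj_mob[OF N z] by simp
  have au: "aut M (mob ?N z) * aut ?N z = of_int (mdet M)" using aut_madj_mob[OF N z] by simp
  hence au': "aut M (mob ?N z) = of_int (mdet M) / aut ?N z" using nz by (simp add: field_simps)
  have n2: "complex_of_real ((norm (aut ?N z))\<^sup>2) = aut ?N z * cnj (aut ?N z)" by (rule complex_norm_square)
  have im: "complex_of_real (Im (mob ?N z)) = of_int (mdet M) * of_real (Im z) / (aut ?N z * cnj (aut ?N z))"
    unfolding Im_mob[OF N z] n2[symmetric] by simp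
  have "pker M (mob ?N z) = h z / (of_int (mdet M) / aut ?N z) ^ k * cnj (h (mob ?N z)) * (of_int (mdet M) * of_real (Im z) / (aut ?N z * cnj (aut ?N z))) ^ k"
    unfolding pker_def bk au' hh_eq[OF z] hh_eq[OF iz] of_real_power im ..
  also have "\<dots> = cnj (h (mob ?N z)) / cnj (aut ?N z) ^ k * h z * of_real (Im z ^ k)"
    using nz M by (simp add: power_divide power_mult_distrib)
  also have "\<dots> = cnj (pker ?N z)" using z iz by (simp add: pker_def hh_eq)
  finally show ?thesis .
qed

text \<open>Up to \<open>mdet M ^ k\<close>, which is at least 1, the square of the norm is the
  product of the values of the bounded function \<open>|h z|^2 (Im z)^k\<close> at
  \<open>mob M z\<close> and at \<open>z\<close>.\<close>

lemma pker_bound: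
  obtains B where "B \<ge> 0" "\<And>M z. mdet M > 0 \<Longrightarrow> Im z > 0 \<Longrightarrow> norm (pker M z) \<le> B"
proof -
  obtain B where B: "B \<ge> 0" "\<And>z. Im z > 0 \<Longrightarrow> (norm (h z))\<^sup>2 * Im z ^ k \<le> B" using hecke_bound by blast
  show ?thesis
  proof (rule that[OF B(1)])
    fix M z assume M: "mdet M > 0" and z: "Im z > 0"
    have iz: "Im (mob M z) > 0" by (rule Im_mob_pos[OF M z])
    have nz: "aut M z \<noteq> 0" by (rule aut_nonzero[OF M z])
    have d: "1 \<le> real_of_int (mdet M) ^ k" using M by simp
    have "(norm (pker M z))\<^sup>2 * real_of_int (mdet M) ^ k =
       ((norm (h (mob M z)))\<^sup>2 * Im (mob M z) ^ k) * ((norm (h z))\<^sup>2 * Im z ^ k)"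
      using nz
      by (simp add: pker_def hh_eq[OF z] hh_eq[OF iz] Im_mob[OF M z] abs_of_pos[OF z] norm_mult norm_divide norm_power power_mult_distrib power_divide power2_eq_square)
    also have "\<dots> \<le> B * B" using B z iz by (intro mult_mono B) auto
    finally have "(norm (pker M z))\<^sup>2 * real_of_int (mdet M) ^ k \<le> B\<^sup>2" by (simp add: power2_eq_square)
    moreover have "(norm (pker M z))\<^sup>2 * 1 \<le> (norm (pker M z))\<^sup>2 * real_of_int (mdet M) ^ k"
      using d by (intro mult_left_mono) auto
    ultimately have "(norm (pker M z))\<^sup>2 \<le> B\<^sup>2" by linarith
    thus "norm (pker M z) \<le> B" using B(1) by (rule power2_le_imp_le)
  qed
qed

definition pnorm :: "complex \<Rightarrow> real" where "pnorm z = (norm (hh z))\<^sup>2 * Im z ^ k"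

lemma pnorm_measurable [measurable]: "pnorm \<in> borel_measurable borel"
  unfolding pnorm_def[abs_def] by measurable

lemma hecke_pker:
  assumes p: "prime p" and z: "Im z > 0"
  shows "(\<Sum>r\<in>hecke_reps p. pker r z) = a p * of_real (pnorm z) / of_nat p ^ (k - 1)"
proof -
  have p0: "p > 0" using p prime_gt_0_nat by simp
  have p1: "p \<noteq> 1" using p by auto
  have inj: "inj_on (\<lambda>b. (1::int, int b, 0::int, int p)) {..<p}" by (auto simp: inj_on_def)
  have "(\<Sum>r\<in>hecke_reps p. pker r z) = pker (int p, 0, 0, 1) z + (\<Sum>b<p. pker (1, int b, 0, int p) z)"
    unfolding hecke_reps_def using p1 by (subst sum.insert) (auto simp: sum.reindex[OF inj])
  also have "pker (int p, 0, 0, 1) z = h (of_nat p * z) * (cnj (h z) * of_real (Im z ^ k))"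
    using z p0 by (simp add: pker_def hh_eq)
  also have "(\<Sum>b<p. pker (1, int b, 0, int p) z) = (\<Sum>b<p. h ((z + of_nat b) / of_nat p)) / of_nat p ^ k * (cnj (h z) * of_real (Im z ^ k))"
    using z p0 by (simp add: pker_def hh_eq Im_divide_of_nat sum_divide_distrib sum_distrib_right mult.assoc)
  also have "h (of_nat p * z) * (cnj (h z) * of_real (Im z ^ k)) + (\<Sum>b<p. h ((z + of_nat b) / of_nat p)) / of_nat p ^ k * (cnj (h z) * of_real (Im z ^ k))
    = (of_nat p ^ (k - 1) * h (of_nat p * z) + (\<Sum>b<p. h ((z + of_nat b) / of_nat p)) / of_nat p) * (cnj (h z) * of_real (Im z ^ k)) / of_nat p ^ (k - 1)"
  proof -
    have "k = Suc (k - 1)" using k_ge_1 by simp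
    hence "(of_nat p :: complex) ^ k = of_nat p * of_nat p ^ (k - 1)" by (metis power_Suc)
    thus ?thesis using p0 by (simp add: field_simps)
  qed
  also have "\<dots> = a p * of_real (pnorm z) / of_nat p ^ (k - 1)"
  proof -
    have "of_real (pnorm z) = h z * cnj (h z) * of_real (Im z ^ k)"
      unfolding pnorm_def of_real_mult complex_norm_square hh_eq[OF z] ..
    thus ?thesis unfolding hecke_prime[OF p z, symmetric] by (simp only: mult_ac)
  qed
  finally show ?thesis .
qed

text \<open>Integrability comes from the Hecke bound and the finite area. For positivity,
  \<open>h\<close> has no zero on some nonempty open subset of the Siegel set, and such a set is not
  null.\<close>

lemma petersson_norm_pos:
  "integrable lborel (\<lambda>x. psi (hcoord x) * pnorm (hcoord x))"
  "(\<integral>x. psi (hcoord x) * pnorm (hcoord x) \<partial>lborel) > 0"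
proof -
  obtain B where B: "B \<ge> 0" "\<And>z. Im z > 0 \<Longrightarrow> (norm (h z))\<^sup>2 * Im z ^ k \<le> B" using hecke_bound by blast
  have pn: "0 \<le> pnorm z \<and> pnorm z \<le> B" if "Im z > 0" for z using B(2)[OF that] that by (simp add: pnorm_def hh_eq)
  have [measurable]: "{x. hcoord x \<in> siegel} \<in> sets borel"
    using measurable_sets[OF hcoord_measurable siegel_measurable] by (simp add: vimage_def)
  have ind: "integrable lborel (\<lambda>x. B * indicator {x. hcoord x \<in> siegel} x)"
    using emeasure_siegel by (intro integrable_mult_right integrable_real_indicator) auto
  have nonneg: "0 \<le> psi (hcoord x) * pnorm (hcoord x)" for x
    using psi_bounds[OF Im_hcoord] pn[OF Im_hcoord] by (intro mult_nonneg_nonneg) auto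
  show int: "integrable lborel (\<lambda>x. psi (hcoord x) * pnorm (hcoord x))"
  proof (rule Bochner_Integration.integrable_bound[OF ind])
    have "norm (psi (hcoord x) * pnorm (hcoord x)) \<le> norm (B * indicator {x. hcoord x \<in> siegel} x)" for x
    proof -
      have "psi (hcoord x) * pnorm (hcoord x) \<le> indicator siegel (hcoord x) * B"
        using psi_bounds[OF Im_hcoord, of x] pn[OF Im_hcoord, of x] by (intro mult_mono) auto
      thus ?thesis using nonneg[of x] B(1) by (cases "hcoord x \<in> siegel") (simp_all add: psi_def)
    qed
    thus "AE x in lborel. norm (psi (hcoord x) * pnorm (hcoord x)) \<le> norm (B * indicator {x. hcoord x \<in> siegel} x)" by simp
  qed simp
  have "(\<integral>x. psi (hcoord x) * pnorm (hcoord x) \<partial>lborel) \<noteq> 0"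
  proof
    assume "(\<integral>x. psi (hcoord x) * pnorm (hcoord x) \<partial>lborel) = 0"
    hence ae: "AE x in lborel. psi (hcoord x) * pnorm (hcoord x) = 0"
      using integral_nonneg_eq_0_iff_AE[OF int] nonneg by simp
    obtain x where x: "h (Complex x 1) \<noteq> 0" using h_nonzero[of 1] by auto
    define n where "n = round x"
    define z1 where "z1 = Complex (x - of_int n) 1"
    have "h (mob (1, n, 0, 1) z1) = h z1" by (subst h_mob) (auto simp: z1_def)
    moreover have "mob (1, n, 0, 1) z1 = Complex x 1" by (simp add: z1_def complex_eq_iff)
    ultimately have hz1: "h z1 \<noteq> 0" using x by simp
    have re: "\<bar>Re z1\<bar> \<le> 1 / 2" using of_int_round_abs_le[of x] by (simp add: z1_def n_def abs_minus_commute)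
    have cont: "continuous_on {z. Im z > 0} h" by (intro holomorphic_on_imp_continuous_on h_holomorphic)
    define U where "U = {z. Im z > 0} \<inter> h -` (- {0})"
    have oU: "open U" unfolding U_def
      by (rule continuous_open_preimage[OF cont]) (auto simp: open_halfspace_Im_gt)
    define V where "V = U \<inter> {z. Im z > 1 / 5} \<inter> {z. Re z < 1 / 2} \<inter> {z. Re z > - (1 / 2)}"
    have oV: "open V" unfolding V_def by (intro open_Int oU open_halfspace_Im_gt open_halfspace_Re_lt open_halfspace_Re_gt)
    have "V \<noteq> {}"
    proof -
      have "z1 \<in> U" using hz1 by (simp add: U_def z1_def)
      then obtain e where e: "e > 0" "ball z1 e \<subseteq> U" using oU open_contains_ball by blast
      \<comment> \<open>Shrinking the real part by \<open>\<theta>\<close> moves the point off the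
        possible boundary value \<open>|Re z1| = 1/2\<close> while staying in the ball.\<close>
      define \<theta> where "\<theta> = (1 - min (e / 2) (1 / 2))"
      define z2 where "z2 = Complex (\<theta> * Re z1) 1"
      have th: "0 < \<theta>" "\<theta> < 1" using e by (auto simp: \<theta>_def min_def)
      have "dist z1 z2 = \<bar>(1 - \<theta>) * Re z1\<bar>"
        by (simp add: z2_def dist_norm z1_def cmod_def complex_eq_iff algebra_simps)
      also have "\<dots> \<le> (e / 2) * 1" unfolding abs_mult using re e by (intro mult_mono) (auto simp: \<theta>_def)
      finally have "z2 \<in> U" using e by auto
      moreover have "\<bar>\<theta> * Re z1\<bar> < 1 / 2"
      proof (cases "Re z1 = 0")
        case False
        hence "\<bar>\<theta> * Re z1\<bar> < 1 * \<bar>Re z1\<bar>" unfolding abs_mult using th by (intro mult_strict_right_mono) auto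
        thus ?thesis using re by simp
      qed simp
      hence "\<theta> * Re z1 < 1 / 2" "\<theta> * Re z1 > - (1 / 2)" by (auto simp: abs_less_iff)
      ultimately have "z2 \<in> V" by (simp add: V_def z2_def)
      thus ?thesis by blast
    qed
    then obtain z3 where z3: "z3 \<in> V" by blast
    define W where "W = hcoord -` V"
    have "continuous_on UNIV hcoord" unfolding hcoord_eq[abs_def] by (intro continuous_intros)
    hence oW: "open W" unfolding W_def using oV by (simp add: open_vimage)
    have "hcoord (Re z3 / Im z3, ln (Im z3)) = z3" using z3 by (simp add: hcoord_def complex_eq_iff V_def)
    hence W0: "W \<noteq> {}" using z3 unfolding W_def by (metis empty_iff vimage_eq)
    have nzW: "psi (hcoord x) * pnorm (hcoord x) \<noteq> 0" if "x \<in> W" for x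
    proof -
      have "hcoord x \<in> siegel" "h (hcoord x) \<noteq> 0" using that by (auto simp: W_def V_def U_def siegel_def abs_le_iff)
      thus ?thesis using orbit_count_pos[OF Im_hcoord, of x] Im_hcoord[of x] by (simp add: psi_def pnorm_def hh_eq)
    qed
    from ae have "AE x in lborel. x \<notin> W" by eventually_elim (use nzW in blast)
    hence "W \<in> null_sets lborel" using oW by (subst (asm) AE_iff_null_sets[symmetric]) auto
    hence "W \<in> null_sets lebesgue" by (rule null_sets_completionI)
    hence "negligible W" by (simp add: negligible_iff_null_sets)
    thus False using open_not_negligible[OF oW W0] by simp
  qed
  moreover have "(\<integral>x. psi (hcoord x) * pnorm (hcoord x) \<partial>lborel) \<ge> 0" by (rule Bochner_Integration.integral_nonneg) (rule nonneg)
  ultimately show "(\<integral>x. psi (hcoord x) * pnorm (hcoord x) \<partial>lborel) > 0" by linarith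
qed

text \<open>Passing from \<open>M\<close> to \<open>madj M\<close> permutes the matrices of
  determinant \<open>p\<close> and conjugates the weighted Petersson integrals, so their total is
  real. Unfolding with \<open>psi_sum\<close> identifies the total as \<open>a p\<close> times a
  positive number.\<close>

theorem a_prime_real:
  assumes p: "prime p"
  shows "cnj (a p) = a p"
proof -
  define MM where "MM = {M. mdet M = int p}"
  let ?C = "count_space MM"
  have p0: "p > 0" using p prime_gt_0_nat by simp
  interpret C: sigma_finite_measure ?C by (rule sigma_finite_measure_count_space_countable) simp
  interpret P: pair_sigma_finite "lborel :: (real \<times> real) measure" ?C ..
  \<comment> \<open>Weighting both \<open>z\<close> and \<open>mob M z\<close> makes the integral
    compatible with the adjugate and leaves finitely many \<open>M\<close> for each
    \<open>z\<close>.\<close>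
  define F where "F M z = of_real (psi z) * (of_real (psi (mob M z)) * pker M z)" for M z
  have F_meas [measurable]: "F M \<in> borel_measurable borel" for M
    unfolding F_def[abs_def] by measurable
  let ?f = "\<lambda>x M. F M (hcoord x)"
  let ?S = "\<lambda>x. {M. mdet M = int p \<and> mob M (hcoord x) \<in> siegel}"
  have finS: "finite (?S x)" for x by (rule finite_siegel_orbit[OF Im_hcoord]) (use p0 in simp)
  have SM: "?S x \<subseteq> MM" for x by (auto simp: MM_def)
  have F0: "?f x M = 0" if "M \<in> MM" "M \<notin> ?S x" for x M
    using that by (simp add: F_def psi_def MM_def)
  obtain B where B: "B \<ge> 0" "\<And>M z. mdet M > 0 \<Longrightarrow> Im z > 0 \<Longrightarrow> norm (pker M z) \<le> B" using pker_bound by blast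
  have pos: "0 \<le> psi (mob M (hcoord x))" if "M \<in> MM" for M x
    using psi_bounds[OF Im_mob_pos[OF _ Im_hcoord]] that p0 by (simp add: MM_def)
  have meas: "case_prod ?f \<in> borel_measurable (lborel \<Otimes>\<^sub>M ?C)"
  proof -
    have "(\<lambda>(M, x). ?f x M) \<in> borel_measurable (?C \<Otimes>\<^sub>M lborel)"
      by (rule measurable_pair_measure_countable1) simp_all
    from measurable_pair_swap[OF this] show ?thesis by (simp add: case_prod_beta')
  qed
  have inner: "(\<integral>M. ?f x M \<partial>?C) = of_real (psi (hcoord x)) * (a p * of_real (pnorm (hcoord x)) / of_nat p ^ (k - 1))" for x
  proof -
    have "(\<integral>M. ?f x M \<partial>?C) = (\<Sum>M\<in>?S x. ?f x M)" by (rule count_space_finite_support(2)[OF finS SM F0])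
    also have "\<dots> = of_real (psi (hcoord x)) * (\<Sum>M\<in>?S x. of_real (psi (mob M (hcoord x))) * pker M (hcoord x))"
      by (simp add: F_def sum_distrib_left)
    also have "(\<Sum>M\<in>?S x. of_real (psi (mob M (hcoord x))) * pker M (hcoord x)) = (\<Sum>r\<in>hecke_reps p. pker r (hcoord x))"
      by (rule psi_sum[OF p Im_hcoord]) (use p0 in \<open>simp add: pker_mmul Im_hcoord\<close>)
    finally show ?thesis by (simp only: hecke_pker[OF p Im_hcoord])
  qed
  \<comment> \<open>For fixed \<open>x\<close> the weights of the matrices add up to the number of
    representatives, and the weight of \<open>x\<close> itself is supported on a set of finite
    area.\<close>
  have int: "integrable (lborel \<Otimes>\<^sub>M ?C) (case_prod ?f)"
  proof (rule P.Fubini_integrable[OF meas])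
    have "integrable ?C (\<lambda>M. ?f x M)" for x by (rule count_space_finite_support(1)[OF finS SM F0])
    thus "AE x in lborel. integrable ?C (\<lambda>M. case_prod ?f (x, M))" by simp
    have [measurable]: "{x. hcoord x \<in> siegel} \<in> sets borel"
      using measurable_sets[OF hcoord_measurable siegel_measurable] by (simp add: vimage_def)
    have ind: "integrable lborel (\<lambda>x. (B * real (card (hecke_reps p))) * indicator {x. hcoord x \<in> siegel} x)"
      using emeasure_siegel by (intro integrable_mult_right integrable_real_indicator) auto
    have "integrable lborel (\<lambda>x. \<integral>M. norm (?f x M) \<partial>?C)"
    proof (rule Bochner_Integration.integrable_bound[OF ind])
      have "(\<lambda>(x, M). norm (?f x M)) \<in> borel_measurable (lborel \<Otimes>\<^sub>M ?C)"
        using measurable_compose[OF meas borel_measurable_norm] by (simp add: case_prod_beta')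
      thus "(\<lambda>x. \<integral>M. norm (?f x M) \<partial>?C) \<in> borel_measurable lborel"
        by (rule C.borel_measurable_lebesgue_integral)
      have "norm (\<integral>M. norm (?f x M) \<partial>?C) \<le> norm ((B * real (card (hecke_reps p))) * indicator {x. hcoord x \<in> siegel} x)" for x
      proof -
        have ps: "0 \<le> psi (hcoord x)" "psi (hcoord x) \<le> indicator siegel (hcoord x)" using psi_bounds[OF Im_hcoord, of x] by auto
        have "(\<integral>M. norm (?f x M) \<partial>?C) = (\<Sum>M\<in>?S x. norm (?f x M))"
          by (rule count_space_finite_support(2)[OF finS SM]) (simp add: F0)
        also have "\<dots> \<le> (\<Sum>M\<in>?S x. indicator siegel (hcoord x) * (psi (mob M (hcoord x)) * B))"
        proof (rule sum_mono)
          fix M assume M: "M \<in> ?S x"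
          have "norm (?f x M) = psi (hcoord x) * (psi (mob M (hcoord x)) * norm (pker M (hcoord x)))"
            using ps pos[of M x] M by (simp add: F_def norm_mult MM_def)
          also have "\<dots> \<le> indicator siegel (hcoord x) * (psi (mob M (hcoord x)) * B)"
            using ps pos[of M x] M SM B(2)[of M "hcoord x"] Im_hcoord[of x] p0 B(1)
            by (intro mult_mono mult_left_mono mult_nonneg_nonneg) (auto simp: MM_def)
          finally show "norm (?f x M) \<le> indicator siegel (hcoord x) * (psi (mob M (hcoord x)) * B)" .
        qed
        also have "\<dots> = indicator siegel (hcoord x) * B * (\<Sum>M\<in>?S x. psi (mob M (hcoord x)))"
          by (simp add: sum_distrib_left mult_ac)
        also have "(\<Sum>M\<in>?S x. psi (mob M (hcoord x))) = real (card (hecke_reps p))"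
        proof -
          have "complex_of_real (\<Sum>M\<in>?S x. psi (mob M (hcoord x))) = (\<Sum>M\<in>?S x. of_real (psi (mob M (hcoord x))) * 1)" by simp
          also have "\<dots> = (\<Sum>r\<in>hecke_reps p. 1)" by (rule psi_sum[OF p Im_hcoord]) simp
          also have "\<dots> = complex_of_real (real (card (hecke_reps p)))" by simp
          finally show ?thesis by (simp only: of_real_eq_iff)
        qed
        finally have "(\<integral>M. norm (?f x M) \<partial>?C) \<le> (B * real (card (hecke_reps p))) * indicator {x. hcoord x \<in> siegel} x"
          by (cases "hcoord x \<in> siegel") simp_all
        moreover have "0 \<le> (\<integral>M. norm (?f x M) \<partial>?C)" by (rule Bochner_Integration.integral_nonneg) simp
        ultimately show ?thesis by simp
      qed
      thus "AE x in lborel. norm (\<integral>M. norm (?f x M) \<partial>?C) \<le> norm ((B * real (card (hecke_reps p))) * indicator {x. hcoord x \<in> siegel} x)" by simp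
    qed
    thus "integrable lborel (\<lambda>x. \<integral>M. norm (case_prod ?f (x, M)) \<partial>?C)" by simp
  qed
  define A where "A = (\<integral>x. psi (hcoord x) * pnorm (hcoord x) \<partial>lborel)"
  define J where "J M = (\<integral>x. ?f x M \<partial>lborel)" for M
  have lhs: "(\<integral>x. (\<integral>M. ?f x M \<partial>?C) \<partial>lborel) = a p * of_real A / of_nat p ^ (k - 1)"
  proof -
    have "(\<integral>x. (\<integral>M. ?f x M \<partial>?C) \<partial>lborel) = (\<integral>x. (a p / of_nat p ^ (k - 1)) * of_real (psi (hcoord x) * pnorm (hcoord x)) \<partial>lborel)"
      unfolding inner by (intro Bochner_Integration.integral_cong refl) simp
    also have "\<dots> = (a p / of_nat p ^ (k - 1)) * of_real A"
      unfolding A_def by (simp only: integral_mult_right_zero integral_complex_of_real)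
    finally show ?thesis by simp
  qed
  have J: "J M = cnj (J (madj M))" if M: "M \<in> MM" for M
  proof -
    have dM: "mdet M > 0" "mdet (madj M) > 0" using M p0 by (simp_all add: MM_def)
    have "J M = (\<integral>x. F M (mob (madj M) (hcoord x)) \<partial>lborel)"
      unfolding J_def by (rule integral_hcoord_mob[OF dM(2), symmetric]) simp
    also have "\<dots> = (\<integral>x. cnj (F (madj M) (hcoord x)) \<partial>lborel)"
    proof (rule Bochner_Integration.integral_cong[OF refl])
      fix x :: "real \<times> real"
      show "F M (mob (madj M) (hcoord x)) = cnj (F (madj M) (hcoord x))"
        unfolding F_def pker_adjoint[OF dM(1) Im_hcoord]
        using mob_madj_mob[OF dM(2) Im_hcoord, of x] by simp
    qed
    finally show ?thesis unfolding J_def by simp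
  qed
  have "bij_betw madj MM MM"
    by (rule bij_betw_byWitness[where f' = madj]) (auto simp: MM_def mult.commute)
  from integral_bij_count_space[OF this, of "\<lambda>M. cnj (J M)"]
  have "(\<integral>M. cnj (J (madj M)) \<partial>?C) = (\<integral>M. cnj (J M) \<partial>?C)" .
  moreover have "(\<integral>M. cnj (J (madj M)) \<partial>?C) = (\<integral>M. J M \<partial>?C)"
    by (rule Bochner_Integration.integral_cong[OF refl]) (simp add: J)
  ultimately have real: "cnj (\<integral>M. J M \<partial>?C) = (\<integral>M. J M \<partial>?C)" by simp
  have "(\<integral>M. J M \<partial>?C) = a p * of_real A / of_nat p ^ (k - 1)"
    unfolding J_def lhs[symmetric] by (rule P.Fubini_integral[OF int])
  hence "cnj (a p) * of_real A / of_nat p ^ (k - 1) = a p * of_real A / of_nat p ^ (k - 1)"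
    using real by simp
  thus ?thesis using petersson_norm_pos(2) p0 unfolding A_def[symmetric] by simp
qed

lemma a_prime_power_real: "prime p \<Longrightarrow> cnj (a (p ^ m)) = a (p ^ m)"
proof -
  assume p: "prime p"
  have "cnj (a (p ^ m)) = a (p ^ m) \<and> cnj (a (p ^ Suc m)) = a (p ^ Suc m)"
  proof (induction m)
    case 0
    show ?case using a_prime_real[OF p] by simp
  next
    case (Suc m)
    thus ?case using a_prime_real[OF p] by (simp only: a_prime_power_Suc[OF p] complex_cnj_diff complex_cnj_mult) simp
  qed
  thus ?thesis by blast
qed

theorem a_real: "Im (a n) = 0"
proof -
  have "cnj (a n) = a n"
  proof (induction n rule: less_induct)
    case (less n)
    show ?case
    proof (cases "n \<le> 1")
      case True
      thus ?thesis by (auto simp: le_Suc_eq)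
    next
      case False
      then obtain p e m where n: "prime p" "e > 0" "n = p ^ e * m" "\<not> p dvd m" "m < n"
        using split_prime_power[of n] by auto
      have "coprime (p ^ e) m" using n by (simp add: prime_imp_coprime)
      thus ?thesis unfolding n(3) using less[OF n(5)] a_prime_power_real[OF n(1)] by (simp add: a_mult_coprime)
    qed
  qed
  thus ?thesis by (simp add: complex_eq_iff)
qed

end

subsection \<open>Primes congruent to 1 modulo 3\<close>

definition coprime_to :: "nat set \<Rightarrow> nat set" where
  "coprime_to P = {n. n > 0 \<and> (\<forall>p\<in>P. \<not> p dvd n)}"

text \<open>For completely multiplicative \<open>g\<close>, passing from \<open>P\<close> to
  \<open>insert p P\<close> removes the multiples of \<open>p\<close>, whose sum is
  \<open>g p\<close> times the previous sum. This is the Euler product with finitely many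
  factors.\<close>

lemma euler_sieve:
  fixes g :: "nat \<Rightarrow> real"
  assumes "finite P" "\<And>p. p \<in> P \<Longrightarrow> prime p"
    and mult: "\<And>m n. g (m * n) = g m * g n" and sm: "g summable_on {0<..}"
  shows "infsum g (coprime_to P) = infsum g {0<..} * (\<Prod>p\<in>P. 1 - g p)"
  using assms(1,2)
proof (induction P rule: finite_induct)
  case empty
  show ?case by (simp add: coprime_to_def greaterThan_def)
next
  case (insert p P)
  let ?C = "coprime_to P" and ?C' = "coprime_to (insert p P)"
  have p: "prime p" "p > 0" using insert.prems prime_gt_0_nat by auto
  have sC: "g summable_on A" if "A \<subseteq> {0<..}" for A using summable_on_subset_banach[OF sm that] .
  have sub: "?C \<subseteq> {0<..}" "?C' \<subseteq> {0<..}" "(*) p ` ?C \<subseteq> {0<..}" using p by (auto simp: coprime_to_def)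
  have "\<not> q dvd p" if "q \<in> P" for q
    using that insert.hyps insert.prems p primes_dvd_imp_eq by blast
  hence ndvd: "\<not> q dvd p * n" if "q \<in> P" "n \<in> ?C" for q n
    using that insert.prems by (auto simp: coprime_to_def prime_dvd_mult_iff)
  have un: "?C = ?C' \<union> (*) p ` ?C"
  proof (intro equalityI subsetI)
    fix n assume n: "n \<in> ?C"
    show "n \<in> ?C' \<union> (*) p ` ?C"
    proof (cases "p dvd n")
      case True
      then obtain m where m: "n = p * m" by blast
      hence "m \<in> ?C" using n by (auto simp: coprime_to_def)
      thus ?thesis using m by blast
    qed (use n in \<open>auto simp: coprime_to_def\<close>)
  next
    fix n assume "n \<in> ?C' \<union> (*) p ` ?C"
    thus "n \<in> ?C"
    proof
      assume "n \<in> (*) p ` ?C"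
      then obtain m where "n = p * m" "m \<in> ?C" by blast
      thus ?thesis using ndvd p by (auto simp: coprime_to_def)
    qed (auto simp: coprime_to_def)
  qed
  have dj: "?C' \<inter> (*) p ` ?C = {}" by (auto simp: coprime_to_def)
  have "infsum g ?C = infsum g ?C' + infsum g ((*) p ` ?C)"
    by (subst un) (rule infsum_Un_disjoint[OF sC[OF sub(2)] sC[OF sub(3)] dj])
  also have "infsum g ((*) p ` ?C) = infsum (g \<circ> (*) p) ?C"
    by (rule infsum_reindex) (use p in \<open>auto simp: inj_on_def\<close>)
  also have "\<dots> = g p * infsum g ?C"
    by (simp add: o_def mult infsum_cmult_right')
  finally have e: "infsum g ?C = infsum g ?C' + g p * infsum g ?C" .
  have aux: "y = x * (1 - c)" if "x = y + c * x" for x y c :: real using that by (simp add: right_diff_distrib mult.commute)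
  have IH: "infsum g ?C = infsum g {0<..} * (\<Prod>p\<in>P. 1 - g p)" using insert by blast
  show ?case unfolding aux[OF e] IH prod.insert[OF insert.hyps] by (simp only: mult_ac)
qed

lemma summable_powr_on: "s > 1 \<Longrightarrow> (\<lambda>n::nat. real n powr - s) summable_on {0<..}"
proof -
  assume "s > 1"
  hence "summable (\<lambda>n::nat. norm (real n powr - s))" by (simp add: summable_real_powr_iff)
  hence "(\<lambda>n::nat. real n powr - s) summable_on UNIV" by (rule norm_summable_imp_summable_on)
  thus ?thesis by (rule summable_on_subset_banach) simp
qed

section \<open>The zeta function and the character modulo 3 near \<open>s = 1\<close>\<close>

definition chi3 :: "nat \<Rightarrow> real" where
  "chi3 n = (if n mod 3 = 1 then 1 else if n mod 3 = 2 then -1 else 0)"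

lemma chi3_mult: "chi3 (m * n) = chi3 m * chi3 n"
proof -
  have "m mod 3 = 0 \<or> m mod 3 = 1 \<or> m mod 3 = 2" "n mod 3 = 0 \<or> n mod 3 = 1 \<or> n mod 3 = 2" by presburger+
  moreover have "(m * n) mod 3 = ((m mod 3) * (n mod 3)) mod 3" by (simp add: mod_mult_eq)
  ultimately show ?thesis by (auto simp: chi3_def)
qed

text \<open>Telescoping comparison with the integral of \<open>x powr - s\<close>; \<open>N\<close>
  is so large that half of the integral is already reached.\<close>

lemma zeta_lower_bound:
  assumes s: "s > 1"
  shows "infsum (\<lambda>n::nat. real n powr - s) {0<..} \<ge> 1 / (2 * (s - 1))"
proof -
  have step: "real n powr - s \<ge> (real n powr (1 - s) - real (Suc n) powr (1 - s)) / (s - 1)" if n: "n > 0" for n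
  proof -
    have "\<exists>x. real n < x \<and> x < real (Suc n) \<and> real (Suc n) powr (1 - s) - real n powr (1 - s) = (real (Suc n) - real n) * ((1 - s) * x powr (1 - s - 1))"
      by (rule MVT2) (use n in \<open>auto intro!: derivative_eq_intros\<close>)
    then obtain x where x: "real n < x" "real (Suc n) powr (1 - s) - real n powr (1 - s) = (1 - s) * x powr (- s)" by auto
    have "x powr - s \<le> real n powr - s" using x(1) n s by (intro powr_mono2') auto
    moreover have "(real n powr (1 - s) - real (Suc n) powr (1 - s)) / (s - 1) = x powr - s"
      using x(2) s by (simp add: field_simps)
    ultimately show ?thesis by simp
  qed
  have part: "(\<Sum>n\<in>{1..N}. real n powr - s) \<ge> (1 - real (Suc N) powr (1 - s)) / (s - 1)" for N
  proof (induction N)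
    case (Suc N)
    thus ?case using step[of "Suc N"] by (simp add: diff_divide_distrib)
  qed simp
  have "((\<lambda>N. real (Suc N) powr (1 - s)) \<longlongrightarrow> 0) sequentially"
    by (rule tendsto_neg_powr[OF _ filterlim_compose[OF filterlim_real_sequentially filterlim_Suc]]) (use s in simp)
  hence "\<forall>\<^sub>F N in sequentially. real (Suc N) powr (1 - s) < 1 / 2" by (rule order_tendstoD) simp
  then obtain N where N: "real (Suc N) powr (1 - s) < 1 / 2" by (auto simp: eventually_sequentially)
  have "1 / (2 * (s - 1)) = (1 / 2) / (s - 1)" by simp
  also have "\<dots> \<le> (1 - real (Suc N) powr (1 - s)) / (s - 1)" using N s by (intro divide_right_mono) auto
  also have "\<dots> \<le> (\<Sum>n\<in>{1..N}. real n powr - s)" by (rule part)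
  also have "\<dots> \<le> infsum (\<lambda>n::nat. real n powr - s) {0<..}"
    by (rule finite_sum_le_infsum[OF summable_powr_on[OF s]]) auto
  finally show ?thesis .
qed

lemma chi3_summable: "s > 1 \<Longrightarrow> (\<lambda>n. chi3 n * real n powr - s) summable_on {0<..}"
proof -
  assume s: "s > 1"
  have "(\<lambda>n. norm (chi3 n * real n powr - s)) summable_on {0<..}"
    by (rule summable_on_comparison_test[OF summable_powr_on[OF s]]) (auto simp: chi3_def abs_mult)
  thus ?thesis by (rule abs_summable_summable)
qed

text \<open>The terms at \<open>3 m + 1\<close> and \<open>3 m + 2\<close> form nonnegative pairs,
  and the first pair alone gives \<open>1 - 2 powr - s\<close>, at least 1/2.\<close>

lemma L_chi3_lower_bound:
  assumes s: "s > 1"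
  shows "infsum (\<lambda>n. chi3 n * real n powr - s) {0<..} \<ge> 1 / 2"
proof -
  let ?g = "\<lambda>n. chi3 n * real n powr - s"
  have sG: "?g summable_on A" if "A \<subseteq> {0<..}" for A
    using summable_on_subset_banach[OF chi3_summable[OF s] that] .
  let ?A = "range (\<lambda>m. 3 * m + 1 :: nat)" and ?B = "range (\<lambda>m. 3 * m + 2 :: nat)" and ?C = "range (\<lambda>m. 3 * m + 3 :: nat)"
  have un: "{0<..} = (?A \<union> ?B) \<union> ?C"
  proof (intro equalityI subsetI)
    fix n :: nat assume n: "n \<in> {0<..}"
    have "n = 3 * (n div 3) + 1 \<or> n = 3 * (n div 3) + 2 \<or> n = 3 * (n div 3 - 1) + 3"
      using n by (simp; presburger)
    thus "n \<in> (?A \<union> ?B) \<union> ?C" 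
      using range_eqI[of n "\<lambda>m. 3 * m + 1" "n div 3"] range_eqI[of n "\<lambda>m. 3 * m + 2" "n div 3"]
        range_eqI[of n "\<lambda>m. 3 * m + 3" "n div 3 - 1"] by blast
  qed auto
  have dj: "(?A \<union> ?B) \<inter> ?C = {}" "?A \<inter> ?B = {}" by (auto; presburger)+
  have pos: "?A \<subseteq> {0<..}" "?B \<subseteq> {0<..}" "?A \<union> ?B \<subseteq> {0<..}" "?C \<subseteq> {0<..}" by auto
  have inj: "inj (\<lambda>m. 3 * m + 1 :: nat)" "inj (\<lambda>m. 3 * m + 2 :: nat)" by (auto simp: inj_on_def)
  have "(3 * m + 1) mod 3 = 1" "(3 * m + 2) mod 3 = 2" for m :: nat by presburger+
  hence chi: "chi3 (3 * m + 1) = 1" "chi3 (3 * m + 2) = -1" for m unfolding chi3_def by simp_all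
  have "infsum ?g {0<..} = infsum ?g ?A + infsum ?g ?B + infsum ?g ?C"
    unfolding un using infsum_Un_disjoint[OF sG[OF pos(3)] sG[OF pos(4)] dj(1)] infsum_Un_disjoint[OF sG[OF pos(1)] sG[OF pos(2)] dj(2)] by simp
  also have "infsum ?g ?C = 0" by (rule infsum_0) (auto simp: chi3_def)
  also have "infsum ?g ?A = infsum (\<lambda>m. real (3 * m + 1) powr - s) UNIV"
    unfolding infsum_reindex[OF inj(1)] o_def chi by simp
  also have "infsum ?g ?B = infsum (\<lambda>m. - (real (3 * m + 2) powr - s)) UNIV"
    unfolding infsum_reindex[OF inj(2)] o_def chi by simp
  finally have e: "infsum ?g {0<..} = infsum (\<lambda>m. real (3 * m + 1) powr - s) UNIV + infsum (\<lambda>m. - (real (3 * m + 2) powr - s)) UNIV" by simp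
  have sA: "(\<lambda>m. real (3 * m + 1) powr - s) summable_on UNIV"
    using sG[OF pos(1)] unfolding summable_on_reindex[OF inj(1)] o_def chi by simp
  have sB: "(\<lambda>m. - (real (3 * m + 2) powr - s)) summable_on UNIV"
    using sG[OF pos(2)] unfolding summable_on_reindex[OF inj(2)] o_def chi by simp
  have "infsum ?g {0<..} = infsum (\<lambda>m. real (3 * m + 1) powr - s + - (real (3 * m + 2) powr - s)) UNIV"
    unfolding e by (rule infsum_add[symmetric, OF sA sB])
  also have "\<dots> \<ge> (\<Sum>m\<in>{0}. real (3 * m + 1) powr - s + - (real (3 * m + 2) powr - s))"
  proof (rule finite_sum_le_infsum[OF summable_on_add[OF sA sB]])
    fix m :: nat
    have "real (3 * m + 2) powr - s \<le> real (3 * m + 1) powr - s" using s by (intro powr_mono2') auto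
    thus "0 \<le> real (3 * m + 1) powr - s + - (real (3 * m + 2) powr - s)" by simp
  qed auto
  also have "(\<Sum>m\<in>{0}. real (3 * m + 1) powr - s + - (real (3 * m + 2) powr - s)) = 1 - 2 powr - s" by simp
  finally have "infsum ?g {0<..} \<ge> 1 - 2 powr - s" .
  moreover have "(2::real) powr - s \<le> 2 powr - 1" using s by (intro powr_mono) auto
  ultimately show ?thesis by (simp add: powr_minus)
qed

text \<open>The product over all of \<open>{2..N}\<close> telescopes to
  \<open>(N + 1) / (2 N)\<close>, and leaving out factors between 0 and 1 does not decrease
  it.\<close>

lemma prod_one_minus_inverse_square:
  assumes "finite A" "A \<subseteq> {2..}"
  shows "(\<Prod>n\<in>A. 1 - 1 / (real n)\<^sup>2) \<ge> 1 / 2"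
proof -
  define N where "N = Max (insert 2 A)"
  have N: "N \<ge> 2" "A \<subseteq> {2..N}" using assms by (auto simp: N_def)
  have f: "0 \<le> 1 - 1 / (real n)\<^sup>2 \<and> 1 - 1 / (real n)\<^sup>2 \<le> 1" if "n \<ge> 2" for n :: nat
    using that by (simp add: divide_le_eq)
  have "(\<Prod>n\<in>{2..N}. 1 - 1 / (real n)\<^sup>2) = (real N + 1) / (2 * real N)"
    using N(1)
  proof (induction N rule: dec_induct)
    case (step N)
    have "(\<Prod>n\<in>{2..Suc N}. 1 - 1 / (real n)\<^sup>2) = (real N + 1) / (2 * real N) * (1 - 1 / (real (Suc N))\<^sup>2)"
      using step by simp
    also have "\<dots> = (real (Suc N) + 1) / (2 * real (Suc N))"
    proof -
      have "(x + 1) / (2 * x) * (1 - 1 / (x + 1)\<^sup>2) = (x + 2) / (2 * (x + 1))" if "x > 0" for x :: real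
        using that by (simp add: divide_simps power2_eq_square) (simp add: algebra_simps)
      from this[of "real N"] show ?thesis using step(1) by (simp add: add.commute)
    qed
    finally show ?case .
  qed (simp add: power2_eq_square)
  also have "\<dots> \<ge> 1 / 2" using N(1) by (simp add: field_simps)
  finally have "1 / 2 \<le> (\<Prod>n\<in>{2..N}. 1 - 1 / (real n)\<^sup>2)" .
  also have "\<dots> = (\<Prod>n\<in>A. 1 - 1 / (real n)\<^sup>2) * (\<Prod>n\<in>{2..N} - A. 1 - 1 / (real n)\<^sup>2)"
    using prod.subset_diff[OF N(2), of "\<lambda>n. 1 - 1 / (real n)\<^sup>2"] by (simp add: mult.commute)
  also have "\<dots> \<le> (\<Prod>n\<in>A. 1 - 1 / (real n)\<^sup>2) * 1"
    using assms f by (intro mult_left_mono prod_le_1 prod_nonneg) force+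
  finally show ?thesis by simp
qed

text \<open>Telescoping with \<open>1 / (n - 1) - 1 / n\<close>; the start 19 is the least element
  of \<open>P13\<close>.\<close>

lemma sum_inverse_square_bound:
  assumes "finite A" "A \<subseteq> {19..}"
  shows "(\<Sum>n\<in>A. 1 / (real n)\<^sup>2) \<le> 1 / 18"
proof -
  define N where "N = Max (insert 19 A)"
  have N: "N \<ge> 19" "A \<subseteq> {19..N}" using assms by (auto simp: N_def)
  have "(\<Sum>n\<in>A. 1 / (real n)\<^sup>2) \<le> (\<Sum>n\<in>{19..N}. 1 / (real n)\<^sup>2)"
    using N by (intro sum_mono2) auto
  also have "\<dots> \<le> 1 / 18 - 1 / real N"
    using N(1)
  proof (induction N rule: dec_induct)
    case (step N)
    have "1 / (real (Suc N))\<^sup>2 \<le> 1 / real N - 1 / real (Suc N)"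
      using step by (simp add: divide_simps power2_eq_square)
    thus ?case using step by simp
  qed (simp add: power2_eq_square)
  finally show ?thesis using N by (smt (verit) divide_nonneg_nonneg of_nat_0_le_iff)
qed

text \<open>The bound 13 excludes 7 and 13, which can divide the values of \<open>Phi\<close> used
  later even when they divide the argument \<open>u\<close>.\<close>

definition P13 :: "nat set" where
  "P13 = {p. prime p \<and> p mod 3 = 1 \<and> p > 13}"

lemma P13_ge: "p \<in> P13 \<Longrightarrow> p \<ge> 19"
proof -
  assume p: "p \<in> P13"
  have "\<not> prime (16::nat)" by simp
  hence "p \<noteq> 14" "p \<noteq> 15" "p \<noteq> 16" "p \<noteq> 17" "p \<noteq> 18" using p by (auto simp: P13_def)
  thus ?thesis using p by (auto simp: P13_def)
qed

text \<open>For a prime that is 2 modulo 3 the two Euler factors multiply to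
  \<open>1 - p powr (- 2 s)\<close>. The primes 3, 7 and 13 get the crude bound 1/4.\<close>

lemma rest_factor_bound:
  assumes p: "prime p" "p \<notin> P13" and s: "s > 1"
  shows "(if p \<in> {3, 7, 13} then 1 / 4 else 1) * (1 - 1 / (real p)\<^sup>2) \<le> (1 - real p powr - s) * (1 - chi3 p * real p powr - s)"
proof -
  have p2: "real p \<ge> 2" using prime_ge_2_nat[OF p(1)] by simp
  define x where "x = real p powr - s"
  have "x \<le> real p powr - 1" unfolding x_def using s p2 by (intro powr_mono) auto
  hence x: "0 < x" "x \<le> 1 / real p" using p2 by (auto simp: x_def powr_minus divide_inverse)
  moreover have "1 / real p \<le> 1 / 2" using p2 by (simp add: divide_simps)
  ultimately have x2: "x \<le> 1 / 2" by linarith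
  show ?thesis
  proof (cases "p \<in> {3, 7, 13}")
    case True
    have "1 / 4 * (1 - 1 / (real p)\<^sup>2) \<le> 1 / 4 * 1" by (intro mult_left_mono) auto
    also have "\<dots> \<le> (1 - x) * (1 - chi3 p * x)"
    proof -
      have "(1 / 2) * (1 / 2) \<le> (1 - x) * (1 - chi3 p * x)"
        using x x2 by (intro mult_mono) (auto simp: chi3_def)
      thus ?thesis by simp
    qed
    finally show ?thesis using True by (simp add: x_def)
  next
    case False
    have "p mod 3 \<noteq> 1"
    proof
      assume "p mod 3 = 1"
      hence "p \<le> 13" using p by (auto simp: P13_def)
      hence "p = 1 \<or> p = 4 \<or> p = 7 \<or> p = 10 \<or> p = 13" using \<open>p mod 3 = 1\<close> by presburger
      hence "p = 1 \<or> p = 4 \<or> p = 10" using False by auto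
      moreover have "\<not> prime (4::nat)" "\<not> prime (10::nat)" by simp_all
      ultimately show False using p(1) by auto
    qed
    moreover have "p mod 3 \<noteq> 0"
    proof
      assume "p mod 3 = 0"
      hence "3 dvd p" by auto
      hence "p = 3" using p(1) primes_dvd_imp_eq[of 3 p] by simp
      thus False using False by simp
    qed
    ultimately have "p mod 3 = 2" by presburger
    hence "(1 - x) * (1 - chi3 p * x) = 1 - x\<^sup>2" by (simp add: chi3_def algebra_simps power2_eq_square)
    moreover have "x\<^sup>2 \<le> (1 / real p)\<^sup>2" using x by (intro power_mono) auto
    ultimately show ?thesis using False by (simp add: x_def power_divide)
  qed
qed

text \<open>The product of the zeta function and the L-series has a simple pole, and in its Euler
  product the primes 1 modulo 3 enter squared. Hence the product \<open>W\<close> of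
  \<open>(1 - p powr - s)^2\<close> over them is of order at most \<open>s - 1\<close>, and that of
  \<open>1 + 4 * p powr - s\<close> is at least of order \<open>(s - 1)^(-2)\<close>, which beats
  every \<open>C / (s - 1)\<close>.\<close>

theorem many_primes_1_mod_3:
  fixes C :: real
  obtains Q s where "finite Q" "Q \<subseteq> P13" "1 < s" "s \<le> 2" "(\<Prod>p\<in>Q. 1 + 4 * real p powr - s) > C / (s - 1)"
proof -
  \<comment> \<open>Chosen so that \<open>4 / 9 / (2048\<^sup>2 * t)\<close> exceeds
    \<open>C\<close>; 2048 is the constant of the bound \<open>Wt\<close> below.\<close>
  define t where "t = min 1 (1 / (3 * 2048\<^sup>2 * (\<bar>C\<bar> + 1)))"
  define s where "s = 1 + t"
  have t: "0 < t" "t \<le> 1" by (auto simp: t_def)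
  have s: "1 < s" "s \<le> 2" using t by (auto simp: s_def)
  let ?z = "\<lambda>n::nat. real n powr - s"
  let ?l = "\<lambda>n. chi3 n * real n powr - s"
  define Z where "Z = infsum ?z {0<..}"
  define L where "L = infsum ?l {0<..}"
  have Z: "Z \<ge> 1 / (2 * t)" using zeta_lower_bound[OF s(1)] by (simp add: Z_def s_def)
  have "0 \<le> 1 / (2 * t)" using t by simp
  hence Z0: "0 \<le> Z" using Z by linarith
  have L: "L \<ge> 1 / 2" using L_chi3_lower_bound[OF s(1)] by (simp add: L_def)
  have sz: "?z summable_on A" if "A \<subseteq> {0<..}" for A using summable_on_subset_banach[OF summable_powr_on[OF s(1)] that] .
  have sl: "?l summable_on A" if "A \<subseteq> {0<..}" for A using summable_on_subset_banach[OF chi3_summable[OF s(1)] that] .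
  obtain N where N: "infsum ?z {N<..} \<le> 1"
  proof -
    have "\<forall>\<^sub>F F in finite_subsets_at_top {0<..}. sum ?z F > Z - 1"
      using order_tendstoD(1)[OF infsum_tendsto[OF summable_powr_on[OF s(1)]], of "Z - 1"] by (simp add: Z_def)
    then obtain F where F: "finite F" "F \<subseteq> {0<..}" "sum ?z F > Z - 1"
      by (auto simp: eventually_finite_subsets_at_top)
    have "{Max (insert 0 F)<..} \<subseteq> {0<..} - F"
      using F(1) by (auto simp: not_less dest!: Max_ge[rotated, of _ "insert 0 F"])
    hence "infsum ?z {Max (insert 0 F)<..} \<le> infsum ?z ({0<..} - F)"
      by (intro infsum_mono2 sz) auto
    also have "\<dots> = Z - sum ?z F"
      unfolding Z_def using F by (subst infsum_Diff) (auto intro!: sz)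
    also have "\<dots> \<le> 1" using F(3) by simp
    finally show ?thesis using that by blast
  qed
  \<comment> \<open>Sieving by all primes up to \<open>N\<close> leaves only \<open>n = 1\<close>
    and part of a tail of sum at most 1.\<close>
  define P where "P = {p. prime p \<and> p \<le> N}"
  have finP: "finite P" unfolding P_def by (rule finite_subset[of _ "{..N}"]) auto
  have cop: "coprime_to P \<subseteq> insert 1 {N<..}"
  proof
    fix n assume n: "n \<in> coprime_to P"
    show "n \<in> insert 1 {N<..}"
    proof (rule ccontr)
      assume "n \<notin> insert 1 {N<..}"
      hence n1: "n \<noteq> 1" "n \<le> N" by auto
      then obtain p where "prime p" "p dvd n" using prime_factor_nat by blast
      moreover have "p \<le> n" using dvd_imp_le[OF \<open>p dvd n\<close>] n by (simp add: coprime_to_def)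
      ultimately show False using n n1 by (auto simp: coprime_to_def P_def)
    qed
  qed
  have cpos: "coprime_to P \<subseteq> {0<..}" by (auto simp: coprime_to_def)
  have zP: "infsum ?z (coprime_to P) \<le> 2"
  proof -
    have "infsum ?z (coprime_to P) \<le> infsum ?z ({1} \<union> ({N<..} - {1}))"
      using cop by (intro infsum_mono2 sz) (auto simp: coprime_to_def)
    also have "\<dots> = ?z 1 + infsum ?z ({N<..} - {1})"
      by (subst infsum_Un_disjoint) (auto intro!: sz)
    also have "infsum ?z ({N<..} - {1}) \<le> infsum ?z {N<..}"
      by (intro infsum_mono2 sz) auto
    finally show ?thesis using N by simp
  qed
  have lz: "infsum ?l (coprime_to P) \<le> infsum ?z (coprime_to P)"
    by (intro infsum_mono sl sz cpos) (auto simp: chi3_def)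
  let ?f = "\<lambda>p. (1 - ?z p) * (1 - ?l p)"
  have pos_f: "0 < 1 - ?z p" "0 < 1 - ?l p" if "prime p" for p
  proof -
    have "?z p < 1" using prime_gt_1_nat[OF that] s by (simp add: powr_less_one)
    thus "0 < 1 - ?z p" "0 < 1 - ?l p" by (auto simp: chi3_def) (smt (verit) powr_ge_zero)
  qed
  have "Z * L * (\<Prod>p\<in>P. ?f p) = (Z * (\<Prod>p\<in>P. 1 - ?z p)) * (L * (\<Prod>p\<in>P. 1 - ?l p))"
    by (simp add: prod.distrib mult_ac)
  also have "Z * (\<Prod>p\<in>P. 1 - ?z p) = infsum ?z (coprime_to P)"
    unfolding Z_def by (rule euler_sieve[symmetric, OF finP]) (auto simp: P_def powr_mult intro!: sz)
  also have "L * (\<Prod>p\<in>P. 1 - ?l p) = infsum ?l (coprime_to P)"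
    unfolding L_def by (rule euler_sieve[symmetric, OF finP]) (auto simp: P_def powr_mult chi3_mult intro!: sl)
  also have "infsum ?z (coprime_to P) * infsum ?l (coprime_to P) \<le> 2 * 2"
  proof -
    have "0 \<le> infsum ?z (coprime_to P)" by (rule infsum_nonneg) auto
    moreover have "0 \<le> L * (\<Prod>p\<in>P. 1 - ?l p)"
      using L pos_f by (intro mult_nonneg_nonneg prod_nonneg) (auto simp: P_def less_imp_le)
    hence "0 \<le> infsum ?l (coprime_to P)"
      unfolding L_def by (subst (asm) euler_sieve[symmetric, OF finP]) (auto simp: P_def powr_mult chi3_mult intro!: sl)
    ultimately show ?thesis using zP lz by (intro mult_mono) auto
  qed
  finally have main: "Z * L * (\<Prod>p\<in>P. ?f p) \<le> 4" by simp
  define Q where "Q = P \<inter> P13"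
  have finQ: "finite Q" using finP by (simp add: Q_def)
  have splitP: "(\<Prod>p\<in>P. ?f p) = (\<Prod>p\<in>P - Q. ?f p) * (\<Prod>p\<in>Q. ?f p)"
    by (rule prod.subset_diff) (auto simp: Q_def finP)
  \<comment> \<open>The constant 1/128 combines three factors 1/4 for the primes 3, 7 and 13 with
    1/2 for the product of \<open>1 - 1 / p^2\<close>.\<close>
  have rest: "(\<Prod>p\<in>P - Q. ?f p) \<ge> 1 / 128"
  proof -
    let ?v = "\<lambda>p::nat. if p \<in> {3, 7, 13} then 1 / 4 else (1::real)"
    let ?A = "(P - Q) \<inter> {3, 7, 13}"
    have "(\<Prod>p\<in>P - Q. ?v p) = (\<Prod>p\<in>?A. 1 / 4)"
      by (rule prod.mono_neutral_cong_right) (use finP in auto)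
    also have "\<dots> = (1 / 4) ^ card ?A" by simp
    also have "\<dots> \<ge> (1 / 4 :: real) ^ 3"
    proof (rule power_decreasing)
      have "card ?A \<le> card {3::nat, 7, 13}" by (rule card_mono) auto
      thus "card ?A \<le> 3" by simp
    qed auto
    finally have v: "(1 / 4) ^ 3 \<le> (\<Prod>p\<in>P - Q. ?v p)" .
    have u: "1 / 2 \<le> (\<Prod>p\<in>P - Q. 1 - 1 / (real p)\<^sup>2)"
      by (rule prod_one_minus_inverse_square) (use finP prime_ge_2_nat in \<open>auto simp: P_def\<close>)
    have "1 / 128 = (1 / 4) ^ 3 * (1 / 2 :: real)" by (simp add: power3_eq_cube)
    also have "\<dots> \<le> (\<Prod>p\<in>P - Q. ?v p) * (\<Prod>p\<in>P - Q. 1 - 1 / (real p)\<^sup>2)"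
      by (intro mult_mono u v prod_nonneg) auto
    also have "\<dots> = (\<Prod>p\<in>P - Q. ?v p * (1 - 1 / (real p)\<^sup>2))" by (rule prod.distrib[symmetric])
    also have "\<dots> \<le> (\<Prod>p\<in>P - Q. ?f p)"
    proof (intro prod_mono conjI)
      fix p assume "p \<in> P - Q"
      hence p: "prime p" "p \<notin> P13" by (auto simp: P_def Q_def)
      show "?v p * (1 - 1 / (real p)\<^sup>2) \<le> ?f p" by (rule rest_factor_bound[OF p s(1)])
      have "1 \<le> real p" using prime_ge_1_nat[OF p(1)] by simp
      thus "0 \<le> ?v p * (1 - 1 / (real p)\<^sup>2)" by (intro mult_nonneg_nonneg) (auto simp: divide_le_eq)
    qed
    finally show ?thesis .
  qed
  define W where "W = (\<Prod>p\<in>Q. (1 - ?z p)\<^sup>2)"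
  have fQ: "(\<Prod>p\<in>Q. ?f p) = W"
    unfolding W_def by (intro prod.cong refl) (auto simp: Q_def P13_def chi3_def power2_eq_square)
  have W0: "W \<ge> 0" unfolding W_def by (intro prod_nonneg) auto
  have "(1 / (2 * t)) * (1 / 2) * ((1 / 128) * W) \<le> Z * L * ((\<Prod>p\<in>P - Q. ?f p) * W)"
    using Z Z0 L rest W0 t by (intro mult_mono mult_nonneg_nonneg) auto
  also have "\<dots> \<le> 4" using main unfolding splitP fQ .
  finally have Wt: "W \<le> 2048 * t" using t by (simp add: field_simps)
  define V where "V = (\<Prod>p\<in>Q. 1 + 4 * ?z p)"
  have V0: "V \<ge> 0" unfolding V_def by (intro prod_nonneg) (auto intro!: add_nonneg_nonneg)
  \<comment> \<open>Here \<open>4/9 = 1 - 10/18\<close>, where 10 is the quadratic coefficient found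
    below and 1/18 bounds the sum of inverse squares.\<close>
  have "4 / 9 \<le> 1 - (\<Sum>p\<in>Q. 10 * (1 / (real p)\<^sup>2))"
    using sum_inverse_square_bound[OF finQ] P13_ge unfolding sum_distrib_left[symmetric] by (force simp: Q_def)
  also have "\<dots> \<le> (\<Prod>p\<in>Q. 1 - 10 * (1 / (real p)\<^sup>2))"
  proof (rule Weierstrass_prod_ineq)
    fix p assume "p \<in> Q"
    hence "real p \<ge> 19" using P13_ge by (force simp: Q_def)
    hence "(real p)\<^sup>2 \<ge> 19\<^sup>2" by (intro power_mono) auto
    thus "10 * (1 / (real p)\<^sup>2) \<in> {0..1}" by (simp add: divide_le_eq)
  qed
  also have "\<dots> \<le> (\<Prod>p\<in>Q. ((1 - ?z p)\<^sup>2)\<^sup>2 * (1 + 4 * ?z p))"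
  proof (intro prod_mono conjI)
    fix p assume "p \<in> Q"
    hence p19: "real p \<ge> 19" using P13_ge by (force simp: Q_def)
    hence "(real p)\<^sup>2 \<ge> 19\<^sup>2" by (intro power_mono) auto
    thus "0 \<le> 1 - 10 * (1 / (real p)\<^sup>2)" by (simp add: divide_le_eq)
    define x where "x = ?z p"
    have "x \<le> real p powr - 1" unfolding x_def using s p19 by (intro powr_mono) auto
    hence x: "0 \<le> x" "x \<le> 1 / real p" using p19 by (auto simp: x_def powr_minus divide_inverse)
    have x1: "x \<le> 1" using x p19 by (smt (verit) divide_le_eq_1)
    \<comment> \<open>The linear terms cancel, which is why the fourth power of \<open>1 - x\<close>
      is paired with \<open>1 + 4 * x\<close>.\<close>
    have "((1 - x)\<^sup>2)\<^sup>2 * (1 + 4 * x) = 1 - 10 * x\<^sup>2 + 5 * x ^ 3 * (1 - x) * 3 + 5 * x ^ 3 + 4 * x ^ 5"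
      by (simp add: power2_eq_square power3_eq_cube eval_nat_numeral algebra_simps)
    moreover have "0 \<le> 5 * x ^ 3 * (1 - x) * 3" "0 \<le> 5 * x ^ 3" "0 \<le> 4 * x ^ 5" using x x1 by auto
    ultimately have "1 - 10 * x\<^sup>2 \<le> ((1 - x)\<^sup>2)\<^sup>2 * (1 + 4 * x)" by linarith
    moreover have "x\<^sup>2 \<le> (1 / real p)\<^sup>2" using x by (intro power_mono) auto
    ultimately show "1 - 10 * (1 / (real p)\<^sup>2) \<le> ((1 - ?z p)\<^sup>2)\<^sup>2 * (1 + 4 * ?z p)"
      by (simp add: x_def power_divide)
  qed
  also have "\<dots> = W\<^sup>2 * V" by (simp add: W_def V_def prod.distrib prod_power_distrib)
  also have "\<dots> \<le> (2048 * t)\<^sup>2 * V" using Wt W0 V0 by (intro mult_right_mono power_mono) auto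
  finally have "4 / 9 \<le> (2048 * t)\<^sup>2 * V" .
  hence V: "4 / 9 / (2048\<^sup>2 * t) / t \<le> V" using t by (simp add: field_simps power2_eq_square)
  have "C < 4 / 9 / (2048\<^sup>2 * t)"
  proof -
    have "t \<le> 1 / (3 * 2048\<^sup>2 * (\<bar>C\<bar> + 1))" by (simp add: t_def)
    hence "2048\<^sup>2 * t * (3 * (\<bar>C\<bar> + 1)) \<le> 1" by (simp add: field_simps)
    hence "\<bar>C\<bar> + 1 \<le> 1 / 3 / (2048\<^sup>2 * t)" using t by (simp add: field_simps)
    also have "\<dots> \<le> 4 / 9 / (2048\<^sup>2 * t)" using t by (intro divide_right_mono) auto
    finally show ?thesis by linarith
  qed
  hence "C / t < 4 / 9 / (2048\<^sup>2 * t) / t" using t by (intro divide_strict_right_mono) auto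
  hence "C / (s - 1) < V" using V by (simp add: s_def)
  thus ?thesis using that[of Q s] finQ s by (simp add: V_def Q_def)
qed

subsection \<open>A prime congruent to 1 modulo 3 with small eigenvalue\<close>

text \<open>Expanding the product gives a sum over squarefree numbers, so multiplicativity enters
  only for a prime and a number it does not divide.\<close>

lemma prod_one_plus_eq_sum:
  fixes f :: "nat \<Rightarrow> real"
  assumes "finite Q" "\<And>p. p \<in> Q \<Longrightarrow> prime p" "f 1 = 1"
    and mult: "\<And>p n. prime p \<Longrightarrow> \<not> p dvd n \<Longrightarrow> f (p * n) = f p * f n"
  shows "\<exists>B. finite B \<and> 0 \<notin> B \<and> (\<forall>n\<in>B. \<forall>q. prime q \<and> q dvd n \<longrightarrow> q \<in> Q) \<and> (\<Prod>p\<in>Q. 1 + f p) = (\<Sum>n\<in>B. f n)"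
  using assms(1,2)
proof (induction Q rule: finite_induct)
  case empty
  show ?case using assms(3) by (intro exI[of _ "{1}"]) auto
next
  case (insert p Q)
  then obtain B where B: "finite B" "0 \<notin> B" "\<forall>n\<in>B. \<forall>q. prime q \<and> q dvd n \<longrightarrow> q \<in> Q" "(\<Prod>p\<in>Q. 1 + f p) = (\<Sum>n\<in>B. f n)"
    by auto
  have p: "prime p" "p > 0" using insert.prems prime_gt_0_nat by auto
  have ndvd: "\<not> p dvd n" if "n \<in> B" for n using B(3) that insert.hyps p by blast
  have dj: "B \<inter> (*) p ` B = {}" using ndvd by (metis disjoint_iff dvd_triv_left imageE)
  have "(\<Prod>p\<in>insert p Q. 1 + f p) = (\<Sum>n\<in>B. f n) + (\<Sum>n\<in>B. f p * f n)"
    using insert.hyps B(4) by (simp add: distrib_right sum_distrib_left sum.distrib)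
  also have "(\<Sum>n\<in>B. f p * f n) = (\<Sum>n\<in>(*) p ` B. f n)"
    using p ndvd by (subst sum.reindex) (auto simp: inj_on_def mult)
  also have "(\<Sum>n\<in>B. f n) + (\<Sum>n\<in>(*) p ` B. f n) = (\<Sum>n\<in>B \<union> (*) p ` B. f n)"
    by (rule sum.union_disjoint[symmetric]) (use B dj in auto)
  finally have "(\<Prod>p\<in>insert p Q. 1 + f p) = (\<Sum>n\<in>B \<union> (*) p ` B. f n)" .
  moreover have "\<forall>n\<in>B \<union> (*) p ` B. \<forall>q. prime q \<and> q dvd n \<longrightarrow> q \<in> insert p Q"
    using B(3) p by (auto simp: prime_dvd_mult_iff primes_dvd_imp_eq)
  ultimately show ?case using B(1,2) p by (intro exI[of _ "B \<union> (*) p ` B"]) auto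
qed

text \<open>If \<open>f\<close> stayed nonnegative, its differences \<open>d\<close> would decrease,
  and a negative one would make \<open>f\<close> drop linearly below 0. So \<open>d\<close> is
  nonnegative and \<open>f\<close> at least 1 throughout; but then \<open>d\<close> falls by at
  least \<open>2 - \<tau>\<close> at each step, a contradiction.\<close>

lemma recurrence_becomes_negative:
  fixes f :: "nat \<Rightarrow> real"
  assumes f0: "f 0 = 1" and rec: "\<And>e. f (e + 2) = \<tau> * f (e + 1) - f e" and \<tau>: "\<tau> < 2"
  shows "\<exists>e. f e < 0"
proof (rule ccontr)
  assume "\<not> ?thesis"
  hence pos: "f e \<ge> 0" for e by (simp add: not_less)
  define d where "d e = f (Suc e) - f e" for e
  have d_step: "d (Suc e) = d e - (2 - \<tau>) * f (Suc e)" for e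
    using rec[of e] by (simp add: d_def algebra_simps)
  have d_dec: "d (E + n) \<le> d E" for E n
  proof (induction n)
    case (Suc n)
    have "0 \<le> (2 - \<tau>) * f (Suc (E + n))" using \<tau> pos by simp
    thus ?case using Suc d_step[of "E + n"] by simp
  qed simp
  have f_bound: "f (E + n) \<le> f E + real n * d E" for E n
  proof (induction n)
    case (Suc n)
    thus ?case using d_dec[of E n] by (simp add: d_def algebra_simps)
  qed simp
  have dpos: "d E \<ge> 0" for E
  proof (rule ccontr)
    assume "\<not> d E \<ge> 0"
    hence dE: "d E < 0" by simp
    obtain n :: nat where n: "real n > f E / (- d E)" using reals_Archimedean2 by blast
    hence "f E + real n * d E < 0" using dE by (simp add: field_simps)
    thus False using f_bound[of E n] pos[of "E + n"] by linarith
  qed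
  have f1: "f e \<ge> 1" for e
  proof (induction e)
    case (Suc e)
    thus ?case using dpos[of e] by (simp add: d_def)
  qed (simp add: f0)
  have "d e \<le> d 0 - real e * (2 - \<tau>)" for e
  proof (induction e)
    case (Suc e)
    have "(2 - \<tau>) * 1 \<le> (2 - \<tau>) * f (Suc e)" using \<tau> f1 by (intro mult_left_mono) auto
    thus ?case using Suc d_step[of e] by (simp add: algebra_simps)
  qed simp
  moreover obtain e :: nat where "real e > d 0 / (2 - \<tau>)" using reals_Archimedean2 by blast
  hence "d 0 - real e * (2 - \<tau>) < 0" using \<tau> by (simp add: field_simps)
  ultimately show False using dpos[of e] by (smt (verit))
qed

text \<open>The characteristic roots are \<open>z\<close> and \<open>1/z\<close> with sum
  \<open>c\<close>. Taking every second term squares them, and the new sum is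
  \<open>c^2 - 2\<close>.\<close>

lemma recurrence_double:
  fixes u :: "nat \<Rightarrow> real"
  assumes "\<And>m. u (m + 2) = c * u (m + 1) - u m"
  shows "u (m + 4) = (c\<^sup>2 - 2) * u (m + 2) - u m"
proof -
  have r: "u (m + 3) = c * u (m + 2) - u (m + 1)" "u (m + 4) = c * u (m + 3) - u (m + 2)"
    using assms[of "m + 1"] assms[of "m + 2"] by (simp_all add: eval_nat_numeral)
  have r2: "u (m + 2) = c * u (m + 1) - u m" by (rule assms)
  show ?thesis unfolding r r2 by (simp add: algebra_simps power2_eq_square)
qed

text \<open>Taking every third term cubes the characteristic roots, whose sum becomes
  \<open>c^3 - 3 c\<close>.\<close>

lemma recurrence_triple:
  fixes u :: "nat \<Rightarrow> real"
  assumes "\<And>m. u (m + 2) = c * u (m + 1) - u m"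
  shows "u (m + 6) = (c ^ 3 - 3 * c) * u (m + 3) - u m"
proof -
  have r: "u (m + 3) = c * u (m + 2) - u (m + 1)" "u (m + 4) = c * u (m + 3) - u (m + 2)"
    "u (m + 5) = c * u (m + 4) - u (m + 3)" "u (m + 6) = c * u (m + 5) - u (m + 4)"
    using assms[of "m + 1"] assms[of "m + 2"] assms[of "m + 3"] assms[of "m + 4"] by (simp_all add: eval_nat_numeral)
  have r2: "u (m + 2) = c * u (m + 1) - u m" by (rule assms)
  show ?thesis unfolding r r2 by (simp add: algebra_simps power3_eq_cube)
qed

context cusp_eigenform
begin

text \<open>Dyadic decomposition: for the least \<open>i\<close> with \<open>n \<le> 2 ^ i\<close>,
  the exponential weight at height \<open>y i = 2 ^ (- i)\<close> is bounded below at
  \<open>n\<close>, and the mean square bound applies at that height. The resulting terms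
  \<open>y i powr (s - 1)\<close> form a geometric series with sum of order
  \<open>1 / (s - 1)\<close>.\<close>

lemma dirichlet_mean_square:
  obtains C where "\<And>s B. 1 < s \<Longrightarrow> s \<le> 2 \<Longrightarrow> finite B \<Longrightarrow> 0 \<notin> B \<Longrightarrow>
    (\<Sum>n\<in>B. (norm (a n))\<^sup>2 / real n ^ (k - 1) * real n powr - s) \<le> C / (s - 1)"
proof -
  obtain B0 where B0: "B0 \<ge> 0" "\<And>y N. y > 0 \<Longrightarrow> (\<Sum>n<N. (norm (a n))\<^sup>2 * exp (- 4 * pi * y * real n)) \<le> B0 / y ^ k"
    using mean_square_bound by blast
  define K where "K = 2 ^ (k + 1) * exp (4 * pi)"
  have K: "K > 0" by (simp add: K_def)
  show ?thesis
  proof (rule that[of "3 * K * B0"])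
    fix s :: real and B :: "nat set"
    assume s: "1 < s" "s \<le> 2" and B: "finite B" "0 \<notin> B"
    define y where "y i = (1 / 2 :: real) ^ i" for i :: nat
    have y0: "y i > 0" for i by (simp add: y_def)
    define I where "I = Max (insert 0 B)"
    let ?t = "\<lambda>n i. K * (y i ^ (k - 1) * y i powr s) * ((norm (a n))\<^sup>2 * exp (- 4 * pi * y i * real n))"
    have pw: "(norm (a n))\<^sup>2 / real n ^ (k - 1) * real n powr - s \<le> (\<Sum>i\<le>I. ?t n i)" if n: "n \<in> B" for n
    proof -
      have n1: "n \<ge> 1" using n B by (cases n) auto
      have nI: "n \<le> I" using n B by (simp add: I_def)
      have "n \<le> 2 ^ I" using nI less_exp[of I] by linarith
      define i where "i = (LEAST i. n \<le> 2 ^ i)"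
      have i1: "n \<le> 2 ^ i" unfolding i_def by (rule LeastI[of _ I]) fact
      have iI: "i \<le> I" unfolding i_def by (rule Least_le) fact
      have i2: "2 ^ i \<le> 2 * n"
      proof (cases i)
        case (Suc j)
        hence "\<not> n \<le> 2 ^ j" using not_less_Least[of j "\<lambda>i. n \<le> 2 ^ i"] by (simp add: i_def)
        thus ?thesis using Suc by simp
      qed (use n1 in simp)
      have yi: "y i * real n \<le> 1" "1 / real n \<le> 2 * y i"
      proof -
        have "real n \<le> 2 ^ i" using i1 by (metis of_nat_le_iff of_nat_numeral of_nat_power)
        thus "y i * real n \<le> 1" by (simp add: y_def power_divide)
        have "(2::real) ^ i \<le> 2 * real n" using i2 by (metis of_nat_le_iff of_nat_mult of_nat_numeral of_nat_power)
        thus "1 / real n \<le> 2 * y i" using n1 by (simp add: y_def power_divide field_simps)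
      qed
      have e: "1 \<le> exp (4 * pi) * exp (- 4 * pi * y i * real n)"
      proof -
        have "0 \<le> 4 * pi * (1 - y i * real n)" using yi(1) by simp
        hence "1 \<le> exp (4 * pi * (1 - y i * real n))" by simp
        thus ?thesis by (simp flip: exp_add) (simp add: algebra_simps)
      qed
      have p1: "1 / real n ^ (k - 1) \<le> 2 ^ (k - 1) * y i ^ (k - 1)"
        using power_mono[OF yi(2), of "k - 1"] by (simp add: power_divide power_mult_distrib)
      have "real n powr - s = (1 / real n) powr s" using n1 by (simp add: powr_minus powr_divide inverse_eq_divide)
      also have "\<dots> \<le> (2 * y i) powr s" using yi(2) s by (intro powr_mono2) auto
      also have "\<dots> = 2 powr s * y i powr s" using y0 by (simp add: powr_mult)
      also have "\<dots> \<le> 2 powr 2 * y i powr s" using s by (intro mult_right_mono powr_mono) auto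
      finally have p2: "real n powr - s \<le> 4 * y i powr s" by simp
      have k: "(2::real) ^ (k - 1) * 4 = 2 ^ (k + 1)"
      proof -
        have "k + 1 = (k - 1) + 2" using k_ge_1 by simp
        hence "(2::real) ^ (k + 1) = 2 ^ (k - 1) * 2 ^ 2" by (simp only: power_add)
        thus ?thesis by simp
      qed
      have "(norm (a n))\<^sup>2 / real n ^ (k - 1) * real n powr - s = (norm (a n))\<^sup>2 * ((1 / real n ^ (k - 1)) * real n powr - s * 1)" by simp
      also have "\<dots> \<le> (norm (a n))\<^sup>2 * ((2 ^ (k - 1) * y i ^ (k - 1)) * (4 * y i powr s) * (exp (4 * pi) * exp (- 4 * pi * y i * real n)))"
        using y0[of i] by (intro mult_left_mono mult_mono p1 p2 e) auto
      also have "\<dots> = ?t n i" unfolding K_def k[symmetric] by (simp only: mult_ac)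
      also have "\<dots> \<le> (\<Sum>i\<le>I. ?t n i)"
        using iI y0 K by (intro member_le_sum) (auto intro!: mult_nonneg_nonneg simp: less_imp_le)
      finally show ?thesis .
    qed
    define r where "r = (1 / 2 :: real) powr (s - 1)"
    have "r = inverse (2 powr (s - 1))" by (simp add: r_def powr_divide inverse_eq_divide)
    moreover have "1 < 2 powr (s - 1)" using s by (intro gr_one_powr) auto
    ultimately have r: "0 < r" "r < 1" by (simp_all add: inverse_less_1_iff)
    have "(\<Sum>n\<in>B. (norm (a n))\<^sup>2 / real n ^ (k - 1) * real n powr - s) \<le> (\<Sum>n\<in>B. \<Sum>i\<le>I. ?t n i)"
      by (intro sum_mono pw)
    also have "\<dots> = (\<Sum>i\<le>I. K * (y i ^ (k - 1) * y i powr s) * (\<Sum>n\<in>B. (norm (a n))\<^sup>2 * exp (- 4 * pi * y i * real n)))"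
      by (subst sum.swap) (simp add: sum_distrib_left)
    also have "\<dots> \<le> (\<Sum>i\<le>I. K * (y i ^ (k - 1) * y i powr s) * (B0 / y i ^ k))"
    proof (intro sum_mono mult_left_mono)
      fix i
      have "(\<Sum>n\<in>B. (norm (a n))\<^sup>2 * exp (- 4 * pi * y i * real n)) \<le> (\<Sum>n<Suc I. (norm (a n))\<^sup>2 * exp (- 4 * pi * y i * real n))"
        using B by (intro sum_mono2) (auto simp: I_def less_Suc_eq_le)
      also have "\<dots> \<le> B0 / y i ^ k" by (rule B0(2)[OF y0])
      finally show "(\<Sum>n\<in>B. (norm (a n))\<^sup>2 * exp (- 4 * pi * y i * real n)) \<le> B0 / y i ^ k" .
      show "0 \<le> K * (y i ^ (k - 1) * y i powr s)" using K y0[of i] by simp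
    qed
    also have "\<dots> = (\<Sum>i\<le>I. K * B0 * r ^ i)"
    proof (intro sum.cong refl)
      fix i
      have "k = Suc (k - 1)" using k_ge_1 by simp
      hence yk: "y i ^ k = y i * y i ^ (k - 1)" by (metis power_Suc)
      have "r ^ i = (1 / 2) powr (real i * (s - 1))" unfolding r_def by (subst powr_power) (auto simp: mult.commute)
      also have "\<dots> = y i powr (s - 1)" unfolding y_def by (simp add: powr_powr flip: powr_realpow)
      also have "\<dots> = y i powr s / y i" using y0[of i] by (simp add: powr_diff)
      finally show "K * (y i ^ (k - 1) * y i powr s) * (B0 / y i ^ k) = K * B0 * r ^ i"
        unfolding yk using y0[of i] by simp
    qed
    also have "\<dots> = K * B0 * ((1 - r ^ Suc I) / (1 - r))"
      unfolding sum_distrib_left[symmetric] lessThan_Suc_atMost[symmetric] using r by (subst sum_gp_strict) simp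
    also have "\<dots> \<le> K * B0 * (1 / (1 - r))"
      using r K B0(1) by (intro mult_left_mono divide_right_mono) auto
    also have "\<dots> \<le> K * B0 * (3 / (s - 1))"
    proof (intro mult_left_mono)
      define t where "t = s - 1"
      have t: "0 < t" "t \<le> 1" using s by (auto simp: t_def)
      have ln2: "ln (2::real) \<ge> 1 / 2"
        using ln_one_minus_pos_upper_bound[of "1/2"] by (simp add: ln_div)
      have "1 + t / 2 \<le> 1 + t * ln 2" using ln2 t by (simp add: field_simps)
      also have "\<dots> \<le> exp (t * ln 2)" by (rule exp_ge_add_one_self)
      also have "\<dots> = 2 powr t" by (simp add: powr_def)
      finally have "1 / (2 powr t) \<le> 1 / (1 + t / 2)" using t by (intro divide_left_mono) auto
      moreover have "r = 1 / (2 powr t)" by (simp add: r_def t_def powr_divide)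
      ultimately have "1 - r \<ge> 1 - 1 / (1 + t / 2)" by simp
      also have "1 - 1 / (1 + t / 2) \<ge> t / 3" using t by (simp add: field_simps)
      finally have "t / 3 \<le> 1 - r" .
      hence "1 / (1 - r) \<le> 1 / (t / 3)" using t r by (intro divide_left_mono) auto
      thus "1 / (1 - r) \<le> 3 / (s - 1)" by (simp add: t_def)
      show "0 \<le> K * B0" using K B0 by simp
    qed
    finally show "(\<Sum>n\<in>B. (norm (a n))\<^sup>2 / real n ^ (k - 1) * real n powr - s) \<le> 3 * K * B0 / (s - 1)" by (simp only: times_divide_eq_right mult_ac)
  qed
qed

lemma norm_a: "norm (a n) = \<bar>Re (a n)\<bar>"
  by (simp add: cmod_def a_real)

lemma exists_small_eigenvalue: "\<exists>p\<in>P13. (Re (a p))\<^sup>2 < 4 * real p ^ (k - 1)"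
proof (rule ccontr)
  assume "\<not> ?thesis"
  hence big: "(Re (a p))\<^sup>2 \<ge> 4 * real p ^ (k - 1)" if "p \<in> P13" for p using that by (auto simp: not_less)
  obtain C where C: "\<And>s B. 1 < s \<Longrightarrow> s \<le> 2 \<Longrightarrow> finite B \<Longrightarrow> 0 \<notin> B \<Longrightarrow>
    (\<Sum>n\<in>B. (norm (a n))\<^sup>2 / real n ^ (k - 1) * real n powr - s) \<le> C / (s - 1)"
    using dirichlet_mean_square by blast
  obtain Q s where Q: "finite Q" "Q \<subseteq> P13" "1 < s" "s \<le> 2" "(\<Prod>p\<in>Q. 1 + 4 * real p powr - s) > C / (s - 1)"
    using many_primes_1_mod_3[of C] by blast
  let ?f = "\<lambda>n. (norm (a n))\<^sup>2 / real n ^ (k - 1) * real n powr - s"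
  have "\<exists>B. finite B \<and> 0 \<notin> B \<and> (\<forall>n\<in>B. \<forall>q. prime q \<and> q dvd n \<longrightarrow> q \<in> Q) \<and> (\<Prod>p\<in>Q. 1 + ?f p) = (\<Sum>n\<in>B. ?f n)"
  proof (rule prod_one_plus_eq_sum[OF Q(1)])
    show "prime p" if "p \<in> Q" for p using that Q(2) by (auto simp: P13_def)
    fix p n :: nat assume "prime p" "\<not> p dvd n"
    hence "a (p * n) = a p * a n" by (intro a_mult_coprime prime_imp_coprime)
    thus "?f (p * n) = ?f p * ?f n" by (simp add: norm_mult power_mult_distrib powr_mult)
  qed simp
  then obtain B where B: "finite B" "0 \<notin> B" "(\<Prod>p\<in>Q. 1 + ?f p) = (\<Sum>n\<in>B. ?f n)" by blast
  have "(\<Prod>p\<in>Q. 1 + 4 * real p powr - s) \<le> (\<Prod>p\<in>Q. 1 + ?f p)"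
  proof (intro prod_mono conjI)
    fix p assume "p \<in> Q"
    hence p: "p \<in> P13" using Q(2) by blast
    hence p0: "real p > 0" by (auto simp: P13_def)
    have "4 \<le> (norm (a p))\<^sup>2 / real p ^ (k - 1)" using big[OF p] p0 by (simp add: norm_a pos_le_divide_eq)
    hence "4 * real p powr - s \<le> ?f p" by (intro mult_right_mono) auto
    thus "1 + 4 * real p powr - s \<le> 1 + ?f p" by simp
    show "0 \<le> 1 + 4 * real p powr - s" by (intro add_nonneg_nonneg) auto
  qed
  also have "\<dots> \<le> C / (s - 1)" unfolding B(3) by (rule C[OF Q(3,4) B(1,2)])
  finally show False using Q(5) by simp
qed

text \<open>Normalized by powers of \<open>q = sqrt (p ^ (k - 1))\<close>, the sequence satisfies
  \<open>u (m + 2) = c * u (m + 1) - u m\<close>, and \<open>u (j * e)\<close> has the parameter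
  \<open>c^2 - 2\<close>, \<open>c^3 - 3 c\<close> or \<open>(c^2 - 2)^2 - 2\<close>. For
  \<open>|c| < 2\<close> these stay below 2 except at \<open>c = -1\<close> when
  \<open>j = 3\<close> and at \<open>c = 0\<close> when \<open>j = 4\<close>. Nonvanishing of
  \<open>a (p ^ 2)\<close> and of \<open>a p\<close>, from the congruences modulo 2 and 3, rules out
  these two values.\<close>

lemma negative_prime_power:
  assumes p: "p \<in> P13" and small: "(Re (a p))\<^sup>2 < 4 * real p ^ (k - 1)" and j: "j \<in> {2, 3, 4}"
  shows "\<exists>e. Re (a (p ^ (j * e))) < 0"
proof -
  have pr: "prime p" "p mod 3 = 1" "p > 13" using p by (auto simp: P13_def)
  define P where "P = real p ^ (k - 1)"
  define q where "q = sqrt P"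
  have P0: "P > 0" using pr by (simp add: P_def)
  have q0: "q > 0" and q2: "q\<^sup>2 = P" using P0 by (simp_all add: q_def)
  define c where "c = Re (a p) / q"
  define u where "u m = Re (a (p ^ m)) / q ^ m" for m
  have rec: "u (m + 2) = c * u (m + 1) - u m" for m
  proof -
    have "a (p ^ (m + 2)) = a p * a (p ^ (m + 1)) - of_real P * a (p ^ m)"
      using a_prime_power_Suc[OF pr(1), of m] by (simp add: P_def)
    hence "Re (a (p ^ (m + 2))) = Re (a p) * Re (a (p ^ (m + 1))) - P * Re (a (p ^ m))" by (simp add: a_real)
    thus ?thesis using q0 unfolding u_def c_def q2[symmetric] by (simp add: field_simps power2_eq_square)
  qed
  have "(Re (a p))\<^sup>2 < 4 * P" using small by (simp add: P_def)
  hence c2: "c\<^sup>2 < 4" unfolding c_def power_divide q2 by (simp only: pos_divide_less_eq[OF P0])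
  have c_lt: "c < 2"
  proof (rule ccontr)
    assume "\<not> c < 2"
    hence "2\<^sup>2 \<le> c\<^sup>2" by (intro power_mono) auto
    thus False using c2 by simp
  qed
  have d3: "int 3 dvd int p - 1" using pr(2) by presburger
  have d2: "int 2 dvd int p - 1"
  proof -
    have "odd p" using pr(1,3) prime_odd_nat[of p] by simp
    thus ?thesis by simp
  qed
  have "\<not> 3 dvd Suc (Suc 0)" by presburger
  hence "a (p ^ 1) \<noteq> 0" by (intro a_prime_power_nonzero[of 3]) (use pr d3 in auto)
  hence c0: "c \<noteq> 0" using q0 a_real[of p] by (auto simp: c_def complex_eq_iff)
  have "a (p ^ 2) \<noteq> 0" by (rule a_prime_power_nonzero[of 2]) (use pr d2 in auto)
  hence "u 2 \<noteq> 0" using q0 a_real[of "p ^ 2"] by (auto simp: u_def complex_eq_iff)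
  moreover have u01: "u 0 = 1" "u 1 = c" by (simp_all add: u_def c_def)
  ultimately have cm1: "c \<noteq> -1" using rec[of 0] by (auto simp: numeral_2_eq_2)
  have double: "u (m + 4) = (c\<^sup>2 - 2) * u (m + 2) - u m" for m by (rule recurrence_double[of u, OF rec])
  have "\<exists>e. u (j * e) < 0"
  proof -
    consider "j = 2" | "j = 3" | "j = 4" using j by auto
    thus ?thesis
    proof cases
      case 1
      have "u (2 * (e + 2)) = (c\<^sup>2 - 2) * u (2 * (e + 1)) - u (2 * e)" for e
        using double[of "2 * e"] by (simp add: eval_nat_numeral algebra_simps)
      thus ?thesis using recurrence_becomes_negative[of "\<lambda>e. u (2 * e)" "c\<^sup>2 - 2"] c2 u01 1 by simp
    next
      case 2
      have "(2 - c) * (c + 1)\<^sup>2 > 0" using c_lt cm1 by (intro mult_pos_pos) auto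
      hence t: "c ^ 3 - 3 * c < 2" by (simp add: power2_eq_square power3_eq_cube algebra_simps)
      have "u (3 * (e + 2)) = (c ^ 3 - 3 * c) * u (3 * (e + 1)) - u (3 * e)" for e
        using recurrence_triple[of u c "3 * e", OF rec] by (simp add: eval_nat_numeral algebra_simps)
      thus ?thesis using recurrence_becomes_negative[of "\<lambda>e. u (3 * e)" "c ^ 3 - 3 * c"] t u01 2 by simp
    next
      case 3
      define v where "v m = u (2 * m)" for m
      have v: "v (m + 2) = (c\<^sup>2 - 2) * v (m + 1) - v m" for m
        using double[of "2 * m"] unfolding v_def by (simp add: eval_nat_numeral algebra_simps)
      have t: "(c\<^sup>2 - 2)\<^sup>2 - 2 < 2"
      proof -
        have "0 < c\<^sup>2 * (4 - c\<^sup>2)" using c0 c2 by (intro mult_pos_pos) auto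
        thus ?thesis by (simp add: power2_eq_square algebra_simps)
      qed
      have "u (4 * (e + 2)) = ((c\<^sup>2 - 2)\<^sup>2 - 2) * u (4 * (e + 1)) - u (4 * e)" for e
        using recurrence_double[of v "c\<^sup>2 - 2" "2 * e", OF v] unfolding v_def by (simp add: eval_nat_numeral algebra_simps)
      thus ?thesis using recurrence_becomes_negative[of "\<lambda>e. u (4 * e)" "(c\<^sup>2 - 2)\<^sup>2 - 2"] t u01 3 by simp
    qed
  qed
  then obtain e where "Re (a (p ^ (j * e))) / q ^ (j * e) < 0" by (auto simp: u_def)
  hence "Re (a (p ^ (j * e))) < 0" using q0 by (simp add: divide_less_0_iff zero_less_power not_less[symmetric])
  thus ?thesis by blast
qed

subsection \<open>Nonvanishing and short intervals\<close>

text \<open>Reduction to prime powers by multiplicativity; the modulus 3 serves for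
  \<open>j = 3\<close> and the modulus 2 for even \<open>j\<close>.\<close>

lemma a_power_nonzero:
  assumes j: "j \<in> {2, 3, 4}" and n: "n > 0" "\<And>q. prime q \<Longrightarrow> q dvd n \<Longrightarrow> q mod 3 = 1"
  shows "Re (a (n ^ j)) \<noteq> 0"
proof -
  have "a (n ^ j) \<noteq> 0"
    using n
  proof (induction n rule: less_induct)
    case (less n)
    show ?case
    proof (cases "n \<le> 1")
      case True
      hence "n = 1" using less.prems by simp
      thus ?thesis by simp
    next
      case False
      then obtain q e m where q: "prime q" "e > 0" "n = q ^ e * m" "\<not> q dvd m" "m < n"
        using split_prime_power[of n] by auto
      have "q dvd n" using q by (simp add: dvd_mult2)
      hence q3: "q mod 3 = 1" using less.prems(2) q(1) by blast
      have "q \<noteq> 2" using q3 by auto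
      hence "odd q" using prime_odd_nat[OF q(1)] prime_ge_2_nat[OF q(1)] by simp
      hence d2: "int 2 dvd int q - 1" by simp
      have d3: "int 3 dvd int q - 1" using q3 by presburger
      have "a (q ^ (e * j)) \<noteq> 0"
      proof (cases "j = 3")
        case True
        have "\<not> 3 dvd e * 3 + 1" by presburger
        thus ?thesis using True by (intro a_prime_power_nonzero[of 3] q(1) d3) auto
      next
        case False
        hence "even (e * j)" using j by auto
        hence "\<not> 2 dvd e * j + 1" by simp
        thus ?thesis by (intro a_prime_power_nonzero[of 2] q(1) d2) auto
      qed
      moreover have "a (m ^ j) \<noteq> 0"
      proof (rule less.IH[OF q(5)])
        show "m > 0" using q(3) less.prems(1) by (cases m) auto
        show "r mod 3 = 1" if "prime r" "r dvd m" for r using less.prems(2)[of r] that q(3) by simp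
      qed
      moreover have "coprime (q ^ (e * j)) (m ^ j)" using q by (simp add: prime_imp_coprime)
      ultimately show ?thesis unfolding q(3) power_mult_distrib power_mult[symmetric] by (simp add: a_mult_coprime)
    qed
  qed
  thus ?thesis using a_real[of "n ^ j"] by (simp add: complex_eq_iff)
qed

end

section \<open>Values of the third cyclotomic polynomial\<close>

definition Phi :: "nat \<Rightarrow> nat" where "Phi u = u\<^sup>2 + u + 1"

text \<open>Modulo \<open>r\<close> the number \<open>u\<close> is a cube root of unity. If
  \<open>r\<close> were 2 modulo 3, Fermat's theorem would force \<open>u = 1\<close> and hence
  \<open>r\<close> to divide 3; the condition on \<open>u\<close> excludes
  \<open>r = 3\<close>.\<close>

lemma prime_dvd_Phi:
  assumes r: "prime r" "r dvd Phi u" and u: "u mod 3 \<noteq> 1"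
  shows "r mod 3 = 1"
proof (rule ccontr)
  assume n1: "r mod 3 \<noteq> 1"
  have ru: "\<not> r dvd u"
  proof
    assume "r dvd u"
    hence "r dvd u\<^sup>2 + u" by (simp add: power2_eq_square)
    hence "r dvd 1" using r(2) unfolding Phi_def by (simp only: dvd_add_right_iff)
    thus False using r(1) by simp
  qed
  have r3: "r \<noteq> 3"
  proof
    assume "r = 3"
    hence "Phi u mod 3 = 0" using r(2) by (simp add: dvd_eq_mod_eq_0)
    moreover have "Phi u mod 3 = 1"
    proof -
      have "u mod 3 = 0 \<or> u mod 3 = 2" using u by presburger
      then consider q where "u = 3 * q" | q where "u = 3 * q + 2" by (metis add.right_neutral mult_div_mod_eq)
      thus ?thesis
      proof cases
        case 1
        hence "Phi u = 1 + 3 * (3 * q\<^sup>2 + q)" by (simp add: Phi_def power2_eq_square algebra_simps)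
        thus ?thesis by presburger
      next
        case 2
        hence "Phi u = 1 + 3 * (3 * q\<^sup>2 + 5 * q + 2)" by (simp add: Phi_def power2_eq_square algebra_simps)
        thus ?thesis by presburger
      qed
    qed
    ultimately show False by simp
  qed
  have "r mod 3 \<noteq> 0"
  proof
    assume "r mod 3 = 0"
    hence "3 dvd r" by auto
    thus False using r(1) r3 primes_dvd_imp_eq[of 3 r] by simp
  qed
  hence "r mod 3 = 2" using n1 by presburger
  then obtain m where m: "r = 3 * m + 2" by (metis mult_div_mod_eq)
  have "int u ^ 3 - 1 = (int u - 1) * int (Phi u)" by (simp add: Phi_def power2_eq_square power3_eq_cube algebra_simps)
  hence "int r dvd int u ^ 3 - 1" using r(2) by simp
  hence c3: "[int u ^ 3 = 1] (mod int r)" by (simp add: cong_iff_dvd_diff)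
  have "[(int u ^ 3) ^ m * int u = 1 ^ m * int u] (mod int r)" by (intro cong_mult cong_pow c3 cong_refl)
  moreover have "(int u ^ 3) ^ m * int u = int u ^ (r - 1)" unfolding m by (simp add: power_mult)
  moreover have "[int u ^ (r - 1) = 1] (mod int r)"
    using fermat_theorem[OF r(1) ru] by (metis cong_int_iff of_nat_1 of_nat_power)
  ultimately have "[int u = 1] (mod int r)" by (metis cong_sym cong_trans mult_1 power_one)
  hence d: "int r dvd int u - 1" by (simp add: cong_iff_dvd_diff)
  have "int (Phi u) = (int u - 1) * (int u + 2) + 3" by (simp add: Phi_def power2_eq_square algebra_simps)
  hence "int r dvd 3" using r(2) d by (metis dvd_add_right_iff dvd_mult2 int_dvd_int_iff)
  hence "r dvd 3" by (metis int_dvd_int_iff of_nat_numeral)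
  thus False using r(1) r3 primes_dvd_imp_eq[of r 3] by simp
qed

text \<open>The factor 3 of 42 keeps \<open>u\<close>, \<open>u + 2\<close> and \<open>u + 3\<close>
  away from 1 modulo 3. For coprimality, polynomial identities eliminate \<open>u\<close>; the only
  possible common prime that is 1 modulo 3 is then 7, for \<open>Phi u\<close> and
  \<open>Phi (u + 2)\<close>, and the factor 7 of 42 excludes it.\<close>

lemma Phi_triple:
  assumes u: "42 dvd u"
  shows "r \<in> {Phi u, Phi (u + 2), Phi (u + 3)} \<Longrightarrow> prime q \<Longrightarrow> q dvd r \<Longrightarrow> q mod 3 = 1"
    and "coprime (Phi u) (Phi (u + 2))" "coprime (Phi u) (Phi (u + 3))" "coprime (Phi (u + 2)) (Phi (u + 3))"
proof -
  have "u mod 3 = 0" using u by presburger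
  hence m: "u mod 3 \<noteq> 1" "(u + 2) mod 3 \<noteq> 1" "(u + 3) mod 3 \<noteq> 1" by presburger+
  have p: "q mod 3 = 1" if "r \<in> {Phi u, Phi (u + 2), Phi (u + 3)}" "prime q" "q dvd r" for r q
    using that prime_dvd_Phi[OF _ _ m(1)] prime_dvd_Phi[OF _ _ m(2)] prime_dvd_Phi[OF _ _ m(3)] by blast
  show "r \<in> {Phi u, Phi (u + 2), Phi (u + 3)} \<Longrightarrow> prime q \<Longrightarrow> q dvd r \<Longrightarrow> q mod 3 = 1" by (rule p)
  have co: "coprime x y" if "\<And>q. prime q \<Longrightarrow> int q dvd int x \<Longrightarrow> int q dvd int y \<Longrightarrow> False" for x y
  proof (rule ccontr)
    assume "\<not> coprime x y"
    hence "gcd x y \<noteq> 1" using coprime_iff_gcd_eq_1 by blast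
    then obtain q where "prime q" "q dvd gcd x y" using prime_factor_nat by blast
    thus False using that[of q] by simp
  qed
  have nd: "\<not> int q dvd 2" "\<not> int q dvd 3" if "prime q" "q mod 3 = 1" for q :: nat
  proof -
    have "q \<noteq> 2" "q \<noteq> 3" using that(2) by auto
    hence "\<not> q dvd 2" "\<not> q dvd 3" using that(1) primes_dvd_imp_eq[of q 2] primes_dvd_imp_eq[of q 3] by auto
    thus "\<not> int q dvd 2" "\<not> int q dvd 3" by (metis int_dvd_int_iff of_nat_numeral)+
  qed
  have pm: "int q dvd x" if "prime q" "q mod 3 = 1" "int q dvd 2 * x" for q x
    using that nd[of q] by (auto simp: prime_dvd_mult_iff)
  have pm3: "int q dvd x" if "prime q" "q mod 3 = 1" "int q dvd 3 * x" for q x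
    using that nd[of q] by (auto simp: prime_dvd_mult_iff)
  show "coprime (Phi u) (Phi (u + 2))"
  proof (rule co)
    fix q assume q: "prime q" "int q dvd int (Phi u)" "int q dvd int (Phi (u + 2))"
    hence q3: "q mod 3 = 1" using p[of "Phi u" q] by simp
    have "int (Phi (u + 2)) - int (Phi u) = 2 * (2 * int u + 3)" by (simp add: Phi_def power2_eq_square algebra_simps)
    hence "int q dvd 2 * (2 * int u + 3)" using dvd_diff[OF q(3) q(2)] by (simp only:)
    hence d: "int q dvd 2 * int u + 3" by (rule pm[OF q(1) q3])
    have "7 = 4 * int (Phi u) - (2 * int u + 3) * (2 * int u - 1)" by (simp add: Phi_def power2_eq_square algebra_simps)
    moreover have "int q dvd 4 * int (Phi u) - (2 * int u + 3) * (2 * int u - 1)"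
      by (rule dvd_diff[OF dvd_mult[OF q(2)] dvd_mult2[OF d]])
    ultimately have "int q dvd 7" by (simp only:)
    hence "q dvd 7" by (metis int_dvd_int_iff of_nat_numeral)
    hence "q = 7" using q(1) primes_dvd_imp_eq[of q 7] by simp
    moreover have "7 dvd u" using u by presburger
    ultimately have "int q dvd int u" by (simp only: int_dvd_int_iff)
    moreover have "int (Phi u) = int u * (int u + 1) + 1" by (simp add: Phi_def power2_eq_square algebra_simps)
    ultimately have "int q dvd 1" using q(2) by (simp add: dvd_add_right_iff)
    thus False using \<open>q = 7\<close> by simp
  qed
  show "coprime (Phi u) (Phi (u + 3))"
  proof (rule co)
    fix q assume q: "prime q" "int q dvd int (Phi u)" "int q dvd int (Phi (u + 3))"
    hence q3: "q mod 3 = 1" using p[of "Phi u" q] by simp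
    have "int (Phi (u + 3)) - int (Phi u) = 2 * (3 * (int u + 2))" by (simp add: Phi_def power2_eq_square algebra_simps)
    hence "int q dvd 2 * (3 * (int u + 2))" using dvd_diff[OF q(3) q(2)] by (simp only:)
    hence d: "int q dvd int u + 2" using pm3[OF q(1) q3 pm[OF q(1) q3]] by blast
    have "3 = int (Phi u) - (int u + 2) * (int u - 1)" by (simp add: Phi_def power2_eq_square algebra_simps)
    moreover have "int q dvd int (Phi u) - (int u + 2) * (int u - 1)" by (rule dvd_diff[OF q(2) dvd_mult2[OF d]])
    ultimately have "int q dvd 3" by (simp only:)
    thus False using nd(2)[OF q(1) q3] by blast
  qed
  show "coprime (Phi (u + 2)) (Phi (u + 3))"
  proof (rule co)
    fix q assume q: "prime q" "int q dvd int (Phi (u + 2))" "int q dvd int (Phi (u + 3))"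
    hence q3: "q mod 3 = 1" using p[of "Phi (u + 2)" q] by simp
    have "int (Phi (u + 3)) - int (Phi (u + 2)) = 2 * (int u + 3)" by (simp add: Phi_def power2_eq_square algebra_simps)
    hence "int q dvd 2 * (int u + 3)" using dvd_diff[OF q(3) q(2)] by (simp only:)
    hence d: "int q dvd int u + 3" by (rule pm[OF q(1) q3])
    have "1 = int (Phi (u + 3)) - (int u + 3) * (int u + 4)" by (simp add: Phi_def power2_eq_square algebra_simps)
    moreover have "int q dvd int (Phi (u + 3)) - (int u + 3) * (int u + 4)" by (rule dvd_diff[OF q(3) dvd_mult2[OF d]])
    ultimately have "int q dvd 1" by (simp only:)
    thus False using q(1) by simp
  qed
qed

text \<open>Modulo \<open>u\<close> the three values are 1, 7 and 13.\<close>

lemma prime_not_dvd_Phi: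
  assumes p: "prime p" "p > 13" "p dvd u"
  shows "\<not> p dvd Phi u" "\<not> p dvd Phi (u + 2)" "\<not> p dvd Phi (u + 3)"
proof -
  have "Phi u = u * (u + 1) + 1" "Phi (u + 2) = u * (u + 5) + 7" "Phi (u + 3) = u * (u + 7) + 13"
    by (simp_all add: Phi_def power2_eq_square algebra_simps)
  note Phi_eq = this
  have "\<not> p dvd u * w + r" if "0 < r" "r \<le> 13" for w r
  proof
    assume "p dvd u * w + r"
    hence "p dvd r" using p(3) dvd_add_right_iff dvd_mult2 by blast
    thus False using that p(2) dvd_imp_le[of p r] by simp
  qed
  thus "\<not> p dvd Phi u" "\<not> p dvd Phi (u + 2)" "\<not> p dvd Phi (u + 3)" unfolding Phi_eq by (simp_all only: zero_less_one order_refl semiring_norm not_False_eq_True)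
qed

lemma fourth_power_shift_le:
  fixes v d :: real
  assumes "v \<ge> 1" "d \<ge> 0"
  shows "(v + d) ^ 4 \<le> v ^ 4 + (1 + d) ^ 4 * v ^ 3"
proof -
  have v: "1 \<le> v ^ 3" "v \<le> v ^ 3" "v\<^sup>2 \<le> v ^ 3"
    using assms power_increasing[of 0 3 v] power_increasing[of 1 3 v] power_increasing[of 2 3 v] by simp_all
  have "(v + d) ^ 4 = v ^ 4 + (4 * d * v ^ 3 + 6 * d\<^sup>2 * v\<^sup>2 + 4 * d ^ 3 * v + d ^ 4 * 1)"
    by (simp add: eval_nat_numeral algebra_simps)
  also have "4 * d * v ^ 3 + 6 * d\<^sup>2 * v\<^sup>2 + 4 * d ^ 3 * v + d ^ 4 * 1 \<le>
    4 * d * v ^ 3 + 6 * d\<^sup>2 * v ^ 3 + 4 * d ^ 3 * v ^ 3 + d ^ 4 * v ^ 3"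
    using v assms by (intro add_mono mult_left_mono) auto
  also have "\<dots> = ((1 + d) ^ 4 - 1) * v ^ 3" by (simp add: eval_nat_numeral algebra_simps)
  also have "\<dots> \<le> (1 + d) ^ 4 * v ^ 3" using assms by (intro mult_right_mono) auto
  finally show ?thesis by simp
qed

context cusp_eigenform
begin

lemma Re_a_power_mult:
  assumes "coprime m n"
  shows "Re (a ((m * n) ^ j)) = Re (a (m ^ j)) * Re (a (n ^ j))"
  using assms by (simp add: power_mult_distrib a_mult_coprime a_real)

text \<open>Among three pairwise coprime numbers near \<open>y^(1/2)\<close> with nonvanishing coefficients, two have
  coefficients of equal sign, and their product is close to \<open>y\<close>.\<close>

lemma short_interval_positive:
  assumes p: "p \<in> P13" and j: "j \<in> {2, 3, 4}"
  obtains C where "C > 0" "\<And>y. y \<ge> 1 \<Longrightarrow>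
    \<exists>n. \<not> p dvd n \<and> y < real n \<and> real n \<le> y + C * y powr (3/4) \<and> Re (a (n ^ j)) > 0"
proof -
  have pr: "prime p" "p > 13" using p by (auto simp: P13_def)
  \<comment> \<open>\<open>u\<close> will be the first multiple of \<open>42 * p\<close> beyond
    \<open>v = y powr (1/4)\<close>: the factor 42 serves \<open>Phi_triple\<close>, and the factor
    \<open>p\<close> keeps the three values prime to \<open>p\<close>.\<close>
  define c where "c = real (42 * p)"
  have c0: "c > 0" using pr by (simp add: c_def)
  \<comment> \<open>The 4 comes from \<open>Phi (u + 3) \<le> (u + 4)^2\<close>.\<close>
  define d where "d = c + 4"
  show ?thesis
  proof (rule that[of "(1 + d) ^ 4"])
    show "(1 + d) ^ 4 > 0" using c0 by (simp add: d_def)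
    fix y :: real assume y: "y \<ge> 1"
    define v where "v = y powr (1/4)"
    have v1: "v \<ge> 1" using y by (simp add: v_def ge_one_powr_ge_zero)
    have v4: "v ^ 4 = y" and v3: "v ^ 3 = y powr (3/4)" using y by (simp_all add: v_def powr_power)
    define N where "N = nat \<lfloor>v / c\<rfloor> + 1"
    define u where "u = 42 * p * N"
    have uc: "real u = c * real N" by (simp add: u_def c_def)
    have "0 \<le> v / c" using v1 c0 by simp
    hence rN: "real N = of_int \<lfloor>v / c\<rfloor> + 1" by (simp add: N_def)
    have N: "v / c < real N" "real N \<le> v / c + 1" unfolding rN by linarith+
    have u: "v < real u" "real u \<le> v + c" using N c0 unfolding uc by (simp_all add: field_simps)
    have d42: "42 dvd u" "p dvd u" by (simp_all add: u_def)
    define S where "S = {Phi u, Phi (u + 2), Phi (u + 3)}"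
    have S: "\<not> p dvd r \<and> Re (a (r ^ j)) \<noteq> 0 \<and> u\<^sup>2 \<le> r \<and> r \<le> (u + 4)\<^sup>2" if r: "r \<in> S" for r
    proof (intro conjI)
      show "\<not> p dvd r" using prime_not_dvd_Phi[OF pr d42(2)] r by (auto simp: S_def)
      show "u\<^sup>2 \<le> r" "r \<le> (u + 4)\<^sup>2" using r by (auto simp: S_def Phi_def power2_eq_square algebra_simps)
      show "Re (a (r ^ j)) \<noteq> 0"
      proof (rule a_power_nonzero[OF j])
        show "r > 0" using r by (auto simp: S_def Phi_def)
        show "q mod 3 = 1" if "prime q" "q dvd r" for q using Phi_triple(1)[OF d42(1)] r that by (auto simp: S_def)
      qed
    qed
    have good: "\<exists>n. \<not> p dvd n \<and> y < real n \<and> real n \<le> y + (1 + d) ^ 4 * y powr (3/4) \<and> Re (a (n ^ j)) > 0"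
      if rs: "r \<in> S" "s \<in> S" "coprime r s" "Re (a (r ^ j)) * Re (a (s ^ j)) > 0" for r s
    proof (intro exI[of _ "r * s"] conjI)
      show "\<not> p dvd r * s" using S[OF rs(1)] S[OF rs(2)] pr(1) by (simp add: prime_dvd_mult_iff)
      show "Re (a ((r * s) ^ j)) > 0" using rs by (simp add: Re_a_power_mult)
      have "v ^ 4 < real u ^ 4" using u v1 by (intro power_strict_mono) auto
      also have "real u ^ 4 = real (u\<^sup>2 * u\<^sup>2)" by (simp add: power2_eq_square eval_nat_numeral)
      also have "\<dots> \<le> real (r * s)" using S[OF rs(1)] S[OF rs(2)] by (intro of_nat_mono mult_le_mono) auto
      finally show "y < real (r * s)" unfolding v4 .
      have "real (r * s) \<le> real ((u + 4)\<^sup>2 * (u + 4)\<^sup>2)"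
        using S[OF rs(1)] S[OF rs(2)] by (intro of_nat_mono mult_le_mono) auto
      also have "\<dots> = (real u + 4) ^ 4" by (simp add: eval_nat_numeral algebra_simps)
      also have "\<dots> \<le> (v + d) ^ 4" using u by (intro power_mono) (auto simp: d_def)
      also have "\<dots> \<le> v ^ 4 + (1 + d) ^ 4 * v ^ 3"
        using v1 c0 by (intro fourth_power_shift_le) (auto simp: d_def)
      finally show "real (r * s) \<le> y + (1 + d) ^ 4 * y powr (3/4)" unfolding v4 v3 .
    qed
    define A B E where "A = Phi u" and "B = Phi (u + 2)" and "E = Phi (u + 3)"
    have m: "A \<in> S" "B \<in> S" "E \<in> S" by (simp_all add: S_def A_def B_def E_def)
    have co: "coprime A B" "coprime A E" "coprime B E" using Phi_triple[OF d42(1)] by (simp_all add: A_def B_def E_def)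
    let ?F = "\<lambda>n. Re (a (n ^ j))"
    have "?F A \<noteq> 0" "?F B \<noteq> 0" "?F E \<noteq> 0" using S m by blast+
    hence "?F A * ?F B > 0 \<or> ?F A * ?F E > 0 \<or> ?F B * ?F E > 0"
      by (auto simp: zero_less_mult_iff)
    thus "\<exists>n. \<not> p dvd n \<and> y < real n \<and> real n \<le> y + (1 + d) ^ 4 * y powr (3/4) \<and> Re (a (n ^ j)) > 0"
      using good[OF m(1,2) co(1)] good[OF m(1,3) co(2)] good[OF m(2,3) co(3)] by blast
  qed
qed

text \<open>The negative values near \<open>y\<close> come from positive ones near
  \<open>y / q\<close> with \<open>q = p ^ e\<close>. Stretching by \<open>q\<close> keeps the
  length within \<open>C * q * y powr (3/4)\<close>, and multiplicativity applies because the
  positive values are found at \<open>n\<close> not divisible by \<open>p\<close>.\<close>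

lemma short_interval_both_signs:
  assumes j: "j \<in> {2, 3, 4}"
  obtains C Y where "C > 0" "Y \<ge> 1"
    "\<And>y. y \<ge> Y \<Longrightarrow> \<exists>n. y < real n \<and> real n \<le> y + C * y powr (3/4) \<and> Re (a (n ^ j)) > 0"
    "\<And>y. y \<ge> Y \<Longrightarrow> \<exists>n. y < real n \<and> real n \<le> y + C * y powr (3/4) \<and> Re (a (n ^ j)) < 0"
proof -
  obtain p where p: "p \<in> P13" "(Re (a p))\<^sup>2 < 4 * real p ^ (k - 1)" using exists_small_eigenvalue by blast
  obtain e where e: "Re (a (p ^ (j * e))) < 0" using negative_prime_power[OF p j] by blast
  obtain C where C: "C > 0" "\<And>y. y \<ge> 1 \<Longrightarrow>
    \<exists>n. \<not> p dvd n \<and> y < real n \<and> real n \<le> y + C * y powr (3/4) \<and> Re (a (n ^ j)) > 0"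
    using short_interval_positive[OF p(1) j] by blast
  have pr: "prime p" using p(1) by (simp add: P13_def)
  define q where "q = real (p ^ e)"
  have "p ^ e \<ge> 1" using prime_gt_0_nat[OF pr] by simp
  hence q1: "q \<ge> 1" unfolding q_def by linarith
  show ?thesis
  proof (rule that[of "C * q" q])
    show "C * q > 0" "q \<ge> 1" using C(1) q1 by auto
    fix y assume y: "y \<ge> q"
    hence y1: "y \<ge> 1" "y / q \<ge> 1" using q1 by auto
    have "C * 1 * y powr (3/4) \<le> C * q * y powr (3/4)" using C(1) q1 by (intro mult_right_mono mult_left_mono) auto
    thus "\<exists>n. y < real n \<and> real n \<le> y + C * q * y powr (3/4) \<and> Re (a (n ^ j)) > 0"
      using C(2)[OF y1(1)] by fastforce
    obtain n where n: "\<not> p dvd n" "y / q < real n" "real n \<le> y / q + C * (y / q) powr (3/4)" "Re (a (n ^ j)) > 0"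
      using C(2)[OF y1(2)] by blast
    show "\<exists>n. y < real n \<and> real n \<le> y + C * q * y powr (3/4) \<and> Re (a (n ^ j)) < 0"
    proof (intro exI[of _ "p ^ e * n"] conjI)
      have eq: "real (p ^ e * n) = q * real n" by (simp add: q_def)
      show "y < real (p ^ e * n)" unfolding eq using n(2) q1 by (simp add: field_simps)
      have "y / q \<le> y / 1" using y1 q1 by (intro divide_left_mono) auto
      hence "(y / q) powr (3/4) \<le> y powr (3/4)" using y1 by (intro powr_mono2) auto
      hence "real n \<le> y / q + C * y powr (3/4)" using n(3) C(1) by (smt (verit) mult_left_mono)
      hence "q * real n \<le> q * (y / q + C * y powr (3/4))" using q1 by (intro mult_left_mono) auto
      also have "\<dots> = y + C * q * y powr (3/4)" using q1 by (simp add: distrib_left)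
      finally show "real (p ^ e * n) \<le> y + C * q * y powr (3/4)" unfolding eq .
      have "coprime (p ^ e) n" using n(1) pr by (simp add: prime_imp_coprime)
      hence "Re (a ((p ^ e * n) ^ j)) = Re (a (p ^ (j * e))) * Re (a (n ^ j))"
        using Re_a_power_mult[of "p ^ e" n j] by (simp only: power_mult[symmetric] mult.commute[of e j])
      thus "Re (a ((p ^ e * n) ^ j)) < 0" using e n(4) by (simp add: mult_neg_pos)
    qed
  qed
qed

end

subsection \<open>Counting sign changes\<close>

text \<open>A supremum of natural numbers is an upper bound only for a bounded set; here
  \<open>card S\<close> bounds it, since an increasing chain in \<open>S\<close> is
  injective.\<close>

lemma sign_changes_ge:
  assumes "finite S" "strict_mono_on {..m} g" "\<And>i. i \<le> m \<Longrightarrow> g i \<in> S" "\<And>i. i < m \<Longrightarrow> f (g i) * f (g (Suc i)) < 0"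
  shows "m \<le> sign_changes f S"
  unfolding sign_changes_def
proof (rule cSup_upper)
  show "m \<in> {m. \<exists>g. strict_mono_on {..m} g \<and> (\<forall>i\<le>m. g i \<in> S) \<and> (\<forall>i<m. f (g i) * f (g (Suc i)) < 0)}"
    using assms by blast
  have "m' \<le> card S" if g: "strict_mono_on {..m'} g" "\<forall>i\<le>m'. g i \<in> S" for m' and g :: "nat \<Rightarrow> nat"
  proof -
    have "inj_on g {..m'}" by (rule strict_mono_on_imp_inj_on[OF g(1)])
    hence "card {..m'} \<le> card S" using g(2) assms(1) by (intro card_inj_on_le[of g]) auto
    thus ?thesis by simp
  qed
  thus "bdd_above {m. \<exists>g. strict_mono_on {..m} g \<and> (\<forall>i\<le>m. g i \<in> S) \<and> (\<forall>i<m. f (g i) * f (g (Suc i)) < 0)}"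
    by (intro bdd_aboveI[of _ "card S"]) blast
qed

text \<open>The interval is cut into blocks of length \<open>H\<close>, of order
  \<open>x powr (3/4)\<close>, and positive and negative values are picked alternately from
  consecutive blocks.\<close>

lemma sign_changes_dyadic_ge:
  fixes f :: "nat \<Rightarrow> real"
  assumes C: "C > 0" and
    pos: "\<And>y. y \<ge> Y \<Longrightarrow> \<exists>n. y < real n \<and> real n \<le> y + C * y powr (3/4) \<and> f n > 0" and
    neg: "\<And>y. y \<ge> Y \<Longrightarrow> \<exists>n. y < real n \<and> real n \<le> y + C * y powr (3/4) \<and> f n < 0"
  obtains c X where "c > 0" "X \<ge> 1"
    "\<And>x. x \<ge> X \<Longrightarrow> real (sign_changes f {n. x < real n \<and> real n \<le> 2 * x}) \<ge> c * x powr (1/4)"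
proof -
  \<comment> \<open>The factor \<open>2 powr (3/4)\<close> allows for left ends of blocks up to
    \<open>2 * x\<close>.\<close>
  define D where "D = C * 2 powr (3/4)"
  have D: "D > 0" using C by (simp add: D_def)
  show ?thesis
  \<comment> \<open>Beyond \<open>(4 * D) powr 4\<close> the interval is at least 4 blocks long, so
    that \<open>x / H - 2\<close>, a lower bound for the number of sign changes, is at least half of
    \<open>x / H\<close>.\<close>
  proof (rule that[of "1 / (2 * D)" "max 1 (max Y ((4 * D) powr 4))"])
    show "1 / (2 * D) > 0" "max 1 (max Y ((4 * D) powr 4)) \<ge> 1" using D by auto
    fix x assume "x \<ge> max 1 (max Y ((4 * D) powr 4))"
    hence x: "x \<ge> 1" "x \<ge> Y" "x \<ge> (4 * D) powr 4" by auto
    define H where "H = D * x powr (3/4)"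
    have H: "H > 0" using D x by (simp add: H_def)
    have "x = x powr (1/4) * x powr (3/4)" using x by (simp flip: powr_add)
    hence xH: "x / H = x powr (1/4) / D" using x D unfolding H_def by (simp add: field_simps)
    have "4 * D = ((4 * D) powr 4) powr (1/4)" using D by (simp only: powr_powr) simp
    also have "\<dots> \<le> x powr (1/4)" using x by (intro powr_mono2) auto
    finally have ge4: "x / H \<ge> 4" unfolding xH using D by (simp add: field_simps)
    \<comment> \<open>Blocks are numbered from 0 to \<open>m\<close>, so \<open>m + 1\<close> of
      them have to fit.\<close>
    define m where "m = nat \<lfloor>x / H\<rfloor> - 1"
    have "real (nat \<lfloor>x / H\<rfloor>) \<le> x / H" "real (nat \<lfloor>x / H\<rfloor>) \<ge> x / H - 1" using ge4 by linarith+
    hence m: "real m + 1 \<le> x / H" "real m \<ge> x / H - 2" unfolding m_def using ge4 by linarith+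
    define y where "y i = x + real i * H" for i :: nat
    have yx: "y i \<ge> x" for i using H by (simp add: y_def)
    have mH: "(real m + 1) * H \<le> x" using m(1) H by (simp add: field_simps)
    have ym: "y i + H \<le> 2 * x" if "i \<le> m" for i
    proof -
      have "(real i + 1) * H \<le> (real m + 1) * H" using that H by (intro mult_right_mono) auto
      thus ?thesis using mH by (simp add: y_def algebra_simps)
    qed
    have short: "C * y i powr (3/4) \<le> H" if "i \<le> m" for i
    proof -
      have "y i powr (3/4) \<le> (2 * x) powr (3/4)" using ym[OF that] yx[of i] x H by (intro powr_mono2) auto
      thus ?thesis using C x by (simp add: H_def D_def powr_mult)
    qed
    have "\<exists>n. i \<le> m \<longrightarrow> y i < real n \<and> real n \<le> y i + H \<and> (if even i then f n > 0 else f n < 0)" for i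
    proof (cases "i \<le> m")
      case True
      have "y i \<ge> Y" using yx[of i] x by simp
      thus ?thesis using pos[of "y i"] neg[of "y i"] short[OF True] by (cases "even i") (fastforce, fastforce)
    qed simp
    then obtain g where g: "\<And>i. i \<le> m \<Longrightarrow> y i < real (g i) \<and> real (g i) \<le> y i + H \<and> (if even i then f (g i) > 0 else f (g i) < 0)"
      by metis
    let ?S = "{n. x < real n \<and> real n \<le> 2 * x}"
    have "m \<le> sign_changes f ?S"
    proof (rule sign_changes_ge)
      have "?S \<subseteq> {..nat \<lfloor>2 * x\<rfloor>}" by (auto simp: le_nat_floor)
      thus "finite ?S" by (rule finite_subset) simp
      show "strict_mono_on {..m} g"
      proof (rule strict_mono_onI)
        fix r s assume rs: "r \<in> {..m}" "s \<in> {..m}" "r < s"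
        have "real (g r) \<le> y r + H" using g rs by auto
        also have "\<dots> = (real r + 1) * H + x" by (simp add: y_def algebra_simps)
        also have "\<dots> \<le> real s * H + x" using rs H by (intro add_right_mono mult_right_mono) auto
        also have "\<dots> < real (g s)" using g[of s] rs by (simp add: y_def)
        finally show "g r < g s" by simp
      qed
      show "g i \<in> ?S" if "i \<le> m" for i using g[OF that] ym[OF that] yx[of i] by simp
      show "f (g i) * f (g (Suc i)) < 0" if "i < m" for i
        using g[of i] g[of "Suc i"] that by (auto simp: mult_less_0_iff split: if_splits)
    qed
    moreover have "r / 2 \<le> real m" if "r - 2 \<le> real m" "4 \<le> r" for r using that by linarith
    hence "(x / H) / 2 \<le> real m" using m(2) ge4 by blast
    hence "1 / (2 * D) * x powr (1/4) \<le> real m" by (simp add: xH)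
    ultimately show "1 / (2 * D) * x powr (1/4) \<le> real (sign_changes f ?S)" by linarith
  qed
qed

lemma infinite_if_arbitrarily_large:
  assumes "\<And>y. y \<ge> Y \<Longrightarrow> \<exists>n. y < real n \<and> P n"
  shows "infinite {n. P n}"
proof
  assume "finite {n. P n}"
  then obtain N where N: "\<And>n. P n \<Longrightarrow> n \<le> N" using finite_nat_set_iff_bounded_le[of "{n. P n}"] by auto
  show False using assms[of "max Y (real N)"] N by fastforce
qed

lemma normalized_coeff_sgn:
  assumes "n > 0"
  shows "normalized_coeff k a n > 0 \<longleftrightarrow> Re (a n) > 0" "normalized_coeff k a n < 0 \<longleftrightarrow> Re (a n) < 0"
  using assms by (simp_all add: normalized_coeff_def zero_less_divide_iff divide_less_0_iff)

theorem theorem2p1: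
  fixes k :: nat and h :: "complex \<Rightarrow> complex" and a :: "nat \<Rightarrow> complex" and j :: nat
  assumes "k \<ge> 1"
    and "cusp_form k h"
    and "hecke_eigenform k h"
    and "cusp_q_expansion h a"
    and "a 1 = 1"
    and "j \<in> {2, 3, 4}"
  shows "infinite {n. normalized_coeff k a (n ^ j) > 0} \<and> infinite {n. normalized_coeff k a (n ^ j) < 0}
    \<and> (\<exists>\<epsilon>0 > 0. \<forall>\<epsilon>. 0 < \<epsilon> \<and> \<epsilon> < \<epsilon>0 \<longrightarrow>
          (\<exists>C > 0. \<exists>X. \<forall>x \<ge> X.
             real (sign_changes (\<lambda>n. normalized_coeff k a (n ^ j)) {n. x < real n \<and> real n \<le> 2 * x})
               \<ge> C * x powr (delta_exp j - 2 * \<epsilon>)))"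
proof -
  interpret cusp_eigenform k h a using assms by unfold_locales auto
  define f where "f n = normalized_coeff k a (n ^ j)" for n
  obtain C Y where C: "C > 0" "Y \<ge> 1"
    and pos: "\<And>y. y \<ge> Y \<Longrightarrow> \<exists>n. y < real n \<and> real n \<le> y + C * y powr (3/4) \<and> Re (a (n ^ j)) > 0"
    and neg: "\<And>y. y \<ge> Y \<Longrightarrow> \<exists>n. y < real n \<and> real n \<le> y + C * y powr (3/4) \<and> Re (a (n ^ j)) < 0"
    using short_interval_both_signs[OF assms(6)] by blast
  \<comment> \<open>\<open>Y \<ge> 1\<close> keeps \<open>n\<close> away from 0, where the
    normalization divides by zero.\<close>
  have sgn: "f n > 0 \<longleftrightarrow> Re (a (n ^ j)) > 0" "f n < 0 \<longleftrightarrow> Re (a (n ^ j)) < 0" if "real n > y" "y \<ge> Y" for n y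
  proof -
    have "n ^ j > 0" using that C(2) by (cases n) auto
    thus "f n > 0 \<longleftrightarrow> Re (a (n ^ j)) > 0" "f n < 0 \<longleftrightarrow> Re (a (n ^ j)) < 0"
      unfolding f_def by (rule normalized_coeff_sgn)+
  qed
  have fpos: "\<exists>n. y < real n \<and> real n \<le> y + C * y powr (3/4) \<and> f n > 0" if "y \<ge> Y" for y
    using pos[OF that] sgn(1)[OF _ that] by blast
  have fneg: "\<exists>n. y < real n \<and> real n \<le> y + C * y powr (3/4) \<and> f n < 0" if "y \<ge> Y" for y
    using neg[OF that] sgn(2)[OF _ that] by blast
  have "infinite {n. f n > 0}" "infinite {n. f n < 0}"
    by (rule infinite_if_arbitrarily_large[of Y]; use fpos fneg in blast)+
  moreover obtain c X where X: "c > 0" "X \<ge> 1"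
    "\<And>x. x \<ge> X \<Longrightarrow> real (sign_changes f {n. x < real n \<and> real n \<le> 2 * x}) \<ge> c * x powr (1/4)"
    using sign_changes_dyadic_ge[OF C(1) fpos fneg] by blast
  have "real (sign_changes f {n. x < real n \<and> real n \<le> 2 * x}) \<ge> c * x powr (delta_exp j - 2 * \<epsilon>)"
    if "x \<ge> X" "\<epsilon> > 0" for x \<epsilon>
  proof -
    have "delta_exp j \<le> 1/4" by (simp add: delta_exp_def)
    hence "delta_exp j - 2 * \<epsilon> \<le> 1/4" using that by linarith
    hence "c * x powr (delta_exp j - 2 * \<epsilon>) \<le> c * x powr (1/4)" using X that by (intro mult_left_mono powr_mono) auto
    thus ?thesis using X(3)[OF that(1)] by linarith
  qed
  hence "\<exists>\<epsilon>0 > 0. \<forall>\<epsilon>. 0 < \<epsilon> \<and> \<epsilon> < \<epsilon>0 \<longrightarrow> (\<exists>C > 0. \<exists>X. \<forall>x \<ge> X.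
    real (sign_changes f {n. x < real n \<and> real n \<le> 2 * x}) \<ge> C * x powr (delta_exp j - 2 * \<epsilon>))"
    \<comment> \<open>The same \<open>c\<close> and \<open>X\<close> serve for every positive
      \<open>\<epsilon>\<close>, so the threshold 1 is an arbitrary choice.\<close>
    using X(1) by (intro exI[of _ "1::real"]) auto
  ultimately show ?thesis unfolding f_def by blast
qed

end
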